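(* Let $t\in\mathbf C$, $s\in\overline{\mathbf R_\flat}$ be such that $s<\frac12$, $\Lambda=\mathbf N^{2d}$, and let $U_{t,\#}$ be the map from $\ell_0(\Lambda)\times\ell_0(\Lambda)$ to $\ell_0(\Lambda)$ given by $$U_{t,\#}(c_1,c_2)(\alpha,\beta)=\sum\left(\binom\alpha{\alpha_0}\binom\beta{\beta_0}\binom{\alpha-\alpha_0+\gamma}\gamma\binom{\beta-\beta_0+\gamma}\gamma\right)^{1/2}t^{|\gamma|}c_1(\alpha_0,\beta-\beta_0+\gamma)\,c_2(\alpha-\alpha_0+\gamma,\beta_0),$$ where the sum is taken over all $\alpha_0,\beta_0,\gamma\in\mathbf N^d$ with $\alpha_0\le\alpha$, $\beta_0\le\beta$. Then $U_{t,\#}$ is uniquely extendable to continuous mappings $$\ell_{\mathcal A,s}(\Lambda)\times\ell_{\mathcal A,s}(\Lambda)\to\ell_{\mathcal A,s}(\Lambda),$$ $$\ell_{\mathcal A,s}^\star(\Lambda)\times\ell_{\mathcal B,s}(\Lambda)\to\ell_{\mathcal A,s}^\star(\Lambda),\qquad \ell_{\mathcal B,s}^\star(\Lambda)\times\ell_{\mathcal A,s}^\star(\Lambda)\to\ell_{\mathcal A,s}^\star(\Lambda),$$ $$\ell_{\mathcal B,s}(\Lambda)\times\ell_{\mathcal B,s}(\Lambda)\to\ell_{\mathcal B,s}(\Lambda),\qquad \ell_{\mathcal B,s}^\star(\Lambda)\times\ell_{\mathcal B,s}^\star(\Lambda)\to\ell_{\mathcal B,s}^\star(\Lambda),$$ $$\ell_{\mathcal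 C,s}(\Lambda)\times\ell_{\mathcal C,s}(\Lambda)\to\ell_{\mathcal C,s}(\Lambda),\qquad \ell_{\mathcal C,s}^\star(\Lambda)\times\ell_{\mathcal C,s}^\star(\Lambda)\to\ell_{\mathcal C,s}^\star(\Lambda).$$ If instead $0<s\le\frac12$, then the same holds true with $\ell_{\mathcal A,0,s}$, $\ell_{\mathcal B,0,s}$ and $\ell_{\mathcal C,0,s}$ in place of $\ell_{\mathcal A,s}$, $\ell_{\mathcal B,s}$ and $\ell_{\mathcal C,s}$, respectively, at each occurrence (and likewise for the $\star$-versions).
   Context: **Indices and weights.** $\mathbf N=\{0,1,2,\dots\}$. $\overline{\mathbf R_\flat}=[0,\infty)\cup\{\flat_\sigma:\sigma>0\}$, where the $\flat_\sigma$ are formal symbols, ordered so that $x_1<\flat_{\sigma_1}<\flat_{\sigma_2}<x_2$ whenever $x_1<\frac12\le x_2$ and $\sigma_1<\sigma_2$. For $r>0$ and $\alpha\in\mathbf N^d$: $\vartheta_{r,s}(\alpha)=e^{r|\alpha|^{1/(2s)}}$ if $s\in(0,\infty)$; $\vartheta_{r,s}(\alpha)=r^{|\alpha|}(\alpha!)^{1/(2\sigma)}$ if $s=\flat_\sigma$; $\vartheta_{r,0}(\alpha)=1$ if $|\alpha|\le r$ and $=\infty$ if $|\alpha|>r$. Conventions: $a/\infty=0$ for all $a\in(0,\infty]$, $\infty\cdot0=0$, $0^0=1$. For $\omega:\Lambda\to[0,\infty]$, $\ell_{[\omega]}(\Lambda)$ is the set of $c:\Lambda\to\mathbf C$ with $\|c\,\omega\|_{\ell^p(\Lambda)}<\infty$,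 with this (quasi-/semi-)norm, $p\in(0,\infty]$ fixed (the limit spaces below do not depend on $p$). **Spaces on $\Lambda=\mathbf N^d\times\mathbf N^d\ni(\alpha,\beta)$.** $\ell_0(\Lambda)$ is the set of finitely supported sequences. Put $\vartheta_r(\alpha,\beta)=\vartheta_{r,s}(\alpha)\vartheta_{r,s}(\beta)$, $\omega_{r_2,r_1}(\alpha,\beta)=\vartheta_{r_2,s}(\alpha)/\vartheta_{r_1,s}(\beta)$, $\omega^\star_{r_2,r_1}(\alpha,\beta)=\vartheta_{r_1,s}(\beta)/\vartheta_{r_2,s}(\alpha)$. With limits over positive parameters: $\ell_{\mathcal A,s}=\operatorname{ind\,lim}_r\ell_{[\vartheta_r]}$, $\ell_{\mathcal A,s}^\star=\operatorname{proj\,lim}_r\ell_{[1/\vartheta_r]}$, $\ell_{\mathcal A,0,s}=\operatorname{proj\,lim}_r\ell_{[\vartheta_r]}$, $\ell_{\mathcal A,0,s}^\star=\operatorname{ind\,lim}_r\ell_{[1/\vartheta_r]}$; $\ell_{\mathcal B,s}=\operatorname{proj\,lim}_{r_1}\operatorname{ind\,lim}_{r_2}\ell_{[\omega_{r_2,r_1}]}$, $\ell_{\mathcal B,0,s}=\operatorname{proj\,lim}_{r_2}\operatorname{ind\,lim}_{r_1}\ell_{[\omega_{r_2,r_1}]}$, $\ell_{\mathcal B,s}^\star=\operatorname{proj\,lim}_{r_2}\operatorname{ind\,lim}_{r_1}\ell_{[\omega^\star_{r_2,r_1}]}$, $\ell_{\mathcal B,0,s}^\star=\operatorname{proj\,lim}_{r_1}\operatorname{ind\,lim}_{r_2}\ell_{[\omega^\star_{r_2,r_1}]}$;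 $\ell_{\mathcal C,s}=\operatorname{ind\,lim}_{r_2}\operatorname{proj\,lim}_{r_1}\ell_{[\omega_{r_2,r_1}]}$, $\ell_{\mathcal C,0,s}=\operatorname{ind\,lim}_{r_1}\operatorname{proj\,lim}_{r_2}\ell_{[\omega_{r_2,r_1}]}$, $\ell_{\mathcal C,s}^\star=\operatorname{ind\,lim}_{r_1}\operatorname{proj\,lim}_{r_2}\ell_{[\omega^\star_{r_2,r_1}]}$, $\ell_{\mathcal C,0,s}^\star=\operatorname{ind\,lim}_{r_2}\operatorname{proj\,lim}_{r_1}\ell_{[\omega^\star_{r_2,r_1}]}$. As sets, projective/inductive limits are intersections/unions.
   Formalization: "Continuous" is joint continuity only for ℓ_A×ℓ_A→ℓ_A (and ℓ_{A,0}); for the other six mappings it is hypocontinuity on bounded sets of each factor, since joint continuity fails there for t≠0 (for ℓ_C for every t). At t=0 this is also all that is stated for those six. *)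

theory Defs
  imports "HOL-Analysis.Analysis"
begin

section \<open>Indices and weights\<close>

text \<open>
  \<open>Fin x\<close> is the number \<open>x\<close> and \<open>Flat \<sigma>\<close> is the formal symbol \<open>\<flat>\<^sub>\<sigma>\<close>; the admissible indices are those
  in \<open>R_flat\<close>. All \<open>Flat \<sigma>\<close> lie directly below \<open>Fin (1/2)\<close>.
\<close>

datatype rflat = Fin real | Flat real

definition R_flat :: "rflat set" where
  "R_flat = Fin ` {0..} \<union> Flat ` {0<..}"

instantiation rflat :: linorder
begin

fun less_rflat :: "rflat \<Rightarrow> rflat \<Rightarrow> bool" where
  "Fin x < Fin y \<longleftrightarrow> x < y"
| "Fin x < Flat \<sigma> \<longleftrightarrow> x < 1/2"
| "Flat \<sigma> < Fin x \<longleftrightarrow> 1/2 \<le> x"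
| "Flat \<sigma> < Flat \<tau> \<longleftrightarrow> \<sigma> < \<tau>"

definition less_eq_rflat :: "rflat \<Rightarrow> rflat \<Rightarrow> bool" where
  "x \<le> y \<longleftrightarrow> x < y \<or> x = (y :: rflat)"

instance
proof
  fix x y z :: rflat
  show "x < y \<longleftrightarrow> x \<le> y \<and> \<not> y \<le> x"
    by (cases x; cases y) (auto simp: less_eq_rflat_def)
  show "x \<le> x"
    by (simp add: less_eq_rflat_def)
  show "x \<le> y \<Longrightarrow> y \<le> z \<Longrightarrow> x \<le> z"
    by (cases x; cases y; cases z) (auto simp: less_eq_rflat_def)
  show "x \<le> y \<Longrightarrow> y \<le> x \<Longrightarrow> x = y"
    by (cases x; cases y) (auto simp: less_eq_rflat_def)
  show "x \<le> y \<or> y \<le> x"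
    by (cases x; cases y) (auto simp: less_eq_rflat_def)
qed

end

type_synonym 'd mindex = "nat ^ 'd"
type_synonym 'd dindex = "'d mindex \<times> 'd mindex"
type_synonym 'd dseq = "'d dindex \<Rightarrow> complex"

definition mlen :: "('d::finite) mindex \<Rightarrow> nat" where
  "mlen \<alpha> = (\<Sum>i\<in>UNIV. \<alpha> $ i)"

definition mfact :: "('d::finite) mindex \<Rightarrow> nat" where
  "mfact \<alpha> = (\<Prod>i\<in>UNIV. fact (\<alpha> $ i))"

definition mbinom :: "('d::finite) mindex \<Rightarrow> 'd mindex \<Rightarrow> nat" where
  "mbinom \<alpha> \<beta> = (\<Prod>i\<in>UNIV. (\<alpha> $ i) choose (\<beta> $ i))"

text \<open>
  In \<^typ>\<open>ennreal\<close> one has \<open>a / \<infinity> = 0\<close> for every \<open>a\<close>, including \<open>a = \<infinity>\<close>, and \<open>\<infinity> * 0 = 0\<close>;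
  these are the conventions needed when \<open>s = 0\<close>.
\<close>

fun \<theta> :: "real \<Rightarrow> rflat \<Rightarrow> ('d::finite) mindex \<Rightarrow> ennreal" where
  "\<theta> r (Fin x) \<alpha> =
     (if x = 0 then (if real (mlen \<alpha>) \<le> r then 1 else \<infinity>)
      else ennreal (exp (r * real (mlen \<alpha>) powr (1 / (2 * x)))))"
| "\<theta> r (Flat \<sigma>) \<alpha> = ennreal (r ^ mlen \<alpha> * real (mfact \<alpha>) powr (1 / (2 * \<sigma>)))"

definition w\<^sub>A :: "rflat \<Rightarrow> real \<Rightarrow> ('d::finite) dindex \<Rightarrow> ennreal" where
  "w\<^sub>A s r = (\<lambda>(\<alpha>, \<beta>). \<theta> r s \<alpha> * \<theta> r s \<beta>)"

definition w\<^sub>B :: "rflat \<Rightarrow> real \<Rightarrow> real \<Rightarrow> ('d::finite) dindex \<Rightarrow> ennreal" where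
  "w\<^sub>B s r\<^sub>2 r\<^sub>1 = (\<lambda>(\<alpha>, \<beta>). \<theta> r\<^sub>2 s \<alpha> / \<theta> r\<^sub>1 s \<beta>)"

definition w\<^sub>B_star :: "rflat \<Rightarrow> real \<Rightarrow> real \<Rightarrow> ('d::finite) dindex \<Rightarrow> ennreal" where
  "w\<^sub>B_star s r\<^sub>2 r\<^sub>1 = (\<lambda>(\<alpha>, \<beta>). \<theta> r\<^sub>1 s \<beta> / \<theta> r\<^sub>2 s \<alpha>)"


section \<open>Weighted sequence spaces\<close>

definition ennpow :: "ennreal \<Rightarrow> real \<Rightarrow> ennreal" where
  "ennpow x a = (if x = \<infinity> then \<infinity> else ennreal (enn2real x powr a))"

definition lp_norm :: "ennreal \<Rightarrow> ('i \<Rightarrow> ennreal) \<Rightarrow> ennreal" where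
  "lp_norm p f =
     (if p = \<infinity> then (SUP i. f i)
      else ennpow (\<Sum>\<^sub>\<infinity>i\<in>UNIV. ennpow (f i) (enn2real p)) (1 / enn2real p))"

definition wnorm :: "ennreal \<Rightarrow> ('i \<Rightarrow> ennreal) \<Rightarrow> ('i \<Rightarrow> complex) \<Rightarrow> ennreal" where
  "wnorm p \<omega> c = lp_norm p (\<lambda>i. ennreal (cmod (c i)) * \<omega> i)"

definition lw_set :: "ennreal \<Rightarrow> ('i \<Rightarrow> ennreal) \<Rightarrow> ('i \<Rightarrow> complex) set" where
  "lw_set p \<omega> = {c. wnorm p \<omega> c < \<infinity>}"

definition lw_open :: "ennreal \<Rightarrow> ('i \<Rightarrow> ennreal) \<Rightarrow> ('i \<Rightarrow> complex) set \<Rightarrow> bool" where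
  "lw_open p \<omega> U \<longleftrightarrow> U \<subseteq> lw_set p \<omega> \<and>
     (\<forall>x\<in>U. \<exists>\<epsilon>>0. \<forall>y\<in>lw_set p \<omega>. wnorm p \<omega> (\<lambda>i. y i - x i) < \<epsilon> \<longrightarrow> y \<in> U)"

definition lw :: "ennreal \<Rightarrow> ('i \<Rightarrow> ennreal) \<Rightarrow> ('i \<Rightarrow> complex) topology" where
  "lw p \<omega> = topology (lw_open p \<omega>)"

lemma istopology_lw_open: "istopology (lw_open p \<omega>)"
  unfolding istopology_def
proof (intro conjI allI impI)
  fix S T assume S: "lw_open p \<omega> S" and T: "lw_open p \<omega> T"
  have "\<exists>\<epsilon>>0. \<forall>y\<in>lw_set p \<omega>. wnorm p \<omega> (\<lambda>i. y i - x i) < \<epsilon> \<longrightarrow> y \<in> S \<inter> T"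
    if x: "x \<in> S \<inter> T" for x
  proof -
    obtain a where "a > 0" "\<forall>y\<in>lw_set p \<omega>. wnorm p \<omega> (\<lambda>i. y i - x i) < a \<longrightarrow> y \<in> S"
      using S x unfolding lw_open_def by blast
    moreover obtain b where "b > 0" "\<forall>y\<in>lw_set p \<omega>. wnorm p \<omega> (\<lambda>i. y i - x i) < b \<longrightarrow> y \<in> T"
      using T x unfolding lw_open_def by blast
    ultimately show ?thesis
      by (intro exI[of _ "min a b"]) auto
  qed
  then show "lw_open p \<omega> (S \<inter> T)"
    using S unfolding lw_open_def by blast
next
  fix \<K> assume K: "\<forall>K\<in>\<K>. lw_open p \<omega> K"
  have "\<exists>\<epsilon>>0. \<forall>y\<in>lw_set p \<omega>. wnorm p \<omega> (\<lambda>i. y i - x i) < \<epsilon> \<longrightarrow> y \<in> \<Union>\<K>"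
    if x: "x \<in> \<Union>\<K>" for x
  proof -
    obtain k where k: "k \<in> \<K>" "x \<in> k"
      using x by blast
    obtain a where "a > 0" "\<forall>y\<in>lw_set p \<omega>. wnorm p \<omega> (\<lambda>i. y i - x i) < a \<longrightarrow> y \<in> k"
      using K k unfolding lw_open_def by blast
    then show ?thesis
      using k(1) by blast
  qed
  then show "lw_open p \<omega> (\<Union>\<K>)"
    using K unfolding lw_open_def by blast
qed


section \<open>Projective and inductive limits\<close>

text \<open>
  Both limits run over all parameters \<open>r > 0\<close>. The projective limit carries the coarsest topology
  for which the inclusions into the \<open>T r\<close> are continuous; the inductive limit carries the finest
  locally convex topology for which the inclusions of the \<open>T r\<close> are continuous. A base of
  neighbourhoods of zero of the latter consists of the absolutely convex sets whose intersection
  with each \<open>T r\<close> is a neighbourhood of zero there.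
\<close>

definition abs_convex :: "('i \<Rightarrow> complex) set \<Rightarrow> bool" where
  "abs_convex V \<longleftrightarrow>
     (\<forall>x\<in>V. \<forall>y\<in>V. \<forall>a b. cmod a + cmod b \<le> 1 \<longrightarrow> (\<lambda>i. a * x i + b * y i) \<in> V)"

definition zero_nhd :: "('i \<Rightarrow> complex) topology \<Rightarrow> ('i \<Rightarrow> complex) set \<Rightarrow> bool" where
  "zero_nhd T V \<longleftrightarrow> V \<subseteq> topspace T \<and> (\<exists>U. openin T U \<and> (\<lambda>_. 0) \<in> U \<and> U \<subseteq> V)"

definition proj_lim :: "(real \<Rightarrow> ('i \<Rightarrow> complex) topology) \<Rightarrow> ('i \<Rightarrow> complex) topology" where
  "proj_lim T =
     topology_generated_by
       {U \<inter> (\<Inter>r\<in>{0<..}. topspace (T r)) | U r. r > 0 \<and> openin (T r) U}"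

definition ind_lim_nhd ::
  "(real \<Rightarrow> ('i \<Rightarrow> complex) topology) \<Rightarrow> ('i \<Rightarrow> complex) set \<Rightarrow> bool" where
  "ind_lim_nhd T V \<longleftrightarrow> abs_convex V \<and> V \<subseteq> (\<Union>r\<in>{0<..}. topspace (T r)) \<and>
     (\<forall>r>0. zero_nhd (T r) (V \<inter> topspace (T r)))"

definition ind_lim_open ::
  "(real \<Rightarrow> ('i \<Rightarrow> complex) topology) \<Rightarrow> ('i \<Rightarrow> complex) set \<Rightarrow> bool" where
  "ind_lim_open T U \<longleftrightarrow> U \<subseteq> (\<Union>r\<in>{0<..}. topspace (T r)) \<and>
     (\<forall>x\<in>U. \<exists>V. ind_lim_nhd T V \<and> (\<forall>v\<in>V. (\<lambda>i. x i + v i) \<in> U))"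

definition ind_lim :: "(real \<Rightarrow> ('i \<Rightarrow> complex) topology) \<Rightarrow> ('i \<Rightarrow> complex) topology" where
  "ind_lim T = topology (ind_lim_open T)"

lemma zero_nhd_Int: "zero_nhd T V \<Longrightarrow> zero_nhd T W \<Longrightarrow> zero_nhd T (V \<inter> W)"
  unfolding zero_nhd_def by (meson IntI Int_mono inf.coboundedI1 openin_Int)

lemma ind_lim_nhd_Int:
  assumes "ind_lim_nhd T V" "ind_lim_nhd T W"
  shows "ind_lim_nhd T (V \<inter> W)"
  unfolding ind_lim_nhd_def
proof (intro conjI allI impI)
  show "abs_convex (V \<inter> W)"
    using assms by (simp add: ind_lim_nhd_def abs_convex_def)
  show "V \<inter> W \<subseteq> (\<Union>r\<in>{0<..}. topspace (T r))"
    using assms by (auto simp: ind_lim_nhd_def)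
  fix r :: real assume "r > 0"
  then have "zero_nhd (T r) ((V \<inter> topspace (T r)) \<inter> (W \<inter> topspace (T r)))"
    using assms zero_nhd_Int[of "T r" "V \<inter> topspace (T r)" "W \<inter> topspace (T r)"]
    by (simp add: ind_lim_nhd_def)
  moreover have "(V \<inter> topspace (T r)) \<inter> (W \<inter> topspace (T r)) = V \<inter> W \<inter> topspace (T r)"
    by auto
  ultimately show "zero_nhd (T r) (V \<inter> W \<inter> topspace (T r))"
    by simp
qed

lemma istopology_ind_lim_open: "istopology (ind_lim_open T)"
  unfolding istopology_def
proof (intro conjI allI impI)
  fix A B assume A: "ind_lim_open T A" and B: "ind_lim_open T B"
  have "\<exists>V. ind_lim_nhd T V \<and> (\<forall>v\<in>V. (\<lambda>i. x i + v i) \<in> A \<inter> B)" if x: "x \<in> A \<inter> B" for x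
  proof -
    obtain V where V: "ind_lim_nhd T V" "\<forall>v\<in>V. (\<lambda>i. x i + v i) \<in> A"
      using A x unfolding ind_lim_open_def by auto
    obtain W where W: "ind_lim_nhd T W" "\<forall>v\<in>W. (\<lambda>i. x i + v i) \<in> B"
      using B x unfolding ind_lim_open_def by auto
    show ?thesis
      using V W ind_lim_nhd_Int[of T V W] by (intro exI[of _ "V \<inter> W"]) auto
  qed
  then show "ind_lim_open T (A \<inter> B)"
    using A unfolding ind_lim_open_def by auto
next
  fix \<K> assume K: "\<forall>K\<in>\<K>. ind_lim_open T K"
  show "ind_lim_open T (\<Union>\<K>)"
    unfolding ind_lim_open_def
  proof (intro conjI ballI)
    show "\<Union>\<K> \<subseteq> (\<Union>r\<in>{0<..}. topspace (T r))"
      using K unfolding ind_lim_open_def by (meson Sup_least)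
  next
    fix x assume "x \<in> \<Union>\<K>"
    then obtain k where k: "k \<in> \<K>" "x \<in> k" by auto
    then have "ind_lim_open T k"
      using K by auto
    then obtain V where "ind_lim_nhd T V" "\<forall>v\<in>V. (\<lambda>i. x i + v i) \<in> k"
      using k(2) unfolding ind_lim_open_def by auto
    then show "\<exists>V. ind_lim_nhd T V \<and> (\<forall>v\<in>V. (\<lambda>i. x i + v i) \<in> \<Union>\<K>)"
      using k(1) by (intro exI[of _ V]) auto
  qed
qed


section \<open>The spaces on \<open>\<Lambda> = N\<^sup>d \<times> N\<^sup>d\<close>\<close>

definition l\<^sub>0 :: "('d::finite) dseq set" where
  "l\<^sub>0 = {c. finite {x. c x \<noteq> 0}}"

definition lA :: "ennreal \<Rightarrow> rflat \<Rightarrow> ('d::finite) dseq topology" where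
  "lA p s = ind_lim (\<lambda>r. lw p (w\<^sub>A s r))"

definition lA_star :: "ennreal \<Rightarrow> rflat \<Rightarrow> ('d::finite) dseq topology" where
  "lA_star p s = proj_lim (\<lambda>r. lw p (\<lambda>x. 1 / w\<^sub>A s r x))"

definition lA0 :: "ennreal \<Rightarrow> rflat \<Rightarrow> ('d::finite) dseq topology" where
  "lA0 p s = proj_lim (\<lambda>r. lw p (w\<^sub>A s r))"

definition lA0_star :: "ennreal \<Rightarrow> rflat \<Rightarrow> ('d::finite) dseq topology" where
  "lA0_star p s = ind_lim (\<lambda>r. lw p (\<lambda>x. 1 / w\<^sub>A s r x))"

definition lB :: "ennreal \<Rightarrow> rflat \<Rightarrow> ('d::finite) dseq topology" where
  "lB p s = proj_lim (\<lambda>r\<^sub>1. ind_lim (\<lambda>r\<^sub>2. lw p (w\<^sub>B s r\<^sub>2 r\<^sub>1)))"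

definition lB0 :: "ennreal \<Rightarrow> rflat \<Rightarrow> ('d::finite) dseq topology" where
  "lB0 p s = proj_lim (\<lambda>r\<^sub>2. ind_lim (\<lambda>r\<^sub>1. lw p (w\<^sub>B s r\<^sub>2 r\<^sub>1)))"

definition lB_star :: "ennreal \<Rightarrow> rflat \<Rightarrow> ('d::finite) dseq topology" where
  "lB_star p s = proj_lim (\<lambda>r\<^sub>2. ind_lim (\<lambda>r\<^sub>1. lw p (w\<^sub>B_star s r\<^sub>2 r\<^sub>1)))"

definition lB0_star :: "ennreal \<Rightarrow> rflat \<Rightarrow> ('d::finite) dseq topology" where
  "lB0_star p s = proj_lim (\<lambda>r\<^sub>1. ind_lim (\<lambda>r\<^sub>2. lw p (w\<^sub>B_star s r\<^sub>2 r\<^sub>1)))"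

definition lC :: "ennreal \<Rightarrow> rflat \<Rightarrow> ('d::finite) dseq topology" where
  "lC p s = ind_lim (\<lambda>r\<^sub>2. proj_lim (\<lambda>r\<^sub>1. lw p (w\<^sub>B s r\<^sub>2 r\<^sub>1)))"

definition lC0 :: "ennreal \<Rightarrow> rflat \<Rightarrow> ('d::finite) dseq topology" where
  "lC0 p s = ind_lim (\<lambda>r\<^sub>1. proj_lim (\<lambda>r\<^sub>2. lw p (w\<^sub>B s r\<^sub>2 r\<^sub>1)))"

definition lC_star :: "ennreal \<Rightarrow> rflat \<Rightarrow> ('d::finite) dseq topology" where
  "lC_star p s = ind_lim (\<lambda>r\<^sub>1. proj_lim (\<lambda>r\<^sub>2. lw p (w\<^sub>B_star s r\<^sub>2 r\<^sub>1)))"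

definition lC0_star :: "ennreal \<Rightarrow> rflat \<Rightarrow> ('d::finite) dseq topology" where
  "lC0_star p s = ind_lim (\<lambda>r\<^sub>2. proj_lim (\<lambda>r\<^sub>1. lw p (w\<^sub>B_star s r\<^sub>2 r\<^sub>1)))"


section \<open>The map \<open>U\<^bsub>t,#\<^esub>\<close>\<close>

text \<open>
  For finitely supported \<open>c\<^sub>1\<close> and \<open>c\<^sub>2\<close> only finitely many terms are nonzero. The differences of
  multi-indices are componentwise and never truncate, since \<open>\<alpha>\<^sub>0 \<le> \<alpha>\<close> and \<open>\<beta>\<^sub>0 \<le> \<beta>\<close>.
\<close>

definition U_sharp :: "complex \<Rightarrow> ('d::finite) dseq \<Rightarrow> 'd dseq \<Rightarrow> 'd dseq" where
  "U_sharp t c\<^sub>1 c\<^sub>2 = (\<lambda>(\<alpha>, \<beta>).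
     \<Sum>\<^sub>\<infinity>(\<alpha>\<^sub>0, \<beta>\<^sub>0, \<gamma>)\<in>{(\<alpha>\<^sub>0, \<beta>\<^sub>0, \<gamma>). \<alpha>\<^sub>0 \<le> \<alpha> \<and> \<beta>\<^sub>0 \<le> \<beta>}.
       complex_of_real (sqrt (real
         (mbinom \<alpha> \<alpha>\<^sub>0 * mbinom \<beta> \<beta>\<^sub>0 * mbinom (\<alpha> - \<alpha>\<^sub>0 + \<gamma>) \<gamma> * mbinom (\<beta> - \<beta>\<^sub>0 + \<gamma>) \<gamma>)))
       * t ^ mlen \<gamma> * c\<^sub>1 (\<alpha>\<^sub>0, \<beta> - \<beta>\<^sub>0 + \<gamma>) * c\<^sub>2 (\<alpha> - \<alpha>\<^sub>0 + \<gamma>, \<beta>\<^sub>0))"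


section \<open>Continuity of bilinear maps and unique extension\<close>

definition tvs_bounded :: "('i \<Rightarrow> complex) topology \<Rightarrow> ('i \<Rightarrow> complex) set \<Rightarrow> bool" where
  "tvs_bounded X D \<longleftrightarrow> D \<subseteq> topspace X \<and>
     (\<forall>V. zero_nhd X V \<longrightarrow> (\<exists>k::real. k > 0 \<and> D \<subseteq> (\<lambda>v i. of_real k * v i) ` V))"

definition bilinear_between ::
  "('i \<Rightarrow> complex) set \<Rightarrow> ('j \<Rightarrow> complex) set \<Rightarrow> (('i \<Rightarrow> complex) \<Rightarrow> ('j \<Rightarrow> complex) \<Rightarrow> ('k \<Rightarrow> complex)) \<Rightarrow> bool" where
  "bilinear_between A B F \<longleftrightarrow>
     (\<forall>x\<in>A. \<forall>x'\<in>A. \<forall>y\<in>B. \<forall>a b.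
        F (\<lambda>i. a * x i + b * x' i) y = (\<lambda>k. a * F x y k + b * F x' y k)) \<and>
     (\<forall>x\<in>A. \<forall>y\<in>B. \<forall>y'\<in>B. \<forall>a b.
        F x (\<lambda>j. a * y j + b * y' j) = (\<lambda>k. a * F x y k + b * F x y' k))"

definition separately_continuous ::
  "('i \<Rightarrow> complex) topology \<Rightarrow> ('j \<Rightarrow> complex) topology \<Rightarrow> ('k \<Rightarrow> complex) topology \<Rightarrow>
   (('i \<Rightarrow> complex) \<Rightarrow> ('j \<Rightarrow> complex) \<Rightarrow> ('k \<Rightarrow> complex)) \<Rightarrow> bool" where
  "separately_continuous X Y Z F \<longleftrightarrow>
     (\<forall>y\<in>topspace Y. continuous_map X Z (\<lambda>x. F x y)) \<and>
     (\<forall>x\<in>topspace X. continuous_map Y Z (F x))"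

definition jointly_continuous ::
  "('i \<Rightarrow> complex) topology \<Rightarrow> ('j \<Rightarrow> complex) topology \<Rightarrow> ('k \<Rightarrow> complex) topology \<Rightarrow>
   (('i \<Rightarrow> complex) \<Rightarrow> ('j \<Rightarrow> complex) \<Rightarrow> ('k \<Rightarrow> complex)) \<Rightarrow> bool" where
  "jointly_continuous X Y Z F \<longleftrightarrow> continuous_map (prod_topology X Y) Z (\<lambda>(x, y). F x y)"

text \<open>
  Hypocontinuity with respect to the bounded sets of both factors.
\<close>

definition hypocontinuous ::
  "('i \<Rightarrow> complex) topology \<Rightarrow> ('j \<Rightarrow> complex) topology \<Rightarrow> ('k \<Rightarrow> complex) topology \<Rightarrow>
   (('i \<Rightarrow> complex) \<Rightarrow> ('j \<Rightarrow> complex) \<Rightarrow> ('k \<Rightarrow> complex)) \<Rightarrow> bool" where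
  "hypocontinuous X Y Z F \<longleftrightarrow>
     bilinear_between (topspace X) (topspace Y) F \<and> separately_continuous X Y Z F \<and>
     (\<forall>D W. tvs_bounded Y D \<and> zero_nhd Z W \<longrightarrow>
        (\<exists>V. zero_nhd X V \<and> (\<forall>x\<in>V. \<forall>y\<in>D. F x y \<in> W))) \<and>
     (\<forall>D W. tvs_bounded X D \<and> zero_nhd Z W \<longrightarrow>
        (\<exists>V. zero_nhd Y V \<and> (\<forall>x\<in>D. \<forall>y\<in>V. F x y \<in> W)))"

definition extends_to ::
  "('d::finite) dseq topology \<Rightarrow> 'd dseq topology \<Rightarrow> 'd dseq topology \<Rightarrow>
   ('d dseq \<Rightarrow> 'd dseq \<Rightarrow> 'd dseq) \<Rightarrow> ('d dseq \<Rightarrow> 'd dseq \<Rightarrow> 'd dseq) \<Rightarrow> bool" where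
  "extends_to X Y Z U F \<longleftrightarrow>
     l\<^sub>0 \<subseteq> topspace X \<and> l\<^sub>0 \<subseteq> topspace Y \<and>
     (\<forall>x\<in>topspace X. \<forall>y\<in>topspace Y. F x y \<in> topspace Z) \<and>
     (\<forall>x\<in>l\<^sub>0. \<forall>y\<in>l\<^sub>0. F x y = U x y)"

text \<open>
  On \<open>\<ell>\<^sub>A \<times> \<ell>\<^sub>A\<close> and its projective counterpart, continuity is joint continuity for the product
  topology. In all other cases, for \<open>t \<noteq> 0\<close>, no extension is jointly continuous: the value at
  \<open>(0, 0)\<close>, restricted to \<open>c\<^sub>1\<close> supported in \<open>{0} \<times> N\<^sup>d\<close> and \<open>c\<^sub>2\<close> supported in \<open>N\<^sup>d \<times> {0}\<close>, is the
  (rescaled) duality pairing \<open>\<Sum>\<gamma>. t\<^bsup>|\<gamma>|\<^esup> c\<^sub>1(0,\<gamma>) c\<^sub>2(\<gamma>,0)\<close> of a non-normable space with its dual.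
  Continuity of the bilinear extension means hypocontinuity there. Uniqueness is among all
  separately continuous maps, hence also among the jointly continuous or hypocontinuous ones.
\<close>

definition uniquely_extends_joint ::
  "('d::finite) dseq topology \<Rightarrow> 'd dseq topology \<Rightarrow> 'd dseq topology \<Rightarrow>
   ('d dseq \<Rightarrow> 'd dseq \<Rightarrow> 'd dseq) \<Rightarrow> bool" where
  "uniquely_extends_joint X Y Z U \<longleftrightarrow>
     (\<exists>F. extends_to X Y Z U F \<and> jointly_continuous X Y Z F \<and>
       (\<forall>G. extends_to X Y Z U G \<and> separately_continuous X Y Z G \<longrightarrow>
          (\<forall>x\<in>topspace X. \<forall>y\<in>topspace Y. G x y = F x y)))"

definition uniquely_extends_hypo ::
  "('d::finite) dseq topology \<Rightarrow> 'd dseq topology \<Rightarrow> 'd dseq topology \<Rightarrow>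
   ('d dseq \<Rightarrow> 'd dseq \<Rightarrow> 'd dseq) \<Rightarrow> bool" where
  "uniquely_extends_hypo X Y Z U \<longleftrightarrow>
     (\<exists>F. extends_to X Y Z U F \<and> hypocontinuous X Y Z F \<and>
       (\<forall>G. extends_to X Y Z U G \<and> separately_continuous X Y Z G \<longrightarrow>
          (\<forall>x\<in>topspace X. \<forall>y\<in>topspace Y. G x y = F x y)))"

end

(*
  All twelve limit spaces are Koethe spaces: sequences c whose modulus lies in a solid cone S, with
  the seminorms c |-> sum |c| w for w in a cone W of weights. This is independent of p because
  passing from one parameter to another gains a summable geometric factor, and in the limits l^p
  norms (quasi-norms for p < 1) may be replaced by weighted l^1 norms.

  With a = alpha_0, a' = alpha - alpha_0, b = beta - beta_0, b' = beta_0, the map U is a bilinear map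
  with kernel on the free variables (a, a', b, b', gamma), with first argument read at (a, b + gamma),
  second at (a' + gamma, b') and value at (a + a', b + b'). The binomials and t^|gamma| are bounded
  by an exponential in |a| + |a'| + |b| + |b'| + |gamma|. Everything then follows from
    R^(|alpha| + |beta|) th_r (alpha + beta) <= C th_p alpha th_q beta,
  valid for small r when s < 1/2 and for large p, q when 0 < s <= 1/2, together with
  th_r alpha th_r beta <= th_r (alpha + beta).

  Hypocontinuity is transferred to the positive kernel by duality: gliding hump arguments identify the
  bounded sets and the dual cones through weighted sup norms. The starred cases are mirror images:
  U x y is the transpose of U y' x' for the transposed sequences x', y'.
*)

theory Submission
  imports Defs
begin

section \<open>Sums of extended nonnegative functions\<close>

text \<open>Hypocontinuity is uniformity over bounded sets. The summable factor \<open>g\<close>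
  makes the pointwise supremum of a bounded set pair finitely with every weight, so one nonnegative
  sequence replaces the set; but this sequence is only known to lie in the Koethe dual of the
  weights, which may exceed the space. Hence the kernel must be controlled on that dual. For
  projective limits of inductive limits the gliding hump returns the dual to sup-norm bounds at
  every outer parameter, and the kernel estimates are arranged so that only one argument has to
  satisfy all of them. For inductive limits of projective limits the weights form the whole dual of
  the space, and transposing the kernel twice reaches the bidual without a further estimate.

  The other obstacle is s = 0, where weights take the value infinity and their reciprocals vanish.
  Sequences then vanish where a weight is infinite, and seminorms ignore what happens there. This is
  why all estimates run in \<open>ennreal\<close>, why weights may be infinite, and why some
  constants are enlarged by 1: infinity must not meet a factor 0.\<close>

definition pairing :: "('i \<Rightarrow> ennreal) \<Rightarrow> ('i \<Rightarrow> ennreal) \<Rightarrow> ennreal" where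
  "pairing x w = (\<integral>\<^sup>+i. x i * w i \<partial>count_space UNIV)"

definition delta :: "'i \<Rightarrow> 'i \<Rightarrow> ennreal" where
  "delta i = indicator {i}"

definition mag :: "('i \<Rightarrow> complex) \<Rightarrow> 'i \<Rightarrow> ennreal" where
  "mag c = (\<lambda>i. ennreal (cmod (c i)))"

lemma sum_le_nn_integral_count_space:
  fixes f :: "'i \<Rightarrow> ennreal"
  assumes "finite F"
  shows "sum f F \<le> (\<integral>\<^sup>+i. f i \<partial>count_space UNIV)"
proof -
  have "sum f F = (\<integral>\<^sup>+i. f i * indicator F i \<partial>count_space UNIV)"
    using assms by (subst nn_integral_count_space'[where A = F]) (auto simp: indicator_def)
  also have "\<dots> \<le> (\<integral>\<^sup>+i. f i \<partial>count_space UNIV)"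
    by (intro nn_integral_mono) (auto simp: indicator_def)
  finally show ?thesis .
qed

lemma ennreal_less_imp: "ennreal x < ennreal y \<Longrightarrow> x < y"
  by (meson ennreal_leI not_le)

text \<open>The sets \<open>to_nat i < n\<close> are finite and exhaust the index type, so by
  monotone convergence the truncated integrals approach the finite total and the remainder drops
  below \<open>e\<close>.\<close>

lemma nn_integral_count_space_tail:
  fixes f :: "'i::countable \<Rightarrow> ennreal"
  assumes fin: "(\<integral>\<^sup>+i. f i \<partial>count_space UNIV) < \<infinity>" and e: "0 < e"
  shows "\<exists>F. finite F \<and> (\<integral>\<^sup>+i. f i * indicator (- F) i \<partial>count_space UNIV) < e"
proof -
  define h where "h n i = f i * indicator {i. to_nat i < n} i" for n :: nat and i
  have inc: "incseq h"
    by (auto simp: incseq_def le_fun_def h_def indicator_def)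
  have "(SUP n. h n i) = f i" for i
  proof (rule antisym)
    show "(SUP n. h n i) \<le> f i"
      by (rule SUP_least) (auto simp: h_def indicator_def)
    show "f i \<le> (SUP n. h n i)"
      by (rule SUP_upper2[of "Suc (to_nat i)"]) (auto simp: h_def indicator_def)
  qed
  then have lim: "(\<integral>\<^sup>+i. f i \<partial>count_space UNIV) = (SUP n. \<integral>\<^sup>+i. h n i \<partial>count_space UNIV)"
    using nn_integral_monotone_convergence_SUP[of h "count_space UNIV"] inc by simp
  let ?I = "\<integral>\<^sup>+i. f i \<partial>count_space UNIV"
  obtain n where n: "?I < (\<integral>\<^sup>+i. h n i \<partial>count_space UNIV) + e"
  proof (cases "?I = 0")
    case True
    then show ?thesis
      using that[of 0] e by (simp add: add_nonneg_pos)
  next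
    case False
    \<comment> \<open>\<open>e\<close> may be infinite; with a finite \<open>d\<close> the truncated
      subtraction \<open>?I - d\<close> can be undone by real arithmetic.\<close>
    define d where "d = min e 1"
    have d: "0 < d" "d \<le> e" "d < \<infinity>"
      using e by (auto simp: d_def min_def intro: order_le_less_trans[of _ 1])
    have "?I - d < ?I"
      using False fin d by (intro ennreal_between) (auto simp: zero_less_iff_neq_zero)
    then obtain n where n: "?I - d < (\<integral>\<^sup>+i. h n i \<partial>count_space UNIV)"
      unfolding lim less_SUP_iff by auto
    have "a < b + d" if "a - d < b" "a < \<infinity>" for a b :: ennreal
      using that d by (cases a; cases b; cases d)
        (auto simp: ennreal_minus ennreal_less_iff simp flip: ennreal_plus dest!: ennreal_less_imp)
    from this[OF n fin] show ?thesis
      using that[of n] d(2) by (meson add_left_mono order_less_le_trans)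
  qed
  let ?F = "{i::'i. to_nat i < n}"
  have "finite ?F"
    by (rule finite_imageD[of to_nat]) (auto intro: finite_subset[of _ "{..<n}"] inj_on_subset[OF inj_to_nat])
  have "?I = (\<integral>\<^sup>+i. h n i + f i * indicator (- ?F) i \<partial>count_space UNIV)"
    by (intro nn_integral_cong) (auto simp: h_def indicator_def)
  also have "\<dots> = (\<integral>\<^sup>+i. h n i \<partial>count_space UNIV) + (\<integral>\<^sup>+i. f i * indicator (- ?F) i \<partial>count_space UNIV)"
    by (rule nn_integral_add) auto
  finally have I: "?I = (\<integral>\<^sup>+i. h n i \<partial>count_space UNIV) + (\<integral>\<^sup>+i. f i * indicator (- ?F) i \<partial>count_space UNIV)" .
  then have "(\<integral>\<^sup>+i. f i * indicator (- ?F) i \<partial>count_space UNIV) < e"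
    using n fin by (metis add_left_mono linorder_not_le)
  with \<open>finite ?F\<close> show ?thesis
    by blast
qed

section \<open>The pairing of nonnegative sequences\<close>

lemma pairing_mono: "(\<And>i. x i \<le> x' i) \<Longrightarrow> (\<And>i. w i \<le> w' i) \<Longrightarrow> pairing x w \<le> pairing x' w'"
  unfolding pairing_def by (intro nn_integral_mono mult_mono) auto

lemma pairing_add_left: "pairing (\<lambda>i. x i + y i) w = pairing x w + pairing y w"
  unfolding pairing_def by (simp add: distrib_right nn_integral_add)

lemma pairing_commute: "pairing x w = pairing w x"
  unfolding pairing_def by (simp add: mult.commute)

lemma pairing_add_right: "pairing x (\<lambda>i. w i + v i) = pairing x w + pairing x v"
  by (metis pairing_add_left pairing_commute)

lemma pairing_cmult_left: "pairing (\<lambda>i. c * x i) w = c * pairing x w"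
  unfolding pairing_def by (simp add: mult.assoc nn_integral_cmult)

lemma pairing_cmult_right: "pairing x (\<lambda>i. c * w i) = c * pairing x w"
  by (metis pairing_cmult_left pairing_commute)

lemma pairing_zero_left [simp]: "pairing (\<lambda>_. 0) w = 0"
  by (simp add: pairing_def)

lemma pairing_zero_right [simp]: "pairing x (\<lambda>_. 0) = 0"
  by (simp add: pairing_def)

lemma pairing_delta_left [simp]: "pairing (delta i) w = w i"
  unfolding pairing_def delta_def
  by (subst nn_integral_count_space'[where A = "{i}"]) (auto simp: indicator_def)

lemma pairing_delta_right [simp]: "pairing x (delta i) = x i"
  by (metis pairing_delta_left pairing_commute)

lemma le_pairing: "x i * w i \<le> pairing x w"
  using sum_le_nn_integral_count_space[of "{i}" "\<lambda>i. x i * w i"] by (simp add: pairing_def)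

lemma pairing_tail:
  fixes x w :: "'i::countable \<Rightarrow> ennreal"
  assumes "pairing x w < \<infinity>" "0 < e"
  shows "\<exists>F. finite F \<and> pairing (\<lambda>i. x i * indicator (- F) i) w < e"
  using nn_integral_count_space_tail[of "\<lambda>i. x i * w i" e] assms
  by (simp add: pairing_def mult.assoc mult.commute mult.left_commute)

lemma mag_zero [simp]: "mag (\<lambda>_. 0) = (\<lambda>_. 0)"
  by (simp add: mag_def)

lemma mag_cmult: "mag (\<lambda>i. a * x i) = (\<lambda>i. ennreal (cmod a) * mag x i)"
  by (simp add: mag_def norm_mult ennreal_mult)

lemma mag_add_le: "mag (\<lambda>i. x i + y i) i \<le> mag x i + mag y i"
  unfolding mag_def by (simp add: norm_triangle_ineq flip: ennreal_plus)

lemma pairing_mag_triangle: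
  "pairing (mag (\<lambda>i. x i - z i)) w \<le> pairing (mag (\<lambda>i. x i - y i)) w + pairing (mag (\<lambda>i. y i - z i)) w"
proof -
  have "mag (\<lambda>i. x i - z i) i \<le> mag (\<lambda>i. x i - y i) i + mag (\<lambda>i. y i - z i) i" for i
    using mag_add_le[of "\<lambda>i. x i - y i" "\<lambda>i. y i - z i" i] by simp
  then show ?thesis
    unfolding pairing_add_left[symmetric] by (intro pairing_mono) auto
qed

section \<open>Koethe spaces\<close>

text \<open>Serves both for the moduli of the elements of a space and for its weights. Solidity
  turns every pointwise majorization into membership.\<close>

definition wcone :: "('i \<Rightarrow> ennreal) set \<Rightarrow> bool" where
  "wcone S \<longleftrightarrow> (\<lambda>_. 0) \<in> S \<and> (\<forall>x\<in>S. \<forall>y\<in>S. (\<lambda>i. x i + y i) \<in> S) \<and>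
     (\<forall>x\<in>S. \<forall>c<\<infinity>. (\<lambda>i. c * x i) \<in> S) \<and> (\<forall>x\<in>S. \<forall>y. (\<forall>i. y i \<le> x i) \<longrightarrow> y \<in> S)"

text \<open>The Koethe (or alpha-) dual, restricted to nonnegative sequences.\<close>

definition dual :: "('i \<Rightarrow> ennreal) set \<Rightarrow> ('i \<Rightarrow> ennreal) set" where
  "dual S = {v. \<forall>x\<in>S. pairing x v < \<infinity>}"

definition seqs :: "('i \<Rightarrow> ennreal) set \<Rightarrow> ('i \<Rightarrow> complex) set" where
  "seqs S = {c. mag c \<in> S}"

text \<open>
  The Koethe space of \<open>S\<close> and \<open>W\<close> consists of the sequences with modulus in \<open>S\<close>; its topology is given
  by the seminorms \<open>c \<mapsto> \<Sum>i. |c i| w i\<close>, \<open>w \<in> W\<close>. As \<open>W\<close> is a cone, balls of radius 1 suffice.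
\<close>

definition kopen :: "('i \<Rightarrow> ennreal) set \<Rightarrow> ('i \<Rightarrow> ennreal) set \<Rightarrow> ('i \<Rightarrow> complex) set \<Rightarrow> bool" where
  "kopen S W U \<longleftrightarrow> U \<subseteq> seqs S \<and>
     (\<forall>x\<in>U. \<exists>w\<in>W. \<forall>y\<in>seqs S. pairing (mag (\<lambda>i. y i - x i)) w < 1 \<longrightarrow> y \<in> U)"

definition ktop :: "('i \<Rightarrow> ennreal) set \<Rightarrow> ('i \<Rightarrow> ennreal) set \<Rightarrow> ('i \<Rightarrow> complex) topology" where
  "ktop S W = topology (kopen S W)"

lemma
  assumes "wcone S"
  shows wcone_zero: "(\<lambda>_. 0) \<in> S"
    and wcone_add: "x \<in> S \<Longrightarrow> y \<in> S \<Longrightarrow> (\<lambda>i. x i + y i) \<in> S"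
    and wcone_cmult: "x \<in> S \<Longrightarrow> c < \<infinity> \<Longrightarrow> (\<lambda>i. c * x i) \<in> S"
    and wcone_solid: "x \<in> S \<Longrightarrow> (\<And>i. y i \<le> x i) \<Longrightarrow> y \<in> S"
  using assms by (auto simp: wcone_def)

lemma wcone_dual: "wcone (dual S)"
proof -
  have "pairing x y < \<infinity>" if "\<forall>i. y i \<le> v i" "pairing x v < \<infinity>" for x y v :: "'a \<Rightarrow> ennreal"
    using pairing_mono[of x x y v] that by (simp add: order_le_less_trans)
  then show ?thesis
    unfolding wcone_def dual_def
    by (auto simp: pairing_add_right pairing_cmult_right ennreal_mult_less_top)
qed

lemma wcone_Inter:
  assumes "\<And>r. r \<in> R \<Longrightarrow> wcone (S r)"
  shows "wcone (\<Inter>r\<in>R. S r)"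
  using assms unfolding wcone_def by auto

text \<open>Comparability closes the union under addition: two elements taken from different members
  both lie in the larger one.\<close>

lemma wcone_Union_chain:
  assumes "\<And>r. r \<in> R \<Longrightarrow> wcone (S r)" "R \<noteq> {}"
    and chain: "\<And>r r'. r \<in> R \<Longrightarrow> r' \<in> R \<Longrightarrow> S r \<subseteq> S r' \<or> S r' \<subseteq> S r"
  shows "wcone (\<Union>r\<in>R. S r)"
proof -
  show ?thesis
    unfolding wcone_def
  proof (intro conjI ballI allI impI)
    show "(\<lambda>_. 0) \<in> (\<Union>r\<in>R. S r)"
      using assms(1,2) wcone_zero by blast
  next
    fix x y assume "x \<in> (\<Union>r\<in>R. S r)" "y \<in> (\<Union>r\<in>R. S r)"
    then obtain r r' where r: "r \<in> R" "r' \<in> R" "x \<in> S r" "y \<in> S r'"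
      by blast
    from chain[OF r(1,2)] show "(\<lambda>i. x i + y i) \<in> (\<Union>r\<in>R. S r)"
    proof
      assume "S r \<subseteq> S r'"
      then show ?thesis
        using wcone_add[OF assms(1)[OF r(2)]] r by (intro UN_I[of r']) auto
    next
      assume "S r' \<subseteq> S r"
      then show ?thesis
        using wcone_add[OF assms(1)[OF r(1)]] r by (intro UN_I[of r]) auto
    qed
  next
    fix x and c :: ennreal assume "x \<in> (\<Union>r\<in>R. S r)" "c < \<infinity>"
    then show "(\<lambda>i. c * x i) \<in> (\<Union>r\<in>R. S r)"
      using wcone_cmult[OF assms(1)] by auto
  next
    fix x y assume "x \<in> (\<Union>r\<in>R. S r)" "\<forall>i. y i \<le> x i"
    then obtain r where "r \<in> R" "x \<in> S r"
      by blast
    then show "y \<in> (\<Union>r\<in>R. S r)"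
      using wcone_solid[OF assms(1)[of r], of x y] \<open>\<forall>i. y i \<le> x i\<close> by auto
  qed
qed

lemma seqs_zero: "wcone S \<Longrightarrow> (\<lambda>_. 0) \<in> seqs S"
  by (simp add: seqs_def wcone_zero)

lemma seqs_add: "wcone S \<Longrightarrow> x \<in> seqs S \<Longrightarrow> y \<in> seqs S \<Longrightarrow> (\<lambda>i. x i + y i) \<in> seqs S"
  unfolding seqs_def mem_Collect_eq
  by (rule wcone_solid[OF _ wcone_add[of S "mag x" "mag y"] mag_add_le])

lemma seqs_cmult: "wcone S \<Longrightarrow> x \<in> seqs S \<Longrightarrow> (\<lambda>i. a * x i) \<in> seqs S"
  unfolding seqs_def by (simp add: mag_cmult wcone_cmult)

lemma seqs_diff: "wcone S \<Longrightarrow> x \<in> seqs S \<Longrightarrow> y \<in> seqs S \<Longrightarrow> (\<lambda>i. x i - y i) \<in> seqs S"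
  using seqs_add[of S x "\<lambda>i. -1 * y i"] seqs_cmult[of S y "-1"] by simp

lemma istopology_kopen:
  assumes "wcone W"
  shows "istopology (kopen S W)"
  unfolding istopology_def
proof (intro conjI allI impI)
  fix A B assume A: "kopen S W A" and B: "kopen S W B"
  have "\<exists>w\<in>W. \<forall>y\<in>seqs S. pairing (mag (\<lambda>i. y i - x i)) w < 1 \<longrightarrow> y \<in> A \<inter> B" if x: "x \<in> A \<inter> B" for x
  proof -
    obtain a where a: "a \<in> W" "\<And>y. y \<in> seqs S \<Longrightarrow> pairing (mag (\<lambda>i. y i - x i)) a < 1 \<Longrightarrow> y \<in> A"
      using A x unfolding kopen_def by blast
    obtain b where b: "b \<in> W" "\<And>y. y \<in> seqs S \<Longrightarrow> pairing (mag (\<lambda>i. y i - x i)) b < 1 \<Longrightarrow> y \<in> B"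
      using B x unfolding kopen_def by blast
    have "y \<in> A \<inter> B" if "y \<in> seqs S" "pairing (mag (\<lambda>i. y i - x i)) (\<lambda>i. a i + b i) < 1" for y
      using that a(2)[of y] b(2)[of y] unfolding pairing_add_right
      by (meson IntI add_increasing add_increasing2 linorder_not_le order_refl zero_le)
    then show ?thesis
      using wcone_add[OF assms a(1) b(1)] by blast
  qed
  then show "kopen S W (A \<inter> B)"
    using A unfolding kopen_def by blast
next
  fix \<K> assume "\<forall>K\<in>\<K>. kopen S W K"
  then show "kopen S W (\<Union>\<K>)"
    unfolding kopen_def by (meson Sup_least UnionE UnionI)
qed

lemma openin_ktop: "wcone W \<Longrightarrow> openin (ktop S W) U \<longleftrightarrow> kopen S W U"
  by (simp add: ktop_def istopology_kopen topology_inverse')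

lemma topspace_ktop: "wcone W \<Longrightarrow> topspace (ktop S W) = seqs S"
proof (rule antisym)
  assume W: "wcone W"
  then show "topspace (ktop S W) \<subseteq> seqs S"
    using openin_ktop[OF W] unfolding topspace_def kopen_def by blast
  have "kopen S W (seqs S)"
    unfolding kopen_def using wcone_zero[OF W] by auto
  then show "seqs S \<subseteq> topspace (ktop S W)"
    using openin_ktop[OF W] by (simp add: openin_subset)
qed

lemma openin_ktop_ball:
  assumes W: "wcone W" and w: "w \<in> W"
  shows "openin (ktop S W) {y \<in> seqs S. pairing (mag (\<lambda>i. y i - x i)) w < 1}"
  unfolding openin_ktop[OF W] kopen_def
proof (intro conjI ballI)
  fix y assume "y \<in> {y \<in> seqs S. pairing (mag (\<lambda>i. y i - x i)) w < 1}"
  then have y: "y \<in> seqs S" and less: "pairing (mag (\<lambda>i. y i - x i)) w < 1"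
    by auto
  obtain N where N: "pairing (mag (\<lambda>i. y i - x i)) w = ennreal N" "0 \<le> N" "N < 1"
    using less by (cases "pairing (mag (\<lambda>i. y i - x i)) w") auto
  \<comment> \<open>Neighbourhoods are unit balls of weights, so the ball of radius 1 - N around
    \<open>y\<close> is the unit ball of the weight scaled by 1 / (1 - N); the triangle inequality
    keeps it inside the given ball.\<close>
  define c where "c = ennreal (1 / (1 - N))"
  have "pairing (mag (\<lambda>i. z i - x i)) w < 1" if z: "pairing (mag (\<lambda>i. z i - y i)) (\<lambda>i. c * w i) < 1" for z
  proof -
    have "c * pairing (mag (\<lambda>i. z i - y i)) w < 1"
      using z by (simp add: pairing_cmult_right)
    then obtain M where M: "pairing (mag (\<lambda>i. z i - y i)) w = ennreal M" "0 \<le> M" "M / (1 - N) < 1"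
      using N by (cases "pairing (mag (\<lambda>i. z i - y i)) w")
        (auto simp: c_def ennreal_mult_top ennreal_mult'[symmetric])
    have "pairing (mag (\<lambda>i. z i - x i)) w \<le> ennreal M + ennreal N"
      using pairing_mag_triangle[of z x w y] M N by simp
    also have "\<dots> < 1"
      using M N by (simp add: divide_simps flip: ennreal_plus)
    finally show ?thesis .
  qed
  moreover have "(\<lambda>i. c * w i) \<in> W"
    using wcone_cmult[OF W w] by (simp add: c_def)
  ultimately show "\<exists>w'\<in>W. \<forall>z\<in>seqs S. pairing (mag (\<lambda>i. z i - y i)) w' < 1 \<longrightarrow>
      z \<in> {y \<in> seqs S. pairing (mag (\<lambda>i. y i - x i)) w < 1}"
    by blast
qed auto

lemma zero_nhd_ktop:
  assumes S: "wcone S" and W: "wcone W"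
  shows "zero_nhd (ktop S W) V \<longleftrightarrow>
    V \<subseteq> seqs S \<and> (\<exists>w\<in>W. \<forall>y\<in>seqs S. pairing (mag y) w < 1 \<longrightarrow> y \<in> V)"
proof safe
  assume V: "zero_nhd (ktop S W) V"
  show "x \<in> seqs S" if "x \<in> V" for x
    using V that unfolding zero_nhd_def topspace_ktop[OF W] by blast
  obtain U where "kopen S W U" "(\<lambda>_. 0) \<in> U" "U \<subseteq> V"
    using V unfolding zero_nhd_def openin_ktop[OF W] by blast
  then show "\<exists>w\<in>W. \<forall>y\<in>seqs S. pairing (mag y) w < 1 \<longrightarrow> y \<in> V"
    unfolding kopen_def by fastforce
next
  fix w assume V: "V \<subseteq> seqs S" and w: "w \<in> W" "\<forall>y\<in>seqs S. pairing (mag y) w < 1 \<longrightarrow> y \<in> V"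
  show "zero_nhd (ktop S W) V"
    unfolding zero_nhd_def topspace_ktop[OF W]
    using V w openin_ktop_ball[OF W w(1), of S "\<lambda>_. 0"] seqs_zero[OF S]
    by (intro conjI exI[of _ "{y \<in> seqs S. pairing (mag y) w < 1}"]) auto
qed

section \<open>Limits of topologies\<close>

text \<open>Limit topologies are compared by continuous inclusions in both directions, which
  together force equality (\<open>emb_antisym\<close>). In this way l^p steps are exchanged for l^1
  steps.\<close>

definition emb :: "'a topology \<Rightarrow> 'a topology \<Rightarrow> bool" where
  "emb X Y \<longleftrightarrow> continuous_map X Y (\<lambda>x. x)"

definition lin :: "('i \<Rightarrow> complex) set \<Rightarrow> bool" where
  "lin E \<longleftrightarrow> (\<lambda>_. 0) \<in> E \<and> (\<forall>x\<in>E. \<forall>y\<in>E. \<forall>a b. (\<lambda>i. a * x i + b * y i) \<in> E)"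

lemma lin_comb: "lin E \<Longrightarrow> x \<in> E \<Longrightarrow> y \<in> E \<Longrightarrow> (\<lambda>i. a * x i + b * y i) \<in> E"
  by (simp add: lin_def)

lemma lin_add: "lin E \<Longrightarrow> x \<in> E \<Longrightarrow> y \<in> E \<Longrightarrow> (\<lambda>i. x i + y i) \<in> E"
  using lin_comb[of E x y 1 1] by simp

lemma lin_abs_convex: "lin E \<Longrightarrow> abs_convex E"
  by (simp add: abs_convex_def lin_comb)

lemma abs_convex_Int: "abs_convex V \<Longrightarrow> abs_convex W \<Longrightarrow> abs_convex (V \<inter> W)"
  unfolding abs_convex_def by auto

lemma lin_seqs: "wcone S \<Longrightarrow> lin (seqs S)"
  unfolding lin_def by (simp add: seqs_add seqs_cmult seqs_zero)

lemma lin_Union_chain: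
  assumes lin: "\<And>r. r \<in> R \<Longrightarrow> lin (E r)" and "R \<noteq> {}"
    and chain: "\<And>r r'. r \<in> R \<Longrightarrow> r' \<in> R \<Longrightarrow> E r \<subseteq> E r' \<or> E r' \<subseteq> E r"
  shows "lin (\<Union>r\<in>R. E r)"
  unfolding lin_def
proof (intro conjI ballI allI)
  show "(\<lambda>_. 0) \<in> (\<Union>r\<in>R. E r)"
    using assms(1,2) by (auto simp: lin_def)
next
  fix x y a b assume "x \<in> (\<Union>r\<in>R. E r)" "y \<in> (\<Union>r\<in>R. E r)"
  then obtain r r' where r: "r \<in> R" "r' \<in> R" "x \<in> E r" "y \<in> E r'"
    by blast
  from chain[OF r(1,2)] have "\<exists>s\<in>R. x \<in> E s \<and> y \<in> E s"
    using r by auto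
  then obtain s where "s \<in> R" "x \<in> E s" "y \<in> E s"
    by blast
  then show "(\<lambda>i. a * x i + b * y i) \<in> (\<Union>r\<in>R. E r)"
    using lin[of s] by (intro UN_I[of s]) (auto simp: lin_def)
qed

lemma embD:
  assumes "emb X Y"
  shows "topspace X \<subseteq> topspace Y" and "openin Y U \<Longrightarrow> openin X (U \<inter> topspace X)"
proof -
  show sub: "topspace X \<subseteq> topspace Y"
    using assms unfolding emb_def continuous_map_def by auto
  show "openin Y U \<Longrightarrow> openin X (U \<inter> topspace X)"
    using assms openin_continuous_map_preimage[of X Y "\<lambda>x. x" U]
    by (simp add: emb_def Int_def conj_commute)
qed

lemma embI:
  assumes "topspace X \<subseteq> topspace Y" "\<And>U. openin Y U \<Longrightarrow> openin X (U \<inter> topspace X)"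
  shows "emb X Y"
  unfolding emb_def continuous_map_def
  using assms by (auto simp: Int_def conj_commute)

lemma emb_antisym: "emb X Y \<Longrightarrow> emb Y X \<Longrightarrow> X = Y"
  unfolding topology_eq
  using embD[of X Y] embD[of Y X] by (metis inf.absorb1 openin_subset subset_antisym)

lemma openin_ind_lim: "openin (ind_lim T) U \<longleftrightarrow> ind_lim_open T U"
  by (simp add: ind_lim_def istopology_ind_lim_open topology_inverse')

lemma ind_lim_nhd_topspace:
  assumes lin: "lin (\<Union>r\<in>{0<..}. topspace (T r))" and zero: "\<And>r. r > 0 \<Longrightarrow> (\<lambda>_. 0) \<in> topspace (T r)"
  shows "ind_lim_nhd T (\<Union>r\<in>{0<..}. topspace (T r))"
  unfolding ind_lim_nhd_def
proof (intro conjI allI impI)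
  fix r :: real assume r: "r > 0"
  then have "(\<Union>r\<in>{0<..}. topspace (T r)) \<inter> topspace (T r) = topspace (T r)"
    by auto
  then show "zero_nhd (T r) ((\<Union>r\<in>{0<..}. topspace (T r)) \<inter> topspace (T r))"
    unfolding zero_nhd_def using zero[OF r] by auto
qed (use lin_abs_convex[OF lin] in auto)

text \<open>The union is open because it is itself an admissible neighbourhood of zero and its
  translates by its own points stay inside; both rest on its being a linear space.\<close>

lemma topspace_ind_lim:
  assumes lin: "lin (\<Union>r\<in>{0<..}. topspace (T r))" and zero: "\<And>r. r > 0 \<Longrightarrow> (\<lambda>_. 0) \<in> topspace (T r)"
  shows "topspace (ind_lim T) = (\<Union>r\<in>{0<..}. topspace (T r))" (is "_ = ?E")
proof (rule antisym)
  show "topspace (ind_lim T) \<subseteq> ?E"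
    unfolding topspace_def openin_ind_lim ind_lim_open_def by blast
  have "ind_lim_open T ?E"
    unfolding ind_lim_open_def
    by (intro conjI ballI subset_refl exI[of _ ?E] ind_lim_nhd_topspace[OF lin zero] lin_add[OF lin]) auto
  then show "?E \<subseteq> topspace (ind_lim T)"
    by (metis openin_ind_lim openin_subset)
qed

lemma topspace_proj_lim: "topspace (proj_lim T) = (\<Inter>r\<in>{0<..}. topspace (T r))"
proof -
  have "(\<Inter>r\<in>{0<..}. topspace (T r)) = topspace (T 1) \<inter> (\<Inter>r\<in>{0<..}. topspace (T r))"
    by auto
  then have "(\<Inter>r\<in>{0<..}. topspace (T r)) \<in> {U \<inter> (\<Inter>r\<in>{0<..}. topspace (T r)) |U r. 0 < r \<and> openin (T r) U}"
    by (metis (mono_tags, lifting) mem_Collect_eq openin_topspace zero_less_one)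
  then show ?thesis
    unfolding proj_lim_def topology_generated_by_topspace by auto
qed

lemma emb_trans: "emb X Y \<Longrightarrow> emb Y Z \<Longrightarrow> emb X Z"
  unfolding emb_def using continuous_map_compose[of X Y "\<lambda>x. x" Z "\<lambda>x. x"] by (simp add: o_def)

lemma openin_proj_lim:
  assumes "r > 0" "openin (T r) U"
  shows "openin (proj_lim T) (U \<inter> topspace (proj_lim T))"
proof -
  have "U \<inter> (\<Inter>r\<in>{0<..}. topspace (T r)) \<in> {U \<inter> (\<Inter>r\<in>{0<..}. topspace (T r)) | U r. r > 0 \<and> openin (T r) U}"
    using assms by auto
  then show ?thesis
    unfolding topspace_proj_lim unfolding proj_lim_def by (rule topology_generated_by_Basis)
qed

lemma emb_proj_lim_component: "r > 0 \<Longrightarrow> emb (proj_lim T) (T r)"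
  by (rule embI) (auto simp: topspace_proj_lim intro: openin_proj_lim[unfolded topspace_proj_lim])

text \<open>Universal property of the coarsest topology; with \<open>emb_proj_lim_component\<close>
  it reduces comparisons of projective limits to single factors.\<close>

lemma emb_into_proj_lim:
  assumes emb: "\<And>r. r > 0 \<Longrightarrow> emb X (T r)"
  shows "emb X (proj_lim T)"
  unfolding emb_def proj_lim_def
proof (rule continuous_on_generated_topo)
  have sub: "topspace X \<subseteq> (\<Inter>r\<in>{0<..}. topspace (T r))"
    using embD(1)[OF emb] by auto
  show "(\<lambda>x. x) ` topspace X \<subseteq> \<Union> {U \<inter> (\<Inter>r\<in>{0<..}. topspace (T r)) |U r. 0 < r \<and> openin (T r) U}"
    using sub unfolding topology_generated_by_topspace[symmetric] proj_lim_def[symmetric] topspace_proj_lim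
    by simp
  fix V assume "V \<in> {U \<inter> (\<Inter>r\<in>{0<..}. topspace (T r)) |U r. 0 < r \<and> openin (T r) U}"
  then obtain U r where V: "V = U \<inter> (\<Inter>r\<in>{0<..}. topspace (T r))" "r > 0" "openin (T r) U"
    by auto
  have "(\<lambda>x. x) -` V \<inter> topspace X = U \<inter> topspace X"
    using sub unfolding V(1) by auto
  then show "openin X ((\<lambda>x. x) -` V \<inter> topspace X)"
    using embD(2)[OF emb[OF V(2)] V(3)] by simp
qed

lemma emb_proj_lim:
  assumes "\<And>r. r > 0 \<Longrightarrow> \<exists>r'>0. emb (T r') (T' r)"
  shows "emb (proj_lim T) (proj_lim T')"
proof (rule emb_into_proj_lim)
  fix r :: real assume "r > 0"
  then obtain r' where "r' > 0" "emb (T r') (T' r)"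
    using assms by blast
  then show "emb (proj_lim T) (T' r)"
    using emb_trans[OF emb_proj_lim_component[of r' T]] by blast
qed

text \<open>Lets a single inductive limit be handled as an iterated limit that is constant in its
  outer parameter.\<close>

lemma proj_lim_const: "proj_lim (\<lambda>_. X) = X"
  using emb_antisym[OF emb_proj_lim_component[of 1 "\<lambda>_. X"] emb_into_proj_lim[of X "\<lambda>_. X"]]
  by (simp add: emb_def)

text \<open>An absolutely convex zero neighbourhood of the second limit, cut down to the first
  space, is one of the first limit: on each step \<open>T r\<close> it contains the preimage of an
  open set of some \<open>T' r'\<close>.\<close>

lemma emb_ind_lim:
  assumes emb: "\<And>r. r > 0 \<Longrightarrow> \<exists>r'>0. emb (T r) (T' r')"
    and lin: "lin (\<Union>r\<in>{0<..}. topspace (T r))" and zero: "\<And>r. r > 0 \<Longrightarrow> (\<lambda>_. 0) \<in> topspace (T r)"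
    and lin': "lin (\<Union>r\<in>{0<..}. topspace (T' r))" and zero': "\<And>r. r > 0 \<Longrightarrow> (\<lambda>_. 0) \<in> topspace (T' r)"
  shows "emb (ind_lim T) (ind_lim T')"
proof (rule embI)
  let ?E = "\<Union>r\<in>{0<..}. topspace (T r)"
  have E: "topspace (ind_lim T) = ?E"
    using topspace_ind_lim[OF lin zero] .
  have E': "topspace (ind_lim T') = (\<Union>r\<in>{0<..}. topspace (T' r))"
    by (rule topspace_ind_lim) (use lin' zero' in auto)
  have "x \<in> (\<Union>r\<in>{0<..}. topspace (T' r))" if x: "x \<in> topspace (T r)" and r: "r > 0" for x r
  proof -
    obtain r' where "r' > 0" "emb (T r) (T' r')"
      using emb[OF r] by blast
    then show ?thesis
      using embD(1)[of "T r" "T' r'"] x by auto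
  qed
  then show "topspace (ind_lim T) \<subseteq> topspace (ind_lim T')"
    unfolding E E' by auto
  fix U assume "openin (ind_lim T') U"
  then have U: "ind_lim_open T' U"
    by (simp add: openin_ind_lim)
  show "openin (ind_lim T) (U \<inter> topspace (ind_lim T))"
    unfolding openin_ind_lim ind_lim_open_def E
  proof (intro conjI ballI)
    fix x assume x: "x \<in> U \<inter> ?E"
    then obtain V where V: "ind_lim_nhd T' V" "\<And>v. v \<in> V \<Longrightarrow> (\<lambda>i. x i + v i) \<in> U"
      using U unfolding ind_lim_open_def by auto
    have "ind_lim_nhd T (V \<inter> ?E)"
      unfolding ind_lim_nhd_def
    proof (intro conjI allI impI)
      show "abs_convex (V \<inter> ?E)"
        using V(1) lin_abs_convex[OF lin] by (intro abs_convex_Int) (simp_all add: ind_lim_nhd_def)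
      fix r :: real assume r: "r > 0"
      obtain r' where r': "r' > 0" "emb (T r) (T' r')"
        using emb[OF r] by blast
      obtain O' where O': "openin (T' r') O'" "(\<lambda>_. 0) \<in> O'" "O' \<subseteq> V"
        using V(1) r'(1) unfolding ind_lim_nhd_def zero_nhd_def by (meson le_inf_iff)
      have "openin (T r) (O' \<inter> topspace (T r))"
        using embD(2)[OF r'(2) O'(1)] .
      moreover have "V \<inter> ?E \<inter> topspace (T r) = V \<inter> topspace (T r)"
        using r by auto
      ultimately show "zero_nhd (T r) (V \<inter> ?E \<inter> topspace (T r))"
        unfolding zero_nhd_def using O' zero[OF r]
        by (intro conjI exI[of _ "O' \<inter> topspace (T r)"]) auto
    qed auto
    moreover have "(\<lambda>i. x i + v i) \<in> U \<inter> ?E" if "v \<in> V \<inter> ?E" for v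
      using that V(2)[of v] lin_add[OF lin, of x v] x by simp
    ultimately show "\<exists>V. ind_lim_nhd T V \<and> (\<forall>v\<in>V. (\<lambda>i. x i + v i) \<in> U \<inter> ?E)"
      by (intro exI[of _ "V \<inter> ?E"]) simp
  qed auto
qed

section \<open>Limits of Koethe spaces\<close>

definition kpair :: "('i \<Rightarrow> ennreal) set \<Rightarrow> ('i \<Rightarrow> ennreal) set \<Rightarrow> bool" where
  "kpair S W \<longleftrightarrow> wcone S \<and> wcone W \<and> (\<forall>x\<in>S. \<forall>w\<in>W. pairing x w < \<infinity>)"

lemma kpairD:
  assumes "kpair S W"
  shows "wcone S" "wcone W" "x \<in> S \<Longrightarrow> w \<in> W \<Longrightarrow> pairing x w < \<infinity>"
  using assms by (auto simp: kpair_def)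

lemma kopenE:
  assumes "kopen S W V" "x \<in> V"
  obtains w where "w \<in> W" "\<And>y. y \<in> seqs S \<Longrightarrow> pairing (mag (\<lambda>i. y i - x i)) w < 1 \<Longrightarrow> y \<in> V"
proof -
  have "\<exists>w\<in>W. \<forall>y\<in>seqs S. pairing (mag (\<lambda>i. y i - x i)) w < 1 \<longrightarrow> y \<in> V"
    using assms by (simp add: kopen_def)
  then show thesis
    using that by blast
qed

text \<open>Each weight of the union already belongs to one \<open>W r\<close>, so its ball is the
  trace of an open set of that factor; conversely every weight of a factor is a weight of the
  union.\<close>

lemma proj_lim_ktop:
  assumes wcone: "\<And>r. r > 0 \<Longrightarrow> wcone (W r)" and U: "wcone (\<Union>r\<in>{0<..}. W r)"
  shows "proj_lim (\<lambda>r::real. ktop (S r) (W r)) = ktop (\<Inter>r\<in>{0<..}. S r) (\<Union>r\<in>{0<..}. W r)"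
    (is "?P = ktop ?S ?W")
proof (rule emb_antisym)
  have seqs: "seqs ?S = (\<Inter>r\<in>{0<..}. seqs (S r))"
    by (auto simp: seqs_def)
  have top: "topspace ?P = seqs ?S"
    unfolding topspace_proj_lim seqs using topspace_ktop[OF wcone] by auto
  show "emb ?P (ktop ?S ?W)"
  proof (rule embI)
    show "topspace ?P \<subseteq> topspace (ktop ?S ?W)"
      by (simp add: top topspace_ktop[OF U])
    fix V assume "openin (ktop ?S ?W) V"
    then have V: "kopen ?S ?W V"
      by (simp add: openin_ktop[OF U])
    then have sub: "V \<subseteq> seqs ?S"
      by (simp add: kopen_def)
    have "\<exists>B. openin ?P B \<and> x \<in> B \<and> B \<subseteq> V" if x: "x \<in> V" for x
    proof -
      obtain w where "w \<in> ?W" and w: "\<And>y. y \<in> seqs ?S \<Longrightarrow> pairing (mag (\<lambda>i. y i - x i)) w < 1 \<Longrightarrow> y \<in> V"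
        using kopenE[OF V x] by blast
      then obtain r where r: "r > 0" "w \<in> W r"
        by auto
      let ?B = "{y \<in> seqs (S r). pairing (mag (\<lambda>i. y i - x i)) w < 1} \<inter> topspace ?P"
      have "openin ?P ?B"
        by (rule openin_proj_lim[of r], fact, rule openin_ktop_ball[OF wcone[OF r(1)] r(2)])
      moreover have "x \<in> ?B"
        using sub x r(1) unfolding top by (auto simp: seqs)
      moreover have "?B \<subseteq> V"
        using w unfolding top by auto
      ultimately show ?thesis
        by (intro exI conjI)
    qed
    then have "openin ?P V"
      by (subst openin_subopen) simp
    then show "openin ?P (V \<inter> topspace ?P)"
      by (simp add: openin_Int)
  qed
  show "emb (ktop ?S ?W) ?P"
  proof (rule emb_into_proj_lim, rule embI)
    fix r :: real assume r: "r > 0"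
    show "topspace (ktop ?S ?W) \<subseteq> topspace (ktop (S r) (W r))"
      using r by (auto simp: topspace_ktop[OF U] topspace_ktop[OF wcone] seqs)
    fix A assume "openin (ktop (S r) (W r)) A"
    then have A: "kopen (S r) (W r) A"
      by (simp add: openin_ktop[OF wcone[OF r]])
    show "openin (ktop ?S ?W) (A \<inter> topspace (ktop ?S ?W))"
      unfolding openin_ktop[OF U] topspace_ktop[OF U] kopen_def
    proof (intro conjI ballI)
      fix x assume x: "x \<in> A \<inter> seqs ?S"
      obtain w where w: "w \<in> W r" "\<And>y. y \<in> seqs (S r) \<Longrightarrow> pairing (mag (\<lambda>i. y i - x i)) w < 1 \<Longrightarrow> y \<in> A"
        using kopenE[OF A, of x] x by blast
      then show "\<exists>w\<in>?W. \<forall>y\<in>seqs ?S. pairing (mag (\<lambda>i. y i - x i)) w < 1 \<longrightarrow> y \<in> A \<inter> seqs ?S"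
        using r by (intro bexI[of _ w]) (auto simp: seqs)
    qed simp
  qed
qed

lemma abs_convex_ball:
  assumes S: "wcone S"
  shows "abs_convex {y \<in> seqs S. pairing (mag y) w < 1}"
  unfolding abs_convex_def
proof (intro ballI allI impI)
  fix x y a b
  assume x: "x \<in> {y \<in> seqs S. pairing (mag y) w < 1}" and y: "y \<in> {y \<in> seqs S. pairing (mag y) w < 1}"
    and ab: "cmod a + cmod b \<le> 1"
  obtain X Y where XY: "pairing (mag x) w = ennreal X" "0 \<le> X" "X < 1" "pairing (mag y) w = ennreal Y" "0 \<le> Y" "Y < 1"
    using x y by (cases "pairing (mag x) w"; cases "pairing (mag y) w") auto
  have "pairing (mag (\<lambda>i. a * x i + b * y i)) w \<le> pairing (\<lambda>i. ennreal (cmod a) * mag x i + ennreal (cmod b) * mag y i) w"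
    using mag_add_le[of "\<lambda>i. a * x i" "\<lambda>i. b * y i"] by (intro pairing_mono) (auto simp: mag_cmult)
  also have "\<dots> = ennreal (cmod a * X + cmod b * Y)"
    using XY by (simp add: pairing_add_left pairing_cmult_left ennreal_mult)
  also have "\<dots> < 1"
  proof -
    have "cmod a * X + cmod b * Y \<le> cmod a * max X Y + cmod b * max X Y"
      by (intro add_mono mult_left_mono) auto
    also have "\<dots> = (cmod a + cmod b) * max X Y"
      by (simp add: distrib_right)
    also have "\<dots> \<le> 1 * max X Y"
      using ab XY by (intro mult_right_mono) auto
    also have "\<dots> < 1"
      using XY by simp
    finally show ?thesis
      by simp
  qed
  finally have "pairing (mag (\<lambda>i. a * x i + b * y i)) w < 1" .
  moreover have "(\<lambda>i. a * x i + b * y i) \<in> seqs S"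
    using x y seqs_add[OF S] seqs_cmult[OF S] by auto
  ultimately show "(\<lambda>i. a * x i + b * y i) \<in> {y \<in> seqs S. pairing (mag y) w < 1}"
    by simp
qed

lemma abs_convexD:
  "abs_convex V \<Longrightarrow> x \<in> V \<Longrightarrow> y \<in> V \<Longrightarrow> cmod a + cmod b \<le> 1 \<Longrightarrow> (\<lambda>i. a * x i + b * y i) \<in> V"
  by (simp add: abs_convex_def)

lemma abs_convex_sum:
  assumes V: "abs_convex V" "(\<lambda>_. 0) \<in> V" and "finite F"
  shows "(\<And>i. i \<in> F \<Longrightarrow> z i \<in> V) \<Longrightarrow> (\<Sum>i\<in>F. cmod (a i)) \<le> 1 \<Longrightarrow> (\<lambda>k. \<Sum>i\<in>F. a i * z i k) \<in> V"
  using \<open>finite F\<close>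
proof (induction F arbitrary: a rule: finite_induct)
  case empty
  then show ?case
    using V(2) by simp
next
  case (insert j F)
  define s where "s = (\<Sum>i\<in>F. cmod (a i))"
  have s: "0 \<le> s" "cmod (a j) + s \<le> 1"
    using insert.prems(2) insert.hyps by (auto simp: s_def sum_nonneg)
  \<comment> \<open>For \<open>s = 0\<close> all quotients are 0 by the convention for division, so
    the bound covers this case as well.\<close>
  have "(\<Sum>i\<in>F. cmod (a i / of_real s)) \<le> 1"
    using s(1) by (simp add: norm_divide flip: sum_divide_distrib s_def)
  then have "(\<lambda>k. \<Sum>i\<in>F. a i / of_real s * z i k) \<in> V"
    using insert.prems(1) by (intro insert.IH) auto
  moreover have "z j \<in> V"
    using insert.prems(1) by auto
  ultimately have "(\<lambda>k. a j * z j k + of_real s * (\<Sum>i\<in>F. a i / of_real s * z i k)) \<in> V"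
    using V(1) s by (simp add: abs_convex_def)
  moreover have "of_real s * (\<Sum>i\<in>F. a i / of_real s * z i k) = (\<Sum>i\<in>F. a i * z i k)" for k
  proof (cases "s = 0")
    case True
    then have "a i = 0" if "i \<in> F" for i
      using insert.hyps(1) that by (simp add: s_def sum_nonneg_eq_0_iff)
    then show ?thesis
      using True by simp
  qed (simp add: sum_distrib_left)
  ultimately show ?case
    using insert.hyps by simp
qed

text \<open>The reason why the weights of an inductive limit are closed under pointwise infima over
  the steps: absolute convexity lets every coordinate \<open>i\<close> choose its own
  \<open>r\<close> with \<open>w r i\<close> close to the infimum. Multiples of unit sequences then
  lie in \<open>V\<close>, and \<open>y\<close> is an absolutely convex combination of them. By
  \<open>off\<close>, a step with a finite weight at \<open>i\<close> contains the unit sequence at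
  \<open>i\<close>.\<close>

lemma INF_gauge_finite_support:
  fixes w :: "real \<Rightarrow> 'i \<Rightarrow> ennreal"
  assumes V: "abs_convex V" "(\<lambda>_. 0) \<in> V"
    and cone: "\<And>r. r > 0 \<Longrightarrow> wcone (S r)"
    and ball: "\<And>r y. r > 0 \<Longrightarrow> y \<in> seqs (S r) \<Longrightarrow> pairing (mag y) (w r) < 1 \<Longrightarrow> y \<in> V"
    and off: "\<And>r i. r > 0 \<Longrightarrow> delta i \<notin> S r \<Longrightarrow> w r i = \<infinity>"
    and F: "finite F" "\<And>i. i \<notin> F \<Longrightarrow> y i = 0"
    and small: "pairing (mag y) (\<lambda>i. INF r\<in>{0<..}. w r i) < 1"
  shows "y \<in> V"
proof -
  define v where "v i = (INF r\<in>{0<..}. w r i)" for i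
  define m where "m i = enn2real (mag y i * v i)" for i
  have sum: "(\<Sum>i\<in>F. mag y i * v i) < 1"
    using sum_le_nn_integral_count_space[OF F(1), of "\<lambda>i. mag y i * v i"] small
    by (simp add: pairing_def v_def)
  have fin: "mag y i * v i < \<infinity>" if "i \<in> F" for i
    using le_pairing[of "mag y" i v] small by (auto simp: v_def[abs_def] intro: order_le_less_trans order_less_trans)
  have m: "mag y i * v i = ennreal (m i)" "0 \<le> m i" if "i \<in> F" for i
    using fin[OF that] by (simp_all add: m_def)
  have "(\<Sum>i\<in>F. mag y i * v i) = ennreal (\<Sum>i\<in>F. m i)"
    using m by (simp add: sum_ennreal cong: sum.cong)
  with sum have sum_m: "(\<Sum>i\<in>F. m i) < 1"
    using ennreal_less_imp[of "\<Sum>i\<in>F. m i" 1] by simp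
  \<comment> \<open>The slack left by the strict inequality, spread over the coordinates: each
    \<open>\<eta> i\<close> exceeds \<open>m i\<close> strictly, yet they sum to at most 1. The
    \<open>+ 1\<close> in the denominator covers an empty \<open>F\<close>.\<close>
  define e where "e = (1 - (\<Sum>i\<in>F. m i)) / (real (card F) + 1)"
  have e: "e > 0"
    using sum_m by (simp add: e_def)
  define \<eta> where "\<eta> i = m i + e" for i
  have \<eta>: "\<eta> i > 0" if "i \<in> F" for i
    using m(2)[OF that] e by (simp add: \<eta>_def)
  have "(\<Sum>i\<in>F. \<eta> i) = (\<Sum>i\<in>F. m i) + real (card F) * e"
    by (simp add: \<eta>_def sum.distrib)
  also have "\<dots> \<le> (\<Sum>i\<in>F. m i) + (real (card F) + 1) * e"
    using e by (simp add: distrib_right)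
  also have "\<dots> = 1"
    by (simp add: e_def)
  finally have sum_\<eta>: "(\<Sum>i\<in>F. cmod (of_real (\<eta> i))) \<le> 1"
    using \<eta> by (simp add: less_imp_le cong: sum.cong)
  \<comment> \<open>Coordinate \<open>i\<close> of \<open>y\<close>, blown up by
    \<open>1 / \<eta> i\<close>, so that \<open>y\<close> is the combination of the
    \<open>z i\<close> with coefficients \<open>\<eta> i\<close>.\<close>
  define z where "z i = (\<lambda>k. if k = i then y i / of_real (\<eta> i) else 0)" for i
  have mag_z: "mag (z i) = (\<lambda>k. ennreal (cmod (y i) / \<eta> i) * delta i k)" if "i \<in> F" for i
    using \<eta>[OF that] by (auto simp: mag_def z_def delta_def norm_divide)
  have "z i \<in> V" if i: "i \<in> F" for i
  proof (cases "y i = 0")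
    case True
    then show ?thesis
      using V(2) by (simp add: z_def if_distrib cong: if_cong)
  next
    case False
    have "v i < ennreal (\<eta> i / cmod (y i))"
    proof -
      obtain V where V: "v i = ennreal V" "0 \<le> V"
        using fin[OF i] False by (cases "v i") (auto simp: mag_def ennreal_mult_top)
      have "cmod (y i) * V = m i"
        using m[OF i] V by (simp add: mag_def flip: ennreal_mult)
      then have "cmod (y i) * V < \<eta> i"
        using e by (simp add: \<eta>_def)
      then show ?thesis
        using V False by (simp add: ennreal_less_iff field_simps)
    qed
    then obtain r where r: "r > 0" "w r i < ennreal (\<eta> i / cmod (y i))"
      unfolding v_def INF_less_iff by auto
    then have S: "delta i \<in> S r"
      using off[OF r(1), of i] r(2) by (cases "delta i \<in> S r") auto
    obtain W where W: "w r i = ennreal W" "0 \<le> W" "W < \<eta> i / cmod (y i)"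
      using r(2) by (cases "w r i") (auto simp: ennreal_less_iff)
    have "pairing (mag (z i)) (w r) = ennreal (cmod (y i) / \<eta> i * W)"
      unfolding mag_z[OF i] pairing_cmult_left pairing_delta_left W(1)
      by (subst ennreal_mult) (use W \<eta>[OF i] in auto)
    also have "\<dots> < 1"
      using W \<eta>[OF i] False by (simp add: field_simps)
    finally have "pairing (mag (z i)) (w r) < 1" .
    moreover have "z i \<in> seqs (S r)"
      using wcone_cmult[OF cone[OF r(1)] S] by (simp add: seqs_def mag_z[OF i])
    ultimately show ?thesis
      using ball[OF r(1)] by blast
  qed
  then have "(\<lambda>k. \<Sum>i\<in>F. of_real (\<eta> i) * z i k) \<in> V"
    using sum_\<eta> by (intro abs_convex_sum[OF V F(1)]) auto
  moreover have "(\<Sum>i\<in>F. of_real (\<eta> i) * z i k) = y k" for k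
  proof -
    have "(\<Sum>i\<in>F. of_real (\<eta> i) * z i k) = (\<Sum>i\<in>F. if k = i then y k else 0)"
    proof (rule sum.cong)
      fix i assume "i \<in> F"
      then show "of_real (\<eta> i) * z i k = (if k = i then y k else 0)"
        using \<eta>[of i] by (auto simp: z_def)
    qed simp
    then show ?thesis
      using F by (cases "k \<in> F") auto
  qed
  ultimately show ?thesis
    by simp
qed

text \<open>The substance is that a neighbourhood \<open>V\<close> of the inductive limit contains
  the ball of one weight lying in every \<open>W r\<close>, namely twice the infimum
  \<open>v\<close> of weights chosen for the steps. An element \<open>y\<close> of the ball lies in
  some step \<open>r\<close>; outside a finite set its tail is small for \<open>w r\<close>, and the
  finite part is governed by \<open>v\<close> alone. Twice each of the two parts lies in
  \<open>V\<close>, and \<open>y\<close> is the midpoint. By \<open>full\<close> a step may be given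
  weight infinity at the coordinates it does not reach, so it does not lower the infimum
  there.\<close>

lemma ind_lim_ktop:
  fixes S W :: "real \<Rightarrow> ('i::countable \<Rightarrow> ennreal) set"
  assumes kp: "\<And>r. r > 0 \<Longrightarrow> kpair (S r) (W r)"
    and full: "\<And>r w. r > 0 \<Longrightarrow> w \<in> W r \<Longrightarrow>
      \<exists>w'\<in>W r. (\<forall>i. w i \<le> w' i) \<and> (\<forall>i. delta i \<notin> S r \<longrightarrow> w' i = \<infinity>)"
    and US: "wcone (\<Union>r\<in>{0<..}. S r)"
  shows "ind_lim (\<lambda>r. ktop (S r) (W r)) = ktop (\<Union>r\<in>{0<..}. S r) (\<Inter>r\<in>{0<..}. W r)"
    (is "ind_lim ?T = ktop ?S ?W")
proof -
  have S: "wcone (S r)" and W: "wcone (W r)" if "r > 0" for r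
    using kpairD[OF kp[OF that]] by auto
  have UW: "wcone ?W"
    using W by (intro wcone_Inter) auto
  have seqs: "seqs ?S = (\<Union>r\<in>{0<..}. seqs (S r))"
    by (auto simp: seqs_def)
  have top: "(\<Union>r\<in>{0<..}. topspace (?T r)) = seqs ?S"
    unfolding seqs using topspace_ktop[OF W] by auto
  have "ind_lim_open ?T U" if U: "kopen ?S ?W U" for U
    unfolding ind_lim_open_def top
  proof (intro conjI ballI)
    show sub: "U \<subseteq> seqs ?S"
      using U by (simp add: kopen_def)
    fix x assume x: "x \<in> U"
    obtain w where w: "w \<in> ?W" "\<And>y. y \<in> seqs ?S \<Longrightarrow> pairing (mag (\<lambda>i. y i - x i)) w < 1 \<Longrightarrow> y \<in> U"
      using kopenE[OF U x] by blast
    let ?V = "{v \<in> seqs ?S. pairing (mag v) w < 1}"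
    have "ind_lim_nhd ?T ?V"
      unfolding ind_lim_nhd_def top
    proof (intro conjI allI impI abs_convex_ball[OF US])
      fix r :: real assume r: "r > 0"
      show "zero_nhd (?T r) (?V \<inter> topspace (?T r))"
        unfolding zero_nhd_ktop[OF S[OF r] W[OF r]] topspace_ktop[OF W[OF r]]
        using w(1) r by (intro conjI bexI[of _ w]) (auto simp: seqs)
    qed auto
    moreover have "(\<lambda>i. x i + v i) \<in> U" if v: "v \<in> ?V" for v
      using v w(2)[of "\<lambda>i. x i + v i"] seqs_add[OF US, of x v] sub x by (simp add: subset_iff)
    ultimately show "\<exists>V. ind_lim_nhd ?T V \<and> (\<forall>v\<in>V. (\<lambda>i. x i + v i) \<in> U)"
      by (intro exI[of _ ?V]) simp
  qed
  moreover have "kopen ?S ?W U" if U: "ind_lim_open ?T U" for U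
    unfolding kopen_def
  proof (intro conjI ballI)
    show sub: "U \<subseteq> seqs ?S"
      using U unfolding ind_lim_open_def top by simp
    fix x assume x: "x \<in> U"
    then obtain V where V: "ind_lim_nhd ?T V" and VU: "\<forall>v\<in>V. (\<lambda>i. x i + v i) \<in> U"
      using U unfolding ind_lim_open_def by auto
    have "\<exists>w\<in>W r. (\<forall>y\<in>seqs (S r). pairing (mag y) w < 1 \<longrightarrow> y \<in> V) \<and> (\<forall>i. delta i \<notin> S r \<longrightarrow> w i = \<infinity>)"
      if r: "r > 0" for r
    proof -
      have "zero_nhd (?T r) (V \<inter> topspace (?T r))"
        using V r by (simp add: ind_lim_nhd_def)
      then obtain w0 where w0: "w0 \<in> W r" "\<And>y. y \<in> seqs (S r) \<Longrightarrow> pairing (mag y) w0 < 1 \<Longrightarrow> y \<in> V"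
        unfolding zero_nhd_ktop[OF S[OF r] W[OF r]] by blast
      obtain w where w: "w \<in> W r" "\<And>i. w0 i \<le> w i" "\<And>i. delta i \<notin> S r \<Longrightarrow> w i = \<infinity>"
        using full[OF r w0(1)] by blast
      have "y \<in> V" if "y \<in> seqs (S r)" "pairing (mag y) w < 1" for y
        using w0(2)[OF that(1)] pairing_mono[of "mag y" "mag y" w0 w] w(2) that(2)
        by (simp add: order_le_less_trans)
      then show ?thesis
        using w by blast
    qed
    then obtain w where w: "\<And>r. r > 0 \<Longrightarrow> w r \<in> W r"
      and ball: "\<And>r y. r > 0 \<Longrightarrow> y \<in> seqs (S r) \<Longrightarrow> pairing (mag y) (w r) < 1 \<Longrightarrow> y \<in> V"
      and off: "\<And>r i. r > 0 \<Longrightarrow> delta i \<notin> S r \<Longrightarrow> w r i = \<infinity>"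
      by metis
    define v where "v i = (INF r\<in>{0<..}. w r i)" for i
    have v: "v \<in> W r" if r: "r > 0" for r
      by (rule wcone_solid[OF W[OF r] w[OF r]]) (use r in \<open>auto simp: v_def intro: INF_lower\<close>)
    have convex: "abs_convex V"
      using V by (simp add: ind_lim_nhd_def)
    have zero: "(\<lambda>_. 0) \<in> V"
      using ball[of 1 "\<lambda>_. 0"] seqs_zero[OF S] by simp
    have V_if: "y \<in> V" if y: "y \<in> seqs ?S" "pairing (mag y) (\<lambda>i. 2 * v i) < 1" for y
    proof -
      obtain r where r: "r > 0" "y \<in> seqs (S r)"
        using y(1) unfolding seqs by auto
      have half: "0 < ennreal (1/2)"
        by (subst ennreal_0[symmetric], rule ennreal_lessI) auto
      have "pairing (mag y) (w r) < \<infinity>"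
        using kpairD(3)[OF kp[OF r(1)]] r(2) w[OF r(1)] by (simp add: seqs_def)
      then obtain F where F: "finite F" "pairing (\<lambda>i. mag y i * indicator (- F) i) (w r) < ennreal (1/2)"
        using pairing_tail[of "mag y" "w r", OF _ half] by blast
      define yt where "yt i = (if i \<in> F then 0 else 2 * y i)" for i
      define yf where "yf i = (if i \<in> F then 2 * y i else 0)" for i
      have "mag yt = (\<lambda>i. 2 * (mag y i * indicator (- F) i))"
        by (auto simp: mag_def yt_def norm_mult ennreal_mult)
      then have "pairing (mag yt) (w r) = 2 * pairing (\<lambda>i. mag y i * indicator (- F) i) (w r)"
        by (simp add: pairing_cmult_left)
      also have "\<dots> < 2 * ennreal (1/2)"
        using F(2) by (intro ennreal_mult_strict_left_mono) auto
      also have "\<dots> = 1"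
        by (subst ennreal_numeral[symmetric], subst ennreal_mult[symmetric]) auto
      finally have "pairing (mag yt) (w r) < 1" .
      moreover have "yt \<in> seqs (S r)"
        unfolding seqs_def mem_Collect_eq
        by (rule wcone_solid[OF S[OF r(1)], of "mag (\<lambda>i. 2 * y i)"])
          (use seqs_cmult[OF S[OF r(1)] r(2), of 2] in \<open>auto simp: seqs_def mag_def yt_def\<close>)
      ultimately have yt: "yt \<in> V"
        using ball r(1) by blast
      have "pairing (mag yf) v \<le> pairing (\<lambda>i. 2 * mag y i) v"
        by (intro pairing_mono) (auto simp: mag_def yf_def norm_mult ennreal_mult)
      also have "\<dots> < 1"
        using y(2) by (simp add: pairing_cmult_left pairing_cmult_right)
      finally have "pairing (mag yf) v < 1" .
      then have yf: "yf \<in> V"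
        unfolding v_def
        by (intro INF_gauge_finite_support[OF convex zero S ball off F(1)]) (auto simp: yf_def)
      have "(\<lambda>i. (1/2) * yf i + (1/2) * yt i) \<in> V"
        by (rule abs_convexD[OF convex yf yt]) (simp add: norm_divide)
      moreover have "(\<lambda>i. (1/2) * yf i + (1/2) * yt i) = y"
        by (auto simp: yf_def yt_def)
      ultimately show ?thesis
        by simp
    qed
    have "(\<lambda>i. 2 * v i) \<in> ?W"
      using v W wcone_cmult[of _ v 2] by auto
    moreover have "y \<in> U" if "y \<in> seqs ?S" "pairing (mag (\<lambda>i. y i - x i)) (\<lambda>i. 2 * v i) < 1" for y
      using bspec[OF VU V_if[OF _ that(2)]] seqs_diff[OF US that(1)] sub x by auto
    ultimately show "\<exists>w\<in>?W. \<forall>y\<in>seqs ?S. pairing (mag (\<lambda>i. y i - x i)) w < 1 \<longrightarrow> y \<in> U"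
      by (intro bexI[of _ "\<lambda>i. 2 * v i"]) auto
  qed
  ultimately show ?thesis
    unfolding topology_eq openin_ind_lim openin_ktop[OF UW] by blast
qed

section \<open>Weighted spaces\<close>

text \<open>Three cones for one weight: \<open>Lsp\<close> is weighted l^1, on which the pairing
  duality lives; \<open>Osp\<close> holds its continuous weights; \<open>Bsp\<close> is weighted
  l^infinity, where pointwise kernel estimates live. An infinite value of the weight forces elements
  of \<open>Lsp\<close> to vanish and leaves those of \<open>Osp\<close> free.\<close>

definition Lsp :: "('i \<Rightarrow> ennreal) \<Rightarrow> ('i \<Rightarrow> ennreal) set" where
  "Lsp \<omega> = {x. pairing x \<omega> < \<infinity>}"

definition Osp :: "('i \<Rightarrow> ennreal) \<Rightarrow> ('i \<Rightarrow> ennreal) set" where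
  "Osp \<omega> = {w. \<exists>C<\<infinity>. \<forall>i. w i \<le> C * \<omega> i}"

definition Bsp :: "('i \<Rightarrow> ennreal) \<Rightarrow> ('i \<Rightarrow> ennreal) set" where
  "Bsp \<omega> = {x. \<exists>C<\<infinity>. \<forall>i. x i * \<omega> i \<le> C}"

text \<open>Finiteness for every \<open>p\<close>, including \<open>p < 1\<close>, treats norms and
  quasi-norms alike; positivity and finiteness allow division by \<open>g\<close>.\<close>

definition nuclear :: "('i \<Rightarrow> ennreal) \<Rightarrow> bool" where
  "nuclear g \<longleftrightarrow> (\<forall>i. 0 < g i \<and> g i < \<infinity>) \<and> pairing g (\<lambda>_. 1) < \<infinity> \<and> (\<forall>p>0. lp_norm p g < \<infinity>)"

definition faster :: "('i \<Rightarrow> ennreal) \<Rightarrow> ('i \<Rightarrow> ennreal) \<Rightarrow> ('i \<Rightarrow> ennreal) \<Rightarrow> bool" where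
  "faster g \<omega> \<omega>' \<longleftrightarrow> (\<exists>C<\<infinity>. \<forall>i. \<omega> i \<le> C * g i * \<omega>' i)"

lemma ennreal_add_finite: "a < \<infinity> \<Longrightarrow> b < \<infinity> \<Longrightarrow> a + b < (\<infinity>::ennreal)"
  by simp

lemma ennreal_mult_finite: "a < \<infinity> \<Longrightarrow> b < \<infinity> \<Longrightarrow> a * b < (\<infinity>::ennreal)"
  by (simp add: ennreal_mult_less_top)

lemma wcone_Lsp: "wcone (Lsp \<omega>)"
  unfolding wcone_def Lsp_def
proof (intro conjI ballI allI impI)
  fix x y assume "x \<in> {x. pairing x \<omega> < \<infinity>}" "\<forall>i. y i \<le> x i"
  then show "y \<in> {x. pairing x \<omega> < \<infinity>}"
    using pairing_mono[of y x \<omega> \<omega>] by (simp add: order_le_less_trans)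
qed (auto simp: pairing_add_left pairing_cmult_left ennreal_mult_less_top)

lemma wcone_Osp: "wcone (Osp \<omega>)"
  unfolding wcone_def Osp_def
proof (intro conjI ballI allI impI)
  show "(\<lambda>_. 0) \<in> {w. \<exists>C<\<infinity>. \<forall>i. w i \<le> C * \<omega> i}"
    by (auto intro: exI[of _ 0])
next
  fix v w assume "v \<in> {w. \<exists>C<\<infinity>. \<forall>i. w i \<le> C * \<omega> i}" "w \<in> {w. \<exists>C<\<infinity>. \<forall>i. w i \<le> C * \<omega> i}"
  then obtain C D where "C < \<infinity>" "D < \<infinity>" "\<And>i. v i \<le> C * \<omega> i" "\<And>i. w i \<le> D * \<omega> i"
    by auto
  then show "(\<lambda>i. v i + w i) \<in> {w. \<exists>C<\<infinity>. \<forall>i. w i \<le> C * \<omega> i}"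
    by (auto intro!: exI[of _ "C + D"] add_mono simp: distrib_right)
next
  fix v and c :: ennreal assume "v \<in> {w. \<exists>C<\<infinity>. \<forall>i. w i \<le> C * \<omega> i}" "c < \<infinity>"
  then obtain C where "C < \<infinity>" "\<And>i. v i \<le> C * \<omega> i"
    by auto
  then show "(\<lambda>i. c * v i) \<in> {w. \<exists>C<\<infinity>. \<forall>i. w i \<le> C * \<omega> i}"
    using \<open>c < \<infinity>\<close> by (auto intro!: exI[of _ "c * C"] mult_left_mono simp: mult.assoc ennreal_mult_less_top)
next
  fix v w assume "v \<in> {w. \<exists>C<\<infinity>. \<forall>i. w i \<le> C * \<omega> i}" "\<forall>i. w i \<le> v i"
  then show "w \<in> {w. \<exists>C<\<infinity>. \<forall>i. w i \<le> C * \<omega> i}"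
    by (auto intro: order_trans)
qed

lemma kpair_Lsp: "kpair (Lsp \<omega>) (Osp \<omega>)"
proof -
  have "pairing x w < \<infinity>" if "pairing x \<omega> < \<infinity>" "C < \<infinity>" "\<forall>i. w i \<le> C * \<omega> i" for x w C
  proof -
    have "pairing x w \<le> C * pairing x \<omega>"
      unfolding pairing_cmult_right[symmetric] using that by (intro pairing_mono) auto
    then show ?thesis
      using ennreal_mult_finite[OF that(2,1)] by (rule order_le_less_trans)
  qed
  then show ?thesis
    unfolding kpair_def using wcone_Lsp wcone_Osp by (auto simp: Lsp_def Osp_def)
qed

lemma self_in_Osp: "\<omega> \<in> Osp \<omega>"
  by (auto simp: Osp_def intro: exI[of _ 1])

lemma Lsp_subset_Bsp: "Lsp \<omega> \<subseteq> Bsp \<omega>"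
  using le_pairing[of _ _ \<omega>] by (auto simp: Lsp_def Bsp_def)

lemma Lsp_antimono: "(\<And>i. \<omega> i \<le> \<omega>' i) \<Longrightarrow> Lsp \<omega>' \<subseteq> Lsp \<omega>"
  unfolding Lsp_def using pairing_mono[of _ _ \<omega> \<omega>'] by (auto intro: order_le_less_trans)

text \<open>A sup bound against \<open>\<omega>'\<close> becomes summable against
  \<open>\<omega>\<close> because the change of weight gains \<open>g\<close>. With
  \<open>Lsp_subset_Bsp\<close> this makes l^1 and sup norms interchangeable in the limits.\<close>

lemma Bsp_subset_Lsp:
  assumes g: "nuclear g" and f: "faster g \<omega> \<omega>'"
  shows "Bsp \<omega>' \<subseteq> Lsp \<omega>"
proof
  fix x assume "x \<in> Bsp \<omega>'"
  then obtain C where C: "C < \<infinity>" "\<And>i. x i * \<omega>' i \<le> C"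
    by (auto simp: Bsp_def)
  obtain D where D: "D < \<infinity>" "\<And>i. \<omega> i \<le> D * g i * \<omega>' i"
    using f by (auto simp: faster_def)
  have "x i * \<omega> i \<le> C * D * (g i * 1)" for i
  proof -
    have "x i * \<omega> i \<le> x i * (D * g i * \<omega>' i)"
      by (intro mult_left_mono D) simp
    also have "\<dots> = (x i * \<omega>' i) * (D * g i)"
      by (simp add: ac_simps)
    also have "\<dots> \<le> C * (D * g i)"
      by (intro mult_right_mono C) simp
    finally show ?thesis
      by (simp add: ac_simps)
  qed
  then have "pairing x \<omega> \<le> C * D * pairing g (\<lambda>_. 1)"
    unfolding pairing_cmult_left[symmetric] unfolding pairing_def
    by (intro nn_integral_mono) (simp add: mult.assoc)
  also have "\<dots> < \<infinity>"
    using C(1) D(1) g by (simp add: nuclear_def ennreal_mult_less_top)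
  finally show "x \<in> Lsp \<omega>"
    by (simp add: Lsp_def)
qed

section \<open>Weighted l^p quasi-norms for all exponents p > 0\<close>

lemma ennpow_mono: "x \<le> y \<Longrightarrow> 0 < a \<Longrightarrow> ennpow x a \<le> ennpow y a"
  by (cases x; cases y) (auto simp: ennpow_def top_unique intro!: ennreal_leI powr_mono2)

lemma ennpow_inverse: "0 < a \<Longrightarrow> ennpow (ennpow x a) (1 / a) = x"
  by (cases x) (auto simp: ennpow_def powr_powr)

lemma ennpow_mult: "x < \<infinity> \<Longrightarrow> y < \<infinity> \<Longrightarrow> ennpow (x * y) a = ennpow x a * ennpow y a"
  by (cases x; cases y) (auto simp: ennpow_def powr_mult simp flip: ennreal_mult)

lemma ennpow_finite: "ennpow x a < top \<longleftrightarrow> x < top"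
  by (auto simp: ennpow_def less_top)

lemma ennpow_zero [simp]: "ennpow 0 a = 0"
  by (simp add: ennpow_def)

lemma sum_le_infsum_ennreal:
  fixes f :: "'i \<Rightarrow> ennreal"
  shows "finite F \<Longrightarrow> sum f F \<le> infsum f UNIV"
  by (subst nonneg_infsum_complete) (auto intro: SUP_upper)

lemma infsum_ennreal_le:
  fixes f :: "'i \<Rightarrow> ennreal"
  shows "(\<And>F. finite F \<Longrightarrow> sum f F \<le> b) \<Longrightarrow> infsum f UNIV \<le> b"
  by (subst nonneg_infsum_complete) (auto intro: SUP_least)

lemma le_lp_norm:
  assumes "0 < p"
  shows "f i \<le> lp_norm p f"
proof (cases "p = \<infinity>")
  case True
  then show ?thesis
    by (simp add: lp_norm_def SUP_upper)
next
  case False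
  then have P: "0 < enn2real p"
    using assms by (simp add: enn2real_positive_iff less_top)
  have "f i = ennpow (ennpow (f i) (enn2real p)) (1 / enn2real p)"
    using P by (simp add: ennpow_inverse)
  also have "\<dots> \<le> ennpow (\<Sum>\<^sub>\<infinity>i. ennpow (f i) (enn2real p)) (1 / enn2real p)"
    using P sum_le_infsum_ennreal[of "{i}" "\<lambda>i. ennpow (f i) (enn2real p)"] by (intro ennpow_mono) auto
  finally show ?thesis
    using False by (simp add: lp_norm_def)
qed

lemma lp_norm_le:
  assumes "0 < p" and K: "K < \<infinity>" and g: "\<And>i. g i < \<infinity>" and f: "\<And>i. f i \<le> K * g i"
    and fin: "lp_norm p g < \<infinity>"
  shows "lp_norm p f \<le> K * lp_norm p g"
proof (cases "p = \<infinity>")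
  case True
  have "f i \<le> K * (SUP i. g i)" for i
    by (rule order_trans[OF f]) (intro mult_left_mono SUP_upper; simp)
  with True show ?thesis
    by (simp add: lp_norm_def SUP_least)
next
  case False
  define P where "P = enn2real p"
  have P: "0 < P"
    using assms(1) False by (simp add: P_def enn2real_positive_iff less_top)
  define I where "I = (\<Sum>\<^sub>\<infinity>i. ennpow (g i) P)"
  have I: "I < \<infinity>"
    using fin False by (simp add: lp_norm_def ennpow_finite I_def P_def)
  have "(\<Sum>\<^sub>\<infinity>i. ennpow (f i) P) \<le> ennpow K P * I"
  proof (rule infsum_ennreal_le)
    fix F :: "'a set" assume "finite F"
    have "ennpow (f i) P \<le> ennpow K P * ennpow (g i) P" for i
      using ennpow_mono[OF f P] ennpow_mult[OF K g] by simp
    then have "(\<Sum>i\<in>F. ennpow (f i) P) \<le> ennpow K P * (\<Sum>i\<in>F. ennpow (g i) P)"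
      unfolding sum_distrib_left by (intro sum_mono)
    also have "\<dots> \<le> ennpow K P * I"
      unfolding I_def using \<open>finite F\<close> by (intro mult_left_mono sum_le_infsum_ennreal) auto
    finally show "(\<Sum>i\<in>F. ennpow (f i) P) \<le> ennpow K P * I" .
  qed
  then have "ennpow (\<Sum>\<^sub>\<infinity>i. ennpow (f i) P) (1 / P) \<le> ennpow (ennpow K P * I) (1 / P)"
    using P by (intro ennpow_mono) auto
  also have "\<dots> = K * ennpow I (1 / P)"
    using K I P by (subst ennpow_mult) (auto simp: ennpow_finite ennpow_inverse)
  finally show ?thesis
    using False by (simp add: lp_norm_def I_def P_def)
qed

lemma lp_norm_mono:
  assumes "0 < p" and f: "\<And>i. f i \<le> g i"
  shows "lp_norm p f \<le> lp_norm p g"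
proof (cases "p = \<infinity>")
  case False
  then have P: "0 < enn2real p"
    using assms(1) by (simp add: enn2real_positive_iff less_top)
  have "(\<Sum>\<^sub>\<infinity>i. ennpow (f i) (enn2real p)) \<le> (\<Sum>\<^sub>\<infinity>i. ennpow (g i) (enn2real p))"
    by (rule infsum_ennreal_le, rule order_trans[OF sum_mono sum_le_infsum_ennreal])
      (auto intro: ennpow_mono f P)
  then show ?thesis
    using P False by (simp add: lp_norm_def ennpow_mono)
qed (simp add: lp_norm_def SUP_mono' f)

text \<open>Only finiteness is asserted, because for \<open>p < 1\<close> the triangle inequality
  fails. The bound of a sum by twice the maximum serves all finite exponents.\<close>

lemma lp_norm_add_finite:
  assumes "0 < p" and f: "lp_norm p f < \<infinity>" and g: "lp_norm p g < \<infinity>"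
  shows "lp_norm p (\<lambda>i. f i + g i) < \<infinity>"
proof (cases "p = \<infinity>")
  case True
  have "(SUP i. f i + g i) \<le> (SUP i. f i) + (SUP i. g i)"
    by (intro SUP_least add_mono SUP_upper) auto
  also have "\<dots> < \<infinity>"
    using f g True by (simp add: lp_norm_def)
  finally show ?thesis
    using True by (simp add: lp_norm_def)
next
  case False
  define P where "P = enn2real p"
  have P: "0 < P"
    using assms(1) False by (simp add: P_def enn2real_positive_iff less_top)
  have fin: "(\<Sum>\<^sub>\<infinity>i. ennpow (f i) P) < \<infinity>" "(\<Sum>\<^sub>\<infinity>i. ennpow (g i) P) < \<infinity>"
    using f g False by (simp_all add: lp_norm_def ennpow_finite P_def)
  have finite: "f i < \<infinity>" "g i < \<infinity>" for i
    using le_lp_norm[OF assms(1), of f i] le_lp_norm[OF assms(1), of g i] f g by auto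
  have le: "ennpow (f i + g i) P \<le> ennpow 2 P * (ennpow (f i) P + ennpow (g i) P)" for i
  proof -
    have "f i + g i \<le> 2 * max (f i) (g i)"
      by (metis add_mono max.cobounded1 max.cobounded2 mult_2)
    then have "ennpow (f i + g i) P \<le> ennpow (2 * max (f i) (g i)) P"
      using P by (rule ennpow_mono)
    also have "\<dots> = ennpow 2 P * ennpow (max (f i) (g i)) P"
      using finite by (intro ennpow_mult) (auto simp: max_def)
    also have "\<dots> \<le> ennpow 2 P * (ennpow (f i) P + ennpow (g i) P)"
      by (intro mult_left_mono) (auto simp: max_def)
    finally show ?thesis .
  qed
  have "(\<Sum>\<^sub>\<infinity>i. ennpow (f i + g i) P) \<le>
    ennpow 2 P * ((\<Sum>\<^sub>\<infinity>i. ennpow (f i) P) + (\<Sum>\<^sub>\<infinity>i. ennpow (g i) P))"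
  proof (rule infsum_ennreal_le)
    fix F :: "'a set" assume F: "finite F"
    have "(\<Sum>i\<in>F. ennpow (f i + g i) P) \<le> ennpow 2 P * ((\<Sum>i\<in>F. ennpow (f i) P) + (\<Sum>i\<in>F. ennpow (g i) P))"
      unfolding sum.distrib[symmetric] sum_distrib_left by (intro sum_mono le)
    also have "\<dots> \<le> ennpow 2 P * ((\<Sum>\<^sub>\<infinity>i. ennpow (f i) P) + (\<Sum>\<^sub>\<infinity>i. ennpow (g i) P))"
      using F by (intro mult_left_mono add_mono sum_le_infsum_ennreal) auto
    finally show "(\<Sum>i\<in>F. ennpow (f i + g i) P) \<le>
      ennpow 2 P * ((\<Sum>\<^sub>\<infinity>i. ennpow (f i) P) + (\<Sum>\<^sub>\<infinity>i. ennpow (g i) P))" .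
  qed
  also have "\<dots> < \<infinity>"
    using fin by (intro ennreal_mult_finite ennreal_add_finite) (auto simp: ennpow_finite)
  finally show ?thesis
    using False by (simp add: lp_norm_def ennpow_finite P_def)
qed

lemma wnorm_alt: "wnorm p \<omega> c = lp_norm p (\<lambda>i. mag c i * \<omega> i)"
  by (simp add: wnorm_def mag_def)

lemma zero_in_lw_set: "0 < p \<Longrightarrow> (\<lambda>_. 0) \<in> lw_set p \<omega>"
  by (simp add: lw_set_def wnorm_alt lp_norm_def)

lemma lw_set_cmult:
  assumes p: "0 < p" and x: "x \<in> lw_set p \<omega>"
  shows "(\<lambda>i. a * x i) \<in> lw_set p \<omega>"
proof -
  have fin: "lp_norm p (\<lambda>i. mag x i * \<omega> i) < \<infinity>"
    using x by (simp add: lw_set_def wnorm_alt)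
  have "lp_norm p (\<lambda>i. mag (\<lambda>i. a * x i) i * \<omega> i) \<le> ennreal (cmod a) * lp_norm p (\<lambda>i. mag x i * \<omega> i)"
    using le_lp_norm[OF p, of "\<lambda>i. mag x i * \<omega> i"] fin
    by (intro lp_norm_le[OF p]) (auto simp: mag_cmult mult.assoc intro: order_le_less_trans)
  also have "\<dots> < \<infinity>"
    using fin by (simp add: ennreal_mult_less_top)
  finally show ?thesis
    by (simp add: lw_set_def wnorm_alt)
qed

lemma lin_lw_set:
  assumes p: "0 < p"
  shows "lin (lw_set p \<omega>)"
  unfolding lin_def
proof (intro conjI ballI allI)
  fix x y a b assume xy: "x \<in> lw_set p \<omega>" "y \<in> lw_set p \<omega>"
  let ?x = "\<lambda>i. a * x i" and ?y = "\<lambda>i. b * y i"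
  have "lp_norm p (\<lambda>i. mag (\<lambda>i. ?x i + ?y i) i * \<omega> i) \<le> lp_norm p (\<lambda>i. mag ?x i * \<omega> i + mag ?y i * \<omega> i)"
    using mag_add_le[of ?x ?y] by (intro lp_norm_mono[OF p]) (auto simp: mult_right_mono simp flip: distrib_right)
  also have "\<dots> < \<infinity>"
    using lw_set_cmult[OF p xy(1), of a] lw_set_cmult[OF p xy(2), of b]
    by (intro lp_norm_add_finite[OF p]) (auto simp: lw_set_def wnorm_alt)
  finally show "(\<lambda>i. a * x i + b * y i) \<in> lw_set p \<omega>"
    by (simp add: lw_set_def wnorm_alt)
qed (rule zero_in_lw_set[OF p])

lemma lw_set_antimono:
  assumes "0 < p" and le: "\<And>i. \<omega> i \<le> \<omega>' i"
  shows "lw_set p \<omega>' \<subseteq> lw_set p \<omega>"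
proof
  fix c assume "c \<in> lw_set p \<omega>'"
  moreover have "wnorm p \<omega> c \<le> wnorm p \<omega>' c"
    unfolding wnorm_alt by (intro lp_norm_mono mult_left_mono assms) simp
  ultimately show "c \<in> lw_set p \<omega>"
    by (simp add: lw_set_def order_le_less_trans)
qed

lemma openin_lw: "openin (lw p \<omega>) U \<longleftrightarrow> lw_open p \<omega> U"
  by (simp add: lw_def istopology_lw_open topology_inverse')

lemma topspace_lw: "topspace (lw p \<omega>) = lw_set p \<omega>"
proof (rule antisym)
  show "topspace (lw p \<omega>) \<subseteq> lw_set p \<omega>"
    unfolding topspace_def openin_lw lw_open_def by auto
  have "lw_open p \<omega> (lw_set p \<omega>)"
    unfolding lw_open_def by (auto intro: exI[of _ 1])
  then show "lw_set p \<omega> \<subseteq> topspace (lw p \<omega>)"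
    by (metis openin_lw openin_subset)
qed

text \<open>Every l^p quasi-norm dominates the sup norm, and the gained factor \<open>g\<close>
  makes a sup bound summable.\<close>

lemma pairing_le_wnorm:
  assumes p: "0 < p" and g: "nuclear g" and f: "faster g \<omega> \<omega>'"
  shows "\<exists>K<\<infinity>. \<forall>c. pairing (mag c) \<omega> \<le> K * wnorm p \<omega>' c"
proof -
  obtain D where D: "D < \<infinity>" "\<And>i. \<omega> i \<le> D * g i * \<omega>' i"
    using f by (auto simp: faster_def)
  have "mag c i * \<omega> i \<le> D * wnorm p \<omega>' c * (g i * 1)" for c i
  proof -
    have "mag c i * \<omega> i \<le> mag c i * (D * g i * \<omega>' i)"
      by (intro mult_left_mono D) simp
    also have "\<dots> = (mag c i * \<omega>' i) * (D * g i)"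
      by (simp add: ac_simps)
    also have "\<dots> \<le> wnorm p \<omega>' c * (D * g i)"
      unfolding wnorm_alt by (intro mult_right_mono le_lp_norm[OF p, of "\<lambda>i. mag c i * \<omega>' i"]) simp
    finally show ?thesis
      by (simp add: ac_simps)
  qed
  then have "pairing (mag c) \<omega> \<le> D * wnorm p \<omega>' c * pairing g (\<lambda>_. 1)" for c
    unfolding pairing_cmult_left[symmetric] unfolding pairing_def
    by (intro nn_integral_mono) (simp add: mult.assoc)
  moreover have "D * pairing g (\<lambda>_. 1) < \<infinity>"
    using D(1) g by (intro ennreal_mult_finite) (auto simp: nuclear_def)
  ultimately show ?thesis
    by (intro exI[of _ "D * pairing g (\<lambda>_. 1)"]) (simp add: ac_simps)
qed

text \<open>Each term is at most the l^1 norm, so the weighted sequence is majorized by a multiple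
  of \<open>g\<close>, whose l^p quasi-norm is finite.\<close>

lemma wnorm_le_pairing:
  assumes p: "0 < p" and g: "nuclear g" and f: "faster g \<omega> \<omega>'"
  shows "\<exists>K<\<infinity>. \<forall>c. pairing (mag c) \<omega>' < \<infinity> \<longrightarrow> wnorm p \<omega> c \<le> K * pairing (mag c) \<omega>'"
proof -
  obtain D where D: "D < \<infinity>" "\<And>i. \<omega> i \<le> D * g i * \<omega>' i"
    using f by (auto simp: faster_def)
  have g': "lp_norm p g < \<infinity>" "\<And>i. g i < \<infinity>"
    using g p by (auto simp: nuclear_def)
  have "wnorm p \<omega> c \<le> D * pairing (mag c) \<omega>' * lp_norm p g" if c: "pairing (mag c) \<omega>' < \<infinity>" for c
    unfolding wnorm_alt
  proof (rule lp_norm_le[OF p _ g'(2) _ g'(1)])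
    show "D * pairing (mag c) \<omega>' < \<infinity>"
      using D(1) c by (rule ennreal_mult_finite)
    fix i
    have "mag c i * \<omega> i \<le> mag c i * (D * g i * \<omega>' i)"
      by (intro mult_left_mono D) simp
    also have "\<dots> = (mag c i * \<omega>' i) * (D * g i)"
      by (simp add: ac_simps)
    also have "\<dots> \<le> pairing (mag c) \<omega>' * (D * g i)"
      by (intro mult_right_mono le_pairing) simp
    finally show "mag c i * \<omega> i \<le> D * pairing (mag c) \<omega>' * g i"
      by (simp add: ac_simps)
  qed
  moreover have "D * lp_norm p g < \<infinity>"
    using D(1) g'(1) by (rule ennreal_mult_finite)
  ultimately show ?thesis
    by (intro exI[of _ "D * lp_norm p g"]) (simp add: ac_simps)
qed

lemma ennreal_small_multiple:
  fixes K :: ennreal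
  assumes "K < \<infinity>"
  obtains \<epsilon> where "0 < \<epsilon>" "\<And>x. x < \<epsilon> \<Longrightarrow> K * x < 1"
proof -
  obtain k where k: "K = ennreal k" "0 \<le> k"
    using assms by (cases K) auto
  define e where "e = 1 / (k + 1)"
  have e: "0 < e" "k * e < 1"
    using k(2) by (simp_all add: e_def field_simps)
  have "K * x < 1" if x: "x < ennreal e" for x
  proof -
    obtain y where y: "x = ennreal y" "0 \<le> y" "y < e"
      using x e by (cases x) (auto simp: ennreal_less_iff)
    have "k * y \<le> k * e"
      using y k by (intro mult_left_mono) auto
    then show ?thesis
      using y k e by (simp flip: ennreal_mult)
  qed
  then show thesis
    using that[of "ennreal e"] e by simp
qed

text \<open>Together with \<open>emb_ktop_lw\<close>: enlarging the weight by the factor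
  \<open>1 / g\<close> includes the l^p space in the l^1 space and conversely, so the exponent
  disappears in the limit.\<close>

lemma emb_lw_ktop:
  assumes p: "0 < p" and g: "nuclear g" and f: "faster g \<omega> \<omega>'"
  shows "emb (lw p \<omega>') (ktop (Lsp \<omega>) (Osp \<omega>))"
proof (rule embI)
  obtain K where K: "K < \<infinity>" "\<And>c. pairing (mag c) \<omega> \<le> K * wnorm p \<omega>' c"
    using pairing_le_wnorm[OF assms] by blast
  have sub: "lw_set p \<omega>' \<subseteq> seqs (Lsp \<omega>)"
  proof
    fix c assume "c \<in> lw_set p \<omega>'"
    then have "K * wnorm p \<omega>' c < \<infinity>"
      using K(1) by (intro ennreal_mult_finite) (auto simp: lw_set_def)
    then show "c \<in> seqs (Lsp \<omega>)"
      using K(2)[of c] by (simp add: seqs_def Lsp_def order_le_less_trans)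
  qed
  then show "topspace (lw p \<omega>') \<subseteq> topspace (ktop (Lsp \<omega>) (Osp \<omega>))"
    by (simp add: topspace_lw topspace_ktop wcone_Osp)
  fix U assume "openin (ktop (Lsp \<omega>) (Osp \<omega>)) U"
  then have U: "kopen (Lsp \<omega>) (Osp \<omega>) U"
    by (simp add: openin_ktop wcone_Osp)
  show "openin (lw p \<omega>') (U \<inter> topspace (lw p \<omega>'))"
    unfolding openin_lw topspace_lw lw_open_def
  proof (intro conjI ballI)
    fix x assume x: "x \<in> U \<inter> lw_set p \<omega>'"
    then obtain w where w: "w \<in> Osp \<omega>" "\<And>y. y \<in> seqs (Lsp \<omega>) \<Longrightarrow> pairing (mag (\<lambda>i. y i - x i)) w < 1 \<Longrightarrow> y \<in> U"
      using kopenE[OF U, of x] by blast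
    obtain C where C: "C < \<infinity>" "\<And>i. w i \<le> C * \<omega> i"
      using w(1) by (auto simp: Osp_def)
    obtain \<epsilon> where e: "0 < \<epsilon>" "\<And>x. x < \<epsilon> \<Longrightarrow> C * K * x < 1"
      using ennreal_small_multiple[OF ennreal_mult_finite[OF C(1) K(1)]] by blast
    have "y \<in> U \<inter> lw_set p \<omega>'" if y: "y \<in> lw_set p \<omega>'" "wnorm p \<omega>' (\<lambda>i. y i - x i) < \<epsilon>" for y
    proof -
      have "pairing (mag (\<lambda>i. y i - x i)) w \<le> C * pairing (mag (\<lambda>i. y i - x i)) \<omega>"
        unfolding pairing_cmult_right[symmetric] using C(2) by (intro pairing_mono) auto
      also have "\<dots> \<le> C * (K * wnorm p \<omega>' (\<lambda>i. y i - x i))"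
        by (intro mult_left_mono K) simp
      also have "\<dots> < 1"
        using e(2)[OF y(2)] by (simp add: mult.assoc)
      finally show ?thesis
        using w(2)[of y] y(1) sub by blast
    qed
    then show "\<exists>\<epsilon>>0. \<forall>y\<in>lw_set p \<omega>'. wnorm p \<omega>' (\<lambda>i. y i - x i) < \<epsilon> \<longrightarrow> y \<in> U \<inter> lw_set p \<omega>'"
      using e(1) by blast
  qed simp
qed

lemma emb_ktop_lw:
  assumes p: "0 < p" and g: "nuclear g" and f: "faster g \<omega> \<omega>'"
  shows "emb (ktop (Lsp \<omega>') (Osp \<omega>')) (lw p \<omega>)"
proof (rule embI)
  obtain K where K: "K < \<infinity>" "\<And>c. pairing (mag c) \<omega>' < \<infinity> \<Longrightarrow> wnorm p \<omega> c \<le> K * pairing (mag c) \<omega>'"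
    using wnorm_le_pairing[OF assms] by blast
  have sub: "seqs (Lsp \<omega>') \<subseteq> lw_set p \<omega>"
  proof
    fix c assume c: "c \<in> seqs (Lsp \<omega>')"
    then have "K * pairing (mag c) \<omega>' < \<infinity>"
      using K(1) by (intro ennreal_mult_finite) (auto simp: seqs_def Lsp_def)
    then show "c \<in> lw_set p \<omega>"
      using K(2)[of c] c by (simp add: lw_set_def seqs_def Lsp_def order_le_less_trans)
  qed
  then show "topspace (ktop (Lsp \<omega>') (Osp \<omega>')) \<subseteq> topspace (lw p \<omega>)"
    by (simp add: topspace_lw topspace_ktop wcone_Osp)
  fix U assume "openin (lw p \<omega>) U"
  then have U: "lw_open p \<omega> U"
    by (simp add: openin_lw)
  show "openin (ktop (Lsp \<omega>') (Osp \<omega>')) (U \<inter> topspace (ktop (Lsp \<omega>') (Osp \<omega>')))"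
    unfolding openin_ktop[OF wcone_Osp] topspace_ktop[OF wcone_Osp] kopen_def
  proof (intro conjI ballI)
    fix x assume x: "x \<in> U \<inter> seqs (Lsp \<omega>')"
    then obtain \<epsilon> where e: "0 < \<epsilon>" "\<forall>y\<in>lw_set p \<omega>. wnorm p \<omega> (\<lambda>i. y i - x i) < \<epsilon> \<longrightarrow> y \<in> U"
      using U unfolding lw_open_def by blast
    \<comment> \<open>The radius may be infinite, and then any positive real will do.\<close>
    obtain e' where e': "0 < e'" "ennreal e' \<le> \<epsilon>"
    proof (cases \<epsilon>)
      case (real r)
      then show ?thesis
        using that[of r] e(1) by simp
    qed (use that[of 1] in auto)
    obtain k where k: "K = ennreal k" "0 \<le> k"
      using K(1) by (cases K) auto
    define C where "C = ennreal ((k + 1) / e')"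
    have "y \<in> U \<inter> seqs (Lsp \<omega>')" if y: "y \<in> seqs (Lsp \<omega>')" "pairing (mag (\<lambda>i. y i - x i)) (\<lambda>i. C * \<omega>' i) < 1" for y
    proof -
      have "(\<lambda>i. y i - x i) \<in> seqs (Lsp \<omega>')"
        using seqs_diff[OF wcone_Lsp] y(1) x by blast
      then have fin: "pairing (mag (\<lambda>i. y i - x i)) \<omega>' < \<infinity>"
        by (simp add: seqs_def Lsp_def)
      then obtain N where N: "pairing (mag (\<lambda>i. y i - x i)) \<omega>' = ennreal N" "0 \<le> N"
        by (cases "pairing (mag (\<lambda>i. y i - x i)) \<omega>'") auto
      have "ennreal ((k + 1) / e' * N) < 1"
        unfolding ennreal_mult''[OF N(2)] using y(2) by (simp add: pairing_cmult_right N(1) C_def)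
      then have "(k + 1) / e' * N < 1"
        using ennreal_less_imp[of "(k + 1) / e' * N" 1] by (simp only: ennreal_1)
      then have "(k + 1) * N < e'"
        using e' by (simp add: field_simps)
      then have "k * N < e'"
        using N(2) by (simp add: distrib_right)
      have "wnorm p \<omega> (\<lambda>i. y i - x i) \<le> ennreal (k * N)"
        using K(2)[OF fin] k N by (simp add: ennreal_mult)
      also have "\<dots> < ennreal e'"
        using \<open>k * N < e'\<close> e' by (intro ennreal_lessI) auto
      also note e'(2)
      finally show ?thesis
        using e(2) y(1) sub by blast
    qed
    moreover have "(\<lambda>i. C * \<omega>' i) \<in> Osp \<omega>'"
      by (rule wcone_cmult[OF wcone_Osp self_in_Osp]) (simp add: C_def)
    ultimately show "\<exists>w\<in>Osp \<omega>'. \<forall>y\<in>seqs (Lsp \<omega>'). pairing (mag (\<lambda>i. y i - x i)) w < 1 \<longrightarrow> y \<in> U \<inter> seqs (Lsp \<omega>')"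
      by (intro bexI[of _ "\<lambda>i. C * \<omega>' i"]) auto
  qed simp
qed

section \<open>Iterated limits of weighted spaces\<close>

text \<open>\<open>PI\<close> stands for a projective limit over the outer parameter
  \<open>j\<close> of inductive limits over \<open>n\<close>, and \<open>IP\<close> for the opposite
  order. Weights behave contravariantly, hence union and intersection are exchanged in
  \<open>PI_W\<close>.\<close>

definition PI_S :: "(real \<Rightarrow> real \<Rightarrow> 'i \<Rightarrow> ennreal) \<Rightarrow> ('i \<Rightarrow> ennreal) set" where
  "PI_S \<omega> = (\<Inter>j\<in>{0<..}. \<Union>n\<in>{0<..}. Lsp (\<omega> j n))"

definition PI_W :: "(real \<Rightarrow> real \<Rightarrow> 'i \<Rightarrow> ennreal) \<Rightarrow> ('i \<Rightarrow> ennreal) set" where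
  "PI_W \<omega> = (\<Union>j\<in>{0<..}. \<Inter>n\<in>{0<..}. Osp (\<omega> j n))"

text \<open>No companion cone of weights is introduced: for this order of limits the weights turn
  out to be all of \<open>dual (IP_S \<omega>)\<close>.\<close>

definition IP_S :: "(real \<Rightarrow> real \<Rightarrow> 'i \<Rightarrow> ennreal) \<Rightarrow> ('i \<Rightarrow> ennreal) set" where
  "IP_S \<omega> = (\<Union>j\<in>{0<..}. \<Inter>n\<in>{0<..}. Lsp (\<omega> j n))"

text \<open>The direction is left open: in \<open>r\<close> the weights increase for
  \<open>s \<noteq> 0\<close> and decrease for s = 0, and reciprocals reverse it again.\<close>

definition monotone_family :: "(real \<Rightarrow> real \<Rightarrow> 'i \<Rightarrow> ennreal) \<Rightarrow> bool" where
  "monotone_family \<omega> \<longleftrightarrow>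
    (\<forall>j>0. \<forall>j'>0. (\<forall>n>0. \<forall>i. \<omega> j n i \<le> \<omega> j' n i) \<or> (\<forall>n>0. \<forall>i. \<omega> j' n i \<le> \<omega> j n i)) \<and>
    (\<forall>n>0. \<forall>n'>0. (\<forall>j>0. \<forall>i. \<omega> j n i \<le> \<omega> j n' i) \<or> (\<forall>j>0. \<forall>i. \<omega> j n' i \<le> \<omega> j n i))"

text \<open>
  The condition on \<open>faster\<close> says that a change of parameters gains the factor \<open>g\<close>. For nuclear \<open>g\<close> it
  makes all weighted \<open>\<ell>\<^sup>p\<close> norms interchangeable in the limit. The last condition makes the uncountable
  parameter set countably cofinal, as the gliding hump argument requires.
\<close>

definition PI_family :: "('i \<Rightarrow> ennreal) \<Rightarrow> (real \<Rightarrow> real \<Rightarrow> 'i \<Rightarrow> ennreal) \<Rightarrow> bool" where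
  "PI_family g \<omega> \<longleftrightarrow> monotone_family \<omega> \<and>
    (\<forall>j>0. \<exists>j'>0. \<forall>n>0. \<exists>n'>0. faster g (\<omega> j n') (\<omega> j' n)) \<and>
    (\<forall>j>0. \<forall>i. \<exists>n>0. \<omega> j n i < \<infinity>) \<and> (\<forall>i. \<exists>j>0. \<forall>n>0. 0 < \<omega> j n i) \<and>
    (\<forall>j>0. \<forall>n>0. \<forall>n'>0. \<forall>i. \<omega> j n i = 0 \<longrightarrow> \<omega> j n' i = 0) \<and>
    (\<exists>\<rho>. (\<forall>k::nat. \<rho> k > 0) \<and> (\<forall>j>0. \<forall>k i. \<omega> j (\<rho> (Suc k)) i \<le> \<omega> j (\<rho> k) i) \<and>
       (\<forall>n>0. \<exists>k. \<forall>j>0. \<forall>i. \<omega> j (\<rho> k) i \<le> \<omega> j n i))"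

text \<open>The counterpart of \<open>PI_family\<close> with directions reversed: the outer limit is
  a union, so the factor \<open>g\<close> is gained by moving to a larger step \<open>j'\<close>;
  the inner limit is projective, so its cofinal sequence of weights increases.\<close>

definition IP_family :: "('i \<Rightarrow> ennreal) \<Rightarrow> (real \<Rightarrow> real \<Rightarrow> 'i \<Rightarrow> ennreal) \<Rightarrow> bool" where
  "IP_family g \<omega> \<longleftrightarrow> monotone_family \<omega> \<and>
    (\<forall>j>0. \<exists>j'>0. \<forall>n>0. \<exists>n'>0. faster g (\<omega> j' n) (\<omega> j n')) \<and>
    (\<forall>i. \<exists>j>0. \<forall>n>0. \<omega> j n i < \<infinity>) \<and> (\<forall>j>0. \<forall>i. \<exists>n>0. 0 < \<omega> j n i) \<and>
    (\<exists>\<rho>. (\<forall>k::nat. \<rho> k > 0) \<and> (\<forall>j>0. \<forall>k i. \<omega> j (\<rho> k) i \<le> \<omega> j (\<rho> (Suc k)) i) \<and>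
       (\<forall>n>0. \<exists>k. \<forall>j>0. \<forall>i. \<omega> j n i \<le> \<omega> j (\<rho> k) i))"

text \<open>Unit sequences in \<open>S\<close> put the finite sequences into the space, and those in
  \<open>W\<close> make coordinates continuous. Closure of \<open>W\<close> under division by
  \<open>g\<close> is what turns uniform l^1 bounds on a bounded set into a summable pointwise
  supremum.\<close>

definition kgood :: "('i \<Rightarrow> ennreal) \<Rightarrow> ('i \<Rightarrow> ennreal) set \<Rightarrow> ('i \<Rightarrow> ennreal) set \<Rightarrow> bool" where
  "kgood g S W \<longleftrightarrow> kpair S W \<and> (\<forall>i. delta i \<in> S) \<and> (\<forall>i. delta i \<in> W) \<and>
     (\<forall>w\<in>W. (\<lambda>i. w i * inverse (g i)) \<in> W)"

lemma INT_subset_mono: "(\<And>n. n \<in> A \<Longrightarrow> B n \<subseteq> C n) \<Longrightarrow> (\<Inter>n\<in>A. B n) \<subseteq> (\<Inter>n\<in>A. C n)"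
  by blast

lemma Osp_mono:
  assumes "\<And>i. \<omega> i \<le> \<omega>' i"
  shows "Osp \<omega> \<subseteq> Osp \<omega>'"
proof -
  have "w i \<le> C * \<omega>' i" if "\<forall>i. w i \<le> C * \<omega> i" for w C i
    using that assms[of i] by (meson mult_left_mono order_trans zero_le)
  then show ?thesis
    unfolding Osp_def by blast
qed

lemma Bsp_antimono:
  assumes "\<And>i. \<omega> i \<le> \<omega>' i"
  shows "Bsp \<omega>' \<subseteq> Bsp \<omega>"
proof -
  have "x i * \<omega> i \<le> C" if "\<forall>i. x i * \<omega>' i \<le> C" for x C i
    using that assms[of i] by (meson mult_left_mono order_trans zero_le)
  then show ?thesis
    unfolding Bsp_def by blast
qed

lemma delta_in_Lsp_iff: "delta i \<in> Lsp \<omega> \<longleftrightarrow> \<omega> i < \<infinity>"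
  by (simp add: Lsp_def)

lemma monotone_familyD1:
  assumes "monotone_family \<omega>"
  shows "j > 0 \<Longrightarrow> j' > 0 \<Longrightarrow> (\<forall>n>0. \<forall>i. \<omega> j n i \<le> \<omega> j' n i) \<or> (\<forall>n>0. \<forall>i. \<omega> j' n i \<le> \<omega> j n i)"
  using conjunct1[OF assms[unfolded monotone_family_def], THEN spec, THEN mp, THEN spec, THEN mp, of j j'] .

lemma monotone_familyD2:
  assumes "monotone_family \<omega>"
  shows "n > 0 \<Longrightarrow> n' > 0 \<Longrightarrow> (\<forall>j>0. \<forall>i. \<omega> j n i \<le> \<omega> j n' i) \<or> (\<forall>j>0. \<forall>i. \<omega> j n' i \<le> \<omega> j n i)"
  using conjunct2[OF assms[unfolded monotone_family_def], THEN spec, THEN mp, THEN spec, THEN mp, of n n'] .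

lemma wcone_Lsp_Union:
  assumes "monotone_family \<omega>" "j > 0"
  shows "wcone (\<Union>n\<in>{0<..}. Lsp (\<omega> j n))"
proof (rule wcone_Union_chain)
  fix n n' :: real assume "n \<in> {0<..}" "n' \<in> {0<..}"
  then have "(\<forall>i. \<omega> j n i \<le> \<omega> j n' i) \<or> (\<forall>i. \<omega> j n' i \<le> \<omega> j n i)"
    using monotone_familyD2[OF assms(1), of n n'] assms(2) by auto
  then show "Lsp (\<omega> j n) \<subseteq> Lsp (\<omega> j n') \<or> Lsp (\<omega> j n') \<subseteq> Lsp (\<omega> j n)"
    using Lsp_antimono by metis
qed (auto simp: wcone_Lsp)

lemma wcone_Osp_Union:
  assumes "monotone_family \<omega>" "j > 0"
  shows "wcone (\<Union>n\<in>{0<..}. Osp (\<omega> j n))"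
proof (rule wcone_Union_chain)
  fix n n' :: real assume "n \<in> {0<..}" "n' \<in> {0<..}"
  then have "(\<forall>i. \<omega> j n i \<le> \<omega> j n' i) \<or> (\<forall>i. \<omega> j n' i \<le> \<omega> j n i)"
    using monotone_familyD2[OF assms(1), of n n'] assms(2) by auto
  then show "Osp (\<omega> j n) \<subseteq> Osp (\<omega> j n') \<or> Osp (\<omega> j n') \<subseteq> Osp (\<omega> j n)"
    using Osp_mono by metis
qed (auto simp: wcone_Osp)

lemma wcone_PI_S: "monotone_family \<omega> \<Longrightarrow> wcone (PI_S \<omega>)"
  unfolding PI_S_def by (intro wcone_Inter wcone_Lsp_Union) auto

lemma wcone_PI_W:
  assumes "monotone_family \<omega>"
  shows "wcone (PI_W \<omega>)"
  unfolding PI_W_def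
proof (rule wcone_Union_chain)
  fix j j' :: real assume "j \<in> {0<..}" "j' \<in> {0<..}"
  then have "(\<forall>n>0. \<forall>i. \<omega> j n i \<le> \<omega> j' n i) \<or> (\<forall>n>0. \<forall>i. \<omega> j' n i \<le> \<omega> j n i)"
    using monotone_familyD1[OF assms, of j j'] by auto
  then show "(\<Inter>n\<in>{0<..}. Osp (\<omega> j n)) \<subseteq> (\<Inter>n\<in>{0<..}. Osp (\<omega> j' n)) \<or>
      (\<Inter>n\<in>{0<..}. Osp (\<omega> j' n)) \<subseteq> (\<Inter>n\<in>{0<..}. Osp (\<omega> j n))"
  proof
    assume "\<forall>n>0. \<forall>i. \<omega> j n i \<le> \<omega> j' n i"
    then show ?thesis
      by (intro disjI1 INT_subset_mono Osp_mono) auto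
  next
    assume "\<forall>n>0. \<forall>i. \<omega> j' n i \<le> \<omega> j n i"
    then show ?thesis
      by (intro disjI2 INT_subset_mono Osp_mono) auto
  qed
qed (auto intro!: wcone_Inter wcone_Osp)

lemma wcone_IP_S:
  assumes "monotone_family \<omega>"
  shows "wcone (IP_S \<omega>)"
  unfolding IP_S_def
proof (rule wcone_Union_chain)
  fix j j' :: real assume "j \<in> {0<..}" "j' \<in> {0<..}"
  then have "(\<forall>n>0. \<forall>i. \<omega> j n i \<le> \<omega> j' n i) \<or> (\<forall>n>0. \<forall>i. \<omega> j' n i \<le> \<omega> j n i)"
    using monotone_familyD1[OF assms, of j j'] by auto
  then show "(\<Inter>n\<in>{0<..}. Lsp (\<omega> j n)) \<subseteq> (\<Inter>n\<in>{0<..}. Lsp (\<omega> j' n)) \<or>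
      (\<Inter>n\<in>{0<..}. Lsp (\<omega> j' n)) \<subseteq> (\<Inter>n\<in>{0<..}. Lsp (\<omega> j n))"
  proof
    assume "\<forall>n>0. \<forall>i. \<omega> j n i \<le> \<omega> j' n i"
    then show ?thesis
      by (intro disjI2 INT_subset_mono Lsp_antimono) auto
  next
    assume "\<forall>n>0. \<forall>i. \<omega> j' n i \<le> \<omega> j n i"
    then show ?thesis
      by (intro disjI1 INT_subset_mono Lsp_antimono) auto
  qed
qed (auto intro!: wcone_Inter wcone_Lsp)

text \<open>Adding \<open>\<omega>\<close> itself makes the weight infinite wherever the unit
  sequence has infinite norm. This supplies the hypothesis \<open>full\<close> of
  \<open>ind_lim_ktop\<close>.\<close>

lemma Osp_full:
  assumes "w \<in> Osp \<omega>"
  shows "\<exists>w'\<in>Osp \<omega>. (\<forall>i. w i \<le> w' i) \<and> (\<forall>i. delta i \<notin> Lsp \<omega> \<longrightarrow> w' i = \<infinity>)"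
  using wcone_add[OF wcone_Osp assms self_in_Osp]
  by (intro bexI[of _ "\<lambda>i. w i + \<omega> i"]) (auto simp: delta_in_Lsp_iff less_top)

lemma ind_lim_Lsp:
  fixes \<omega> :: "real \<Rightarrow> real \<Rightarrow> 'i::countable \<Rightarrow> ennreal"
  assumes "monotone_family \<omega>" "j > 0"
  shows "ind_lim (\<lambda>n. ktop (Lsp (\<omega> j n)) (Osp (\<omega> j n))) =
    ktop (\<Union>n\<in>{0<..}. Lsp (\<omega> j n)) (\<Inter>n\<in>{0<..}. Osp (\<omega> j n))"
  by (rule ind_lim_ktop, rule kpair_Lsp, erule Osp_full, rule wcone_Lsp_Union[OF assms])

lemma lin_lw_Union:
  assumes "0 < p" "monotone_family \<omega>" "j > 0"
  shows "lin (\<Union>n\<in>{0<..}. topspace (lw p (\<omega> j n)))"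
  unfolding topspace_lw
proof (rule lin_Union_chain)
  fix n n' :: real assume "n \<in> {0<..}" "n' \<in> {0<..}"
  then have "(\<forall>i. \<omega> j n i \<le> \<omega> j n' i) \<or> (\<forall>i. \<omega> j n' i \<le> \<omega> j n i)"
    using monotone_familyD2[OF assms(2), of n n'] assms(3) by auto
  then show "lw_set p (\<omega> j n) \<subseteq> lw_set p (\<omega> j n') \<or> lw_set p (\<omega> j n') \<subseteq> lw_set p (\<omega> j n)"
    using lw_set_antimono[OF assms(1)] by metis
qed (auto simp: lin_lw_set[OF assms(1)])

lemma lin_ktop_Lsp_Union:
  assumes "monotone_family \<omega>" "j > 0"
  shows "lin (\<Union>n\<in>{0<..}. topspace (ktop (Lsp (\<omega> j n)) (Osp (\<omega> j n))))"
proof -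
  have "(\<Union>n\<in>{0<..}. topspace (ktop (Lsp (\<omega> j n)) (Osp (\<omega> j n)))) = seqs (\<Union>n\<in>{0<..}. Lsp (\<omega> j n))"
    by (auto simp: topspace_ktop wcone_Osp seqs_def)
  then show ?thesis
    using lin_seqs[OF wcone_Lsp_Union[OF assms]] by simp
qed

text \<open>The l^p steps and the l^1 steps include each other continuously after a change of the
  outer parameter, so the two iterated limits coincide; for l^1 steps the limits of Koethe spaces
  are already known.\<close>

theorem proj_ind_lim_lw:
  fixes \<omega> :: "real \<Rightarrow> real \<Rightarrow> 'i::countable \<Rightarrow> ennreal"
  assumes p: "0 < p" and g: "nuclear g" and \<omega>: "PI_family g \<omega>"
  shows "proj_lim (\<lambda>j. ind_lim (\<lambda>n. lw p (\<omega> j n))) = ktop (PI_S \<omega>) (PI_W \<omega>)"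
proof -
  have mono: "monotone_family \<omega>"
    and D: "\<And>j. j > 0 \<Longrightarrow> \<exists>j'>0. \<forall>n>0. \<exists>n'>0. faster g (\<omega> j n') (\<omega> j' n)"
    using \<omega> by (auto simp: PI_family_def)
  let ?K = "\<lambda>j. ind_lim (\<lambda>n. ktop (Lsp (\<omega> j n)) (Osp (\<omega> j n)))"
  have zero: "(\<lambda>_. 0) \<in> topspace (lw p (\<omega> j n))" for j n
    by (simp add: topspace_lw zero_in_lw_set p)
  have zero': "(\<lambda>_. 0) \<in> topspace (ktop (Lsp (\<omega> j n)) (Osp (\<omega> j n)))" for j n
    by (simp add: topspace_ktop wcone_Osp seqs_zero wcone_Lsp)
  have "\<exists>j'>0. emb (ind_lim (\<lambda>n. lw p (\<omega> j' n))) (?K j)" if j: "j > 0" for j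
  proof -
    obtain j' where j': "j' > 0" "\<And>n. n > 0 \<Longrightarrow> \<exists>n'>0. faster g (\<omega> j n') (\<omega> j' n)"
      using D[OF j] by blast
    have "emb (ind_lim (\<lambda>n. lw p (\<omega> j' n))) (?K j)"
    proof (rule emb_ind_lim)
      fix n :: real assume "n > 0"
      then obtain n' where "n' > 0" "faster g (\<omega> j n') (\<omega> j' n)"
        using j'(2) by blast
      then show "\<exists>n'>0. emb (lw p (\<omega> j' n)) (ktop (Lsp (\<omega> j n')) (Osp (\<omega> j n')))"
        using emb_lw_ktop[OF p g] by blast
    qed (use zero zero' lin_lw_Union[OF p mono] lin_ktop_Lsp_Union[OF mono] j j'(1) in auto)
    then show ?thesis
      using j'(1) by blast
  qed
  moreover have "\<exists>j'>0. emb (?K j') (ind_lim (\<lambda>n. lw p (\<omega> j n)))" if j: "j > 0" for j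
  proof -
    obtain j' where j': "j' > 0" "\<And>n. n > 0 \<Longrightarrow> \<exists>n'>0. faster g (\<omega> j n') (\<omega> j' n)"
      using D[OF j] by blast
    have "emb (?K j') (ind_lim (\<lambda>n. lw p (\<omega> j n)))"
    proof (rule emb_ind_lim)
      fix n :: real assume "n > 0"
      then obtain n' where "n' > 0" "faster g (\<omega> j n') (\<omega> j' n)"
        using j'(2) by blast
      then show "\<exists>n'>0. emb (ktop (Lsp (\<omega> j' n)) (Osp (\<omega> j' n))) (lw p (\<omega> j n'))"
        using emb_ktop_lw[OF p g] by blast
    qed (use zero zero' lin_lw_Union[OF p mono] lin_ktop_Lsp_Union[OF mono] j j'(1) in auto)
    then show ?thesis
      using j'(1) by blast
  qed
  ultimately have "proj_lim (\<lambda>j. ind_lim (\<lambda>n. lw p (\<omega> j n))) = proj_lim ?K"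
    by (intro emb_antisym emb_proj_lim) auto
  also have "\<dots> = proj_lim (\<lambda>j. ktop (\<Union>n\<in>{0<..}. Lsp (\<omega> j n)) (\<Inter>n\<in>{0<..}. Osp (\<omega> j n)))"
  proof (intro emb_antisym emb_proj_lim)
    fix j :: real assume "j > 0"
    then show "\<exists>j'>0. emb (?K j') (ktop (\<Union>n\<in>{0<..}. Lsp (\<omega> j n)) (\<Inter>n\<in>{0<..}. Osp (\<omega> j n)))"
      "\<exists>j'>0. emb (ktop (\<Union>n\<in>{0<..}. Lsp (\<omega> j' n)) (\<Inter>n\<in>{0<..}. Osp (\<omega> j' n))) (?K j)"
      using ind_lim_Lsp[OF mono, of j] by (auto simp: emb_def intro!: exI[of _ j])
  qed
  also have "\<dots> = ktop (PI_S \<omega>) (PI_W \<omega>)"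
    unfolding PI_S_def PI_W_def
    by (rule proj_lim_ktop) (use wcone_PI_W[OF mono] in \<open>auto simp: PI_W_def intro: wcone_Inter wcone_Osp\<close>)
  finally show ?thesis .
qed

lemma ind_lim_lw:
  fixes \<omega> :: "real \<Rightarrow> 'i::countable \<Rightarrow> ennreal"
  assumes "0 < p" "nuclear g" "PI_family g (\<lambda>_. \<omega>)"
  shows "ind_lim (\<lambda>n. lw p (\<omega> n)) = ktop (PI_S (\<lambda>_. \<omega>)) (PI_W (\<lambda>_. \<omega>))"
  using proj_ind_lim_lw[OF assms] by (simp add: proj_lim_const)

lemma proj_lim_lw:
  fixes \<omega> :: "real \<Rightarrow> 'i::countable \<Rightarrow> ennreal"
  assumes p: "0 < p" and g: "nuclear g" and \<omega>: "PI_family g (\<lambda>j _. \<omega> j)"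
  shows "proj_lim (\<lambda>j. lw p (\<omega> j)) = ktop (PI_S (\<lambda>j _. \<omega> j)) (PI_W (\<lambda>j _. \<omega> j))"
proof -
  have mono: "monotone_family (\<lambda>j _. \<omega> j)"
    and D: "\<And>j. j > 0 \<Longrightarrow> \<exists>j'>0. faster g (\<omega> j) (\<omega> j')"
    using \<omega> unfolding PI_family_def by (blast, meson zero_less_one)
  have "proj_lim (\<lambda>j. lw p (\<omega> j)) = proj_lim (\<lambda>j. ktop (Lsp (\<omega> j)) (Osp (\<omega> j)))"
    using D emb_lw_ktop[OF p g] emb_ktop_lw[OF p g]
    by (intro emb_antisym emb_proj_lim) meson+
  also have "\<dots> = ktop (\<Inter>j\<in>{0<..}. Lsp (\<omega> j)) (\<Union>j\<in>{0<..}. Osp (\<omega> j))"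
    by (rule proj_lim_ktop) (use wcone_PI_W[OF mono] in \<open>auto simp: PI_W_def wcone_Osp\<close>)
  finally show ?thesis
    by (simp add: PI_S_def PI_W_def)
qed

lemma le_Lsp_zero:
  assumes "x \<in> Lsp \<omega>" "\<omega> i = \<infinity>"
  shows "x i = 0"
proof -
  have "x i * \<omega> i < \<infinity>"
    using le_pairing[of x i \<omega>] assms(1) by (auto simp: Lsp_def intro: order_le_less_trans)
  then show ?thesis
    using assms(2) by (auto simp: ennreal_mult_top split: if_splits)
qed

text \<open>Weights enter only through their pairings with \<open>S\<close>, so they may be altered
  where all elements of \<open>S\<close> vanish.\<close>

lemma ktop_cong:
  assumes S: "wcone S" and W: "wcone W" and W': "wcone W'"
    and 1: "\<And>w. w \<in> W \<Longrightarrow> \<exists>w'\<in>W'. \<forall>x\<in>S. pairing x w \<le> pairing x w'"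
    and 2: "\<And>w. w \<in> W' \<Longrightarrow> \<exists>w'\<in>W. \<forall>x\<in>S. pairing x w \<le> pairing x w'"
  shows "ktop S W = ktop S W'"
proof -
  have "kopen S V' U" if U: "kopen S V U" and V: "\<And>w. w \<in> V \<Longrightarrow> \<exists>w'\<in>V'. \<forall>x\<in>S. pairing x w \<le> pairing x w'" for V V' U
    unfolding kopen_def
  proof (intro conjI ballI)
    show sub: "U \<subseteq> seqs S"
      using U by (simp add: kopen_def)
    fix x assume x: "x \<in> U"
    obtain w where w: "w \<in> V" "\<And>y. y \<in> seqs S \<Longrightarrow> pairing (mag (\<lambda>i. y i - x i)) w < 1 \<Longrightarrow> y \<in> U"
      using kopenE[OF U x] by blast
    obtain w' where w': "w' \<in> V'" "\<And>x. x \<in> S \<Longrightarrow> pairing x w \<le> pairing x w'"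
      using V[OF w(1)] by blast
    have "y \<in> U" if y: "y \<in> seqs S" "pairing (mag (\<lambda>i. y i - x i)) w' < 1" for y
      using w(2)[OF y(1)] w'(2)[of "mag (\<lambda>i. y i - x i)"] seqs_diff[OF S y(1), of x] sub x y(2)
      by (auto simp: seqs_def intro: order_le_less_trans)
    then show "\<exists>w\<in>V'. \<forall>y\<in>seqs S. pairing (mag (\<lambda>i. y i - x i)) w < 1 \<longrightarrow> y \<in> U"
      using w'(1) by blast
  qed
  from this[OF _ 1] this[OF _ 2] have "kopen S W U \<longleftrightarrow> kopen S W' U" for U
    by blast
  then show ?thesis
    by (simp add: topology_eq openin_ktop W W')
qed

section \<open>Finitely supported sequences and bounded sets\<close>

lemma ennreal_inverse_cancel: "0 < b \<Longrightarrow> b < \<infinity> \<Longrightarrow> inverse b * b = (1::ennreal)"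
  using ennreal_divide_self[of b] by (simp add: divide_ennreal_def mult.commute zero_less_iff_neq_zero)

definition finsupp :: "('i \<Rightarrow> complex) set" where
  "finsupp = {c. finite {i. c i \<noteq> 0}}"

lemma kgoodD:
  assumes "kgood g S W"
  shows "wcone S" "wcone W" "x \<in> S \<Longrightarrow> w \<in> W \<Longrightarrow> pairing x w < \<infinity>" "delta i \<in> S" "delta i \<in> W"
    "w \<in> W \<Longrightarrow> (\<lambda>i. w i * inverse (g i)) \<in> W"
  using assms by (auto simp: kgood_def kpair_def)

lemma finsupp_subset_seqs:
  assumes "kgood g S W"
  shows "finsupp \<subseteq> seqs S"
proof
  fix c :: "'a \<Rightarrow> complex" assume "c \<in> finsupp"
  then have F: "finite {i. c i \<noteq> 0}"
    by (simp add: finsupp_def)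
  have S: "wcone S"
    using kgoodD(1)[OF assms] .
  have "(\<lambda>k. \<Sum>i\<in>F. mag c i * delta i k) \<in> S" if "finite F" for F
    using that
  proof induction
    case (insert i F)
    have "(\<lambda>k. mag c i * delta i k + (\<Sum>i\<in>F. mag c i * delta i k)) \<in> S"
      by (intro wcone_add[OF S] wcone_cmult[OF S] kgoodD(4)[OF assms] insert.IH) (simp add: mag_def)
    then show ?case
      using insert.hyps by simp
  qed (simp add: wcone_zero[OF S])
  note sum_in = this[OF F]
  have "mag c k \<le> (\<Sum>i\<in>{i. c i \<noteq> 0}. mag c i * delta i k)" for k
  proof (cases "c k = 0")
    case False
    have "mag c k = mag c k * delta k k"
      by (simp add: delta_def)
    also have "\<dots> \<le> (\<Sum>i\<in>{i. c i \<noteq> 0}. mag c i * delta i k)"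
      using F False by (intro member_le_sum[of k _ "\<lambda>i. mag c i * delta i k"]) auto
    finally show ?thesis .
  qed (simp add: mag_def)
  then show "c \<in> seqs S"
    using wcone_solid[OF S sum_in, of "mag c"] by (simp add: seqs_def)
qed

text \<open>Truncation to a finite set outside which the pairing of \<open>x\<close> with the weight
  of the neighbourhood is below 1.\<close>

lemma finsupp_dense:
  fixes S :: "('i::countable \<Rightarrow> ennreal) set"
  assumes k: "kgood g S W" and U: "openin (ktop S W) U" "x \<in> U"
  shows "\<exists>x'\<in>U. x' \<in> finsupp"
proof -
  have U': "kopen S W U"
    using U(1) openin_ktop[OF kgoodD(2)[OF k]] by blast
  obtain w where w: "w \<in> W" "\<And>y. y \<in> seqs S \<Longrightarrow> pairing (mag (\<lambda>i. y i - x i)) w < 1 \<Longrightarrow> y \<in> U"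
    using kopenE[OF U' U(2)] by blast
  have "mag x \<in> S"
    using U' U(2) by (auto simp: kopen_def seqs_def)
  then have "pairing (mag x) w < \<infinity>"
    using kgoodD(3)[OF k _ w(1)] by blast
  then obtain F where F: "finite F" "pairing (\<lambda>i. mag x i * indicator (- F) i) w < 1"
    using pairing_tail[of "mag x" w 1] by auto
  define y where "y i = (if i \<in> F then x i else 0)" for i
  have "mag (\<lambda>i. y i - x i) = (\<lambda>i. mag x i * indicator (- F) i)"
    by (auto simp: y_def mag_def)
  moreover have y: "y \<in> finsupp"
    unfolding finsupp_def using F(1) by (auto simp: y_def intro: finite_subset[of _ F])
  ultimately have "y \<in> U"
    using w(2)[of y] finsupp_subset_seqs[OF k] F(2) by auto
  with y show ?thesis
    by blast
qed

text \<open>Coordinates are continuous and separate points, and finite sequences are dense. The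
  argument is purely topological, so it compares arbitrary continuous maps.\<close>

lemma continuous_eq_on_finsupp:
  fixes SX :: "('i::countable \<Rightarrow> ennreal) set" and SZ :: "('j \<Rightarrow> ennreal) set"
  assumes X: "kgood g SX WX" and Z: "kgood g' SZ WZ"
    and f: "continuous_map (ktop SX WX) (ktop SZ WZ) f"
    and f': "continuous_map (ktop SX WX) (ktop SZ WZ) f'"
    and eq: "\<And>x. x \<in> finsupp \<Longrightarrow> f x = f' x" and x: "x \<in> seqs SX"
  shows "f x = f' x"
proof (rule ext, rule ccontr)
  fix \<nu> assume neq: "f x \<nu> \<noteq> f' x \<nu>"
  define d where "d = cmod (f x \<nu> - f' x \<nu>)"
  have d: "d > 0"
    using neq by (simp add: d_def)
  \<comment> \<open>The unit ball of this weight is given by \<open>cmod (z \<nu>) < d / 2\<close>.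
    Balls around \<open>f x\<close> and \<open>f' x\<close> are then disjoint, since their centres
    differ by \<open>d\<close> at \<nu>.\<close>
  define w where "w = (\<lambda>i. ennreal (2 / d) * delta \<nu> i)"
  have w: "w \<in> WZ"
    unfolding w_def by (rule wcone_cmult[OF kgoodD(2)[OF Z] kgoodD(5)[OF Z]]) simp
  have pair: "pairing (mag z) w < 1 \<longleftrightarrow> cmod (z \<nu>) < d / 2" for z
  proof -
    have "pairing (mag z) w = ennreal (2 / d * cmod (z \<nu>))"
      unfolding w_def pairing_cmult_right using d by (subst ennreal_mult) (auto simp: mag_def)
    also have "\<dots> < 1 \<longleftrightarrow> 2 / d * cmod (z \<nu>) < 1"
      by (rule ennreal_less_one_iff)
    finally show ?thesis
      using d by (simp add: field_simps)
  qed
  let ?B = "\<lambda>z0. {z \<in> seqs SZ. pairing (mag (\<lambda>i. z i - z0 i)) w < 1}"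
  have top: "topspace (ktop SX WX) = seqs SX" "topspace (ktop SZ WZ) = seqs SZ"
    using topspace_ktop[OF kgoodD(2)[OF X]] topspace_ktop[OF kgoodD(2)[OF Z]] .
  have open_B: "openin (ktop SZ WZ) (?B z0)" for z0
    by (rule openin_ktop_ball[OF kgoodD(2)[OF Z] w])
  have "openin (ktop SX WX) {x' \<in> seqs SX. f x' \<in> ?B (f x)}" "openin (ktop SX WX) {x' \<in> seqs SX. f' x' \<in> ?B (f' x)}"
    using openin_continuous_map_preimage[OF f open_B] openin_continuous_map_preimage[OF f' open_B]
    unfolding top by auto
  then have op: "openin (ktop SX WX) ({x' \<in> seqs SX. f x' \<in> ?B (f x)} \<inter> {x' \<in> seqs SX. f' x' \<in> ?B (f' x)})"
    by (rule openin_Int)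
  have "f x \<in> seqs SZ" "f' x \<in> seqs SZ"
    using f f' x unfolding continuous_map_def top by auto
  then have mem: "x \<in> {x' \<in> seqs SX. f x' \<in> ?B (f x)} \<inter> {x' \<in> seqs SX. f' x' \<in> ?B (f' x)}"
    using x d by (simp add: pair)
  obtain x' where x': "x' \<in> finsupp" "f x' \<in> ?B (f x)" "f' x' \<in> ?B (f' x)"
    using finsupp_dense[OF X op mem] by blast
  then have "cmod (f x' \<nu> - f x \<nu>) < d / 2" "cmod (f x' \<nu> - f' x \<nu>) < d / 2"
    using eq[OF x'(1)] by (auto simp: pair)
  then have "cmod (f x \<nu> - f' x \<nu>) < d"
    using norm_triangle_ineq4[of "f x' \<nu> - f' x \<nu>" "f x' \<nu> - f x \<nu>"] by simp
  then show False
    by (simp add: d_def)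
qed

text \<open>Density is used twice: first in the first variable while the second stays finite, then
  in the second variable for arbitrary first.\<close>

lemma separately_continuous_unique:
  fixes SX SY :: "('i::countable \<Rightarrow> ennreal) set"
  assumes X: "kgood g SX WX" and Y: "kgood g SY WY" and Z: "kgood g' SZ WZ"
    and F: "separately_continuous (ktop SX WX) (ktop SY WY) (ktop SZ WZ) F"
    and G: "separately_continuous (ktop SX WX) (ktop SY WY) (ktop SZ WZ) G"
    and eq: "\<And>x y. x \<in> finsupp \<Longrightarrow> y \<in> finsupp \<Longrightarrow> F x y = G x y"
    and x: "x \<in> seqs SX" and y: "y \<in> seqs SY"
  shows "F x y = G x y"
proof -
  have top: "topspace (ktop SX WX) = seqs SX" "topspace (ktop SY WY) = seqs SY"
    using topspace_ktop[OF kgoodD(2)[OF X]] topspace_ktop[OF kgoodD(2)[OF Y]] .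
  note sep = F[unfolded separately_continuous_def top] G[unfolded separately_continuous_def top]
  have 1: "F x' y' = G x' y'" if x': "x' \<in> seqs SX" and y': "y' \<in> finsupp" for x' y'
  proof (rule continuous_eq_on_finsupp[OF X Z _ _ _ x'])
    have "y' \<in> seqs SY"
      using finsupp_subset_seqs[OF Y] y' by (rule subsetD)
    then show "continuous_map (ktop SX WX) (ktop SZ WZ) (\<lambda>x. F x y')"
      "continuous_map (ktop SX WX) (ktop SZ WZ) (\<lambda>x. G x y')"
      using bspec[OF conjunct1[OF sep(1)]] bspec[OF conjunct1[OF sep(2)]] by simp_all
  qed (rule eq[OF _ y'])
  show ?thesis
  proof (rule continuous_eq_on_finsupp[OF Y Z _ _ _ y])
    show "continuous_map (ktop SY WY) (ktop SZ WZ) (F x)" "continuous_map (ktop SY WY) (ktop SZ WZ) (G x)"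
      using bspec[OF conjunct2[OF sep(1)] x] bspec[OF conjunct2[OF sep(2)] x] by simp_all
  qed (rule 1[OF x])
qed

lemma linear_continuous_ktop:
  assumes SX: "wcone SX" and WX: "wcone WX" and WZ: "wcone WZ"
    and maps: "\<And>x. x \<in> seqs SX \<Longrightarrow> f x \<in> seqs SZ"
    and diff: "\<And>x x'. x \<in> seqs SX \<Longrightarrow> x' \<in> seqs SX \<Longrightarrow> f (\<lambda>i. x i - x' i) = (\<lambda>k. f x k - f x' k)"
    and bound: "\<And>w. w \<in> WZ \<Longrightarrow> \<exists>v\<in>WX. \<forall>x\<in>seqs SX. pairing (mag (f x)) w \<le> pairing (mag x) v"
  shows "continuous_map (ktop SX WX) (ktop SZ WZ) f"
  unfolding continuous_map_def
proof (intro conjI allI impI)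
  show "f \<in> topspace (ktop SX WX) \<rightarrow> topspace (ktop SZ WZ)"
    using maps by (simp add: topspace_ktop WX WZ)
  fix U assume "openin (ktop SZ WZ) U"
  then have U: "kopen SZ WZ U"
    by (simp add: openin_ktop WZ)
  show "openin (ktop SX WX) {x \<in> topspace (ktop SX WX). f x \<in> U}"
    unfolding openin_ktop[OF WX] topspace_ktop[OF WX] kopen_def
  proof (intro conjI ballI)
    fix x assume x: "x \<in> {x \<in> seqs SX. f x \<in> U}"
    then obtain w where w: "w \<in> WZ" "\<And>z. z \<in> seqs SZ \<Longrightarrow> pairing (mag (\<lambda>i. z i - f x i)) w < 1 \<Longrightarrow> z \<in> U"
      using kopenE[OF U, of "f x"] by blast
    obtain v where v: "v \<in> WX" "\<And>x. x \<in> seqs SX \<Longrightarrow> pairing (mag (f x)) w \<le> pairing (mag x) v"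
      using bound[OF w(1)] by blast
    have "f y \<in> U" if y: "y \<in> seqs SX" "pairing (mag (\<lambda>i. y i - x i)) v < 1" for y
    proof (rule w(2)[OF maps[OF y(1)]])
      have "pairing (mag (\<lambda>i. f y i - f x i)) w \<le> pairing (mag (\<lambda>i. y i - x i)) v"
        using v(2)[OF seqs_diff[OF SX y(1), of x]] x diff[OF y(1), of x] by simp
      then show "pairing (mag (\<lambda>i. f y i - f x i)) w < 1"
        using y(2) by (rule order_le_less_trans)
    qed
    then show "\<exists>v\<in>WX. \<forall>y\<in>seqs SX. pairing (mag (\<lambda>i. y i - x i)) v < 1 \<longrightarrow> y \<in> {x \<in> seqs SX. f x \<in> U}"
      using v(1) by (intro bexI[of _ v]) auto
  qed auto
qed

section \<open>Bounded sets and absolutely convergent sums\<close>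

lemma tvs_bounded_pairing:
  assumes S: "wcone S" and W: "wcone W" and D: "tvs_bounded (ktop S W) D" and w: "w \<in> W"
  shows "\<exists>C<\<infinity>. \<forall>y\<in>D. pairing (mag y) w \<le> C"
proof -
  let ?V = "{y \<in> seqs S. pairing (mag y) w < 1}"
  have "zero_nhd (ktop S W) ?V"
    unfolding zero_nhd_ktop[OF S W] using w by auto
  then obtain k :: real where k: "k > 0" "D \<subseteq> (\<lambda>v i. of_real k * v i) ` ?V"
    using D unfolding tvs_bounded_def by blast
  have "pairing (mag y) w \<le> ennreal k" if y: "y \<in> D" for y
  proof -
    obtain v where v: "y = (\<lambda>i. of_real k * v i)" "pairing (mag v) w < 1"
      using k(2) y by auto
    have "pairing (mag y) w = ennreal k * pairing (mag v) w"
      using k(1) by (simp add: v(1) mag_cmult pairing_cmult_left)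
    also have "\<dots> \<le> ennreal k * 1"
      using v(2) by (intro mult_left_mono) auto
    finally show ?thesis
      by simp
  qed
  then show ?thesis
    by (intro exI[of _ "ennreal k"]) auto
qed

text \<open>With \<open>w\<close> divided by \<open>g\<close> still a weight, boundedness gives
  \<open>mag y i * w i \<le> C * g i\<close> uniformly for \<open>y\<close> in \<open>D\<close>, and
  the right-hand side is summable. The supremum thus lands in \<open>dual W\<close>; membership in
  \<open>S\<close> is not claimed.\<close>

lemma tvs_bounded_sup:
  assumes g: "nuclear g" and k: "kgood g S W" and D: "tvs_bounded (ktop S W) D"
  shows "(\<lambda>i. SUP y\<in>D. mag y i) \<in> dual W"
  unfolding dual_def mem_Collect_eq
proof
  fix w assume w: "w \<in> W"
  obtain C where C: "C < \<infinity>" "\<And>y. y \<in> D \<Longrightarrow> pairing (mag y) (\<lambda>i. w i * inverse (g i)) \<le> C"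
    using tvs_bounded_pairing[OF kgoodD(1,2)[OF k] D kgoodD(6)[OF k w]] by blast
  have "(SUP y\<in>D. mag y i) * w i \<le> C * (g i * 1)" for i
    unfolding SUP_mult_right_ennreal
  proof (rule SUP_least)
    fix y assume y: "y \<in> D"
    have gi: "0 < g i" "g i < top"
      using g by (auto simp: nuclear_def)
    have "mag y i * w i = mag y i * (w i * inverse (g i)) * g i"
      using gi ennreal_inverse_cancel[of "g i"] by (simp add: mult.assoc)
    also have "\<dots> \<le> C * g i"
      by (intro mult_right_mono order_trans[OF le_pairing[of "mag y" i "\<lambda>i. w i * inverse (g i)"] C(2)[OF y]]) simp
    finally show "mag y i * w i \<le> C * (g i * 1)"
      by simp
  qed
  then have "pairing (\<lambda>i. SUP y\<in>D. mag y i) w \<le> C * pairing g (\<lambda>_. 1)"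
    unfolding pairing_cmult_left[symmetric] unfolding pairing_def
    by (intro nn_integral_mono) (simp add: mult.assoc)
  also have "\<dots> < \<infinity>"
    using C(1) g by (intro ennreal_mult_finite) (auto simp: nuclear_def)
  finally show "pairing w (\<lambda>i. SUP y\<in>D. mag y i) < \<infinity>"
    by (simp add: pairing_commute)
qed

text \<open>Passage from the extended nonnegative integrals, in which all estimates are made, to the
  complex sums that define the map.\<close>

lemma infsum_complex_bound:
  fixes f :: "'u \<Rightarrow> complex"
  assumes "(\<integral>\<^sup>+u. ennreal (cmod (f u)) * indicator A u \<partial>count_space UNIV) < \<infinity>" (is "?I < _")
  shows "(\<lambda>u. cmod (f u)) summable_on A" and "ennreal (cmod (infsum f A)) \<le> ?I"
proof -
  obtain r where r: "?I = ennreal r" "0 \<le> r"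
    using assms by (cases ?I) auto
  have le: "(\<Sum>u\<in>F. cmod (f u)) \<le> r" if F: "finite F" "F \<subseteq> A" for F
  proof -
    have "ennreal (\<Sum>u\<in>F. cmod (f u)) = (\<Sum>u\<in>F. ennreal (cmod (f u)) * indicator A u)"
      unfolding sum_ennreal[OF norm_ge_zero, symmetric] by (rule sum.cong) (use F(2) in auto)
    also have "\<dots> \<le> ennreal r"
      using sum_le_nn_integral_count_space[OF F(1)] r(1) by metis
    finally show ?thesis
      using r(2) by simp
  qed
  show sum: "(\<lambda>u. cmod (f u)) summable_on A"
    by (rule nonneg_bdd_above_summable_on) (auto intro!: bdd_aboveI[of _ r] le)
  have "cmod (infsum f A) \<le> (\<Sum>\<^sub>\<infinity>u\<in>A. cmod (f u))"
    by (rule norm_infsum_bound[OF sum])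
  also have "\<dots> \<le> r"
    by (rule infsum_le_finite_sums[OF sum le])
  finally show "ennreal (cmod (infsum f A)) \<le> ?I"
    unfolding r(1) by (rule ennreal_leI)
qed

lemma ennreal_inverse_antimono:
  fixes a b :: ennreal
  assumes "a \<le> b"
  shows "inverse b \<le> inverse a"
proof (cases "a = 0 \<or> b = top")
  case False
  then obtain x y where "a = ennreal x" "b = ennreal y" "0 < x" "x \<le> y"
    using assms by (cases a; cases b) (auto simp: top_unique)
  then show ?thesis
    by (simp add: inverse_ennreal le_imp_inverse_le ennreal_leI)
qed auto

lemma ennreal_divide_finite: "a < \<infinity> \<Longrightarrow> 0 < b \<Longrightarrow> a / b < (\<infinity>::ennreal)"
  using ennreal_divide_eq_top_iff[of a b] by (auto simp: less_top)

section \<open>Duality of the iterated limits\<close>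

text \<open>
  Otherwise there are indices \<open>i k\<close> with \<open>y (i k) * \<eta> k (i k) > k\<close>, and for suitable constants \<open>C n\<close>
  the sequence \<open>v = (INF n. C n * \<eta> n)\<close> satisfies the hypothesis of \<open>H\<close> but has infinite pairing with \<open>y\<close>.
\<close>

lemma gliding_hump:
  fixes \<eta> :: "nat \<Rightarrow> 'i \<Rightarrow> ennreal"
  assumes dec: "\<And>k i. \<eta> (Suc k) i \<le> \<eta> k i" and pos: "\<And>k i. i \<in> I \<Longrightarrow> 0 < \<eta> k i"
    and y: "\<And>i. y i < \<infinity>"
    and H: "\<And>v. (\<And>n. \<exists>C<\<infinity>. \<forall>i. v i \<le> C * \<eta> n i) \<Longrightarrow> pairing y v < \<infinity>"
  shows "\<exists>n. \<exists>C<\<infinity>. \<forall>i\<in>I. y i * \<eta> n i \<le> C"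
proof (rule ccontr)
  assume "\<not> ?thesis"
  then have "\<exists>i\<in>I. of_nat k < y i * \<eta> k i" for k :: nat
    by (metis ennreal_of_nat_eq_real_of_nat ennreal_less_top infinity_ennreal_def not_le)
  then obtain i where i: "\<And>k. i k \<in> I" "\<And>k. of_nat k < y (i k) * \<eta> k (i k)"
    by metis
  have mono: "\<eta> n j \<le> \<eta> m j" if "m \<le> n" for m n j
    using that by (rule lift_Suc_antimono_le[of "\<lambda>n. \<eta> n j", OF dec])
  \<comment> \<open>The summand with index \<open>k < n\<close> forces
    \<open>y * (C n * \<eta> n)\<close> to be at least \<open>k\<close> at the hump
    \<open>i k\<close>; for \<open>n \<le> k\<close> this follows from \<open>C n \<ge> 1\<close>
    and the monotonicity of \<eta>. Only finitely many humps enter \<open>C n\<close>, so it is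
    finite, while the infimum \<open>v\<close> keeps the bound \<open>k\<close> at every
    \<open>i k\<close>.\<close>
  define C where "C n = 1 + (\<Sum>k<n. of_nat k / (y (i k) * \<eta> n (i k)))" for n
  define v where "v j = (INF n. C n * \<eta> n j)" for j
  have y_pos: "0 < y (i k)" for k
    using i(2)[of k] by (cases "y (i k) = 0") (auto simp: zero_less_iff_neq_zero)
  have "C n < \<infinity>" for n
  proof -
    have "of_nat k / (y (i k) * \<eta> n (i k)) < \<infinity>" for k
      using y_pos[of k] pos[OF i(1), of n k]
      by (intro ennreal_divide_finite) (simp_all add: ennreal_zero_less_mult_iff of_nat_less_top)
    then show ?thesis
      unfolding C_def by (intro ennreal_add_finite) simp_all
  qed
  moreover have "v j \<le> C n * \<eta> n j" for n j
    unfolding v_def by (rule INF_lower) simp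
  ultimately have "pairing y v < \<infinity>"
    by (intro H) blast
  moreover have "of_nat k \<le> pairing y v" for k
  proof -
    have *: "of_nat k \<le> y (i k) * (C n * \<eta> n (i k))" for n
    proof (cases "n \<le> k")
      case True
      have "of_nat k \<le> y (i k) * (1 * \<eta> k (i k))"
        using i(2)[of k] by (simp add: less_imp_le)
      also have "\<dots> \<le> y (i k) * (C n * \<eta> n (i k))"
        by (intro mult_left_mono mult_mono mono[OF True]) (auto simp: C_def)
      finally show ?thesis .
    next
      case False
      let ?a = "y (i k) * \<eta> n (i k)"
      have a: "0 < ?a"
        using y_pos pos[OF i(1)] by (simp add: ennreal_zero_less_mult_iff)
      have Ck: "of_nat k / ?a \<le> C n"
        unfolding C_def using False
        by (intro add_increasing order_trans[OF _ member_le_sum[of k]]) auto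
      have "of_nat k \<le> C n * ?a"
      proof (cases "?a = \<infinity>")
        case True
        have "1 \<le> C n"
          by (simp add: C_def)
        then have "C n * ?a = \<infinity>"
          unfolding True by (auto simp: ennreal_mult_top)
        then show ?thesis
          by simp
      next
        case False
        have "of_nat k = of_nat k * (inverse ?a * ?a)"
          using ennreal_inverse_cancel[OF a] False by (simp add: less_top)
        also have "\<dots> = of_nat k / ?a * ?a"
          by (simp only: divide_ennreal_def mult.assoc)
        also have "\<dots> \<le> C n * ?a"
          by (intro mult_right_mono Ck) simp
        finally show ?thesis .
      qed
      then show ?thesis
        by (simp add: ac_simps)
    qed
    have "of_nat k / y (i k) \<le> v (i k)"
      unfolding v_def
    proof (rule INF_greatest)
      fix n
      show "of_nat k / y (i k) \<le> C n * \<eta> n (i k)"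
        using *[of n] y_pos[of k] y[of "i k"]
        by (simp add: divide_le_posI_ennreal mult.commute)
    qed
    then have "y (i k) * (of_nat k / y (i k)) \<le> y (i k) * v (i k)"
      by (rule mult_left_mono) simp
    moreover have "y (i k) * (of_nat k / y (i k)) = of_nat k"
      using y_pos[of k] y[of "i k"]
      by (simp add: ennreal_times_divide mult_divide_eq_ennreal mult.commute)
    ultimately show ?thesis
      using le_pairing[of y "i k" v] by simp
  qed
  ultimately show False
    using ennreal_Ex_less_of_nat[of "pairing y v"] by (metis infinity_ennreal_def not_le)
qed

lemma PI_familyD:
  assumes "PI_family g \<omega>"
  shows "monotone_family \<omega>" "j > 0 \<Longrightarrow> \<exists>j'>0. \<forall>n>0. \<exists>n'>0. faster g (\<omega> j n') (\<omega> j' n)"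
    "j > 0 \<Longrightarrow> \<exists>n>0. \<omega> j n i < \<infinity>" "\<exists>j>0. \<forall>n>0. 0 < \<omega> j n i"
    "j > 0 \<Longrightarrow> n > 0 \<Longrightarrow> n' > 0 \<Longrightarrow> \<omega> j n i = 0 \<Longrightarrow> \<omega> j n' i = 0"
    "\<exists>\<rho>. (\<forall>k::nat. \<rho> k > 0) \<and> (\<forall>j>0. \<forall>k i. \<omega> j (\<rho> (Suc k)) i \<le> \<omega> j (\<rho> k) i) \<and>
       (\<forall>n>0. \<exists>k. \<forall>j>0. \<forall>i. \<omega> j (\<rho> k) i \<le> \<omega> j n i)"
proof -
  note d = assms[unfolded PI_family_def]
  show "monotone_family \<omega>"
    by (rule conjunct1[OF d])
  show "\<exists>j'>0. \<forall>n>0. \<exists>n'>0. faster g (\<omega> j n') (\<omega> j' n)" if "j > 0"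
    by (rule d[THEN conjunct2, THEN conjunct1, THEN spec, THEN mp, OF that])
  show "\<exists>n>0. \<omega> j n i < \<infinity>" if "j > 0"
    by (rule d[THEN conjunct2, THEN conjunct2, THEN conjunct1, THEN spec, THEN mp, OF that, THEN spec])
  show "\<exists>j>0. \<forall>n>0. 0 < \<omega> j n i"
    by (rule d[THEN conjunct2, THEN conjunct2, THEN conjunct2, THEN conjunct1, THEN spec])
  show "\<omega> j n' i = 0" if "j > 0" "n > 0" "n' > 0" "\<omega> j n i = 0"
    by (rule d[THEN conjunct2, THEN conjunct2, THEN conjunct2, THEN conjunct2, THEN conjunct1,
        THEN spec, THEN mp, OF that(1), THEN spec, THEN mp, OF that(2), THEN spec, THEN mp, OF that(3), THEN spec, THEN mp, OF that(4)])
  show "\<exists>\<rho>. (\<forall>k::nat. \<rho> k > 0) \<and> (\<forall>j>0. \<forall>k i. \<omega> j (\<rho> (Suc k)) i \<le> \<omega> j (\<rho> k) i) \<and>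
       (\<forall>n>0. \<exists>k. \<forall>j>0. \<forall>i. \<omega> j (\<rho> k) i \<le> \<omega> j n i)"
    by (rule d[THEN conjunct2, THEN conjunct2, THEN conjunct2, THEN conjunct2, THEN conjunct2])
qed

lemma IP_familyD:
  assumes "IP_family g \<omega>"
  shows "monotone_family \<omega>" "j > 0 \<Longrightarrow> \<exists>j'>0. \<forall>n>0. \<exists>n'>0. faster g (\<omega> j' n) (\<omega> j n')"
    "\<exists>j>0. \<forall>n>0. \<omega> j n i < \<infinity>" "j > 0 \<Longrightarrow> \<exists>n>0. 0 < \<omega> j n i"
    "\<exists>\<rho>. (\<forall>k::nat. \<rho> k > 0) \<and> (\<forall>j>0. \<forall>k i. \<omega> j (\<rho> k) i \<le> \<omega> j (\<rho> (Suc k)) i) \<and>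
       (\<forall>n>0. \<exists>k. \<forall>j>0. \<forall>i. \<omega> j n i \<le> \<omega> j (\<rho> k) i)"
proof -
  note d = assms[unfolded IP_family_def]
  show "monotone_family \<omega>"
    by (rule conjunct1[OF d])
  show "\<exists>j'>0. \<forall>n>0. \<exists>n'>0. faster g (\<omega> j' n) (\<omega> j n')" if "j > 0"
    by (rule d[THEN conjunct2, THEN conjunct1, THEN spec, THEN mp, OF that])
  show "\<exists>j>0. \<forall>n>0. \<omega> j n i < \<infinity>"
    by (rule d[THEN conjunct2, THEN conjunct2, THEN conjunct1, THEN spec])
  show "\<exists>n>0. 0 < \<omega> j n i" if "j > 0"
    by (rule d[THEN conjunct2, THEN conjunct2, THEN conjunct2, THEN conjunct1, THEN spec, THEN mp, OF that, THEN spec])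
  show "\<exists>\<rho>. (\<forall>k::nat. \<rho> k > 0) \<and> (\<forall>j>0. \<forall>k i. \<omega> j (\<rho> k) i \<le> \<omega> j (\<rho> (Suc k)) i) \<and>
       (\<forall>n>0. \<exists>k. \<forall>j>0. \<forall>i. \<omega> j n i \<le> \<omega> j (\<rho> k) i)"
    by (rule d[THEN conjunct2, THEN conjunct2, THEN conjunct2, THEN conjunct2])
qed

text \<open>Gliding hump at a fixed outer parameter, along the cofinal sequence of inner weights: a
  sequence dominated by all of them belongs to \<open>PI_W\<close>, so it pairs finitely with
  \<open>y\<close>. Coordinates of weight 0 are left out of the hump; since vanishing does not
  depend on the inner parameter, they add nothing to the sup norm.\<close>

lemma dual_PI_W:
  assumes \<omega>: "PI_family g \<omega>" and y: "y \<in> dual (PI_W \<omega>)" "\<And>i. y i < \<infinity>" and j: "j > 0"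
  shows "\<exists>n>0. y \<in> Bsp (\<omega> j n)"
proof -
  obtain \<rho> :: "nat \<Rightarrow> real" where r: "\<forall>k. \<rho> k > 0" "\<forall>j>0. \<forall>k i. \<omega> j (\<rho> (Suc k)) i \<le> \<omega> j (\<rho> k) i"
    "\<forall>n>0. \<exists>k. \<forall>j>0. \<forall>i. \<omega> j (\<rho> k) i \<le> \<omega> j n i"
    using PI_familyD(6)[OF \<omega>] by (elim exE conjE)
  have \<rho>: "\<And>k. \<rho> k > 0" "\<And>k i. \<omega> j (\<rho> (Suc k)) i \<le> \<omega> j (\<rho> k) i"
    using r(1,2) j by simp_all
  have \<rho>_cofinal: "\<exists>k. \<forall>i. \<omega> j (\<rho> k) i \<le> \<omega> j n i" if "n > 0" for n
  proof -
    from r(3) that obtain k where "\<forall>j>0. \<forall>i. \<omega> j (\<rho> k) i \<le> \<omega> j n i"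
      by blast
    with j show ?thesis
      by (intro exI[of _ k]) simp
  qed
  have "\<exists>k. \<exists>C<\<infinity>. \<forall>i\<in>{i. \<omega> j (\<rho> 0) i \<noteq> 0}. y i * \<omega> j (\<rho> k) i \<le> C"
  proof (rule gliding_hump)
    show "0 < \<omega> j (\<rho> k) i" if "i \<in> {i. \<omega> j (\<rho> 0) i \<noteq> 0}" for k i
      using that PI_familyD(5)[OF \<omega> j \<rho>(1)[of k] \<rho>(1)[of 0], of i] by (auto simp: zero_less_iff_neq_zero)
  next
    fix v assume v: "\<And>k. \<exists>C<\<infinity>. \<forall>i. v i \<le> C * \<omega> j (\<rho> k) i"
    have "v \<in> Osp (\<omega> j n)" if n: "n > 0" for n
    proof -
      obtain k where k: "\<forall>i. \<omega> j (\<rho> k) i \<le> \<omega> j n i"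
        using \<rho>_cofinal[OF n] by blast
      have "v \<in> Osp (\<omega> j (\<rho> k))"
        using v by (simp add: Osp_def)
      then show ?thesis
        using Osp_mono[of "\<omega> j (\<rho> k)" "\<omega> j n"] k by blast
    qed
    then have "v \<in> PI_W \<omega>"
      using j by (auto simp: PI_W_def)
    then show "pairing y v < \<infinity>"
      using y(1) pairing_commute[of y v] by (simp add: dual_def)
  qed (use \<rho> y in auto)
  then obtain k C where kC: "C < \<infinity>" "\<And>i. \<omega> j (\<rho> 0) i \<noteq> 0 \<Longrightarrow> y i * \<omega> j (\<rho> k) i \<le> C"
    by auto
  have "y i * \<omega> j (\<rho> k) i \<le> C" for i
    using kC(2)[of i] PI_familyD(5)[OF \<omega> j \<rho>(1)[of 0] \<rho>(1)[of k], of i]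
    by (cases "\<omega> j (\<rho> 0) i = 0") auto
  then show ?thesis
    using kC(1) \<rho>(1)[of k] by (auto simp: Bsp_def)
qed

lemma IP_Bsp_in_S:
  assumes g: "nuclear g" and \<omega>: "IP_family g \<omega>" and j: "j > 0" and x: "\<And>n. n > 0 \<Longrightarrow> x \<in> Bsp (\<omega> j n)"
  shows "x \<in> IP_S \<omega>"
proof -
  obtain j' where j': "j' > 0" "\<And>n. n > 0 \<Longrightarrow> \<exists>n'>0. faster g (\<omega> j' n) (\<omega> j n')"
    using IP_familyD(2)[OF \<omega> j] by blast
  have "x \<in> Lsp (\<omega> j' n)" if "n > 0" for n
    using j'(2)[OF that] Bsp_subset_Lsp[OF g] x by blast
  then show ?thesis
    using j'(1) by (auto simp: IP_S_def)
qed

text \<open>Gliding hump applied to the reciprocal weights: a sequence dominated by all of them has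
  finite sup norms at level \<open>j\<close>, hence lies in the space by \<open>IP_Bsp_in_S\<close>.
  Where some weight of level \<open>j\<close> is infinite, the elements of that step vanish and
  \<open>v\<close> is unrestricted.\<close>

lemma IP_dual:
  assumes g: "nuclear g" and \<omega>: "IP_family g \<omega>" and v: "v \<in> dual (IP_S \<omega>)" and j: "j > 0"
  shows "\<exists>n>0. \<exists>C<\<infinity>. \<forall>i. (\<forall>m>0. \<omega> j m i < \<infinity>) \<longrightarrow> v i \<le> C * \<omega> j n i"
proof -
  obtain \<rho> :: "nat \<Rightarrow> real" where r: "\<forall>k. \<rho> k > 0" "\<forall>j>0. \<forall>k i. \<omega> j (\<rho> k) i \<le> \<omega> j (\<rho> (Suc k)) i"
    "\<forall>n>0. \<exists>k. \<forall>j>0. \<forall>i. \<omega> j n i \<le> \<omega> j (\<rho> k) i"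
    using IP_familyD(5)[OF \<omega>] by (elim exE conjE)
  have \<rho>: "\<And>k. \<rho> k > 0" "\<And>k i. \<omega> j (\<rho> k) i \<le> \<omega> j (\<rho> (Suc k)) i"
    using r(1,2) j by simp_all
  have \<rho>_cofinal: "\<exists>k. \<forall>i. \<omega> j n i \<le> \<omega> j (\<rho> k) i" if "n > 0" for n
  proof -
    from r(3) that obtain k where "\<forall>j>0. \<forall>i. \<omega> j n i \<le> \<omega> j (\<rho> k) i"
      by blast
    with j show ?thesis
      by (intro exI[of _ k]) simp
  qed
  have fin: "v i < \<infinity>" for i
  proof -
    obtain j where "j > 0" "\<forall>n>0. \<omega> j n i < \<infinity>"
      using IP_familyD(3)[OF \<omega>] by blast
    then have "delta i \<in> IP_S \<omega>"
      by (auto simp: IP_S_def delta_in_Lsp_iff)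
    then have "pairing (delta i) v < \<infinity>"
      using v unfolding dual_def by blast
    then show ?thesis
      by simp
  qed
  have "\<exists>k. \<exists>C<\<infinity>. \<forall>i\<in>{i. \<forall>n>0. \<omega> j n i < \<infinity>}. v i * inverse (\<omega> j (\<rho> k) i) \<le> C"
  proof (rule gliding_hump)
    show "0 < inverse (\<omega> j (\<rho> k) i)" if "i \<in> {i. \<forall>n>0. \<omega> j n i < \<infinity>}" for k i
      using that \<rho>(1)[of k] by (auto simp: ennreal_inverse_positive less_top)
  next
    fix x assume x: "\<And>k. \<exists>C<\<infinity>. \<forall>i. x i \<le> C * inverse (\<omega> j (\<rho> k) i)"
    have "x \<in> Bsp (\<omega> j n)" if n: "n > 0" for n
    proof -
      obtain k where k: "\<And>i. \<omega> j n i \<le> \<omega> j (\<rho> k) i"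
        using \<rho>_cofinal[OF n] by blast
      obtain C where C: "C < \<infinity>" "\<And>i. x i \<le> C * inverse (\<omega> j (\<rho> k) i)"
        using x by blast
      have "x i * \<omega> j (\<rho> k) i \<le> C" for i
      proof -
        have inv: "inverse a * a \<le> 1" for a :: ennreal
          using ennreal_inverse_cancel[of a] by (cases "a = 0 \<or> a = top") (auto simp: less_top zero_less_iff_neq_zero)
        have "x i * \<omega> j (\<rho> k) i \<le> C * inverse (\<omega> j (\<rho> k) i) * \<omega> j (\<rho> k) i"
          by (intro mult_right_mono C) simp
        also have "\<dots> \<le> C"
          using mult_left_mono[OF inv[of "\<omega> j (\<rho> k) i"], of C] by (simp add: mult.assoc)
        finally show ?thesis .
      qed
      then have "x \<in> Bsp (\<omega> j (\<rho> k))"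
        using C(1) by (auto simp: Bsp_def)
      then show ?thesis
        using Bsp_antimono[of "\<omega> j n" "\<omega> j (\<rho> k)"] k by blast
    qed
    then have "x \<in> IP_S \<omega>"
      by (rule IP_Bsp_in_S[OF g \<omega> j])
    then show "pairing v x < \<infinity>"
      using v pairing_commute[of v x] by (simp add: dual_def)
  qed (use \<rho> fin in \<open>auto intro: ennreal_inverse_antimono\<close>)
  then obtain k C where kC: "C < \<infinity>" "\<And>i. \<forall>n>0. \<omega> j n i < \<infinity> \<Longrightarrow> v i * inverse (\<omega> j (\<rho> k) i) \<le> C"
    by auto
  have "v i \<le> C * \<omega> j (\<rho> k) i" if i: "\<forall>n>0. \<omega> j n i < \<infinity>" for i
  proof (cases "\<omega> j (\<rho> k) i = 0")
    case True
    then have "v i = 0"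
      using kC(2)[OF i] kC(1) by (auto simp: ennreal_mult_top top_unique split: if_splits)
    then show ?thesis
      by simp
  next
    case False
    have "\<omega> j (\<rho> k) i < \<infinity>"
      using i \<rho>(1) by blast
    then have "v i = v i * inverse (\<omega> j (\<rho> k) i) * \<omega> j (\<rho> k) i"
      using False ennreal_inverse_cancel[of "\<omega> j (\<rho> k) i"] by (simp add: mult.assoc zero_less_iff_neq_zero)
    also have "\<dots> \<le> C * \<omega> j (\<rho> k) i"
      by (intro mult_right_mono kC(2)[OF i]) simp
    finally show ?thesis .
  qed
  then show ?thesis
    using kC(1) \<rho>(1)[of k] by blast
qed

section \<open>Bilinear maps given by a kernel\<close>

locale kernel =
  fixes c :: "'u \<Rightarrow> complex" and p1 p2 p3 :: "'u \<Rightarrow> 'i::countable"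
begin

text \<open>The positive kernel as a trilinear form. It is a pairing in each of its arguments
  (\<open>tri_pairing1\<close> to \<open>tri_pairing3\<close>), and reading one value in several
  ways gives all partial transposes.\<close>

definition tri :: "('i \<Rightarrow> ennreal) \<Rightarrow> ('i \<Rightarrow> ennreal) \<Rightarrow> ('i \<Rightarrow> ennreal) \<Rightarrow> ennreal" where
  "tri x y w = (\<integral>\<^sup>+u. ennreal (cmod (c u)) * x (p1 u) * y (p2 u) * w (p3 u) \<partial>count_space UNIV)"

definition pos :: "('i \<Rightarrow> ennreal) \<Rightarrow> ('i \<Rightarrow> ennreal) \<Rightarrow> 'i \<Rightarrow> ennreal" where
  "pos x y = (\<lambda>\<nu>. tri x y (delta \<nu>))"

definition bil :: "('i \<Rightarrow> complex) \<Rightarrow> ('i \<Rightarrow> complex) \<Rightarrow> 'i \<Rightarrow> complex" where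
  "bil x y = (\<lambda>\<nu>. \<Sum>\<^sub>\<infinity>u\<in>{u. p3 u = \<nu>}. c u * x (p1 u) * y (p2 u))"

text \<open>Tonelli: \<open>w\<close> is expanded into unit sequences and the two sums are
  interchanged.\<close>

lemma nn_integral_pairing:
  fixes k :: "'u \<Rightarrow> ennreal" and q :: "'u \<Rightarrow> 'i"
  shows "(\<integral>\<^sup>+u. k u * w (q u) \<partial>count_space UNIV) =
    pairing w (\<lambda>i. \<integral>\<^sup>+u. k u * delta i (q u) \<partial>count_space UNIV)"
proof -
  have w: "w j = (\<integral>\<^sup>+i. w i * delta i j \<partial>count_space UNIV)" for j
    by (subst nn_integral_count_space'[where A = "{j}"]) (auto simp: delta_def indicator_def)
  have "(\<integral>\<^sup>+u. k u * w (q u) \<partial>count_space UNIV) =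
      (\<integral>\<^sup>+u. (\<integral>\<^sup>+i. w i * (k u * delta i (q u)) \<partial>count_space UNIV) \<partial>count_space UNIV)"
    by (subst w) (simp add: nn_integral_cmult[symmetric] ac_simps)
  also have "\<dots> = (\<integral>\<^sup>+i. (\<integral>\<^sup>+u. w i * (k u * delta i (q u)) \<partial>count_space UNIV) \<partial>count_space UNIV)"
    using nn_integral_fst_count_space[of "\<lambda>(u, i). w i * (k u * delta i (q u))"]
      nn_integral_snd_count_space[of "\<lambda>(u, i). w i * (k u * delta i (q u))"] by simp
  also have "\<dots> = pairing w (\<lambda>i. \<integral>\<^sup>+u. k u * delta i (q u) \<partial>count_space UNIV)"
    by (simp add: pairing_def nn_integral_cmult)
  finally show ?thesis .
qed

lemma tri_pairing1: "tri x y w = pairing x (\<lambda>i. tri (delta i) y w)"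
  using nn_integral_pairing[of "\<lambda>u. ennreal (cmod (c u)) * y (p2 u) * w (p3 u)" x p1]
  by (simp add: tri_def ac_simps)

lemma tri_pairing2: "tri x y w = pairing y (\<lambda>i. tri x (delta i) w)"
  using nn_integral_pairing[of "\<lambda>u. ennreal (cmod (c u)) * x (p1 u) * w (p3 u)" y p2]
  by (simp add: tri_def ac_simps)

lemma tri_pairing3: "tri x y w = pairing (pos x y) w"
  using nn_integral_pairing[of "\<lambda>u. ennreal (cmod (c u)) * x (p1 u) * y (p2 u)" w p3]
  by (simp add: tri_def pos_def ac_simps pairing_commute)

lemma tri_mono:
  "(\<And>i. x i \<le> x' i) \<Longrightarrow> (\<And>i. y i \<le> y' i) \<Longrightarrow> (\<And>i. w i \<le> w' i) \<Longrightarrow> tri x y w \<le> tri x' y' w'"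
  unfolding tri_def by (intro nn_integral_mono mult_mono) auto

lemma pos_eq:
  "pos (mag x) (mag y) \<nu> =
    (\<integral>\<^sup>+u. ennreal (cmod (c u * x (p1 u) * y (p2 u))) * indicator {u. p3 u = \<nu>} u \<partial>count_space UNIV)"
  unfolding pos_def tri_def
  by (intro nn_integral_cong) (auto simp: mag_def delta_def norm_mult ennreal_mult indicator_def)

lemma bil_summable:
  assumes "pos (mag x) (mag y) \<nu> < \<infinity>"
  shows "(\<lambda>u. c u * x (p1 u) * y (p2 u)) summable_on {u. p3 u = \<nu>}"
  using infsum_complex_bound(1)[OF assms[unfolded pos_eq]] by (rule abs_summable_summable)

lemma mag_bil_le: "mag (bil x y) \<nu> \<le> pos (mag x) (mag y) \<nu>"
\<comment> \<open>If the majorant is infinite, the bound holds whatever value the divergent complex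
  sum receives by convention.\<close>
proof (cases "pos (mag x) (mag y) \<nu> < \<infinity>")
  case True
  have "mag (bil x y) \<nu> = ennreal (cmod (\<Sum>\<^sub>\<infinity>u\<in>{u. p3 u = \<nu>}. c u * x (p1 u) * y (p2 u)))"
    by (simp add: mag_def bil_def)
  also note infsum_complex_bound(2)[OF True[unfolded pos_eq]]
  also note pos_eq[symmetric]
  finally show ?thesis .
qed (simp add: not_less top_unique)

lemma pairing_bil_le: "pairing (mag (bil x y)) w \<le> tri (mag x) (mag y) w"
  unfolding tri_pairing3 by (intro pairing_mono mag_bil_le) simp

lemma bil_linear_left:
  assumes "\<And>\<nu>. pos (mag x) (mag y) \<nu> < \<infinity>" "\<And>\<nu>. pos (mag x') (mag y) \<nu> < \<infinity>"
  shows "bil (\<lambda>i. a * x i + b * x' i) y = (\<lambda>k. a * bil x y k + b * bil x' y k)"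
proof
  fix \<nu>
  let ?f = "\<lambda>u. c u * x (p1 u) * y (p2 u)" and ?f' = "\<lambda>u. c u * x' (p1 u) * y (p2 u)"
  have "bil (\<lambda>i. a * x i + b * x' i) y \<nu> = (\<Sum>\<^sub>\<infinity>u\<in>{u. p3 u = \<nu>}. a * ?f u + b * ?f' u)"
    unfolding bil_def by (intro infsum_cong) (simp add: algebra_simps)
  also have "\<dots> = (\<Sum>\<^sub>\<infinity>u\<in>{u. p3 u = \<nu>}. a * ?f u) + (\<Sum>\<^sub>\<infinity>u\<in>{u. p3 u = \<nu>}. b * ?f' u)"
    by (intro infsum_add summable_on_cmult_right bil_summable assms)
  also have "\<dots> = a * bil x y \<nu> + b * bil x' y \<nu>"
    unfolding bil_def by (intro arg_cong2[of _ _ _ _ "(+)"] infsum_cmult_right bil_summable assms)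
  finally show "bil (\<lambda>i. a * x i + b * x' i) y \<nu> = a * bil x y \<nu> + b * bil x' y \<nu>" .
qed

lemma bil_linear_right:
  assumes "\<And>\<nu>. pos (mag x) (mag y) \<nu> < \<infinity>" "\<And>\<nu>. pos (mag x) (mag y') \<nu> < \<infinity>"
  shows "bil x (\<lambda>i. a * y i + b * y' i) = (\<lambda>k. a * bil x y k + b * bil x y' k)"
proof
  fix \<nu>
  let ?f = "\<lambda>u. c u * x (p1 u) * y (p2 u)" and ?f' = "\<lambda>u. c u * x (p1 u) * y' (p2 u)"
  have "bil x (\<lambda>i. a * y i + b * y' i) \<nu> = (\<Sum>\<^sub>\<infinity>u\<in>{u. p3 u = \<nu>}. a * ?f u + b * ?f' u)"
    unfolding bil_def by (intro infsum_cong) (simp add: algebra_simps)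
  also have "\<dots> = (\<Sum>\<^sub>\<infinity>u\<in>{u. p3 u = \<nu>}. a * ?f u) + (\<Sum>\<^sub>\<infinity>u\<in>{u. p3 u = \<nu>}. b * ?f' u)"
    by (intro infsum_add summable_on_cmult_right bil_summable assms)
  also have "\<dots> = a * bil x y \<nu> + b * bil x y' \<nu>"
    unfolding bil_def by (intro arg_cong2[of _ _ _ _ "(+)"] infsum_cmult_right bil_summable assms)
  finally show "bil x (\<lambda>i. a * y i + b * y' i) \<nu> = a * bil x y \<nu> + b * bil x y' \<nu>" .
qed

lemma bilinear_ktop:
  assumes h0: "\<And>x y. x \<in> SX \<Longrightarrow> y \<in> SY \<Longrightarrow> pos x y \<in> SZ" and Z: "kgood g SZ WZ"
  shows "bilinear_between (seqs SX) (seqs SY) bil"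
    and "x \<in> seqs SX \<Longrightarrow> y \<in> seqs SY \<Longrightarrow> bil x y \<in> seqs SZ"
proof -
  have fin: "pos (mag x) (mag y) \<nu> < \<infinity>" if "x \<in> seqs SX" "y \<in> seqs SY" for x y \<nu>
    using kgoodD(3)[OF Z h0 kgoodD(5)[OF Z], of "mag x" "mag y" \<nu>] that by (simp add: seqs_def)
  show "bilinear_between (seqs SX) (seqs SY) bil"
    unfolding bilinear_between_def
    by (intro conjI ballI allI bil_linear_left bil_linear_right fin)
  show "bil x y \<in> seqs SZ" if "x \<in> seqs SX" "y \<in> seqs SY"
    using wcone_solid[OF kgoodD(1)[OF Z] h0 mag_bil_le, of x y] that by (simp add: seqs_def)
qed

lemma bilinear_between_diff:
  assumes "bilinear_between A B F"
  shows "x \<in> A \<Longrightarrow> x' \<in> A \<Longrightarrow> y \<in> B \<Longrightarrow> F (\<lambda>i. x i - x' i) y = (\<lambda>k. F x y k - F x' y k)"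
    and "x \<in> A \<Longrightarrow> y \<in> B \<Longrightarrow> y' \<in> B \<Longrightarrow> F x (\<lambda>i. y i - y' i) = (\<lambda>k. F x y k - F x y' k)"
proof -
  assume x: "x \<in> A" "x' \<in> A" "y \<in> B"
  have "F (\<lambda>i. 1 * x i + (-1) * x' i) y = (\<lambda>k. 1 * F x y k + (-1) * F x' y k)"
    using assms[unfolded bilinear_between_def, THEN conjunct1, THEN bspec, OF x(1), THEN bspec, OF x(2), THEN bspec, OF x(3)]
    by blast
  then show "F (\<lambda>i. x i - x' i) y = (\<lambda>k. F x y k - F x' y k)"
    by simp
next
  assume x: "x \<in> A" "y \<in> B" "y' \<in> B"
  have "F x (\<lambda>i. 1 * y i + (-1) * y' i) = (\<lambda>k. 1 * F x y k + (-1) * F x y' k)"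
    using assms[unfolded bilinear_between_def, THEN conjunct2, THEN bspec, OF x(1), THEN bspec, OF x(2), THEN bspec, OF x(3)]
    by blast
  then show "F x (\<lambda>i. y i - y' i) = (\<lambda>k. F x y k - F x y' k)"
    by simp
qed

text \<open>With one argument fixed, the seminorm of the image is bounded by the pairing of the
  other argument with a partial transpose of the kernel. Continuity therefore only asks this
  transpose to be a weight.\<close>

lemma separately_continuous_bil:
  assumes X: "kgood g SX WX" and Y: "kgood g SY WY" and Z: "kgood g SZ WZ"
    and h0: "\<And>x y. x \<in> SX \<Longrightarrow> y \<in> SY \<Longrightarrow> pos x y \<in> SZ"
    and h1: "\<And>x w. x \<in> SX \<Longrightarrow> w \<in> WZ \<Longrightarrow> (\<lambda>i. tri x (delta i) w) \<in> WY"
    and h2: "\<And>y w. y \<in> SY \<Longrightarrow> w \<in> WZ \<Longrightarrow> (\<lambda>i. tri (delta i) y w) \<in> WX"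
  shows "separately_continuous (ktop SX WX) (ktop SY WY) (ktop SZ WZ) bil"
proof -
  have top: "topspace (ktop SX WX) = seqs SX" "topspace (ktop SY WY) = seqs SY"
    using topspace_ktop[OF kgoodD(2)[OF X]] topspace_ktop[OF kgoodD(2)[OF Y]] .
  have bil: "bilinear_between (seqs SX) (seqs SY) bil"
    "\<And>x y. x \<in> seqs SX \<Longrightarrow> y \<in> seqs SY \<Longrightarrow> bil x y \<in> seqs SZ"
    using bilinear_ktop[of SX SY SZ, OF h0 Z] by blast+
  show ?thesis
    unfolding separately_continuous_def top
  proof (intro conjI ballI)
    fix y assume y: "y \<in> seqs SY"
    show "continuous_map (ktop SX WX) (ktop SZ WZ) (\<lambda>x. bil x y)"
    proof (rule linear_continuous_ktop[OF kgoodD(1)[OF X] kgoodD(2)[OF X] kgoodD(2)[OF Z]])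
      show "bil x y \<in> seqs SZ" if "x \<in> seqs SX" for x
        by (rule bil(2)[OF that y])
      show "bil (\<lambda>i. x i - x' i) y = (\<lambda>k. bil x y k - bil x' y k)" if "x \<in> seqs SX" "x' \<in> seqs SX" for x x'
        by (rule bilinear_between_diff(1)[OF bil(1) that y])
      fix w assume w: "w \<in> WZ"
      have "pairing (mag (bil x y)) w \<le> pairing (mag x) (\<lambda>i. tri (delta i) (mag y) w)" for x
        using pairing_bil_le[of x y w] unfolding tri_pairing1[of "mag x"] .
      then show "\<exists>v\<in>WX. \<forall>x\<in>seqs SX. pairing (mag (bil x y)) w \<le> pairing (mag x) v"
        using h2[OF _ w, of "mag y"] y by (intro bexI[of _ "\<lambda>i. tri (delta i) (mag y) w"]) (auto simp: seqs_def)
    qed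
  next
    fix x assume x: "x \<in> seqs SX"
    show "continuous_map (ktop SY WY) (ktop SZ WZ) (bil x)"
    proof (rule linear_continuous_ktop[OF kgoodD(1)[OF Y] kgoodD(2)[OF Y] kgoodD(2)[OF Z]])
      show "bil x y \<in> seqs SZ" if "y \<in> seqs SY" for y
        by (rule bil(2)[OF x that])
      show "bil x (\<lambda>i. y i - y' i) = (\<lambda>k. bil x y k - bil x y' k)" if "y \<in> seqs SY" "y' \<in> seqs SY" for y y'
        by (rule bilinear_between_diff(2)[OF bil(1) x that])
      fix w assume w: "w \<in> WZ"
      have "pairing (mag (bil x y)) w \<le> pairing (mag y) (\<lambda>i. tri (mag x) (delta i) w)" for y
        using pairing_bil_le[of x y w] unfolding tri_pairing2[of _ "mag y"] .
      then show "\<exists>v\<in>WY. \<forall>y\<in>seqs SY. pairing (mag (bil x y)) w \<le> pairing (mag y) v"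
        using h1[OF _ w, of "mag x"] x by (intro bexI[of _ "\<lambda>i. tri (mag x) (delta i) w"]) (auto simp: seqs_def)
    qed
  qed
qed

lemma dual_superset: "kgood g S W \<Longrightarrow> x \<in> S \<Longrightarrow> x \<in> dual W"
  unfolding dual_def using kgoodD(3)[of g S W x] pairing_commute[of x] by auto

text \<open>The argument for separate continuity with the fixed element replaced by the supremum of
  a bounded set. That supremum is known only in the dual of the weights, which is why
  \<open>h1\<close> and \<open>h2\<close> speak about the dual.\<close>

lemma hypocontinuous_bil:
  assumes g: "nuclear g" and X: "kgood g SX WX" and Y: "kgood g SY WY" and Z: "kgood g SZ WZ"
    and h0: "\<And>x y. x \<in> SX \<Longrightarrow> y \<in> SY \<Longrightarrow> pos x y \<in> SZ"
    and h1: "\<And>x w. x \<in> dual WX \<Longrightarrow> w \<in> WZ \<Longrightarrow> (\<lambda>i. tri x (delta i) w) \<in> WY"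
    and h2: "\<And>y w. y \<in> dual WY \<Longrightarrow> w \<in> WZ \<Longrightarrow> (\<lambda>i. tri (delta i) y w) \<in> WX"
  shows "hypocontinuous (ktop SX WX) (ktop SY WY) (ktop SZ WZ) bil"
proof -
  have top: "topspace (ktop SX WX) = seqs SX" "topspace (ktop SY WY) = seqs SY"
    using topspace_ktop[OF kgoodD(2)[OF X]] topspace_ktop[OF kgoodD(2)[OF Y]] .
  have bil: "bilinear_between (seqs SX) (seqs SY) bil"
    "\<And>x y. x \<in> seqs SX \<Longrightarrow> y \<in> seqs SY \<Longrightarrow> bil x y \<in> seqs SZ"
    using bilinear_ktop[of SX SY SZ, OF h0 Z] by blast+
  note nhdX = zero_nhd_ktop[OF kgoodD(1,2)[OF X]]
  note nhdY = zero_nhd_ktop[OF kgoodD(1,2)[OF Y]]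
  note nhdZ = zero_nhd_ktop[OF kgoodD(1,2)[OF Z]]
  show ?thesis
    unfolding hypocontinuous_def
  proof (intro conjI allI impI)
    show "bilinear_between (topspace (ktop SX WX)) (topspace (ktop SY WY)) bil"
      unfolding top by (rule bil(1))
    show "separately_continuous (ktop SX WX) (ktop SY WY) (ktop SZ WZ) bil"
      by (rule separately_continuous_bil[OF X Y Z h0])
        (use h1 h2 dual_superset[OF X] dual_superset[OF Y] in blast)+
  next
    fix D N assume DN: "tvs_bounded (ktop SY WY) D \<and> zero_nhd (ktop SZ WZ) N"
    then obtain w where w: "w \<in> WZ" "\<And>z. z \<in> seqs SZ \<Longrightarrow> pairing (mag z) w < 1 \<Longrightarrow> z \<in> N"
      unfolding nhdZ by blast
    define v where "v = (\<lambda>i. tri (delta i) (\<lambda>i. SUP y\<in>D. mag y i) w)"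
    have v: "v \<in> WX"
      unfolding v_def using h2[OF tvs_bounded_sup[OF g Y] w(1)] DN by blast
    have "bil x y \<in> N" if x: "x \<in> seqs SX" "pairing (mag x) v < 1" and y: "y \<in> D" for x y
    proof (rule w(2))
      have "y \<in> seqs SY"
        using DN y unfolding tvs_bounded_def top by blast
      then show "bil x y \<in> seqs SZ"
        by (rule bil(2)[OF x(1)])
      have "pairing (mag (bil x y)) w \<le> tri (mag x) (mag y) w"
        by (rule pairing_bil_le)
      also have "\<dots> \<le> tri (mag x) (\<lambda>i. SUP y\<in>D. mag y i) w"
        using y by (intro tri_mono SUP_upper) auto
      also have "\<dots> = pairing (mag x) v"
        unfolding v_def by (rule tri_pairing1)
      finally show "pairing (mag (bil x y)) w < 1"
        using x(2) by (rule order_le_less_trans)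
    qed
    then show "\<exists>V. zero_nhd (ktop SX WX) V \<and> (\<forall>x\<in>V. \<forall>y\<in>D. bil x y \<in> N)"
      unfolding nhdX using v by (intro exI[of _ "{x \<in> seqs SX. pairing (mag x) v < 1}"]) auto
  next
    fix D N assume DN: "tvs_bounded (ktop SX WX) D \<and> zero_nhd (ktop SZ WZ) N"
    then obtain w where w: "w \<in> WZ" "\<And>z. z \<in> seqs SZ \<Longrightarrow> pairing (mag z) w < 1 \<Longrightarrow> z \<in> N"
      unfolding nhdZ by blast
    define v where "v = (\<lambda>i. tri (\<lambda>i. SUP x\<in>D. mag x i) (delta i) w)"
    have v: "v \<in> WY"
      unfolding v_def using h1[OF tvs_bounded_sup[OF g X] w(1)] DN by blast
    have "bil x y \<in> N" if y: "y \<in> seqs SY" "pairing (mag y) v < 1" and x: "x \<in> D" for x y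
    proof (rule w(2))
      have "x \<in> seqs SX"
        using DN x unfolding tvs_bounded_def top by blast
      then show "bil x y \<in> seqs SZ"
        by (rule bil(2)[OF _ y(1)])
      have "pairing (mag (bil x y)) w \<le> tri (mag x) (mag y) w"
        by (rule pairing_bil_le)
      also have "\<dots> \<le> tri (\<lambda>i. SUP x\<in>D. mag x i) (mag y) w"
        using x by (intro tri_mono SUP_upper) auto
      also have "\<dots> = pairing (mag y) v"
        unfolding v_def by (rule tri_pairing2)
      finally show "pairing (mag (bil x y)) w < 1"
        using y(2) by (rule order_le_less_trans)
    qed
    then show "\<exists>V. zero_nhd (ktop SY WY) V \<and> (\<forall>x\<in>D. \<forall>y\<in>V. bil x y \<in> N)"
      unfolding nhdY using v by (intro exI[of _ "{y \<in> seqs SY. pairing (mag y) v < 1}"]) auto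
  qed
qed

text \<open>The product bound in \<open>hj\<close> is the continuity of a bilinear form in two
  seminorms; the rest is the expansion of a difference of products into three terms.\<close>

lemma jointly_continuous_bil:
  assumes X: "kgood g SX WX" and Y: "kgood g SY WY" and Z: "kgood g SZ WZ"
    and h0: "\<And>x y. x \<in> SX \<Longrightarrow> y \<in> SY \<Longrightarrow> pos x y \<in> SZ"
    and hj: "\<And>w. w \<in> WZ \<Longrightarrow> \<exists>v1\<in>WX. \<exists>v2\<in>WY. \<forall>x y. tri x y w \<le> pairing x v1 * pairing y v2"
  shows "jointly_continuous (ktop SX WX) (ktop SY WY) (ktop SZ WZ) bil"
proof -
  note SX = kgoodD(1)[OF X] and SY = kgoodD(1)[OF Y] and WX = kgoodD(2)[OF X] and WY = kgoodD(2)[OF Y] and WZ = kgoodD(2)[OF Z]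
  have bil: "bilinear_between (seqs SX) (seqs SY) bil"
    "\<And>x y. x \<in> seqs SX \<Longrightarrow> y \<in> seqs SY \<Longrightarrow> bil x y \<in> seqs SZ"
    using bilinear_ktop[of SX SY SZ, OF h0 Z] by blast+
  show ?thesis
    unfolding jointly_continuous_def continuous_map_def
  proof (intro conjI allI impI)
    show "(\<lambda>(x, y). bil x y) \<in> topspace (prod_topology (ktop SX WX) (ktop SY WY)) \<rightarrow> topspace (ktop SZ WZ)"
      using bil(2) by (auto simp: topspace_ktop WX WY WZ)
    fix U assume "openin (ktop SZ WZ) U"
    then have U: "kopen SZ WZ U"
      by (simp add: openin_ktop WZ)
    let ?P = "{xy \<in> topspace (prod_topology (ktop SX WX) (ktop SY WY)). (\<lambda>(x, y). bil x y) xy \<in> U}"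
    show "openin (prod_topology (ktop SX WX) (ktop SY WY)) ?P"
      unfolding openin_prod_topology_alt
    proof (intro allI impI)
      fix x0 y0 assume "(x0, y0) \<in> ?P"
      then have x0: "x0 \<in> seqs SX" and y0: "y0 \<in> seqs SY" and F0: "bil x0 y0 \<in> U"
        by (auto simp: topspace_ktop WX WY)
      obtain w where w: "w \<in> WZ" "\<And>z. z \<in> seqs SZ \<Longrightarrow> pairing (mag (\<lambda>i. z i - bil x0 y0 i)) w < 1 \<Longrightarrow> z \<in> U"
        using kopenE[OF U F0] by blast
      obtain v1 v2 where v: "v1 \<in> WX" "v2 \<in> WY" "\<And>x y. tri x y w \<le> pairing x v1 * pairing y v2"
        using hj[OF w(1)] by blast
      have "pairing (mag x0) v1 < \<infinity>" "pairing (mag y0) v2 < \<infinity>"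
        using kgoodD(3)[OF X _ v(1)] kgoodD(3)[OF Y _ v(2)] x0 y0 by (auto simp: seqs_def)
      then obtain a b where ab: "pairing (mag x0) v1 = ennreal a" "0 \<le> a" "pairing (mag y0) v2 = ennreal b" "0 \<le> b"
        by (cases "pairing (mag x0) v1"; cases "pairing (mag y0) v2") auto
      \<comment> \<open>Near \<open>x0\<close> and \<open>y0\<close> the increments satisfy m (b +
        1) < 1/3 and n (a + 1) < 1/3, which keeps m n + m b + a n below 1.\<close>
      define A where "A = {x \<in> seqs SX. pairing (mag (\<lambda>i. x i - x0 i)) (\<lambda>i. ennreal (3 * (b + 1)) * v1 i) < 1}"
      define B where "B = {y \<in> seqs SY. pairing (mag (\<lambda>i. y i - y0 i)) (\<lambda>i. ennreal (3 * (a + 1)) * v2 i) < 1}"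
      have "openin (ktop SX WX) A" "openin (ktop SY WY) B"
        unfolding A_def B_def
        by (rule openin_ktop_ball[OF WX wcone_cmult[OF WX v(1)]], simp)
          (rule openin_ktop_ball[OF WY wcone_cmult[OF WY v(2)]], simp)
      moreover have "x0 \<in> A" "y0 \<in> B"
        using x0 y0 by (simp_all add: A_def B_def)
      moreover have "bil x y \<in> U" if x: "x \<in> A" and y: "y \<in> B" for x y
      proof (rule w(2))
        have xS: "x \<in> seqs SX" and yS: "y \<in> seqs SY"
          using x y by (simp_all add: A_def B_def)
        then show "bil x y \<in> seqs SZ"
          by (rule bil(2))
        let ?dx = "\<lambda>i. x i - x0 i" and ?dy = "\<lambda>i. y i - y0 i"
        have dx: "?dx \<in> seqs SX" and dy: "?dy \<in> seqs SY"
          using seqs_diff[OF SX xS x0] seqs_diff[OF SY yS y0] .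
        have "pairing (mag ?dx) v1 < \<infinity>" "pairing (mag ?dy) v2 < \<infinity>"
          using kgoodD(3)[OF X _ v(1)] kgoodD(3)[OF Y _ v(2)] dx dy by (auto simp: seqs_def)
        then obtain m n where mn: "pairing (mag ?dx) v1 = ennreal m" "0 \<le> m" "pairing (mag ?dy) v2 = ennreal n" "0 \<le> n"
          by (cases "pairing (mag ?dx) v1"; cases "pairing (mag ?dy) v2") auto
        have "ennreal (3 * (b + 1) * m) < 1" "ennreal (3 * (a + 1) * n) < 1"
          using x y unfolding A_def B_def pairing_cmult_right
          by (simp_all only: mem_Collect_eq mn ennreal_mult''[OF mn(2)] ennreal_mult''[OF mn(4)])
        then have mn': "3 * (b + 1) * m < 1" "3 * (a + 1) * n < 1"
          by (simp_all only: ennreal_less_one_iff)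
        have eq: "bil x y i - bil x0 y0 i = (bil ?dx ?dy i + bil ?dx y0 i) + bil x0 ?dy i" for i
          using bilinear_between_diff(1)[OF bil(1) xS x0 dy] bilinear_between_diff(1)[OF bil(1) xS x0 y0]
            bilinear_between_diff(2)[OF bil(1) xS yS y0] bilinear_between_diff(2)[OF bil(1) x0 yS y0]
          by simp
        have "pairing (mag (\<lambda>i. bil x y i - bil x0 y0 i)) w \<le>
            pairing (\<lambda>i. mag (bil ?dx ?dy) i + mag (bil ?dx y0) i + mag (bil x0 ?dy) i) w"
          unfolding eq
          by (intro pairing_mono order_trans[OF mag_add_le] add_right_mono mag_add_le order_refl)
        also have "\<dots> \<le> tri (mag ?dx) (mag ?dy) w + tri (mag ?dx) (mag y0) w + tri (mag x0) (mag ?dy) w"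
          unfolding pairing_add_left by (intro add_mono pairing_bil_le)
        also have "\<dots> \<le> ennreal m * ennreal n + ennreal m * ennreal b + ennreal a * ennreal n"
          using v(3) by (intro add_mono) (metis mn(1,3) ab(1,3))+
        also have "\<dots> = ennreal (m * n + m * b + a * n)"
          using mn ab by (simp add: ennreal_mult)
        also have "\<dots> < 1"
        proof -
          have "m * n + m * b + a * n < 1"
          proof -
            have m3: "3 * m \<le> 1"
            proof -
              have "m * 1 \<le> m * (b + 1)"
                using mn ab by (intro mult_left_mono) auto
              then show ?thesis
                using mn'(1) by (simp add: algebra_simps)
            qed
            have "m * n \<le> 1/3 * n"
              using m3 mn by (intro mult_right_mono) auto
            moreover have "3 * (m * b) \<le> 1" "3 * (a * n) + 3 * n < 1"
              using mn' mn ab by (simp_all add: algebra_simps)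
            ultimately show ?thesis
              using mn by linarith
          qed
          then show ?thesis
            by (simp only: ennreal_less_one_iff)
        qed
        finally show "pairing (mag (\<lambda>i. bil x y i - bil x0 y0 i)) w < 1" .
      qed
      moreover have "A \<subseteq> seqs SX" "B \<subseteq> seqs SY"
        by (auto simp: A_def B_def)
      ultimately show "\<exists>A B. openin (ktop SX WX) A \<and> openin (ktop SY WY) B \<and> x0 \<in> A \<and> y0 \<in> B \<and> A \<times> B \<subseteq> ?P"
        by (intro exI[of _ A] exI[of _ B]) (auto simp: topspace_ktop WX WY)
    qed
  qed
qed

end

section \<open>Inductive limits of projective limits\<close>

text \<open>At \<open>b = \<infinity>\<close> the hypothesis is void, and \<open>C = 0\<close> would
  turn the right-hand side into 0; \<open>C + 1\<close> keeps it infinite. At \<open>b = 0\<close>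
  the finiteness of \<open>C\<close> forces \<open>a = 0\<close>.\<close>

lemma ennreal_le_mult_inverse:
  fixes a b C :: ennreal
  assumes "inverse b * a \<le> C" "C < \<infinity>"
  shows "a \<le> (C + 1) * b"
proof -
  consider "b = top" | "b = 0" | "0 < b" "b < top"
    by (metis less_top not_gr_zero)
  then show ?thesis
  proof cases
    case 1
    have "(C + 1) * b = top"
      unfolding 1 by (simp add: ennreal_mult_top)
    then show ?thesis
      by simp
  next
    case 2
    then have "a = 0"
      using assms by (cases "a = 0") (auto simp: ennreal_top_mult top_unique)
    then show ?thesis
      by simp
  next
    case 3
    have "a = inverse b * b * a"
      using ennreal_inverse_cancel[of b] 3 by simp
    also have "\<dots> = inverse b * a * b"
      by (simp add: ac_simps)
    also have "\<dots> \<le> (C + 1) * b"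
      using assms(1) by (intro mult_right_mono) (auto intro: add_increasing2)
    finally show ?thesis .
  qed
qed

text \<open>A test element: by \<open>ennreal_le_mult_inverse\<close>, any sequence that pairs
  finitely with the reciprocal of \<omega> is dominated by \<omega>, that is, lies in
  \<open>Osp \<omega>\<close>.\<close>

lemma inverse_in_Bsp: "(\<lambda>i. inverse (\<omega> i)) \<in> Bsp \<omega>"
proof -
  have "inverse a * a \<le> 1" for a :: ennreal
    using ennreal_inverse_cancel[of a] by (cases "a = 0 \<or> a = top") (auto simp: less_top zero_less_iff_neq_zero)
  then show ?thesis
    unfolding Bsp_def by (auto intro: exI[of _ 1])
qed

text \<open>One inductive factor of the projective limit in sup-norm form, the form in which the
  pointwise kernel estimates are stated.\<close>

definition Bstep :: "(real \<Rightarrow> real \<Rightarrow> 'i \<Rightarrow> ennreal) \<Rightarrow> real \<Rightarrow> ('i \<Rightarrow> ennreal) set" where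
  "Bstep \<omega> j = (\<Union>n\<in>{0<..}. Bsp (\<omega> j n))"

lemma PI_Bstep_Lsp:
  assumes g: "nuclear g" and \<omega>: "PI_family g \<omega>" and j: "j > 0"
  shows "\<exists>j'>0. Bstep \<omega> j' \<subseteq> (\<Union>n\<in>{0<..}. Lsp (\<omega> j n))"
proof -
  obtain j' where j': "j' > 0" "\<And>n. n > 0 \<Longrightarrow> \<exists>n'>0. faster g (\<omega> j n') (\<omega> j' n)"
    using PI_familyD(2)[OF \<omega> j] by blast
  have "x \<in> (\<Union>n\<in>{0<..}. Lsp (\<omega> j n))" if "x \<in> Bsp (\<omega> j' n)" "n > 0" for x n
    using j'(2)[OF that(2)] Bsp_subset_Lsp[OF g] that(1) by blast
  then have "Bstep \<omega> j' \<subseteq> (\<Union>n\<in>{0<..}. Lsp (\<omega> j n))"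
    by (auto simp: Bstep_def)
  with j'(1) show ?thesis
    by blast
qed

text \<open>Each sup-norm factor embeds into an l^1 factor with another outer parameter, so both
  descriptions have the same intersection.\<close>

lemma PI_S_eq:
  assumes g: "nuclear g" and \<omega>: "PI_family g \<omega>"
  shows "PI_S \<omega> = (\<Inter>j\<in>{0<..}. Bstep \<omega> j)"
proof (rule antisym)
  show "PI_S \<omega> \<subseteq> (\<Inter>j\<in>{0<..}. Bstep \<omega> j)"
    unfolding PI_S_def Bstep_def using Lsp_subset_Bsp by (intro INT_subset_mono UN_mono) auto
  show "(\<Inter>j\<in>{0<..}. Bstep \<omega> j) \<subseteq> PI_S \<omega>"
    unfolding PI_S_def
  proof (rule INT_greatest)
    fix j :: real assume "j \<in> {0<..}"
    then obtain j' where "j' > 0" "Bstep \<omega> j' \<subseteq> (\<Union>n\<in>{0<..}. Lsp (\<omega> j n))"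
      using PI_Bstep_Lsp[OF g \<omega>, of j] by auto
    then show "(\<Inter>j\<in>{0<..}. Bstep \<omega> j) \<subseteq> (\<Union>n\<in>{0<..}. Lsp (\<omega> j n))"
      by blast
  qed
qed

lemma pairing_Lsp_Osp: "x \<in> Lsp \<omega> \<Longrightarrow> w \<in> Osp \<omega> \<Longrightarrow> pairing x w < \<infinity>"
  using kpairD(3)[OF kpair_Lsp] .

lemma faster_Osp:
  assumes g: "nuclear g" and f: "faster g \<omega> \<omega>'" and w: "w \<in> Osp \<omega>"
  shows "(\<lambda>i. w i * inverse (g i)) \<in> Osp \<omega>'"
proof -
  obtain C where C: "C < \<infinity>" "\<And>i. w i \<le> C * \<omega> i"
    using w by (auto simp: Osp_def)
  obtain D where D: "D < \<infinity>" "\<And>i. \<omega> i \<le> D * g i * \<omega>' i"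
    using f by (auto simp: faster_def)
  have "w i * inverse (g i) \<le> C * D * \<omega>' i" for i
  proof -
    have "w i * inverse (g i) \<le> C * (D * g i * \<omega>' i) * inverse (g i)"
      by (intro mult_right_mono order_trans[OF C(2)] mult_left_mono D(2)) simp_all
    also have "\<dots> = C * D * \<omega>' i * (inverse (g i) * g i)"
      by (simp add: ac_simps)
    also have "\<dots> = C * D * \<omega>' i"
      using g ennreal_inverse_cancel[of "g i"] by (simp add: nuclear_def)
    finally show ?thesis .
  qed
  then show ?thesis
    unfolding Osp_def using ennreal_mult_finite[OF C(1) D(1)] by blast
qed

lemma faster_Lsp:
  assumes g: "nuclear g" and f: "faster g \<omega> \<omega>'" and x: "x \<in> Lsp \<omega>'"
  shows "(\<lambda>i. x i * inverse (g i)) \<in> Lsp \<omega>"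
proof -
  obtain D where D: "D < \<infinity>" "\<And>i. \<omega> i \<le> D * g i * \<omega>' i"
    using f by (auto simp: faster_def)
  have "x i * inverse (g i) * \<omega> i \<le> D * x i * \<omega>' i" for i
  proof -
    have "x i * inverse (g i) * \<omega> i \<le> x i * inverse (g i) * (D * g i * \<omega>' i)"
      by (intro mult_left_mono D(2)) simp
    also have "\<dots> = D * x i * \<omega>' i * (inverse (g i) * g i)"
      by (simp add: ac_simps)
    also have "\<dots> = D * x i * \<omega>' i"
      using g ennreal_inverse_cancel[of "g i"] by (simp add: nuclear_def)
    finally show ?thesis .
  qed
  then have "pairing (\<lambda>i. x i * inverse (g i)) \<omega> \<le> pairing (\<lambda>i. D * x i) \<omega>'"
    unfolding pairing_def by (intro nn_integral_mono) simp
  also have "\<dots> < \<infinity>"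
    unfolding pairing_cmult_left using D(1) x by (intro ennreal_mult_finite) (auto simp: Lsp_def)
  finally show ?thesis
    by (simp add: Lsp_def)
qed

lemma delta_in_Osp:
  assumes "0 < \<omega> i"
  shows "delta i \<in> Osp \<omega>"
proof -
  have C: "inverse (\<omega> i) + 1 < \<infinity>"
    using assms by (intro ennreal_add_finite) (auto simp: less_top[symmetric] zero_less_iff_neq_zero)
  have "1 \<le> (inverse (\<omega> i) + 1) * \<omega> i"
  proof (cases "\<omega> i = top")
    case False
    then have "1 = inverse (\<omega> i) * \<omega> i"
      using ennreal_inverse_cancel[of "\<omega> i"] assms by (simp add: less_top)
    also have "\<dots> \<le> (inverse (\<omega> i) + 1) * \<omega> i"
      by (intro mult_right_mono) auto
    finally show ?thesis .
  qed (simp add: ennreal_mult_top)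
  then have "delta i j \<le> (inverse (\<omega> i) + 1) * \<omega> j" for j
    by (cases "j = i") (auto simp: delta_def)
  then show ?thesis
    unfolding Osp_def using C by blast
qed

lemma kgood_PI:
  assumes g: "nuclear g" and \<omega>: "PI_family g \<omega>"
  shows "kgood g (PI_S \<omega>) (PI_W \<omega>)"
  unfolding kgood_def kpair_def
proof (intro conjI ballI allI wcone_PI_S wcone_PI_W PI_familyD(1)[OF \<omega>])
  fix x w assume x: "x \<in> PI_S \<omega>" and "w \<in> PI_W \<omega>"
  then obtain j where j: "j > 0" "\<And>n. n > 0 \<Longrightarrow> w \<in> Osp (\<omega> j n)"
    by (auto simp: PI_W_def)
  obtain n where "n > 0" "x \<in> Lsp (\<omega> j n)"
    using x j(1) by (auto simp: PI_S_def)
  then show "pairing x w < \<infinity>"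
    using j(2) pairing_Lsp_Osp by blast
next
  fix i
  show "delta i \<in> PI_S \<omega>"
    unfolding PI_S_def using PI_familyD(3)[OF \<omega>, of _ i] by (auto simp: delta_in_Lsp_iff)
  obtain j where "j > 0" "\<And>n. n > 0 \<Longrightarrow> 0 < \<omega> j n i"
    using PI_familyD(4)[OF \<omega>] by blast
  then show "delta i \<in> PI_W \<omega>"
    unfolding PI_W_def by (auto intro!: bexI[of _ j] delta_in_Osp)
next
  fix w assume "w \<in> PI_W \<omega>"
  then obtain j where j: "j > 0" "\<And>n. n > 0 \<Longrightarrow> w \<in> Osp (\<omega> j n)"
    by (auto simp: PI_W_def)
  obtain j' where j': "j' > 0" "\<And>n. n > 0 \<Longrightarrow> \<exists>n'>0. faster g (\<omega> j n') (\<omega> j' n)"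
    using PI_familyD(2)[OF \<omega> j(1)] by blast
  have "(\<lambda>i. w i * inverse (g i)) \<in> Osp (\<omega> j' n)" if n: "n > 0" for n
  proof -
    obtain n' where "n' > 0" "faster g (\<omega> j n') (\<omega> j' n)"
      using j'(2)[OF n] by blast
    then show ?thesis
      by (intro faster_Osp[OF g _ j(2)])
  qed
  then show "(\<lambda>i. w i * inverse (g i)) \<in> PI_W \<omega>"
    using j'(1) by (auto simp: PI_W_def)
qed

lemma kgood_IP:
  assumes g: "nuclear g" and \<omega>: "IP_family g \<omega>"
  shows "kgood g (IP_S \<omega>) (dual (IP_S \<omega>))"
  unfolding kgood_def kpair_def
proof (intro conjI ballI allI wcone_IP_S wcone_dual IP_familyD(1)[OF \<omega>])
  show "pairing x w < \<infinity>" if "x \<in> IP_S \<omega>" "w \<in> dual (IP_S \<omega>)" for x w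
    using that by (auto simp: dual_def)
  fix i
  obtain j where "j > 0" "\<forall>n>0. \<omega> j n i < \<infinity>"
    using IP_familyD(3)[OF \<omega>] by blast
  then show "delta i \<in> IP_S \<omega>"
    by (auto simp: IP_S_def delta_in_Lsp_iff)
  have "x i < \<infinity>" if x: "x \<in> IP_S \<omega>" for x
  proof -
    obtain j where j: "j > 0" "\<And>n. n > 0 \<Longrightarrow> x \<in> Lsp (\<omega> j n)"
      using x by (auto simp: IP_S_def)
    obtain n where n: "n > 0" "0 < \<omega> j n i"
      using IP_familyD(4)[OF \<omega> j(1)] by blast
    have "x i * \<omega> j n i < \<infinity>"
      using le_pairing[of x i "\<omega> j n"] j(2)[OF n(1)] by (auto simp: Lsp_def intro: order_le_less_trans)
    then show ?thesis
      using n(2) by (cases "x i"; cases "\<omega> j n i = 0") (auto simp: ennreal_top_mult)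
  qed
  then show "delta i \<in> dual (IP_S \<omega>)"
    by (simp add: dual_def)
next
  fix w assume w: "w \<in> dual (IP_S \<omega>)"
  have "pairing x (\<lambda>i. w i * inverse (g i)) < \<infinity>" if x: "x \<in> IP_S \<omega>" for x
  proof -
    obtain j where j: "j > 0" "\<And>n. n > 0 \<Longrightarrow> x \<in> Lsp (\<omega> j n)"
      using x by (auto simp: IP_S_def)
    obtain j' where j': "j' > 0" "\<And>n. n > 0 \<Longrightarrow> \<exists>n'>0. faster g (\<omega> j' n) (\<omega> j n')"
      using IP_familyD(2)[OF \<omega> j(1)] by blast
    have "(\<lambda>i. x i * inverse (g i)) \<in> Lsp (\<omega> j' n)" if n: "n > 0" for n
    proof -
      obtain n' where "n' > 0" "faster g (\<omega> j' n) (\<omega> j n')"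
        using j'(2)[OF n] by blast
      then show ?thesis
        by (intro faster_Lsp[OF g _ j(2)])
    qed
    then have "(\<lambda>i. x i * inverse (g i)) \<in> IP_S \<omega>"
      using j'(1) by (auto simp: IP_S_def)
    then have "pairing (\<lambda>i. x i * inverse (g i)) w < \<infinity>"
      using w by (auto simp: dual_def)
    then show ?thesis
      by (simp add: pairing_def ac_simps)
  qed
  then show "(\<lambda>i. w i * inverse (g i)) \<in> dual (IP_S \<omega>)"
    by (simp add: dual_def)
qed

text \<open>As for the opposite order of limits, the exponent is removed first. Each inner
  projective limit is then written with weights that are unrestricted off its support, which
  prepares \<open>ind_lim_ktop\<close>; the intersection of these weight cones is the full dual by
  the gliding hump in \<open>IP_dual\<close>.\<close>

theorem ind_proj_lim_lw:
  fixes \<omega> :: "real \<Rightarrow> real \<Rightarrow> 'i::countable \<Rightarrow> ennreal"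
  assumes p: "0 < p" and g: "nuclear g" and \<omega>: "IP_family g \<omega>"
  shows "ind_lim (\<lambda>j. proj_lim (\<lambda>n. lw p (\<omega> j n))) = ktop (IP_S \<omega>) (dual (IP_S \<omega>))"
proof -
  have mono: "monotone_family \<omega>"
    using IP_familyD(1)[OF \<omega>] .
  note D = IP_familyD(2)[OF \<omega>]
  define S where "S j = (\<Inter>n\<in>{0<..}. Lsp (\<omega> j n))" for j
  \<comment> \<open>Bounds are imposed only where every weight of level \<open>j\<close> is finite.
    Elsewhere the elements of \<open>S j\<close> vanish, so the extra weights leave the topology
    unchanged, while infinite values become available.\<close>
  define W where "W j = {w. \<exists>n>0. \<exists>C<\<infinity>. \<forall>i. (\<forall>m>0. \<omega> j m i < \<infinity>) \<longrightarrow> w i \<le> C * \<omega> j n i}" for j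
  have S: "wcone (S j)" for j
    unfolding S_def by (intro wcone_Inter wcone_Lsp)
  have S_off: "x i = 0" if x: "x \<in> S j" and off: "\<not> (\<forall>m>0. \<omega> j m i < \<infinity>)" for x i j
  proof -
    obtain m where "m > 0" "\<omega> j m i = \<infinity>"
      using off by (auto simp: less_top[symmetric])
    then show ?thesis
      using x le_Lsp_zero[of x "\<omega> j m" i] by (auto simp: S_def)
  qed
  have delta_S: "delta i \<in> S j \<longleftrightarrow> (\<forall>m>0. \<omega> j m i < \<infinity>)" for i j
    by (auto simp: S_def delta_in_Lsp_iff)
  have W_restrict: "(\<lambda>i. if \<forall>m>0. \<omega> j m i < \<infinity> then w i else 0) \<in> (\<Union>n\<in>{0<..}. Osp (\<omega> j n))"
    if w: "w \<in> W j" for w j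
  proof -
    obtain n C where "n > 0" "C < \<infinity>" "\<forall>i. (\<forall>m>0. \<omega> j m i < \<infinity>) \<longrightarrow> w i \<le> C * \<omega> j n i"
      using w by (auto simp: W_def)
    then have "(\<lambda>i. if \<forall>m>0. \<omega> j m i < \<infinity> then w i else 0) \<in> Osp (\<omega> j n)"
      unfolding Osp_def by (intro CollectI exI[of _ C]) auto
    then show ?thesis
      using \<open>n > 0\<close> by auto
  qed
  have W_extend: "w \<in> W j" if w: "w' \<in> (\<Union>n\<in>{0<..}. Osp (\<omega> j n))" "\<And>i. (\<forall>m>0. \<omega> j m i < \<infinity>) \<Longrightarrow> w i \<le> w' i" for w w' j
  proof -
    obtain n C where nC: "n > 0" "C < \<infinity>" "\<And>i. w' i \<le> C * \<omega> j n i"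
      using w(1) by (auto simp: Osp_def)
    then have "\<forall>i. (\<forall>m>0. \<omega> j m i < \<infinity>) \<longrightarrow> w i \<le> C * \<omega> j n i"
      using w(2) order_trans by blast
    then show ?thesis
      using nC(1,2) unfolding W_def by blast
  qed
  have OU: "wcone (\<Union>n\<in>{0<..}. Osp (\<omega> j n))" if "j > 0" for j
    using wcone_Osp_Union[OF mono that] .
  have W: "wcone (W j)" if j: "j > 0" for j
    unfolding wcone_def
  proof (intro conjI ballI allI impI)
    show "(\<lambda>_. 0) \<in> W j"
      by (rule W_extend[OF wcone_zero[OF OU[OF j]]]) simp
    show "(\<lambda>i. v i + w i) \<in> W j" if "v \<in> W j" "w \<in> W j" for v w
      by (rule W_extend[OF wcone_add[OF OU[OF j] W_restrict[OF that(1)] W_restrict[OF that(2)]]]) simp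
    show "(\<lambda>i. c * v i) \<in> W j" if "v \<in> W j" "c < \<infinity>" for v c
      by (rule W_extend[OF wcone_cmult[OF OU[OF j] W_restrict[OF that(1)] that(2)]]) simp
    show "w \<in> W j" if "v \<in> W j" "\<forall>i. w i \<le> v i" for v w
      by (rule W_extend[OF W_restrict[OF that(1)]]) (use that(2) in simp)
  qed
  have pairing_restrict: "pairing x w = pairing x (\<lambda>i. if \<forall>m>0. \<omega> j m i < \<infinity> then w i else 0)"
    if "x \<in> S j" for x w j
    unfolding pairing_def using S_off[OF that] by (intro nn_integral_cong) auto
  have inner: "proj_lim (\<lambda>n. ktop (Lsp (\<omega> j n)) (Osp (\<omega> j n))) = ktop (S j) (W j)" if j: "j > 0" for j
  proof -
    have "proj_lim (\<lambda>n. ktop (Lsp (\<omega> j n)) (Osp (\<omega> j n))) = ktop (S j) (\<Union>n\<in>{0<..}. Osp (\<omega> j n))"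
      unfolding S_def by (rule proj_lim_ktop[OF wcone_Osp OU[OF j]])
    also have "\<dots> = ktop (S j) (W j)"
    proof (rule ktop_cong[OF S OU[OF j] W[OF j]])
      fix w assume "w \<in> (\<Union>n\<in>{0<..}. Osp (\<omega> j n))"
      then have "w \<in> W j"
        by (rule W_extend) simp
      then show "\<exists>w'\<in>W j. \<forall>x\<in>S j. pairing x w \<le> pairing x w'"
        by blast
    next
      fix w assume w: "w \<in> W j"
      show "\<exists>w'\<in>(\<Union>n\<in>{0<..}. Osp (\<omega> j n)). \<forall>x\<in>S j. pairing x w \<le> pairing x w'"
        by (rule bexI[OF _ W_restrict[OF w]], rule ballI, rule eq_refl, rule pairing_restrict)
    qed
    finally show ?thesis .
  qed
  have kp: "kpair (S j) (W j)" if j: "j > 0" for j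
    unfolding kpair_def
  proof (intro conjI ballI S W[OF j])
    fix x w assume x: "x \<in> S j" and w: "w \<in> W j"
    obtain n where "n > 0" "(\<lambda>i. if \<forall>m>0. \<omega> j m i < \<infinity> then w i else 0) \<in> Osp (\<omega> j n)"
      using W_restrict[OF w] by auto
    then show "pairing x w < \<infinity>"
      unfolding pairing_restrict[OF x, of w] using x by (intro pairing_Lsp_Osp[of _ "\<omega> j n"]) (auto simp: S_def)
  qed
  have S_IP: "IP_S \<omega> = (\<Union>j\<in>{0<..}. S j)"
    by (simp add: IP_S_def S_def)
  let ?K = "\<lambda>j. proj_lim (\<lambda>n. ktop (Lsp (\<omega> j n)) (Osp (\<omega> j n)))"
  let ?T = "\<lambda>j. proj_lim (\<lambda>n. lw p (\<omega> j n))"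
  have topK: "topspace (?K j) = seqs (S j)" if "j > 0" for j
    unfolding inner[OF that] by (rule topspace_ktop[OF W[OF that]])
  have emb1: "\<exists>j'>0. emb (?T j) (?K j')" and emb2: "\<exists>j'>0. emb (?K j) (?T j')" if j: "j > 0" for j
  proof -
    obtain j' where j': "j' > 0" "\<And>n. n > 0 \<Longrightarrow> \<exists>n'>0. faster g (\<omega> j' n) (\<omega> j n')"
      using D[OF j] by blast
    have "emb (?T j) (?K j')"
    proof (rule emb_proj_lim)
      fix n :: real assume "n > 0"
      then show "\<exists>n'>0. emb (lw p (\<omega> j n')) (ktop (Lsp (\<omega> j' n)) (Osp (\<omega> j' n)))"
        using j'(2) emb_lw_ktop[OF p g] by blast
    qed
    then show "\<exists>j'>0. emb (?T j) (?K j')"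
      using j'(1) by blast
    have "emb (?K j) (?T j')"
    proof (rule emb_proj_lim)
      fix n :: real assume "n > 0"
      then show "\<exists>n'>0. emb (ktop (Lsp (\<omega> j n')) (Osp (\<omega> j n'))) (lw p (\<omega> j' n))"
        using j'(2) emb_ktop_lw[OF p g] by blast
    qed
    then show "\<exists>j'>0. emb (?K j) (?T j')"
      using j'(1) by blast
  qed
  have linK: "lin (\<Union>j\<in>{0<..}. topspace (?K j))"
  proof -
    have "(\<Union>j\<in>{0<..}. topspace (?K j)) = seqs (IP_S \<omega>)"
      using topK by (auto simp: S_IP seqs_def)
    then show ?thesis
      using lin_seqs[OF wcone_IP_S[OF mono]] by simp
  qed
  have "(\<Union>j\<in>{0<..}. topspace (?T j)) = (\<Union>j\<in>{0<..}. topspace (?K j))"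
  proof (intro antisym UN_least)
    fix j :: real assume "j \<in> {0<..}"
    then have j: "j > 0"
      by simp
    obtain j' where "j' > 0" "emb (?T j) (?K j')"
      using emb1[OF j] by blast
    then show "topspace (?T j) \<subseteq> (\<Union>j\<in>{0<..}. topspace (?K j))"
      using embD(1)[of "?T j" "?K j'"] by blast
    obtain j'' where "j'' > 0" "emb (?K j) (?T j'')"
      using emb2[OF j] by blast
    then show "topspace (?K j) \<subseteq> (\<Union>j\<in>{0<..}. topspace (?T j))"
      using embD(1)[of "?K j" "?T j''"] by blast
  qed
  with linK have linT: "lin (\<Union>j\<in>{0<..}. topspace (?T j))"
    by simp
  have zeroT: "(\<lambda>_. 0) \<in> topspace (?T j)" for j
    by (simp add: topspace_proj_lim topspace_lw zero_in_lw_set p)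
  have zeroK: "(\<lambda>_. 0) \<in> topspace (?K j)" for j
    by (simp add: topspace_proj_lim topspace_ktop wcone_Osp seqs_zero wcone_Lsp)
  have "ind_lim ?T = ind_lim ?K"
  proof (rule emb_antisym)
    show "emb (ind_lim ?T) (ind_lim ?K)"
      by (rule emb_ind_lim[OF emb1 linT zeroT linK zeroK])
    show "emb (ind_lim ?K) (ind_lim ?T)"
      by (rule emb_ind_lim[OF emb2 linK zeroK linT zeroT])
  qed
  also have "\<dots> = ind_lim (\<lambda>j. ktop (S j) (W j))"
  proof -
    have linK': "lin (\<Union>j\<in>{0<..}. topspace (ktop (S j) (W j)))"
      using linK inner by simp
    have zeroK': "(\<lambda>_. 0) \<in> topspace (ktop (S j) (W j))" if "j > 0" for j
      using zeroK[of j] inner[OF that] by simp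
    have e: "\<exists>j'>0. emb (?K j) (ktop (S j') (W j'))" "\<exists>j'>0. emb (ktop (S j) (W j)) (?K j')" if "j > 0" for j
      using inner[OF that] that by (auto simp: emb_def intro!: exI[of _ j])
    show ?thesis
      by (rule emb_antisym) (rule emb_ind_lim[OF e(1) linK zeroK linK' zeroK'] emb_ind_lim[OF e(2) linK' zeroK' linK zeroK]; assumption)+
  qed
  also have "\<dots> = ktop (\<Union>j\<in>{0<..}. S j) (\<Inter>j\<in>{0<..}. W j)"
  proof (rule ind_lim_ktop[OF kp])
    show "wcone (\<Union>j\<in>{0<..}. S j)"
      using wcone_IP_S[OF mono] by (simp add: S_IP)
    fix j w assume w: "w \<in> W j"
    \<comment> \<open>Infinity off the support of \<open>S j\<close> is invisible to this step and
      prevents it from lowering the infimum over all steps.\<close>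
    let ?w = "\<lambda>i. if \<forall>m>0. \<omega> j m i < \<infinity> then w i else \<infinity>"
    have w': "?w \<in> W j"
      by (rule W_extend[OF W_restrict[OF w]]) simp
    show "\<exists>w'\<in>W j. (\<forall>i. w i \<le> w' i) \<and> (\<forall>i. delta i \<notin> S j \<longrightarrow> w' i = \<infinity>)"
    proof (intro bexI[OF _ w'] conjI allI impI)
      fix i
      show "w i \<le> ?w i"
        by (cases "\<forall>m>0. \<omega> j m i < \<infinity>") simp_all
      show "?w i = \<infinity>" if "delta i \<notin> S j"
        using that[unfolded delta_S] by (rule if_not_P)
    qed
  qed
  also have "(\<Inter>j\<in>{0<..}. W j) = dual (IP_S \<omega>)"
  proof (rule antisym)
    show "(\<Inter>j\<in>{0<..}. W j) \<subseteq> dual (IP_S \<omega>)"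
      using kpairD(3)[OF kp] by (auto simp: dual_def S_IP)
    show "dual (IP_S \<omega>) \<subseteq> (\<Inter>j\<in>{0<..}. W j)"
      using IP_dual[OF g \<omega>] by (auto simp: W_def)
  qed
  finally show ?thesis
    by (simp add: S_IP)
qed

section \<open>Continuity criteria for kernels\<close>

text \<open>Unique extendability for arbitrary index types: the map is compared with competitors
  that agree with it on finite sequences.\<close>

definition extends_bil ::
  "('i \<Rightarrow> complex) topology \<Rightarrow> ('i \<Rightarrow> complex) topology \<Rightarrow> ('i \<Rightarrow> complex) topology \<Rightarrow>
   (('i \<Rightarrow> complex) \<Rightarrow> ('i \<Rightarrow> complex) \<Rightarrow> ('i \<Rightarrow> complex)) \<Rightarrow> bool" where
  "extends_bil X Y Z F \<longleftrightarrow> finsupp \<subseteq> topspace X \<and> finsupp \<subseteq> topspace Y \<and>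
     (\<forall>x\<in>topspace X. \<forall>y\<in>topspace Y. F x y \<in> topspace Z) \<and>
     (\<forall>G. separately_continuous X Y Z G \<and> (\<forall>x\<in>finsupp. \<forall>y\<in>finsupp. G x y = F x y) \<longrightarrow>
        (\<forall>x\<in>topspace X. \<forall>y\<in>topspace Y. G x y = F x y))"

lemma finite_dual:
  assumes "kgood g S W" "x \<in> dual W"
  shows "x i < \<infinity>"
  using assms kgoodD(5)[OF assms(1), of i] by (auto simp: dual_def)

context kernel
begin

lemma extends_bil_ktop:
  assumes X: "kgood g SX WX" and Y: "kgood g SY WY" and Z: "kgood g SZ WZ"
    and h0: "\<And>x y. x \<in> SX \<Longrightarrow> y \<in> SY \<Longrightarrow> pos x y \<in> SZ"
    and sep: "separately_continuous (ktop SX WX) (ktop SY WY) (ktop SZ WZ) bil"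
  shows "extends_bil (ktop SX WX) (ktop SY WY) (ktop SZ WZ) bil"
proof -
  have top: "topspace (ktop SX WX) = seqs SX" "topspace (ktop SY WY) = seqs SY" "topspace (ktop SZ WZ) = seqs SZ"
    using topspace_ktop[OF kgoodD(2)[OF X]] topspace_ktop[OF kgoodD(2)[OF Y]] topspace_ktop[OF kgoodD(2)[OF Z]] .
  show ?thesis
    unfolding extends_bil_def top
  proof (intro conjI ballI allI impI finsupp_subset_seqs[OF X] finsupp_subset_seqs[OF Y])
    show "bil x y \<in> seqs SZ" if "x \<in> seqs SX" "y \<in> seqs SY" for x y
      using bilinear_ktop(2)[of SX SY SZ, OF h0 Z] that by blast
    fix G x y
    assume G: "separately_continuous (ktop SX WX) (ktop SY WY) (ktop SZ WZ) G \<and> (\<forall>x\<in>finsupp. \<forall>y\<in>finsupp. G x y = bil x y)"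
      and xy: "x \<in> seqs SX" "y \<in> seqs SY"
    show "G x y = bil x y"
      by (rule separately_continuous_unique[OF X Y Z conjunct1[OF G] sep _ xy]) (use G in simp)
  qed
qed

lemma tri_slot1_dual: "(\<lambda>i. tri (delta i) y w) \<in> dual S \<longleftrightarrow> (\<forall>x\<in>S. tri x y w < \<infinity>)"
  unfolding dual_def mem_Collect_eq tri_pairing1[symmetric] ..

lemma tri_slot2_dual: "(\<lambda>i. tri x (delta i) w) \<in> dual S \<longleftrightarrow> (\<forall>y\<in>S. tri x y w < \<infinity>)"
  unfolding dual_def mem_Collect_eq tri_pairing2[symmetric] ..

text \<open>If the weights are the whole dual, \<open>h0\<close> says that \<open>tri\<close> is
  finite on \<open>SX\<close>, \<open>SY\<close> and \<open>dual SZ\<close>. Hence a partial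
  transpose lies in a dual; pairing it with a bidual element and reading the result in the other
  slot shows that the remaining transpose lies in a dual as well.\<close>

lemma normal_spaces:
  assumes g: "nuclear g" and X: "kgood g SX (dual SX)" and Y: "kgood g SY (dual SY)" and Z: "kgood g SZ (dual SZ)"
    and h0: "\<And>x y. x \<in> SX \<Longrightarrow> y \<in> SY \<Longrightarrow> pos x y \<in> SZ"
  shows "extends_bil (ktop SX (dual SX)) (ktop SY (dual SY)) (ktop SZ (dual SZ)) bil"
    and "hypocontinuous (ktop SX (dual SX)) (ktop SY (dual SY)) (ktop SZ (dual SZ)) bil"
proof -
  have fin: "tri x y w < \<infinity>" if "x \<in> SX" "y \<in> SY" "w \<in> dual SZ" for x y w
    unfolding tri_pairing3 using kgoodD(3)[OF Z h0] that by blast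
  have 1: "(\<lambda>i. tri x (delta i) w) \<in> dual SY" if x: "x \<in> dual (dual SX)" and w: "w \<in> dual SZ" for x w
    unfolding tri_slot2_dual
  proof
    fix y assume y: "y \<in> SY"
    have "(\<lambda>i. tri (delta i) y w) \<in> dual SX"
      unfolding tri_slot1_dual using fin y w by blast
    then have "pairing (\<lambda>i. tri (delta i) y w) x < \<infinity>"
      using x unfolding dual_def[of "dual SX"] by blast
    then show "tri x y w < \<infinity>"
      unfolding pairing_commute[of "\<lambda>i. tri (delta i) y w" x] tri_pairing1[symmetric] .
  qed
  have 2: "(\<lambda>i. tri (delta i) y w) \<in> dual SX" if y: "y \<in> dual (dual SY)" and w: "w \<in> dual SZ" for y w
    unfolding tri_slot1_dual
  proof
    fix x assume x: "x \<in> SX"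
    have "(\<lambda>i. tri x (delta i) w) \<in> dual SY"
      unfolding tri_slot2_dual using fin x w by blast
    then have "pairing (\<lambda>i. tri x (delta i) w) y < \<infinity>"
      using y unfolding dual_def[of "dual SY"] by blast
    then show "tri x y w < \<infinity>"
      unfolding pairing_commute[of "\<lambda>i. tri x (delta i) w" y] tri_pairing2[symmetric] .
  qed
  show hypo: "hypocontinuous (ktop SX (dual SX)) (ktop SY (dual SY)) (ktop SZ (dual SZ)) bil"
    by (rule hypocontinuous_bil[OF g X Y Z h0 1 2])
  show "extends_bil (ktop SX (dual SX)) (ktop SY (dual SY)) (ktop SZ (dual SZ)) bil"
    by (rule extends_bil_ktop[OF X Y Z h0]) (use hypo in \<open>simp_all add: hypocontinuous_def\<close>)
qed

text \<open>In \<open>right\<close> and \<open>left\<close> one argument meets all outer conditions,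
  and a single outer parameter \<open>q\<close> serves for the other. This fits both ends: by the
  gliding hump an element of \<open>dual (PI_W _)\<close> meets all outer conditions, and a weight
  in \<open>PI_W\<close> has to be dominated at just one outer parameter.\<close>

lemma PI_spaces:
  assumes g: "nuclear g" and X: "PI_family g \<omega>X" and Y: "PI_family g \<omega>Y" and Z: "PI_family g \<omega>Z"
    and right: "\<And>x \<rho>. (\<And>j. j > 0 \<Longrightarrow> x \<in> Bstep \<omega>X j) \<Longrightarrow> \<rho> > 0 \<Longrightarrow>
      \<exists>q>0. \<forall>y\<in>Bstep \<omega>Y q. pos x y \<in> Bstep \<omega>Z \<rho>"
    and left: "\<And>y \<rho>. (\<And>j. j > 0 \<Longrightarrow> y \<in> Bstep \<omega>Y j) \<Longrightarrow> \<rho> > 0 \<Longrightarrow>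
      \<exists>q>0. \<forall>x\<in>Bstep \<omega>X q. pos x y \<in> Bstep \<omega>Z \<rho>"
  shows "extends_bil (ktop (PI_S \<omega>X) (PI_W \<omega>X)) (ktop (PI_S \<omega>Y) (PI_W \<omega>Y)) (ktop (PI_S \<omega>Z) (PI_W \<omega>Z)) bil"
    and "hypocontinuous (ktop (PI_S \<omega>X) (PI_W \<omega>X)) (ktop (PI_S \<omega>Y) (PI_W \<omega>Y)) (ktop (PI_S \<omega>Z) (PI_W \<omega>Z)) bil"
proof -
  note kX = kgood_PI[OF g X] and kY = kgood_PI[OF g Y] and kZ = kgood_PI[OF g Z]
  have h0: "pos x y \<in> PI_S \<omega>Z" if x: "x \<in> PI_S \<omega>X" and y: "y \<in> PI_S \<omega>Y" for x y
  proof -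
    have x': "x \<in> Bstep \<omega>X j" if "j > 0" for j
      using x that by (simp add: PI_S_eq[OF g X])
    have "pos x y \<in> Bstep \<omega>Z \<rho>" if \<rho>: "\<rho> > 0" for \<rho>
    proof -
      obtain q where "q > 0" "\<forall>y\<in>Bstep \<omega>Y q. pos x y \<in> Bstep \<omega>Z \<rho>"
        using right[OF x' \<rho>] by blast
      then show ?thesis
        using y by (auto simp: PI_S_eq[OF g Y])
    qed
    then show ?thesis
      by (auto simp: PI_S_eq[OF g Z])
  qed
  have pair: "\<exists>\<rho>>0. \<forall>z\<in>Bstep \<omega>Z \<rho>. pairing z w < \<infinity>" if w: "w \<in> PI_W \<omega>Z" for w
  proof -
    obtain j where j: "j > 0" "\<And>n. n > 0 \<Longrightarrow> w \<in> Osp (\<omega>Z j n)"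
      using w by (auto simp: PI_W_def)
    obtain \<rho> where \<rho>: "\<rho> > 0" "Bstep \<omega>Z \<rho> \<subseteq> (\<Union>n\<in>{0<..}. Lsp (\<omega>Z j n))"
      using PI_Bstep_Lsp[OF g Z j(1)] by blast
    have "pairing z w < \<infinity>" if "z \<in> Bstep \<omega>Z \<rho>" for z
    proof -
      have "\<exists>n>0. z \<in> Lsp (\<omega>Z j n)"
        using \<rho>(2) that by auto
      then show ?thesis
        using j(2) pairing_Lsp_Osp by blast
    qed
    with \<rho>(1) show ?thesis
      by blast
  qed
  \<comment> \<open>Testing \<open>v\<close> on the reciprocal of each \<open>\<omega> q n\<close>,
    which belongs to \<open>Bstep \<omega> q\<close>, bounds \<open>v\<close> by a multiple of every
    inner weight.\<close>
  have in_W: "v \<in> PI_W \<omega>" if q: "q > 0" and fin: "\<And>y. y \<in> Bstep \<omega> q \<Longrightarrow> pairing y v < \<infinity>"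
    for v q and \<omega> :: "real \<Rightarrow> real \<Rightarrow> 'i \<Rightarrow> ennreal"
  proof -
    have "v \<in> Osp (\<omega> q n)" if n: "n > 0" for n
    proof -
      have "(\<lambda>i. inverse (\<omega> q n i)) \<in> Bstep \<omega> q"
        using inverse_in_Bsp n by (auto simp: Bstep_def)
      then have C: "pairing (\<lambda>i. inverse (\<omega> q n i)) v < \<infinity>"
        by (rule fin)
      have "v i \<le> (pairing (\<lambda>i. inverse (\<omega> q n i)) v + 1) * \<omega> q n i" for i
        by (rule ennreal_le_mult_inverse[OF le_pairing[of "\<lambda>i. inverse (\<omega> q n i)" i v] C])
      then show ?thesis
        unfolding Osp_def using C by (intro CollectI exI[of _ "pairing (\<lambda>i. inverse (\<omega> q n i)) v + 1"]) auto
    qed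
    then show ?thesis
      using q by (auto simp: PI_W_def)
  qed
  have bidual: "x \<in> Bstep \<omega> j" if \<omega>: "PI_family g \<omega>" and x: "x \<in> dual (PI_W \<omega>)" and j: "j > 0"
    for x j and \<omega> :: "real \<Rightarrow> real \<Rightarrow> 'i \<Rightarrow> ennreal"
    using dual_PI_W[OF \<omega> x finite_dual[OF kgood_PI[OF g \<omega>] x] j] by (auto simp: Bstep_def)
  have 1: "(\<lambda>i. tri x (delta i) w) \<in> PI_W \<omega>Y" if x: "x \<in> dual (PI_W \<omega>X)" and w: "w \<in> PI_W \<omega>Z" for x w
  proof -
    obtain \<rho> where \<rho>: "\<rho> > 0" "\<forall>z\<in>Bstep \<omega>Z \<rho>. pairing z w < \<infinity>"
      using pair[OF w] by blast
    obtain q where q: "q > 0" "\<forall>y\<in>Bstep \<omega>Y q. pos x y \<in> Bstep \<omega>Z \<rho>"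
      using right[OF bidual[OF X x] \<rho>(1)] by blast
    show ?thesis
    proof (rule in_W[OF q(1)])
      fix y assume "y \<in> Bstep \<omega>Y q"
      then show "pairing y (\<lambda>i. tri x (delta i) w) < \<infinity>"
        using q(2) \<rho>(2) unfolding tri_pairing2[symmetric] unfolding tri_pairing3 by blast
    qed
  qed
  have 2: "(\<lambda>i. tri (delta i) y w) \<in> PI_W \<omega>X" if y: "y \<in> dual (PI_W \<omega>Y)" and w: "w \<in> PI_W \<omega>Z" for y w
  proof -
    obtain \<rho> where \<rho>: "\<rho> > 0" "\<forall>z\<in>Bstep \<omega>Z \<rho>. pairing z w < \<infinity>"
      using pair[OF w] by blast
    obtain q where q: "q > 0" "\<forall>x\<in>Bstep \<omega>X q. pos x y \<in> Bstep \<omega>Z \<rho>"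
      using left[OF bidual[OF Y y] \<rho>(1)] by blast
    show ?thesis
    proof (rule in_W[OF q(1)])
      fix x assume "x \<in> Bstep \<omega>X q"
      then show "pairing x (\<lambda>i. tri (delta i) y w) < \<infinity>"
        using q(2) \<rho>(2) unfolding tri_pairing1[symmetric] unfolding tri_pairing3 by blast
    qed
  qed
  show hypo: "hypocontinuous (ktop (PI_S \<omega>X) (PI_W \<omega>X)) (ktop (PI_S \<omega>Y) (PI_W \<omega>Y)) (ktop (PI_S \<omega>Z) (PI_W \<omega>Z)) bil"
    by (rule hypocontinuous_bil[OF g kX kY kZ h0 1 2])
  show "extends_bil (ktop (PI_S \<omega>X) (PI_W \<omega>X)) (ktop (PI_S \<omega>Y) (PI_W \<omega>Y)) (ktop (PI_S \<omega>Z) (PI_W \<omega>Z)) bil"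
    by (rule extends_bil_ktop[OF kX kY kZ h0]) (use hypo in \<open>simp_all add: hypocontinuous_def\<close>)
qed

text \<open>For a positive kernel a product bound on pairs of unit sequences extends to all pairs by
  summation in each slot.\<close>

lemma joint_spaces:
  assumes k: "kgood g S W" and h0: "\<And>x y. x \<in> S \<Longrightarrow> y \<in> S \<Longrightarrow> pos x y \<in> S"
    and hj: "\<And>w. w \<in> W \<Longrightarrow> \<exists>v1\<in>W. \<exists>v2\<in>W. \<forall>i j. tri (delta i) (delta j) w \<le> v1 i * v2 j"
  shows "extends_bil (ktop S W) (ktop S W) (ktop S W) bil"
    and "jointly_continuous (ktop S W) (ktop S W) (ktop S W) bil"
proof -
  have hj': "\<exists>v1\<in>W. \<exists>v2\<in>W. \<forall>x y. tri x y w \<le> pairing x v1 * pairing y v2" if w: "w \<in> W" for w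
  proof -
    obtain v1 v2 where v: "v1 \<in> W" "v2 \<in> W" "\<And>i j. tri (delta i) (delta j) w \<le> v1 i * v2 j"
      using hj[OF w] by blast
    have "tri x y w \<le> pairing x v1 * pairing y v2" for x y
    proof -
      have "tri (delta i) y w \<le> pairing y v2 * v1 i" for i
      proof -
        have "tri (delta i) y w \<le> pairing y (\<lambda>j. v1 i * v2 j)"
          unfolding tri_pairing2[of _ y] by (intro pairing_mono v) simp
        then show ?thesis
          by (simp add: pairing_cmult_right mult.commute)
      qed
      then have "tri x y w \<le> pairing x (\<lambda>i. pairing y v2 * v1 i)"
        unfolding tri_pairing1[of x] by (intro pairing_mono) auto
      also have "\<dots> = pairing y v2 * pairing x v1"
        by (rule pairing_cmult_right)
      also have "\<dots> = pairing x v1 * pairing y v2"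
        by (rule mult.commute)
      finally show ?thesis .
    qed
    with v(1,2) show ?thesis
      by blast
  qed
  note W = kgoodD(2)[OF k]
  have 1: "(\<lambda>i. tri x (delta i) w) \<in> W" if x: "x \<in> S" and w: "w \<in> W" for x w
  proof -
    obtain v1 v2 where v: "v1 \<in> W" "v2 \<in> W" "\<And>x y. tri x y w \<le> pairing x v1 * pairing y v2"
      using hj'[OF w] by blast
    show ?thesis
      by (rule wcone_solid[OF W wcone_cmult[OF W v(2) kgoodD(3)[OF k x v(1)]]])
        (use v(3)[of x "delta _"] in simp)
  qed
  have 2: "(\<lambda>i. tri (delta i) y w) \<in> W" if y: "y \<in> S" and w: "w \<in> W" for y w
  proof -
    obtain v1 v2 where v: "v1 \<in> W" "v2 \<in> W" "\<And>x y. tri x y w \<le> pairing x v1 * pairing y v2"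
      using hj'[OF w] by blast
    show ?thesis
      by (rule wcone_solid[OF W wcone_cmult[OF W v(1) kgoodD(3)[OF k y v(2)]]])
        (use v(3)[of "delta _" y] in \<open>simp add: mult.commute\<close>)
  qed
  show "extends_bil (ktop S W) (ktop S W) (ktop S W) bil"
    by (rule extends_bil_ktop[OF k k k h0 separately_continuous_bil[OF k k k h0 1 2]])
  show "jointly_continuous (ktop S W) (ktop S W) (ktop S W) bil"
    by (rule jointly_continuous_bil[OF k k k h0 hj'])
qed

text \<open>The value at the reciprocals of \<open>u\<close> is a sum of nonnegative terms, and a
  single one of them is \<open>tri (delta i) (delta j) w\<close> divided by
  \<open>u i * u j\<close>. One finite value thus yields a bound for all unit pairs.\<close>

lemma tri_delta_le:
  assumes "tri (\<lambda>i. inverse (u i)) (\<lambda>i. inverse (u i)) w \<le> C" "C < \<infinity>" "\<And>i. 0 < u i"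
  shows "tri (delta i) (delta j) w \<le> (C + 1) * (u i * u j)"
proof (rule ennreal_le_mult_inverse[OF _ assms(2)])
  have "inverse (u j) * tri (delta i) (delta j) w \<le> tri (delta i) (\<lambda>i. inverse (u i)) w" for i
    using le_pairing[of "\<lambda>i. inverse (u i)" j "\<lambda>j. tri (delta i) (delta j) w"] tri_pairing2[of "delta i" "\<lambda>i. inverse (u i)" w]
    by simp
  then have "inverse (u i) * (inverse (u j) * tri (delta i) (delta j) w) \<le> inverse (u i) * tri (delta i) (\<lambda>i. inverse (u i)) w"
    by (intro mult_left_mono) auto
  also have "\<dots> \<le> tri (\<lambda>i. inverse (u i)) (\<lambda>i. inverse (u i)) w"
    using le_pairing[of "\<lambda>i. inverse (u i)" i "\<lambda>i. tri (delta i) (\<lambda>i. inverse (u i)) w"]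
      tri_pairing1[of "\<lambda>i. inverse (u i)" "\<lambda>i. inverse (u i)" w] by simp
  also note assms(1)
  finally show "inverse (u i * u j) * tri (delta i) (delta j) w \<le> C"
    using assms(3) by (simp add: ennreal_inverse_mult' mult.assoc)
qed

text \<open>The lower bounds by 1 exclude a product of 0 and infinity, so the infima can be taken
  out one after the other by division.\<close>

lemma le_INF_mult_INF:
  fixes a :: "real \<Rightarrow> ennreal"
  assumes le: "\<And>r s. r \<in> R \<Longrightarrow> s \<in> R \<Longrightarrow> K \<le> a r * b s"
    and a: "1 \<le> (INF r\<in>R. a r)" and b: "1 \<le> (INF s\<in>R. b s)"
  shows "K \<le> (INF r\<in>R. a r) * (INF s\<in>R. b s)"
proof -
  have div: "K \<le> u * (INF r\<in>R. f r)" if "\<And>r. r \<in> R \<Longrightarrow> K \<le> u * f r" "1 \<le> u" "1 \<le> (INF r\<in>R. f r)"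
    for u and f :: "real \<Rightarrow> ennreal"
  proof (cases "u = top")
    case True
    have "(INF r\<in>R. f r) \<noteq> 0"
      using that(3) by auto
    then show ?thesis
      unfolding True by (simp add: ennreal_top_mult)
  next
    case False
    have u: "0 < u" "u < top"
      using that(2) False by (auto simp: less_top intro: order_less_le_trans[of 0 1])
    have "K / u \<le> f r" if "r \<in> R" for r
      using \<open>\<And>r. r \<in> R \<Longrightarrow> K \<le> u * f r\<close>[OF that] u by (intro divide_le_posI_ennreal) auto
    then have "K / u \<le> (INF r\<in>R. f r)"
      by (rule INF_greatest)
    then have "u * (K / u) \<le> u * (INF r\<in>R. f r)"
      by (rule mult_left_mono) simp
    moreover have "u * (K / u) = K"
    proof -
      have "u * (K / u) = K * (inverse u * u)"
        by (simp add: divide_ennreal_def ac_simps)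
      then show ?thesis
        using ennreal_inverse_cancel[of u] u by simp
    qed
    ultimately show ?thesis
      by simp
  qed
  have "K \<le> a r * (INF s\<in>R. b s)" if "r \<in> R" for r
    by (rule div[OF le[OF that] _ b]) (use a that in \<open>auto intro: order_trans INF_lower\<close>)
  then have "K \<le> (INF s\<in>R. b s) * (INF r\<in>R. a r)"
    by (intro div) (auto simp: mult.commute a b)
  then show ?thesis
    by (simp add: mult.commute)
qed

text \<open>A weight of the space is dominated at one parameter, so a single
  \<open>\<omega> r\<close> serves on both sides; evaluating the kernel at its reciprocals gives the
  product bound.\<close>

lemma joint_proj:
  assumes g: "nuclear g" and \<omega>: "PI_family g (\<lambda>j _. \<omega> j)" and pos: "\<And>r i. r > 0 \<Longrightarrow> 0 < \<omega> r i"
    and step: "\<And>\<rho>. \<rho> > 0 \<Longrightarrow> \<exists>r>0. \<forall>x\<in>Bsp (\<omega> r). \<forall>y\<in>Bsp (\<omega> r). pos x y \<in> Bsp (\<omega> \<rho>)"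
  defines "X \<equiv> ktop (PI_S (\<lambda>j _. \<omega> j)) (PI_W (\<lambda>j _. \<omega> j))"
  shows "extends_bil X X X bil" and "jointly_continuous X X X bil"
proof -
  note k = kgood_PI[OF g \<omega>]
  have S: "PI_S (\<lambda>j _. \<omega> j) = (\<Inter>j\<in>{0<..}. Bsp (\<omega> j))"
    using PI_S_eq[OF g \<omega>] by (auto simp: Bstep_def)
  have h0: "kernel.pos c p1 p2 p3 x y \<in> PI_S (\<lambda>j _. \<omega> j)" if xy: "x \<in> PI_S (\<lambda>j _. \<omega> j)" "y \<in> PI_S (\<lambda>j _. \<omega> j)" for x y
  proof -
    have "kernel.pos c p1 p2 p3 x y \<in> Bsp (\<omega> \<rho>)" if \<rho>: "\<rho> > 0" for \<rho>
    proof -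
      obtain r where "r > 0" "\<forall>x\<in>Bsp (\<omega> r). \<forall>y\<in>Bsp (\<omega> r). kernel.pos c p1 p2 p3 x y \<in> Bsp (\<omega> \<rho>)"
        using step[OF \<rho>] by blast
      then show ?thesis
        using xy unfolding S by auto
    qed
    then show ?thesis
      unfolding S by auto
  qed
  have hj: "\<exists>v1\<in>PI_W (\<lambda>j _. \<omega> j). \<exists>v2\<in>PI_W (\<lambda>j _. \<omega> j). \<forall>i j. tri (delta i) (delta j) w \<le> v1 i * v2 j"
    if w: "w \<in> PI_W (\<lambda>j _. \<omega> j)" for w
  proof -
    obtain j where j: "j > 0" "w \<in> Osp (\<omega> j)"
      using w by (auto simp: PI_W_def)
    obtain \<rho> where \<rho>: "\<rho> > 0" "Bsp (\<omega> \<rho>) \<subseteq> Lsp (\<omega> j)"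
      using PI_Bstep_Lsp[OF g \<omega> j(1)] by (auto simp: Bstep_def)
    obtain r where r: "r > 0" "\<forall>x\<in>Bsp (\<omega> r). \<forall>y\<in>Bsp (\<omega> r). kernel.pos c p1 p2 p3 x y \<in> Bsp (\<omega> \<rho>)"
      using step[OF \<rho>(1)] by blast
    have "kernel.pos c p1 p2 p3 (\<lambda>i. inverse (\<omega> r i)) (\<lambda>i. inverse (\<omega> r i)) \<in> Lsp (\<omega> j)"
      using r(2) \<rho>(2) inverse_in_Bsp[of "\<omega> r"] by blast
    then have C: "tri (\<lambda>i. inverse (\<omega> r i)) (\<lambda>i. inverse (\<omega> r i)) w < \<infinity>" (is "?C < _")
      unfolding tri_pairing3 using pairing_Lsp_Osp[OF _ j(2)] by blast
    have le: "tri (delta i) (delta k) w \<le> ((?C + 1) * \<omega> r i) * \<omega> r k" for i k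
      using tri_delta_le[OF order_refl C pos[OF r(1)], of i k] by (simp add: mult.assoc)
    have v: "\<omega> r \<in> PI_W (\<lambda>j _. \<omega> j)"
      using r(1) self_in_Osp by (auto simp: PI_W_def)
    have v': "(\<lambda>i. (?C + 1) * \<omega> r i) \<in> PI_W (\<lambda>j _. \<omega> j)"
      by (rule wcone_cmult[OF kgoodD(2)[OF k] v]) (use C in simp)
    show ?thesis
      by (rule bexI[where x = "\<lambda>i. (?C + 1) * \<omega> r i", OF _ v'], rule bexI[where x = "\<omega> r", OF _ v],
        intro allI, rule le)
  qed
  show "extends_bil X X X bil" "jointly_continuous X X X bil"
    unfolding X_def by (rule joint_spaces[OF k h0 hj], assumption+)+
qed

text \<open>A weight must now be dominated by every \<open>\<omega> r\<close> at once, which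
  suggests the infimum of multiples \<open>A r * \<omega> r\<close>. In a mixed product of two
  parameters the smaller of the two weights is used in both slots; this is where the chain property
  enters.\<close>

lemma joint_ind:
  assumes g: "nuclear g" and \<omega>: "PI_family g (\<lambda>_. \<omega>)"
    and low: "\<And>r. r > 0 \<Longrightarrow> \<exists>a>0. \<forall>i. a \<le> \<omega> r i"
    and step: "\<And>r x y. r > 0 \<Longrightarrow> x \<in> Bsp (\<omega> r) \<Longrightarrow> y \<in> Bsp (\<omega> r) \<Longrightarrow> \<exists>\<rho>>0. pos x y \<in> Bsp (\<omega> \<rho>)"
  defines "X \<equiv> ktop (PI_S (\<lambda>_. \<omega>)) (PI_W (\<lambda>_. \<omega>))"
  shows "extends_bil X X X bil" and "jointly_continuous X X X bil"
proof -
  note k = kgood_PI[OF g \<omega>]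
  have S: "PI_S (\<lambda>_. \<omega>) = (\<Union>n\<in>{0<..}. Bsp (\<omega> n))"
    using PI_S_eq[OF g \<omega>] by (auto simp: Bstep_def)
  have W: "PI_W (\<lambda>_. \<omega>) = (\<Inter>n\<in>{0<..}. Osp (\<omega> n))"
    by (auto simp: PI_W_def)
  have chain: "(\<forall>i. \<omega> r i \<le> \<omega> s i) \<or> (\<forall>i. \<omega> s i \<le> \<omega> r i)" if "r > 0" "s > 0" for r s
    using monotone_familyD2[OF PI_familyD(1)[OF \<omega>] that] zero_less_one[where 'a = real] by blast
  have h0: "kernel.pos c p1 p2 p3 x y \<in> PI_S (\<lambda>_. \<omega>)" if xy: "x \<in> PI_S (\<lambda>_. \<omega>)" "y \<in> PI_S (\<lambda>_. \<omega>)" for x y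
  proof -
    obtain r s where rs: "r > 0" "x \<in> Bsp (\<omega> r)" "s > 0" "y \<in> Bsp (\<omega> s)"
      using xy unfolding S by auto
    have "\<exists>q>0. x \<in> Bsp (\<omega> q) \<and> y \<in> Bsp (\<omega> q)"
      using chain[OF rs(1,3)]
    proof
      assume "\<forall>i. \<omega> r i \<le> \<omega> s i"
      then show ?thesis
        using Bsp_antimono[of "\<omega> r" "\<omega> s"] rs by blast
    next
      assume "\<forall>i. \<omega> s i \<le> \<omega> r i"
      then show ?thesis
        using Bsp_antimono[of "\<omega> s" "\<omega> r"] rs by blast
    qed
    then obtain q where "q > 0" "x \<in> Bsp (\<omega> q)" "y \<in> Bsp (\<omega> q)"
      by blast
    from step[OF this] show ?thesis
      unfolding S by auto
  qed
  have hj: "\<exists>v1\<in>PI_W (\<lambda>_. \<omega>). \<exists>v2\<in>PI_W (\<lambda>_. \<omega>). \<forall>i j. tri (delta i) (delta j) w \<le> v1 i * v2 j"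
    if w: "w \<in> PI_W (\<lambda>_. \<omega>)" for w
  proof -
    \<comment> \<open>Three demands on one constant: the product bound for unit sequences, a lower
      bound that keeps the infimum at least 1, and \<open>1 \<le> A\<close> for replacing a weight
      by a larger one in mixed products.\<close>
    have "\<exists>A<\<infinity>. (\<forall>i j. tri (delta i) (delta j) w \<le> A * (\<omega> r i * \<omega> r j)) \<and> (\<forall>i. 1 \<le> A * \<omega> r i) \<and> 1 \<le> A"
      if r: "r > 0" for r
    proof -
      obtain a where a: "a > 0" "\<And>i. a \<le> \<omega> r i"
        using low[OF r] by blast
      have pos_r: "0 < \<omega> r i" for i
        using a(1) a(2)[of i] by (rule order_less_le_trans)
      have inS: "(\<lambda>i. inverse (\<omega> r i)) \<in> PI_S (\<lambda>_. \<omega>)"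
        unfolding S using inverse_in_Bsp r by auto
      have C: "tri (\<lambda>i. inverse (\<omega> r i)) (\<lambda>i. inverse (\<omega> r i)) w < \<infinity>" (is "?C < _")
        unfolding tri_pairing3 by (rule kgoodD(3)[OF k h0[OF inS inS] w])
      have inv: "inverse a < \<infinity>"
        using a(1) by (auto simp: less_top[symmetric])
      have one: "1 \<le> (inverse a + 1) * \<omega> r i" for i
      proof (cases "a = top")
        case True
        then have "\<omega> r i = top"
          using a(2)[of i] by (simp add: top_unique)
        then show ?thesis
          by (simp add: ennreal_mult_top)
      next
        case False
        have "1 = inverse a * a"
          using ennreal_inverse_cancel[of a] a(1) False by (simp add: less_top)
        also have "\<dots> \<le> (inverse a + 1) * \<omega> r i"
          by (intro mult_mono a(2)) auto
        finally show ?thesis .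
      qed
      have "1 \<le> (?C + 1 + (inverse a + 1)) * \<omega> r i" for i
        by (rule order_trans[OF one[of i]]) (rule mult_right_mono, rule add_increasing, simp_all)
      moreover have "tri (delta i) (delta j) w \<le> (?C + 1 + (inverse a + 1)) * (\<omega> r i * \<omega> r j)" for i j
        by (rule order_trans[OF tri_delta_le[OF order_refl C pos_r]]) (rule mult_right_mono, rule add_increasing2, simp_all)
      moreover have "?C + 1 + (inverse a + 1) < \<infinity>"
        using C inv by simp
      moreover have "1 \<le> ?C + 1 + (inverse a + 1)"
        unfolding le_iff_add by (rule exI[of _ "?C + (inverse a + 1)"]) (simp only: ac_simps)
      ultimately show ?thesis
        by blast
    qed
    then obtain A where A: "\<And>r. r > 0 \<Longrightarrow> A r < \<infinity>"
      "\<And>r i j. r > 0 \<Longrightarrow> tri (delta i) (delta j) w \<le> A r * (\<omega> r i * \<omega> r j)"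
      "\<And>r i. r > 0 \<Longrightarrow> 1 \<le> A r * \<omega> r i" "\<And>r. r > 0 \<Longrightarrow> 1 \<le> A r"
      by metis
    define v where "v i = (INF r\<in>{0<..}. A r * \<omega> r i)" for i
    have v: "v \<in> PI_W (\<lambda>_. \<omega>)"
      unfolding W
    proof
      fix r :: real assume "r \<in> {0<..}"
      then show "v \<in> Osp (\<omega> r)"
        unfolding Osp_def using A(1)[of r] by (intro CollectI exI[of _ "A r"]) (auto simp: v_def intro: INF_lower)
    qed
    have "tri (delta i) (delta j) w \<le> v i * v j" for i j
      unfolding v_def
    proof (rule le_INF_mult_INF)
      fix r s :: real assume "r \<in> {0<..}" "s \<in> {0<..}"
      then have rs: "r > 0" "s > 0"
        by auto
      from chain[OF this] show "tri (delta i) (delta j) w \<le> A r * \<omega> r i * (A s * \<omega> s j)"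
      proof
        assume le: "\<forall>i. \<omega> r i \<le> \<omega> s i"
        have "tri (delta i) (delta j) w \<le> A r * (\<omega> r i * \<omega> r j)"
          by (rule A(2)[OF rs(1)])
        also have "\<dots> = A r * \<omega> r i * (1 * \<omega> r j)"
          by (simp add: mult.assoc)
        also have "\<dots> \<le> A r * \<omega> r i * (A s * \<omega> s j)"
          using le A(4)[OF rs(2)] by (intro mult_left_mono mult_mono) auto
        finally show ?thesis .
      next
        assume le: "\<forall>i. \<omega> s i \<le> \<omega> r i"
        have "tri (delta i) (delta j) w \<le> A s * (\<omega> s i * \<omega> s j)"
          by (rule A(2)[OF rs(2)])
        also have "\<dots> = 1 * \<omega> s i * (A s * \<omega> s j)"
          by (simp add: ac_simps)
        also have "\<dots> \<le> A r * \<omega> r i * (A s * \<omega> s j)"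
          using le A(4)[OF rs(1)] by (intro mult_right_mono mult_mono) auto
        finally show ?thesis .
      qed
    qed (auto intro!: INF_greatest A(3))
    then show ?thesis
      using v by (intro bexI[of _ v]) simp_all
  qed
  show "extends_bil X X X bil" "jointly_continuous X X X bil"
    unfolding X_def by (rule joint_spaces[OF k h0 hj], assumption+)+
qed

end

section \<open>Multi-indices\<close>

lemma nn_integral_count_space_le:
  fixes f :: "'i::countable \<Rightarrow> ennreal"
  assumes "\<And>F. finite F \<Longrightarrow> sum f F \<le> C"
  shows "(\<integral>\<^sup>+i. f i \<partial>count_space UNIV) \<le> C"
proof (rule ccontr)
  assume neg: "\<not> ?thesis"
  define h where "h n i = f i * indicator {i. to_nat i < n} i" for n :: nat and i
  have inc: "incseq h"
    by (auto simp: incseq_def le_fun_def h_def indicator_def)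
  have "(SUP n. h n i) = f i" for i
  proof (rule antisym)
    show "(SUP n. h n i) \<le> f i"
      by (rule SUP_least) (auto simp: h_def indicator_def)
    show "f i \<le> (SUP n. h n i)"
      by (rule SUP_upper2[of "Suc (to_nat i)"]) (auto simp: h_def indicator_def)
  qed
  then have "(\<integral>\<^sup>+i. f i \<partial>count_space UNIV) = (SUP n. \<integral>\<^sup>+i. h n i \<partial>count_space UNIV)"
    using nn_integral_monotone_convergence_SUP[of h "count_space UNIV"] inc by simp
  also have "\<dots> \<le> C"
  proof (rule SUP_least)
    fix n
    have fin: "finite {i::'i. to_nat i < n}"
      by (rule finite_imageD[of to_nat]) (auto intro: finite_subset[of _ "{..<n}"] inj_on_subset[OF inj_to_nat])
    have "(\<integral>\<^sup>+i. h n i \<partial>count_space UNIV) = sum f {i. to_nat i < n}"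
      using fin by (subst nn_integral_count_space'[where A = "{i. to_nat i < n}"]) (auto simp: h_def)
    then show "(\<integral>\<^sup>+i. h n i \<partial>count_space UNIV) \<le> C"
      using assms[OF fin] by simp
  qed
  finally show False
    using neg by simp
qed

lemma nn_integral_prod:
  "(\<integral>\<^sup>+p. f (fst p) * h (snd p) \<partial>count_space UNIV) =
    (\<integral>\<^sup>+x. f x \<partial>count_space UNIV) * (\<integral>\<^sup>+y. h y \<partial>count_space UNIV)"
proof -
  have "(\<integral>\<^sup>+p. f (fst p) * h (snd p) \<partial>count_space UNIV) =
      (\<integral>\<^sup>+x. \<integral>\<^sup>+y. f x * h y \<partial>count_space UNIV \<partial>count_space UNIV)"
    using nn_integral_fst_count_space[of "\<lambda>p. f (fst p) * h (snd p)"] by simp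
  also have "\<dots> = (\<integral>\<^sup>+x. f x \<partial>count_space UNIV) * (\<integral>\<^sup>+y. h y \<partial>count_space UNIV)"
    by (simp add: nn_integral_cmult nn_integral_multc)
  finally show ?thesis .
qed

section \<open>Lengths of multi-indices and geometric sums\<close>

lemma mlen_zero [simp]: "mlen 0 = 0"
  by (simp add: mlen_def)

lemma mlen_add: "mlen (\<alpha> + \<beta>) = mlen \<alpha> + mlen \<beta>"
  by (simp add: mlen_def sum.distrib)

lemma component_le_mlen: "\<alpha> $ i \<le> mlen \<alpha>"
  unfolding mlen_def by (rule member_le_sum) auto

lemma finite_mindex_le: "finite {\<beta>::('d::finite) mindex. \<beta> \<le> \<alpha>}"
proof (rule finite_subset)
  show "{\<beta>. \<beta> \<le> \<alpha>} \<subseteq> vec_lambda ` (Pi\<^sub>E UNIV (\<lambda>i. {..\<alpha> $ i}))"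
  proof
    fix \<beta> assume "\<beta> \<in> {\<beta>. \<beta> \<le> \<alpha>}"
    then have "vec_nth \<beta> \<in> Pi\<^sub>E UNIV (\<lambda>i. {..\<alpha> $ i})"
      by (auto simp: less_eq_vec_def)
    then show "\<beta> \<in> vec_lambda ` (Pi\<^sub>E UNIV (\<lambda>i. {..\<alpha> $ i}))"
      by (intro image_eqI[of _ _ "vec_nth \<beta>"]) auto
  qed
  show "finite (vec_lambda ` (Pi\<^sub>E UNIV (\<lambda>i. {..\<alpha> $ i})))"
    by (intro finite_imageI finite_PiE) auto
qed

text \<open>A finite set of multi-indices lies in a box, and over a box the sum factors into one
  geometric sum per coordinate.\<close>

lemma sum_power_mlen_le:
  fixes q :: real and F :: "('d::finite) mindex set"
  assumes q: "0 \<le> q" "q < 1" and F: "finite F"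
  shows "(\<Sum>\<alpha>\<in>F. q ^ mlen \<alpha>) \<le> (1 / (1 - q)) ^ CARD('d)"
proof -
  define N where "N = (\<Sum>\<alpha>\<in>F. mlen \<alpha>)"
  have N: "\<alpha> $ i \<le> N" if "\<alpha> \<in> F" for \<alpha> i
    using component_le_mlen[of \<alpha> i] member_le_sum[OF that, of mlen] F unfolding N_def by fastforce
  have "(\<Sum>\<alpha>\<in>F. q ^ mlen \<alpha>) = (\<Sum>\<alpha>\<in>F. \<Prod>i\<in>UNIV. q ^ (vec_nth \<alpha> i))"
    by (simp add: mlen_def power_sum)
  also have "\<dots> = (\<Sum>f\<in>vec_nth ` F. \<Prod>i\<in>UNIV. q ^ f i)"
    by (subst sum.reindex) (auto simp: inj_on_def vec_nth_inject)
  also have "\<dots> \<le> (\<Sum>f\<in>Pi\<^sub>E (UNIV::'d set) (\<lambda>_. {..N}). \<Prod>i\<in>UNIV. q ^ f i)"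
  proof (rule sum_mono2)
    show "finite (Pi\<^sub>E (UNIV::'d set) (\<lambda>_. {..N}))"
      by (intro finite_PiE) auto
    show "vec_nth ` F \<subseteq> Pi\<^sub>E (UNIV::'d set) (\<lambda>_. {..N})"
      using N by auto
    show "0 \<le> (\<Prod>i\<in>UNIV. q ^ f i)" for f :: "'d \<Rightarrow> nat"
      using q by (intro prod_nonneg) auto
  qed
  also have "\<dots> = (\<Prod>i\<in>(UNIV::'d set). \<Sum>k\<le>N. q ^ k)"
    by (subst prod_sum_PiE) auto
  also have "\<dots> \<le> (\<Prod>i\<in>(UNIV::'d set). 1 / (1 - q))"
  proof (intro prod_mono conjI)
    show "(\<Sum>k\<le>N. q ^ k) \<le> 1 / (1 - q)"
      using sum_le_suminf[of "\<lambda>k. q ^ k" "{..N}"] q by (simp add: suminf_geometric summable_geometric)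
  qed (use q in \<open>auto intro: sum_nonneg\<close>)
  finally show ?thesis
    by simp
qed

lemma nn_integral_power_mlen:
  assumes q: "0 \<le> q" "q < (1::real)"
  shows "(\<integral>\<^sup>+\<alpha>. ennreal (q ^ mlen (\<alpha>::('d::finite) mindex)) \<partial>count_space UNIV) < \<infinity>"
proof -
  have "(\<integral>\<^sup>+\<alpha>. ennreal (q ^ mlen (\<alpha>::'d mindex)) \<partial>count_space UNIV) \<le> ennreal ((1 / (1 - q)) ^ CARD('d))"
  proof (rule nn_integral_count_space_le)
    fix F :: "'d mindex set" assume "finite F"
    then show "(\<Sum>\<alpha>\<in>F. ennreal (q ^ mlen \<alpha>)) \<le> ennreal ((1 / (1 - q)) ^ CARD('d))"
      using sum_power_mlen_le[OF q] q by (simp add: ennreal_leI)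
  qed
  then show ?thesis
    by (rule order_le_less_trans) simp
qed

text \<open>The concrete factor \<open>g\<close>. Its ratio 1/2 is matched by the requirement
  \<open>2 \<le> R\<close> on the weights, which lets a change of parameters gain it.\<close>

definition decay :: "('d::finite) dindex \<Rightarrow> ennreal" where
  "decay = (\<lambda>(\<alpha>, \<beta>). ennreal ((1 / 2) ^ (mlen \<alpha> + mlen \<beta>)))"

lemma nn_integral_power_mlen2:
  assumes q: "0 \<le> q" "q < (1::real)"
  shows "(\<integral>\<^sup>+x. ennreal (q ^ (mlen (fst x) + mlen (snd x))) \<partial>count_space (UNIV :: ('d::finite) dindex set)) < \<infinity>"
proof -
  have "(\<integral>\<^sup>+x. ennreal (q ^ (mlen (fst x) + mlen (snd x))) \<partial>count_space (UNIV :: 'd dindex set)) =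
      (\<integral>\<^sup>+x. ennreal (q ^ mlen (fst x)) * ennreal (q ^ mlen (snd x)) \<partial>count_space (UNIV :: 'd dindex set))"
    using q by (simp add: power_add ennreal_mult)
  also have "\<dots> < \<infinity>"
    unfolding nn_integral_prod[of "\<lambda>\<alpha>. ennreal (q ^ mlen \<alpha>)" "\<lambda>\<alpha>. ennreal (q ^ mlen \<alpha>)"]
    by (intro ennreal_mult_finite nn_integral_power_mlen q)
  finally show ?thesis .
qed

lemma nuclear_decay: "nuclear (decay :: ('d::finite) dindex \<Rightarrow> ennreal)"
  unfolding nuclear_def
proof (intro conjI allI impI)
  fix i :: "'d dindex"
  show "0 < decay i" "decay i < \<infinity>"
    by (auto simp: decay_def split: prod.splits)
next
  show "pairing (decay :: 'd dindex \<Rightarrow> ennreal) (\<lambda>_. 1) < \<infinity>"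
    using nn_integral_power_mlen2[of "1/2", where 'd = 'd]
    by (simp only: pairing_def decay_def case_prod_beta mult_1_right)
next
  fix p :: ennreal assume p: "0 < p"
  show "lp_norm p (decay :: 'd dindex \<Rightarrow> ennreal) < \<infinity>"
  proof (cases "p = \<infinity>")
    case True
    have "(SUP i. (decay :: 'd dindex \<Rightarrow> ennreal) i) \<le> 1"
      by (rule SUP_least) (auto simp: decay_def power_le_one split: prod.splits)
    then show ?thesis
      using True by (simp add: lp_norm_def order_le_less_trans)
  next
    case False
    define P where "P = enn2real p"
    have P: "0 < P"
      using p False by (simp add: P_def enn2real_positive_iff less_top)
    \<comment> \<open>Powers of a geometric sequence are again geometric, with ratio
      \<open>q < 1\<close> for every positive \<open>P\<close>.\<close>
    define q :: real where "q = (1 / 2) powr P"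
    have q: "0 \<le> q" "q < 1"
      using P powr_less_mono2[of P "1/2" 1] by (auto simp: q_def)
    have eq: "ennpow (decay i) P = ennreal (q ^ (mlen (fst i) + mlen (snd i)))" for i :: "'d dindex"
      by (cases i) (simp add: decay_def ennpow_def q_def powr_power powr_realpow[symmetric] powr_powr mult.commute)
    have "(\<Sum>\<^sub>\<infinity>i. ennpow ((decay :: 'd dindex \<Rightarrow> ennreal) i) P) \<le>
        (\<integral>\<^sup>+x. ennreal (q ^ (mlen (fst x) + mlen (snd x))) \<partial>count_space (UNIV :: 'd dindex set))"
      unfolding eq by (rule infsum_ennreal_le, rule sum_le_nn_integral_count_space)
    also have "\<dots> < \<infinity>"
      by (rule nn_integral_power_mlen2[OF q])
    finally show ?thesis
      using False by (simp add: lp_norm_def ennpow_finite P_def)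
  qed
qed

section \<open>The kernel of \<open>U\<^bsub>t,#\<^esub>\<close>\<close>

type_synonym 'd quint = "('d mindex \<times> 'd mindex) \<times> ('d mindex \<times> 'd mindex) \<times> 'd mindex"

text \<open>
  A summand of \<open>U\<close> is indexed by \<open>((a, a'), (b, b'), \<gamma>)\<close>, where \<open>a = \<alpha>\<^sub>0\<close>, \<open>a' = \<alpha> - \<alpha>\<^sub>0\<close>, \<open>b = \<beta> - \<beta>\<^sub>0\<close>
  and \<open>b' = \<beta>\<^sub>0\<close>. In these variables all five components are free.
\<close>

definition arg1 :: "('d::finite) quint \<Rightarrow> 'd dindex" where
  "arg1 = (\<lambda>((a, a'), (b, b'), \<gamma>). (a, b + \<gamma>))"

definition arg2 :: "('d::finite) quint \<Rightarrow> 'd dindex" where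
  "arg2 = (\<lambda>((a, a'), (b, b'), \<gamma>). (a' + \<gamma>, b'))"

definition arg3 :: "('d::finite) quint \<Rightarrow> 'd dindex" where
  "arg3 = (\<lambda>((a, a'), (b, b'), \<gamma>). (a + a', b + b'))"

definition coef :: "complex \<Rightarrow> ('d::finite) quint \<Rightarrow> complex" where
  "coef t = (\<lambda>((a, a'), (b, b'), \<gamma>).
     complex_of_real (sqrt (real (mbinom (a + a') a * mbinom (b + b') b' * mbinom (a' + \<gamma>) \<gamma> * mbinom (b + \<gamma>) \<gamma>)))
       * t ^ mlen \<gamma>)"

definition qlen :: "('d::finite) quint \<Rightarrow> nat" where
  "qlen = (\<lambda>((a, a'), (b, b'), \<gamma>). mlen a + mlen a' + (mlen b + mlen b') + mlen \<gamma>)"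

text \<open>The summation set corresponds bijectively to the fibre of \<open>arg3\<close> over the
  target index, since componentwise subtraction inverts addition under the order constraints.
  Reindexing a possibly divergent \<open>infsum\<close> is harmless, so equality holds for all
  sequences.\<close>

lemma U_sharp_eq_bil: "U_sharp t x y = kernel.bil (coef t) arg1 arg2 arg3 x y"
proof
  fix \<nu> :: "'a dindex"
  obtain \<alpha> \<beta> where \<nu>: "\<nu> = (\<alpha>, \<beta>)"
    by fastforce
  define h :: "'a mindex \<times> 'a mindex \<times> 'a mindex \<Rightarrow> 'a quint"
    where "h = (\<lambda>(\<alpha>\<^sub>0, \<beta>\<^sub>0, \<gamma>). ((\<alpha>\<^sub>0, \<alpha> - \<alpha>\<^sub>0), (\<beta> - \<beta>\<^sub>0, \<beta>\<^sub>0), \<gamma>))"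
  have add: "a + (\<alpha> - a) = \<alpha>" "\<alpha> - a + a = \<alpha>" if "a \<le> \<alpha>" for a \<alpha> :: "'a mindex"
    using that by (auto simp: vec_eq_iff less_eq_vec_def)
  have cancel: "a + b - a = b" "a + b - b = a" "a \<le> a + b" "b \<le> a + b" for a b :: "'a mindex"
    by (auto simp: vec_eq_iff less_eq_vec_def)
  have bij: "bij_betw h {(\<alpha>\<^sub>0, \<beta>\<^sub>0, \<gamma>). \<alpha>\<^sub>0 \<le> \<alpha> \<and> \<beta>\<^sub>0 \<le> \<beta>} {u. arg3 u = \<nu>}"
    by (rule bij_betw_byWitness[where f' = "\<lambda>((a, a'), (b, b'), \<gamma>). (a, b', \<gamma>)"])
      (auto simp: h_def arg3_def \<nu> add cancel)
  have "kernel.bil (coef t) arg1 arg2 arg3 x y \<nu> = (\<Sum>\<^sub>\<infinity>u\<in>{u. arg3 u = \<nu>}. coef t u * x (arg1 u) * y (arg2 u))"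
    by (simp add: kernel.bil_def)
  also have "\<dots> = (\<Sum>\<^sub>\<infinity>v\<in>{(\<alpha>\<^sub>0, \<beta>\<^sub>0, \<gamma>). \<alpha>\<^sub>0 \<le> \<alpha> \<and> \<beta>\<^sub>0 \<le> \<beta>}. coef t (h v) * x (arg1 (h v)) * y (arg2 (h v)))"
    by (rule infsum_reindex_bij_betw[OF bij, symmetric])
  also have "\<dots> = U_sharp t x y \<nu>"
    unfolding U_sharp_def \<nu> prod.case
    by (intro infsum_cong) (auto simp: h_def coef_def arg1_def arg2_def add)
  finally show "U_sharp t x y \<nu> = kernel.bil (coef t) arg1 arg2 arg3 x y \<nu>"
    by simp
qed

lemma mbinom_le: "mbinom \<alpha> \<beta> \<le> 2 ^ mlen \<alpha>"
  unfolding mbinom_def mlen_def power_sum by (intro prod_mono) (auto simp: binomial_le_pow2)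

lemma cmod_coef_le: "cmod (coef t u) \<le> (2 * max 1 (cmod t)) ^ qlen u"
proof -
  obtain a a' b b' \<gamma> where u: "u = ((a, a'), (b, b'), \<gamma>)"
    by (metis surj_pair)
  let ?N = "mbinom (a + a') a * mbinom (b + b') b' * mbinom (a' + \<gamma>) \<gamma> * mbinom (b + \<gamma>) \<gamma>"
  have "?N \<le> 2 ^ mlen (a + a') * 2 ^ mlen (b + b') * 2 ^ mlen (a' + \<gamma>) * 2 ^ mlen (b + \<gamma>)"
    by (intro mult_mono mbinom_le) auto
  also have "\<dots> = 2 ^ (mlen (a + a') + mlen (b + b') + mlen (a' + \<gamma>) + mlen (b + \<gamma>))"
    by (simp add: power_add)
  \<comment> \<open>In the four upper indices \<open>a'\<close>, \<open>b\<close> and \<gamma> occur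
    twice, \<open>a\<close> and \<open>b'\<close> once. The square root then halves the
    exponent.\<close>
  also have "\<dots> \<le> (2::nat) ^ (2 * qlen u)"
    by (intro power_increasing) (auto simp: qlen_def u mlen_add)
  finally have "real ?N \<le> real (2 ^ (2 * qlen u))"
    by (rule of_nat_mono)
  also have "\<dots> = (2 ^ qlen u)\<^sup>2"
    by (simp add: power_mult[symmetric] mult.commute)
  finally have sqrt: "sqrt (real ?N) \<le> 2 ^ qlen u"
    by (intro real_le_lsqrt) auto
  have "cmod t ^ mlen \<gamma> \<le> max 1 (cmod t) ^ mlen \<gamma>"
    by (intro power_mono) auto
  also have "\<dots> \<le> max 1 (cmod t) ^ qlen u"
    by (intro power_increasing) (auto simp: qlen_def u)
  finally have t: "cmod t ^ mlen \<gamma> \<le> max 1 (cmod t) ^ qlen u" .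
  have "cmod (coef t u) = sqrt (real ?N) * cmod t ^ mlen \<gamma>"
    by (simp add: coef_def u norm_mult norm_power)
  also have "\<dots> \<le> 2 ^ qlen u * max 1 (cmod t) ^ qlen u"
    using sqrt t by (intro mult_mono) auto
  finally show ?thesis
    by (simp add: power_mult_distrib)
qed

lemma nn_integral_power_qlen:
  assumes q: "0 \<le> q" "q < (1::real)"
  shows "(\<integral>\<^sup>+u. ennreal (q ^ qlen u) \<partial>count_space (UNIV :: ('d::finite) quint set)) < \<infinity>"
proof -
  define f where "f x = ennreal (q ^ (mlen (fst x) + mlen (snd x)))" for x :: "'d mindex \<times> 'd mindex"
  define h where "h \<gamma> = ennreal (q ^ mlen \<gamma>)" for \<gamma> :: "'d mindex"
  define k where "k v = f (fst v) * h (snd v)" for v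
  have f: "(\<integral>\<^sup>+x. f x \<partial>count_space UNIV) < \<infinity>" and h: "(\<integral>\<^sup>+x. h x \<partial>count_space UNIV) < \<infinity>"
    unfolding f_def h_def using nn_integral_power_mlen2[OF q] nn_integral_power_mlen[OF q] .
  have k: "(\<integral>\<^sup>+v. k v \<partial>count_space UNIV) < \<infinity>"
    unfolding k_def nn_integral_prod by (rule ennreal_mult_finite[OF f h])
  have "ennreal (q ^ qlen u) = f (fst u) * k (snd u)" for u :: "'d quint"
  proof -
    obtain a a' b b' \<gamma> where "u = ((a, a'), (b, b'), \<gamma>)"
      by (metis surj_pair)
    then show ?thesis
      using q by (simp add: qlen_def f_def h_def k_def power_add ennreal_mult mult.assoc)
  qed
  then have "(\<integral>\<^sup>+u. ennreal (q ^ qlen u) \<partial>count_space (UNIV :: 'd quint set)) =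
      (\<integral>\<^sup>+u. f (fst u) * k (snd u) \<partial>count_space UNIV)"
    by simp
  also have "\<dots> = (\<integral>\<^sup>+x. f x \<partial>count_space UNIV) * (\<integral>\<^sup>+v. k v \<partial>count_space UNIV)"
    by (rule nn_integral_prod)
  finally show ?thesis
    using ennreal_mult_finite[OF f k] by simp
qed

text \<open>
  The binomials contribute at most \<open>2 ^ qlen u\<close>; a further factor \<open>2 ^ qlen u\<close> is reserved for the
  summation over \<open>u\<close>.
\<close>

definition rate :: "complex \<Rightarrow> real" where
  "rate t = 4 * max 1 (cmod t)"

text \<open>\<open>rate t\<close> is twice the base in \<open>cmod_coef_le\<close>, so each
  coefficient is at most \<open>(1 / 2) ^ qlen u\<close> times \<open>rate t ^ qlen u\<close>. A
  uniform bound on single summands, weighted by the latter power, is therefore summed by the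
  former.\<close>

lemma pos_in_Bsp:
  fixes x y \<omega> :: "('d::finite) dindex \<Rightarrow> ennreal"
  assumes C: "C < \<infinity>" and le: "\<And>u. x (arg1 u) * y (arg2 u) * ennreal (rate t ^ qlen u) * \<omega> (arg3 u) \<le> C"
  shows "kernel.pos (coef t) arg1 arg2 arg3 x y \<in> Bsp \<omega>"
proof -
  let ?S = "\<integral>\<^sup>+u. ennreal ((1 / 2) ^ qlen u) \<partial>count_space (UNIV :: 'd quint set)"
  have coef: "ennreal (cmod (coef t u)) \<le> ennreal ((1 / 2) ^ qlen u) * ennreal (rate t ^ qlen u)" for u :: "'d quint"
  proof -
    have "(1 / 2) ^ qlen u * rate t ^ qlen u = (1 / 2 * rate t) ^ qlen u"
      by (rule power_mult_distrib[symmetric])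
    also have "1 / 2 * rate t = 2 * max 1 (cmod t)"
      by (simp add: rate_def)
    finally have "cmod (coef t u) \<le> (1 / 2) ^ qlen u * rate t ^ qlen u"
      using cmod_coef_le[of t u] by simp
    then have "ennreal (cmod (coef t u)) \<le> ennreal ((1 / 2) ^ qlen u * rate t ^ qlen u)"
      by (rule ennreal_leI)
    also have "\<dots> = ennreal ((1 / 2) ^ qlen u) * ennreal (rate t ^ qlen u)"
      by (rule ennreal_mult) (auto simp: rate_def)
    finally show ?thesis .
  qed
  have "kernel.pos (coef t) arg1 arg2 arg3 x y \<nu> * \<omega> \<nu> \<le> ?S * C" for \<nu>
  proof -
    have "kernel.pos (coef t) arg1 arg2 arg3 x y \<nu> * \<omega> \<nu> =
        (\<integral>\<^sup>+u. ennreal (cmod (coef t u)) * x (arg1 u) * y (arg2 u) * delta \<nu> (arg3 u) * \<omega> \<nu> \<partial>count_space UNIV)"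
      unfolding kernel.pos_def kernel.tri_def by (rule nn_integral_multc[symmetric]) simp
    also have "\<dots> \<le> (\<integral>\<^sup>+u. ennreal ((1 / 2) ^ qlen u) * C \<partial>count_space (UNIV :: 'd quint set))"
    proof (intro nn_integral_mono)
      fix u :: "'d quint"
      show "ennreal (cmod (coef t u)) * x (arg1 u) * y (arg2 u) * delta \<nu> (arg3 u) * \<omega> \<nu> \<le> ennreal ((1 / 2) ^ qlen u) * C"
      proof (cases "arg3 u = \<nu>")
        case True
        have "ennreal (cmod (coef t u)) * x (arg1 u) * y (arg2 u) * \<omega> \<nu> \<le>
            ennreal ((1 / 2) ^ qlen u) * ennreal (rate t ^ qlen u) * x (arg1 u) * y (arg2 u) * \<omega> \<nu>"
          by (intro mult_right_mono coef) auto
        also have "\<dots> = ennreal ((1 / 2) ^ qlen u) * (x (arg1 u) * y (arg2 u) * ennreal (rate t ^ qlen u) * \<omega> (arg3 u))"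
          by (simp only: True ac_simps)
        also have "\<dots> \<le> ennreal ((1 / 2) ^ qlen u) * C"
          by (intro mult_left_mono le) auto
        finally show ?thesis
          using True by (simp add: delta_def)
      qed (simp add: delta_def)
    qed
    also have "\<dots> = ?S * C"
      by (rule nn_integral_multc) simp
    finally show ?thesis .
  qed
  moreover have "?S * C < \<infinity>"
    using C by (intro ennreal_mult_finite nn_integral_power_qlen) auto
  ultimately show ?thesis
    unfolding Bsp_def by blast
qed

lemma finsupp_l0: "l\<^sub>0 = finsupp"
  by (simp add: l\<^sub>0_def finsupp_def)

lemma U_sharp_l0:
  assumes x: "x \<in> l\<^sub>0" and y: "y \<in> l\<^sub>0"
  shows "U_sharp t x y \<in> (l\<^sub>0 :: ('d::finite) dseq set)"
proof -
  define A where "A = {i. x i \<noteq> 0}"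
  define B where "B = {i. y i \<noteq> 0}"
  \<comment> \<open>Componentwise \<open>arg3 u\<close> is at most the sum of \<open>arg1 u\<close>
    and \<open>arg2 u\<close>, so the support of the result lies in finitely many boxes.\<close>
  define M where "M = (\<Union>(i, j)\<in>A \<times> B. {\<beta>. \<beta> \<le> fst i + fst j} \<times> {\<beta>. \<beta> \<le> snd i + snd j})"
  have "finite M"
    using x y unfolding M_def A_def B_def l\<^sub>0_def by (intro finite_UN_I finite_cartesian_product) (auto intro!: finite_mindex_le)
  moreover have "{\<nu>. U_sharp t x y \<nu> \<noteq> 0} \<subseteq> M"
  proof
    fix \<nu> assume "\<nu> \<in> {\<nu>. U_sharp t x y \<nu> \<noteq> 0}"
    then have "(\<Sum>\<^sub>\<infinity>u\<in>{u. arg3 u = \<nu>}. coef t u * x (arg1 u) * y (arg2 u)) \<noteq> 0"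
      by (simp add: U_sharp_eq_bil kernel.bil_def)
    then obtain u where u: "arg3 u = \<nu>" "coef t u * x (arg1 u) * y (arg2 u) \<noteq> 0"
      by (metis (mono_tags, lifting) infsum_0 mem_Collect_eq)
    obtain a a' b b' \<gamma> where u_eq: "u = ((a, a'), (b, b'), \<gamma>)"
      by (metis surj_pair)
    have "(arg1 u, arg2 u) \<in> A \<times> B"
      using u(2) by (simp add: A_def B_def)
    moreover have "\<nu> \<in> {\<beta>. \<beta> \<le> fst (arg1 u) + fst (arg2 u)} \<times> {\<beta>. \<beta> \<le> snd (arg1 u) + snd (arg2 u)}"
      by (simp add: u(1)[symmetric] u_eq arg1_def arg2_def arg3_def less_eq_vec_def)
    ultimately show "\<nu> \<in> M"
      unfolding M_def by blast
  qed
  ultimately show ?thesis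
    by (auto simp: l\<^sub>0_def intro: finite_subset)
qed

section \<open>The weights\<close>

text \<open>The power of \<open>R\<close> is the room in which binomials, powers of \<open>t\<close>
  and the summation are absorbed; later \<open>R\<close> is \<open>rate t\<close>. Putting one index
  to 0 yields the derived forms \<open>dominated_left\<close> and
  \<open>dominated_right\<close>.\<close>

definition dominated :: "real \<Rightarrow> (real \<Rightarrow> ('d::finite) mindex \<Rightarrow> ennreal) \<Rightarrow> real \<Rightarrow> real \<Rightarrow> real \<Rightarrow> bool" where
  "dominated R th r p q \<longleftrightarrow>
     (\<exists>C<\<infinity>. \<forall>\<alpha> \<beta>. ennreal (R ^ (mlen \<alpha> + mlen \<beta>)) * th r (\<alpha> + \<beta>) \<le> C * (th p \<alpha> * th q \<beta>))"

locale scale =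
  fixes R :: real and th :: "real \<Rightarrow> ('d::finite) mindex \<Rightarrow> ennreal"
  assumes R: "2 \<le> R"
    and th_zero: "r > 0 \<Longrightarrow> th r 0 = 1"
    and th_superadd: "r > 0 \<Longrightarrow> th r \<alpha> * th r \<beta> \<le> th r (\<alpha> + \<beta>)"
    and th_low: "r > 0 \<Longrightarrow> \<exists>a>0. \<forall>\<alpha>. a \<le> th r \<alpha>"
    and th_chain: "r > 0 \<Longrightarrow> r' > 0 \<Longrightarrow> (\<forall>\<alpha>. th r \<alpha> \<le> th r' \<alpha>) \<or> (\<forall>\<alpha>. th r' \<alpha> \<le> th r \<alpha>)"

text \<open>Here \<open>r\<close> is found after \<open>p\<close> and \<open>q\<close>. Finiteness
  is required only for a suitable \<open>r\<close>, since for s = 0 every single weight is infinite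
  somewhere.\<close>

locale scale_down = scale +
  assumes down: "p > 0 \<Longrightarrow> q > 0 \<Longrightarrow> \<exists>r>0. dominated R th r p q"
    and down_finite: "\<exists>r>0. th r \<alpha> < \<infinity>"
    and down_cofinal: "\<exists>\<rho>. (\<forall>k::nat. \<rho> k > 0) \<and> (\<forall>k \<alpha>. th (\<rho> (Suc k)) \<alpha> \<le> th (\<rho> k) \<alpha>) \<and>
      (\<forall>n>0. \<exists>k. \<forall>\<alpha>. th (\<rho> k) \<alpha> \<le> th n \<alpha>)"

text \<open>Here \<open>p\<close> and \<open>q\<close> are found after \<open>r\<close>. A threshold
  above which all choices work is needed because one parameter often has to meet several such
  conditions.\<close>

locale scale_up = scale +
  assumes up: "r > 0 \<Longrightarrow> \<exists>q0>0. \<forall>p\<ge>q0. \<forall>q\<ge>q0. dominated R th r p q"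
    and up_finite: "r > 0 \<Longrightarrow> th r \<alpha> < \<infinity>"
    and up_cofinal: "\<exists>\<rho>. (\<forall>k::nat. \<rho> k > 0) \<and> (\<forall>k \<alpha>. th (\<rho> k) \<alpha> \<le> th (\<rho> (Suc k)) \<alpha>) \<and>
      (\<forall>n>0. \<exists>k. \<forall>\<alpha>. th n \<alpha> \<le> th (\<rho> k) \<alpha>)"

lemma mfact_mult_le: "mfact \<alpha> * mfact \<beta> \<le> mfact (\<alpha> + \<beta>)"
  unfolding mfact_def prod.distrib[symmetric]
proof (rule prod_mono)
  fix i
  have "fact (\<alpha> $ i) * fact (\<beta> $ i) dvd (fact (\<alpha> $ i + \<beta> $ i) :: nat)"
    by (rule fact_fact_dvd_fact)
  then show "(0::nat) \<le> fact (\<alpha> $ i) * fact (\<beta> $ i) \<and> fact (\<alpha> $ i) * fact (\<beta> $ i) \<le> (fact ((\<alpha> + \<beta>) $ i) :: nat)"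
    by (simp add: dvd_imp_le)
qed

lemma mfact_add_le: "mfact (\<alpha> + \<beta>) \<le> 2 ^ (mlen \<alpha> + mlen \<beta>) * (mfact \<alpha> * mfact \<beta>)"
proof -
  have "fact (m + n) \<le> 2 ^ (m + n) * (fact m * (fact n :: nat))" for m n :: nat
  proof -
    have "fact m * fact n * (m + n choose m) = (fact (m + n) :: nat)"
      using binomial_fact_lemma[of m "m + n"] by simp
    then have "fact (m + n) = (m + n choose m) * (fact m * (fact n :: nat))"
      by (simp add: ac_simps)
    also have "\<dots> \<le> 2 ^ (m + n) * (fact m * fact n)"
      by (intro mult_right_mono binomial_le_pow2) simp
    finally show ?thesis .
  qed
  then have "mfact (\<alpha> + \<beta>) \<le> (\<Prod>i\<in>UNIV. 2 ^ (\<alpha> $ i + \<beta> $ i) * (fact (\<alpha> $ i) * (fact (\<beta> $ i) :: nat)))"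
    unfolding mfact_def by (intro prod_mono) auto
  also have "\<dots> = 2 ^ (mlen \<alpha> + mlen \<beta>) * (mfact \<alpha> * mfact \<beta>)"
    by (simp add: prod.distrib mfact_def mlen_def power_sum[symmetric] sum.distrib)
  finally show ?thesis .
qed

text \<open>One term of the exponential series in each coordinate. Factorials thus outweigh every
  geometric decay, which bounds the factorial weights from below for \<open>r < 1\<close>
  too.\<close>

lemma power_le_mfact:
  fixes A :: real
  assumes "0 \<le> A"
  shows "A ^ mlen (\<alpha>::('d::finite) mindex) \<le> exp A ^ CARD('d) * real (mfact \<alpha>)"
proof -
  have le: "A ^ k \<le> exp A * fact k" for k
  proof -
    have "(\<Sum>n\<in>{k}. A ^ n /\<^sub>R fact n) \<le> (\<Sum>n. A ^ n /\<^sub>R fact n)"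
      using assms by (intro sum_le_suminf summable_exp_generic) auto
    then have "A ^ k / fact k \<le> exp A"
      by (simp add: exp_def divide_inverse mult.commute)
    then show ?thesis
      by (simp add: divide_le_eq)
  qed
  have "A ^ mlen \<alpha> = (\<Prod>i\<in>UNIV. A ^ (\<alpha> $ i))"
    by (simp add: mlen_def power_sum)
  also have "\<dots> \<le> (\<Prod>i\<in>UNIV. exp A * fact (\<alpha> $ i))"
    using assms le by (intro prod_mono) auto
  also have "\<dots> = exp A ^ CARD('d) * real (mfact \<alpha>)"
    by (simp add: prod.distrib mfact_def)
  finally show ?thesis .
qed

section \<open>Exponential weights: real indices s > 0\<close>

lemma powr_add_le_scaled:
  fixes u v a :: real
  assumes "0 \<le> u" "0 \<le> v" "0 < a"
  shows "(u + v) powr a \<le> 2 powr a * (u powr a + v powr a)"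
proof -
  have "(u + v) powr a \<le> (2 * max u v) powr a"
    using assms by (intro powr_mono2) auto
  also have "\<dots> = 2 powr a * (max u v) powr a"
    using assms by (simp add: powr_mult)
  also have "\<dots> \<le> 2 powr a * (u powr a + v powr a)"
    by (intro mult_left_mono) (auto simp: max_def)
  finally show ?thesis .
qed

lemma powr_split: "x powr 1 * x powr (a - 1) = (x::real) powr a"
  by (simp only: powr_add[symmetric]) simp

text \<open>Both \<open>u\<close> and \<open>v\<close> are at most their sum, so each power is
  bounded by \<open>x * (u + v) powr (a - 1)\<close>; adding the two gives the claim.\<close>

lemma powr_superadd:
  fixes u v a :: real
  assumes "0 \<le> u" "0 \<le> v" "1 \<le> a"
  shows "u powr a + v powr a \<le> (u + v) powr a"
proof (cases "u + v = 0")
  case False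
  then have s: "0 < u + v"
    using assms by simp
  have le: "x powr a \<le> x * (u + v) powr (a - 1)" if "0 \<le> x" "x \<le> u + v" for x
  proof (cases "x = 0")
    case False
    have "x powr a = x powr 1 * x powr (a - 1)"
      by (rule powr_split[symmetric])
    also have "\<dots> \<le> x powr 1 * (u + v) powr (a - 1)"
      using that assms(3) by (intro mult_left_mono powr_mono2) auto
    finally show ?thesis
      using that by simp
  qed simp
  have "u powr a + v powr a \<le> u * (u + v) powr (a - 1) + v * (u + v) powr (a - 1)"
    using assms by (intro add_mono le) auto
  also have "\<dots> = (u + v) powr 1 * (u + v) powr (a - 1)"
    using s by (simp add: distrib_right)
  also have "\<dots> = (u + v) powr a"
    by (rule powr_split)
  finally show ?thesis .
qed (use assms in \<open>simp add: add_nonneg_eq_0_iff\<close>)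

lemma ennreal_mono_mult3:
  fixes x y z :: real
  assumes "x * y \<le> c * (z * w)" "0 \<le> x" "0 \<le> y" "0 \<le> c" "0 \<le> z" "0 \<le> w"
  shows "ennreal x * ennreal y \<le> ennreal c * (ennreal z * ennreal w)"
  using assms by (simp add: ennreal_leI flip: ennreal_mult)

text \<open>The weight of a real index s with \<open>a = 1 / (2 * s)\<close>: the condition s < 1/2
  means \<open>a > 1\<close>, and s \<le> 1/2 means \<open>a \<ge> 1\<close>.\<close>

definition expw :: "real \<Rightarrow> real \<Rightarrow> ('d::finite) mindex \<Rightarrow> ennreal" where
  "expw a r \<alpha> = ennreal (exp (r * real (mlen \<alpha>) powr a))"

lemma scale_expw:
  assumes "2 \<le> R" "1 \<le> a"
  shows "scale R (expw a :: real \<Rightarrow> ('d::finite) mindex \<Rightarrow> ennreal)"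
proof
  fix r r' :: real and \<alpha> \<beta> :: "'d mindex"
  assume r: "r > 0"
  show "expw a r 0 = (1 :: ennreal)"
    by (simp add: expw_def)
  have "r * (real (mlen \<alpha>) powr a) + r * (real (mlen \<beta>) powr a) \<le> r * (real (mlen \<alpha>) + real (mlen \<beta>)) powr a"
    using powr_superadd[of "real (mlen \<alpha>)" "real (mlen \<beta>)" a] r assms(2)
    by (simp add: mult_left_mono flip: distrib_left)
  then show "expw a r \<alpha> * expw a r \<beta> \<le> expw a r (\<alpha> + \<beta>)"
    by (simp add: expw_def mlen_add ennreal_leI flip: ennreal_mult exp_add)
  show "\<exists>c>0. \<forall>\<alpha>::'d mindex. c \<le> expw a r \<alpha>"
    using r by (intro exI[of _ 1]) (auto simp: expw_def)
  assume r': "r' > 0"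
  have mono: "expw a s \<alpha> \<le> expw a s' \<alpha>" if "s \<le> s'" for s s' and \<alpha> :: "'d mindex"
    using that by (simp add: expw_def ennreal_leI mult_right_mono)
  show "(\<forall>\<alpha>::'d mindex. expw a r \<alpha> \<le> expw a r' \<alpha>) \<or> (\<forall>\<alpha>::'d mindex. expw a r' \<alpha> \<le> expw a r \<alpha>)"
    using mono[of r r'] mono[of r' r] by (cases "r \<le> r'") auto
qed (use assms in auto)

text \<open>The exponents \<open>p\<close> and \<open>q\<close> pay for two things:
  \<open>2 powr a * r\<close> for splitting the power of a sum, and \<open>m\<close> for the factor
  \<open>R\<close> per unit of length, up to the constant \<open>K\<close>.\<close>

lemma expw_dominated:
  fixes R a K p q r :: real
  assumes R: "1 \<le> R" and a: "1 \<le> a" and r: "0 < r" and m: "0 \<le> m" "2 powr a * r + m \<le> p" "2 powr a * r + m \<le> q"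
    and K: "\<And>n::nat. real n * ln R \<le> m * real n powr a + K"
  shows "dominated R (expw a :: real \<Rightarrow> ('d::finite) mindex \<Rightarrow> ennreal) r p q"
  unfolding dominated_def
proof (intro exI[of _ "ennreal (exp (2 * K))"] conjI allI)
  fix \<alpha> \<beta> :: "'d mindex"
  let ?u = "real (mlen \<alpha>)" and ?v = "real (mlen \<beta>)"
  have "R ^ (mlen \<alpha> + mlen \<beta>) = exp ((?u + ?v) * ln R)"
    using R by (simp add: powr_realpow[symmetric] powr_def)
  then have lhs: "R ^ (mlen \<alpha> + mlen \<beta>) * exp (r * (?u + ?v) powr a) = exp (?u * ln R + ?v * ln R + r * (?u + ?v) powr a)"
    by (simp add: exp_add distrib_right)
  have "r * (?u + ?v) powr a \<le> r * (2 powr a * (?u powr a + ?v powr a))"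
    using r a by (intro mult_left_mono powr_add_le_scaled) auto
  moreover have "(2 powr a * r + m) * ?u powr a \<le> p * ?u powr a" "(2 powr a * r + m) * ?v powr a \<le> q * ?v powr a"
    using m by (auto intro: mult_right_mono)
  ultimately have "?u * ln R + ?v * ln R + r * (?u + ?v) powr a \<le> 2 * K + (p * ?u powr a + q * ?v powr a)"
    using K[of "mlen \<alpha>"] K[of "mlen \<beta>"] by (simp add: algebra_simps)
  then have "R ^ (mlen \<alpha> + mlen \<beta>) * exp (r * (?u + ?v) powr a) \<le> exp (2 * K) * (exp (p * ?u powr a) * exp (q * ?v powr a))"
    unfolding lhs by (simp flip: exp_add)
  then show "ennreal (R ^ (mlen \<alpha> + mlen \<beta>)) * expw a r (\<alpha> + \<beta>) \<le> ennreal (exp (2 * K)) * (expw a p \<alpha> * expw a q \<beta>)"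
    unfolding expw_def mlen_add of_nat_add using R by (intro ennreal_mono_mult3) auto
qed simp

text \<open>For \<open>a > 1\<close> even a small multiple of the power outgrows every linear
  function, so a geometric factor costs an arbitrarily small share of the exponent.\<close>

lemma linear_le_powr:
  fixes L m a :: real
  assumes "0 < m" "1 < a"
  shows "\<exists>K. \<forall>n::nat. real n * L \<le> m * real n powr a + K"
proof -
  \<comment> \<open>From \<open>n0\<close> on, \<open>m * n powr (a - 1)\<close> is at least
    \<open>L\<close>; below it the additive constant \<open>n0 * \<bar>L\<bar>\<close> covers the
    linear term.\<close>
  define n0 where "n0 = (max 1 (L / m)) powr (1 / (a - 1))"
  have n0: "n0 powr (a - 1) = max 1 (L / m)"
    using assms by (simp add: n0_def powr_powr)
  have n0_nonneg: "0 \<le> n0"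
    by (simp add: n0_def)
  have "real n * L \<le> m * real n powr a + n0 * \<bar>L\<bar>" for n :: nat
  proof (cases "real n \<le> n0")
    case True
    have "real n * L \<le> real n * \<bar>L\<bar>"
      by (intro mult_left_mono) auto
    also have "\<dots> \<le> n0 * \<bar>L\<bar>"
      using True by (intro mult_right_mono) auto
    also have "\<dots> \<le> m * real n powr a + n0 * \<bar>L\<bar>"
      using assms by simp
    finally show ?thesis .
  next
    case False
    then have n: "real n > 0" "n0 \<le> real n"
      using n0_nonneg by auto
    have "L / m \<le> real n powr (a - 1)"
      using powr_mono2[of "a - 1" n0 "real n"] n assms n0 n0_nonneg by auto
    then have "L \<le> m * real n powr (a - 1)"
      using assms by (simp add: divide_le_eq mult.commute)
    then have "real n * L \<le> real n * (m * real n powr (a - 1))"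
      using n by (intro mult_left_mono) auto
    also have "\<dots> = m * (real n powr 1 * real n powr (a - 1))"
      using n by simp
    also have "\<dots> = m * real n powr a"
      by (simp only: powr_split)
    also have "\<dots> \<le> m * real n powr a + n0 * \<bar>L\<bar>"
      by (simp add: n0_def)
    finally show ?thesis .
  qed
  then show ?thesis
    by blast
qed

lemma cofinal_down:
  fixes th :: "real \<Rightarrow> 'a \<Rightarrow> ennreal"
  assumes "\<And>r s \<alpha>. 0 < r \<Longrightarrow> r \<le> s \<Longrightarrow> th r \<alpha> \<le> th s \<alpha>"
  shows "\<exists>\<rho>. (\<forall>k::nat. \<rho> k > 0) \<and> (\<forall>k \<alpha>. th (\<rho> (Suc k)) \<alpha> \<le> th (\<rho> k) \<alpha>) \<and>
    (\<forall>n>0. \<exists>k. \<forall>\<alpha>. th (\<rho> k) \<alpha> \<le> th n \<alpha>)"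
proof (intro exI[of _ "\<lambda>k. inverse (real (Suc k))"] conjI allI impI)
  fix n :: real assume n: "n > 0"
  obtain k where "inverse (real (Suc k)) < n"
    using reals_Archimedean[OF n] by blast
  then show "\<exists>k. \<forall>\<alpha>. th (inverse (real (Suc k))) \<alpha> \<le> th n \<alpha>"
    by (intro exI[of _ k] allI assms) auto
qed (auto intro!: assms le_imp_inverse_le)

lemma cofinal_up:
  fixes th :: "real \<Rightarrow> 'a \<Rightarrow> ennreal"
  assumes "\<And>r s \<alpha>. 0 < r \<Longrightarrow> r \<le> s \<Longrightarrow> th r \<alpha> \<le> th s \<alpha>"
  shows "\<exists>\<rho>. (\<forall>k::nat. \<rho> k > 0) \<and> (\<forall>k \<alpha>. th (\<rho> k) \<alpha> \<le> th (\<rho> (Suc k)) \<alpha>) \<and>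
    (\<forall>n>0. \<exists>k. \<forall>\<alpha>. th n \<alpha> \<le> th (\<rho> k) \<alpha>)"
proof (intro exI[of _ "\<lambda>k. real (Suc k)"] conjI allI impI)
  fix n :: real assume n: "n > 0"
  obtain k where "n < real k"
    using reals_Archimedean2 by blast
  then show "\<exists>k. \<forall>\<alpha>. th n \<alpha> \<le> th (real (Suc k)) \<alpha>"
    using n by (intro exI[of _ k] allI assms) auto
qed (auto intro!: assms)

lemma expw_mono: "r \<le> s \<Longrightarrow> expw a r \<alpha> \<le> expw a s \<alpha>"
  by (simp add: expw_def ennreal_leI mult_right_mono)

lemma scale_down_expw:
  assumes R: "2 \<le> R" and a: "1 < a"
  shows "scale_down R (expw a :: real \<Rightarrow> ('d::finite) mindex \<Rightarrow> ennreal)"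
proof -
  interpret scale R "expw a :: real \<Rightarrow> 'd mindex \<Rightarrow> ennreal"
    using R a by (intro scale_expw) auto
  show ?thesis
  proof
    fix p q :: real assume pq: "p > 0" "q > 0"
    \<comment> \<open>Half of the available exponent pays for the powers of \<open>R\<close>, the
      other half, divided by \<open>2 powr a\<close>, becomes \<open>r\<close>.\<close>
    define m where "m = min p q / 2"
    define r where "r = m / 2 powr a"
    have m: "0 < m" "2 * m \<le> p" "2 * m \<le> q"
      using pq by (auto simp: m_def)
    obtain K where "\<And>n::nat. real n * ln R \<le> m * real n powr a + K"
      using linear_le_powr[OF m(1) a] by blast
    then have "dominated R (expw a :: real \<Rightarrow> 'd mindex \<Rightarrow> ennreal) r p q"
      using R a m by (intro expw_dominated[where m = m and K = K]) (auto simp: r_def)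
    then show "\<exists>r>0. dominated R (expw a :: real \<Rightarrow> 'd mindex \<Rightarrow> ennreal) r p q"
      using m(1) by (intro exI[of _ r]) (auto simp: r_def)
  next
    show "\<exists>r>0. expw a r \<alpha> < \<infinity>" for \<alpha> :: "'d mindex"
      by (intro exI[of _ 1]) (auto simp: expw_def)
    show "\<exists>\<rho>. (\<forall>k::nat. \<rho> k > 0) \<and> (\<forall>k (\<alpha>::'d mindex). expw a (\<rho> (Suc k)) \<alpha> \<le> expw a (\<rho> k) \<alpha>) \<and>
      (\<forall>n>0. \<exists>k. \<forall>\<alpha>::'d mindex. expw a (\<rho> k) \<alpha> \<le> expw a n \<alpha>)"
      by (rule cofinal_down) (rule expw_mono)
  qed
qed

lemma scale_up_expw:
  assumes R: "2 \<le> R" and a: "1 \<le> a"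
  shows "scale_up R (expw a :: real \<Rightarrow> ('d::finite) mindex \<Rightarrow> ennreal)"
proof -
  interpret scale R "expw a :: real \<Rightarrow> 'd mindex \<Rightarrow> ennreal"
    using R a by (intro scale_expw) auto
  show ?thesis
  proof
    fix r :: real assume r: "r > 0"
    \<comment> \<open>At \<open>a = 1\<close> the cost \<open>m = ln R\<close> cannot be made small,
      but here \<open>p\<close> and \<open>q\<close> may be large, and \<open>K = 0\<close>
      suffices.\<close>
    define q0 where "q0 = 2 powr a * r + ln R"
    have K: "real n * ln R \<le> ln R * real n powr a + 0" for n :: nat
    proof (cases "n = 0")
      case False
      then have "real n powr 1 \<le> real n powr a"
        using a by (intro powr_mono) auto
      then have "ln R * real n powr 1 \<le> ln R * real n powr a"
        using R by (intro mult_left_mono) auto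
      then show ?thesis
        using False by (simp add: mult.commute)
    qed simp
    have "dominated R (expw a :: real \<Rightarrow> 'd mindex \<Rightarrow> ennreal) r p q" if "p \<ge> q0" "q \<ge> q0" for p q
      using that R a r K by (intro expw_dominated[where m = "ln R" and K = 0]) (auto simp: q0_def)
    moreover have "q0 > 0"
      using r R by (simp add: q0_def add_pos_nonneg)
    ultimately show "\<exists>q0>0. \<forall>p\<ge>q0. \<forall>q\<ge>q0. dominated R (expw a :: real \<Rightarrow> 'd mindex \<Rightarrow> ennreal) r p q"
      by blast
  next
    show "expw a r \<alpha> < \<infinity>" for r and \<alpha> :: "'d mindex"
      by (auto simp: expw_def)
    show "\<exists>\<rho>. (\<forall>k::nat. \<rho> k > 0) \<and> (\<forall>k (\<alpha>::'d mindex). expw a (\<rho> k) \<alpha> \<le> expw a (\<rho> (Suc k)) \<alpha>) \<and>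
      (\<forall>n>0. \<exists>k. \<forall>\<alpha>::'d mindex. expw a n \<alpha> \<le> expw a (\<rho> k) \<alpha>)"
      by (rule cofinal_up) (rule expw_mono)
  qed
qed

section \<open>Factorial weights: flat indices, with c = 1/(2 \<sigma>)\<close>

definition factw :: "real \<Rightarrow> real \<Rightarrow> ('d::finite) mindex \<Rightarrow> ennreal" where
  "factw c r \<alpha> = ennreal (r ^ mlen \<alpha> * real (mfact \<alpha>) powr c)"

lemma factw_mono: "0 < r \<Longrightarrow> r \<le> s \<Longrightarrow> factw c r \<alpha> \<le> factw c s \<alpha>"
  unfolding factw_def by (intro ennreal_leI mult_right_mono power_mono) auto

text \<open>The factorial of a sum exceeds the product of factorials by a geometric factor at most.
  Together with \<open>R\<close> it is absorbed by rescaling \<open>r\<close>, so flat indices admit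
  both orders of choosing parameters.\<close>

lemma factw_dominated:
  fixes R c p q r :: real
  assumes R: "1 \<le> R" and c: "0 < c" and r: "0 < r" "R * 2 powr c * r \<le> p" "R * 2 powr c * r \<le> q"
  shows "dominated R (factw c :: real \<Rightarrow> ('d::finite) mindex \<Rightarrow> ennreal) r p q"
  unfolding dominated_def
proof (intro exI[of _ "ennreal 1"] conjI allI)
  fix \<alpha> \<beta> :: "'d mindex"
  let ?n = "mlen \<alpha> + mlen \<beta>"
  have "0 \<le> R * 2 powr c * r"
    using R r(1) by simp
  then have pq: "0 \<le> p" "0 \<le> q"
    using r by linarith+
  have "real (mfact (\<alpha> + \<beta>)) powr c \<le> (2 ^ ?n * (real (mfact \<alpha>) * real (mfact \<beta>))) powr c"
    using c of_nat_mono[OF mfact_add_le[of \<alpha> \<beta>], where 'a = real] by (intro powr_mono2) auto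
  also have "\<dots> = (2 powr c) ^ ?n * (real (mfact \<alpha>) powr c * real (mfact \<beta>) powr c)"
    by (simp add: powr_mult powr_realpow[symmetric] powr_powr mult.commute)
  finally have fact: "real (mfact (\<alpha> + \<beta>)) powr c \<le> (2 powr c) ^ ?n * (real (mfact \<alpha>) powr c * real (mfact \<beta>) powr c)" .
  have "R ^ ?n * (r ^ ?n * real (mfact (\<alpha> + \<beta>)) powr c) \<le>
      R ^ ?n * (r ^ ?n * ((2 powr c) ^ ?n * (real (mfact \<alpha>) powr c * real (mfact \<beta>) powr c)))"
    using R r fact by (intro mult_left_mono) auto
  also have "\<dots> = ((R * 2 powr c * r) ^ mlen \<alpha> * (R * 2 powr c * r) ^ mlen \<beta>) * (real (mfact \<alpha>) powr c * real (mfact \<beta>) powr c)"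
    by (simp add: power_mult_distrib power_add ac_simps)
  also have "\<dots> \<le> (p ^ mlen \<alpha> * q ^ mlen \<beta>) * (real (mfact \<alpha>) powr c * real (mfact \<beta>) powr c)"
    using R r pq by (intro mult_right_mono mult_mono power_mono) auto
  finally have "R ^ ?n * (r ^ ?n * real (mfact (\<alpha> + \<beta>)) powr c) \<le>
      1 * ((p ^ mlen \<alpha> * real (mfact \<alpha>) powr c) * (q ^ mlen \<beta> * real (mfact \<beta>) powr c))"
    by (simp add: ac_simps)
  then show "ennreal (R ^ ?n) * factw c r (\<alpha> + \<beta>) \<le> ennreal 1 * (factw c p \<alpha> * factw c q \<beta>)"
    unfolding factw_def mlen_add using R r pq by (intro ennreal_mono_mult3) auto
qed simp

lemma scale_factw:
  assumes "2 \<le> R" "0 < c"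
  shows "scale R (factw c :: real \<Rightarrow> ('d::finite) mindex \<Rightarrow> ennreal)"
proof
  fix r r' :: real and \<alpha> \<beta> :: "'d mindex"
  assume r: "r > 0"
  show "factw c r 0 = (1 :: ennreal)"
    by (simp add: factw_def mfact_def)
  have "(real (mfact \<alpha>) * real (mfact \<beta>)) powr c \<le> real (mfact (\<alpha> + \<beta>)) powr c"
    using assms(2) of_nat_mono[OF mfact_mult_le[of \<alpha> \<beta>], where 'a = real] by (intro powr_mono2) auto
  then have "r ^ (mlen \<alpha> + mlen \<beta>) * (real (mfact \<alpha>) powr c * real (mfact \<beta>) powr c) \<le>
      r ^ (mlen \<alpha> + mlen \<beta>) * real (mfact (\<alpha> + \<beta>)) powr c"
    using r by (intro mult_left_mono) (auto simp: powr_mult)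
  then show "factw c r \<alpha> * factw c r \<beta> \<le> factw c r (\<alpha> + \<beta>)"
    using r by (simp add: factw_def mlen_add ennreal_leI power_add ac_simps flip: ennreal_mult)
  \<comment> \<open>Chosen so that \<open>A powr c = 1 / r\<close>: raising
    \<open>power_le_mfact\<close> to the power \<open>c\<close> then bounds the weight from below by
    \<open>1 / L\<close>.\<close>
  define A where "A = (1 / r) powr (1 / c)"
  define L where "L = (exp A ^ CARD('d)) powr c"
  have L: "L > 0"
    by (simp add: L_def)
  have low: "1 / L \<le> r ^ mlen \<alpha> * real (mfact \<alpha>) powr c" for \<alpha> :: "'d mindex"
  proof -
    have "(A ^ mlen \<alpha>) powr c \<le> (exp A ^ CARD('d) * real (mfact \<alpha>)) powr c"
      using assms(2) by (intro powr_mono2 power_le_mfact) (auto simp: A_def)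
    also have "\<dots> = L * real (mfact \<alpha>) powr c"
      by (simp add: L_def powr_mult)
    also have "(A ^ mlen \<alpha>) powr c = (1 / r) ^ mlen \<alpha>"
    proof -
      have A: "A > 0"
        using r by (simp add: A_def)
      have "(A ^ mlen \<alpha>) powr c = (A powr c) ^ mlen \<alpha>"
        using A by (simp add: powr_realpow[symmetric] powr_powr mult.commute)
      also have "A powr c = 1 / r"
        using r assms(2) by (simp add: A_def powr_powr)
      finally show ?thesis .
    qed
    finally show ?thesis
      using r L by (simp add: field_simps power_divide)
  qed
  show "\<exists>a>0. \<forall>\<alpha>::'d mindex. a \<le> factw c r \<alpha>"
    using L low by (intro exI[of _ "ennreal (1 / L)"]) (auto simp: factw_def intro!: ennreal_leI)
  assume r': "r' > 0"
  show "(\<forall>\<alpha>::'d mindex. factw c r \<alpha> \<le> factw c r' \<alpha>) \<or> (\<forall>\<alpha>::'d mindex. factw c r' \<alpha> \<le> factw c r \<alpha>)"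
    using factw_mono[OF r, of r'] factw_mono[OF r', of r] by (cases "r \<le> r'") auto
qed (use assms in auto)

lemma scale_down_factw:
  assumes R: "2 \<le> R" and c: "0 < c"
  shows "scale_down R (factw c :: real \<Rightarrow> ('d::finite) mindex \<Rightarrow> ennreal)"
proof -
  interpret scale R "factw c :: real \<Rightarrow> 'd mindex \<Rightarrow> ennreal"
    by (rule scale_factw[OF R c])
  show ?thesis
  proof
    fix p q :: real assume pq: "p > 0" "q > 0"
    define r where "r = min p q / (R * 2 powr c)"
    have "r > 0" "R * 2 powr c * r = min p q"
      using pq R by (auto simp: r_def)
    then have "dominated R (factw c :: real \<Rightarrow> 'd mindex \<Rightarrow> ennreal) r p q"
      using R c by (intro factw_dominated) auto
    then show "\<exists>r>0. dominated R (factw c :: real \<Rightarrow> 'd mindex \<Rightarrow> ennreal) r p q"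
      using \<open>r > 0\<close> by blast
  next
    show "\<exists>r>0. factw c r \<alpha> < \<infinity>" for \<alpha> :: "'d mindex"
      by (intro exI[of _ 1]) (auto simp: factw_def)
    show "\<exists>\<rho>. (\<forall>k::nat. \<rho> k > 0) \<and> (\<forall>k (\<alpha>::'d mindex). factw c (\<rho> (Suc k)) \<alpha> \<le> factw c (\<rho> k) \<alpha>) \<and>
      (\<forall>n>0. \<exists>k. \<forall>\<alpha>::'d mindex. factw c (\<rho> k) \<alpha> \<le> factw c n \<alpha>)"
      by (rule cofinal_down) (rule factw_mono)
  qed
qed

lemma scale_up_factw:
  assumes R: "2 \<le> R" and c: "0 < c"
  shows "scale_up R (factw c :: real \<Rightarrow> ('d::finite) mindex \<Rightarrow> ennreal)"
proof -
  interpret scale R "factw c :: real \<Rightarrow> 'd mindex \<Rightarrow> ennreal"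
    by (rule scale_factw[OF R c])
  show ?thesis
  proof
    fix r :: real assume r: "r > 0"
    have "R * 2 powr c * r > 0"
      using r R by simp
    moreover have "dominated R (factw c :: real \<Rightarrow> 'd mindex \<Rightarrow> ennreal) r p q"
      if "p \<ge> R * 2 powr c * r" "q \<ge> R * 2 powr c * r" for p q
      using that R c r by (intro factw_dominated) auto
    ultimately show "\<exists>q0>0. \<forall>p\<ge>q0. \<forall>q\<ge>q0. dominated R (factw c :: real \<Rightarrow> 'd mindex \<Rightarrow> ennreal) r p q"
      by blast
  next
    show "factw c r \<alpha> < \<infinity>" for r and \<alpha> :: "'d mindex"
      by (auto simp: factw_def)
    show "\<exists>\<rho>. (\<forall>k::nat. \<rho> k > 0) \<and> (\<forall>k (\<alpha>::'d mindex). factw c (\<rho> k) \<alpha> \<le> factw c (\<rho> (Suc k)) \<alpha>) \<and>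
      (\<forall>n>0. \<exists>k. \<forall>\<alpha>::'d mindex. factw c n \<alpha> \<le> factw c (\<rho> k) \<alpha>)"
      by (rule cofinal_up) (rule factw_mono)
  qed
qed

section \<open>Cut-off weights: the index s = 0\<close>

definition cutoff :: "real \<Rightarrow> ('d::finite) mindex \<Rightarrow> ennreal" where
  "cutoff r \<alpha> = (if real (mlen \<alpha>) \<le> r then 1 else \<infinity>)"

lemma cutoff_antimono: "r \<le> s \<Longrightarrow> cutoff s \<alpha> \<le> cutoff r \<alpha>"
  by (auto simp: cutoff_def)

lemma scale_down_cutoff:
  assumes R: "2 \<le> R"
  shows "scale_down R (cutoff :: real \<Rightarrow> ('d::finite) mindex \<Rightarrow> ennreal)"
proof
  fix r r' :: real and \<alpha> \<beta> :: "'d mindex"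
  assume r: "r > 0"
  show "cutoff r (0::'d mindex) = (1 :: ennreal)"
    using r by (simp add: cutoff_def)
  show "cutoff r \<alpha> * cutoff r \<beta> \<le> cutoff r (\<alpha> + \<beta>)"
    by (auto simp: cutoff_def mlen_add)
  show "\<exists>c>0. \<forall>\<alpha>::'d mindex. c \<le> cutoff r \<alpha>"
    by (intro exI[of _ 1]) (auto simp: cutoff_def)
  assume r': "r' > 0"
  show "(\<forall>\<alpha>::'d mindex. cutoff r \<alpha> \<le> cutoff r' \<alpha>) \<or> (\<forall>\<alpha>::'d mindex. cutoff r' \<alpha> \<le> cutoff r \<alpha>)"
    using cutoff_antimono[of r r'] cutoff_antimono[of r' r] by (cases "r \<le> r'") auto
next
  fix p q :: real assume pq: "p > 0" "q > 0"
  obtain k :: nat where k: "p + q \<le> real k"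
    using real_arch_simple by blast
  \<comment> \<open>These weights decrease in \<open>r\<close>, so the parameter found is larger
    than \<open>p\<close> and \<open>q\<close>. If both weights on the right are finite, lengths add
    up to at most \<open>p + q\<close> and \<open>R ^ k\<close> covers the power of
    \<open>R\<close>; otherwise the right-hand side is infinite.\<close>
  have "dominated R (cutoff :: real \<Rightarrow> 'd mindex \<Rightarrow> ennreal) (p + q) p q"
    unfolding dominated_def
  proof (intro exI[of _ "ennreal (R ^ k)"] conjI allI)
    fix \<alpha> \<beta> :: "'d mindex"
    have Rk: "0 < R ^ k"
      using R by simp
    show "ennreal (R ^ (mlen \<alpha> + mlen \<beta>)) * cutoff (p + q) (\<alpha> + \<beta>) \<le> ennreal (R ^ k) * (cutoff p \<alpha> * cutoff q \<beta>)"
    proof (cases "real (mlen \<alpha>) \<le> p \<and> real (mlen \<beta>) \<le> q")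
      case True
      then have "mlen \<alpha> + mlen \<beta> \<le> k"
        using k by linarith
      then have "R ^ (mlen \<alpha> + mlen \<beta>) \<le> R ^ k"
        using R by (intro power_increasing) auto
      then show ?thesis
        using True by (auto simp: cutoff_def mlen_add ennreal_leI)
    next
      case False
      then have eq: "cutoff p \<alpha> * cutoff q \<beta> = top"
        by (auto simp: cutoff_def ennreal_mult_top ennreal_top_mult)
      have "ennreal (R ^ k) \<noteq> 0"
        using Rk by (simp only: ennreal_eq_0_iff not_le)
      then show ?thesis
        unfolding eq by (simp only: ennreal_mult_top if_False top_greatest)
    qed
  qed simp
  then show "\<exists>r>0. dominated R (cutoff :: real \<Rightarrow> 'd mindex \<Rightarrow> ennreal) r p q"
    using pq by (intro exI[of _ "p + q"]) auto
next
  show "\<exists>r>0. cutoff r \<alpha> < \<infinity>" for \<alpha> :: "'d mindex"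
    by (intro exI[of _ "real (mlen \<alpha>) + 1"]) (auto simp: cutoff_def)
  show "\<exists>\<rho>. (\<forall>k::nat. \<rho> k > 0) \<and> (\<forall>k (\<alpha>::'d mindex). cutoff (\<rho> (Suc k)) \<alpha> \<le> cutoff (\<rho> k) \<alpha>) \<and>
    (\<forall>n>0. \<exists>k. \<forall>\<alpha>::'d mindex. cutoff (\<rho> k) \<alpha> \<le> cutoff n \<alpha>)"
  proof (intro exI[of _ "\<lambda>k. real (Suc k)"] conjI allI impI)
    fix n :: real
    obtain k where "n < real k"
      using reals_Archimedean2 by blast
    then show "\<exists>k. \<forall>\<alpha>::'d mindex. cutoff (real (Suc k)) \<alpha> \<le> cutoff n \<alpha>"
      by (intro exI[of _ k] allI cutoff_antimono) auto
  qed (auto intro!: cutoff_antimono)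
qed (use R in auto)

theorem scale_down_theta:
  assumes R: "2 \<le> R" and s: "s \<in> R_flat" "s < Fin (1/2)"
  shows "scale_down R (\<lambda>r. \<theta> r s :: ('d::finite) mindex \<Rightarrow> ennreal)"
proof (cases s)
  case (Fin x)
  show ?thesis
  proof (cases "x = 0")
    case True
    have "(\<lambda>r. \<theta> r s :: 'd mindex \<Rightarrow> ennreal) = cutoff"
      by (auto simp: fun_eq_iff cutoff_def Fin True)
    then show ?thesis
      using scale_down_cutoff[OF R] by simp
  next
    case False
    have "0 < x" "x < 1/2"
      using s False by (auto simp: Fin R_flat_def)
    moreover have "(\<lambda>r. \<theta> r s :: 'd mindex \<Rightarrow> ennreal) = expw (1 / (2 * x))"
      using False by (auto simp: fun_eq_iff expw_def Fin)
    ultimately show ?thesis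
      using scale_down_expw[OF R, of "1 / (2 * x)"] by simp
  qed
next
  case (Flat \<sigma>)
  have "0 < \<sigma>"
    using s by (auto simp: Flat R_flat_def)
  moreover have "(\<lambda>r. \<theta> r s :: 'd mindex \<Rightarrow> ennreal) = factw (1 / (2 * \<sigma>))"
    by (auto simp: fun_eq_iff factw_def Flat)
  ultimately show ?thesis
    using scale_down_factw[OF R, of "1 / (2 * \<sigma>)"] by simp
qed

theorem scale_up_theta:
  assumes R: "2 \<le> R" and s: "s \<in> R_flat" "Fin 0 < s" "s \<le> Fin (1/2)"
  shows "scale_up R (\<lambda>r. \<theta> r s :: ('d::finite) mindex \<Rightarrow> ennreal)"
proof (cases s)
  case (Fin x)
  have "0 < x" "x \<le> 1/2"
    using s by (auto simp: Fin less_eq_rflat_def)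
  moreover from this have "(\<lambda>r. \<theta> r s :: 'd mindex \<Rightarrow> ennreal) = expw (1 / (2 * x))"
    by (auto simp: fun_eq_iff expw_def Fin)
  ultimately show ?thesis
    using scale_up_expw[OF R, of "1 / (2 * x)"] by simp
next
  case (Flat \<sigma>)
  have "0 < \<sigma>"
    using s by (auto simp: Flat R_flat_def)
  moreover have "(\<lambda>r. \<theta> r s :: 'd mindex \<Rightarrow> ennreal) = factw (1 / (2 * \<sigma>))"
    by (auto simp: fun_eq_iff factw_def Flat)
  ultimately show ?thesis
    using scale_up_factw[OF R, of "1 / (2 * \<sigma>)"] by simp
qed

section \<open>The families of weights\<close>

definition wA :: "(real \<Rightarrow> ('d::finite) mindex \<Rightarrow> ennreal) \<Rightarrow> real \<Rightarrow> 'd dindex \<Rightarrow> ennreal" where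
  "wA th r = (\<lambda>(\<alpha>, \<beta>). th r \<alpha> * th r \<beta>)"

definition wA_inv :: "(real \<Rightarrow> ('d::finite) mindex \<Rightarrow> ennreal) \<Rightarrow> real \<Rightarrow> 'd dindex \<Rightarrow> ennreal" where
  "wA_inv th r = (\<lambda>i. 1 / wA th r i)"

definition wB :: "(real \<Rightarrow> ('d::finite) mindex \<Rightarrow> ennreal) \<Rightarrow> real \<Rightarrow> real \<Rightarrow> 'd dindex \<Rightarrow> ennreal" where
  "wB th r\<^sub>2 r\<^sub>1 = (\<lambda>(\<alpha>, \<beta>). th r\<^sub>2 \<alpha> / th r\<^sub>1 \<beta>)"

definition transp :: "('a \<times> 'a \<Rightarrow> 'b) \<Rightarrow> 'a \<times> 'a \<Rightarrow> 'b" where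
  "transp x = (\<lambda>(\<alpha>, \<beta>). x (\<beta>, \<alpha>))"

lemma transp_transp [simp]: "transp (transp x) = x"
  by (auto simp: transp_def)

lemma transp_apply: "transp x i = x (prod.swap i)"
  by (cases i) (simp add: transp_def)

lemma transp_le_iff: "(\<forall>i. transp x i \<le> transp y i) \<longleftrightarrow> (\<forall>i. x i \<le> (y i :: ennreal))"
  by (auto simp: transp_def)

lemma transp_decay [simp]: "transp decay = decay"
  by (auto simp: transp_def decay_def add.commute)

lemma faster_transp:
  assumes "faster decay \<omega> \<omega>'"
  shows "faster decay (transp \<omega>) (transp \<omega>')"
proof -
  obtain C where "C < \<infinity>" "\<And>i. \<omega> i \<le> C * decay i * \<omega>' i"
    using assms by (auto simp: faster_def)
  then have "transp \<omega> i \<le> C * transp decay i * transp \<omega>' i" for i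
    by (cases i) (simp only: transp_def prod.case)
  then show ?thesis
    using \<open>C < \<infinity>\<close> by (auto simp: faster_def)
qed

lemma Bsp_transp: "x \<in> Bsp (transp \<omega>) \<longleftrightarrow> transp x \<in> Bsp \<omega>"
  unfolding Bsp_def transp_def by (auto simp: split_paired_all)

lemma monotone_family_transp:
  assumes "monotone_family \<omega>"
  shows "monotone_family (\<lambda>j n. transp (\<omega> j n))"
  unfolding monotone_family_def
proof (intro conjI allI impI)
  fix j j' :: real assume "j > 0" "j' > 0"
  from monotone_familyD1[OF assms this]
  show "(\<forall>n>0. \<forall>i. transp (\<omega> j n) i \<le> transp (\<omega> j' n) i) \<or> (\<forall>n>0. \<forall>i. transp (\<omega> j' n) i \<le> transp (\<omega> j n) i)"
    unfolding transp_le_iff .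
next
  fix n n' :: real assume "n > 0" "n' > 0"
  from monotone_familyD2[OF assms this]
  show "(\<forall>j>0. \<forall>i. transp (\<omega> j n) i \<le> transp (\<omega> j n') i) \<or> (\<forall>j>0. \<forall>i. transp (\<omega> j n') i \<le> transp (\<omega> j n) i)"
    unfolding transp_le_iff .
qed

lemma PI_family_transp:
  assumes \<omega>: "PI_family decay \<omega>"
  shows "PI_family decay (\<lambda>j n. transp (\<omega> j n))"
  unfolding PI_family_def
proof (intro conjI)
  show "monotone_family (\<lambda>j n. transp (\<omega> j n))"
    by (rule monotone_family_transp[OF PI_familyD(1)[OF \<omega>]])
  show "\<forall>j>0. \<exists>j'>0. \<forall>n>0. \<exists>n'>0. faster decay (transp (\<omega> j n')) (transp (\<omega> j' n))"
    using PI_familyD(2)[OF \<omega>] faster_transp by meson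
  show "\<forall>j>0. \<forall>i. \<exists>n>0. transp (\<omega> j n) i < \<infinity>"
    unfolding transp_apply by (intro allI impI PI_familyD(3)[OF \<omega>])
  show "\<forall>i. \<exists>j>0. \<forall>n>0. 0 < transp (\<omega> j n) i"
    unfolding transp_apply by (intro allI PI_familyD(4)[OF \<omega>])
  show "\<forall>j>0. \<forall>n>0. \<forall>n'>0. \<forall>i. transp (\<omega> j n) i = 0 \<longrightarrow> transp (\<omega> j n') i = 0"
    unfolding transp_apply
  proof (intro allI impI)
    fix j n n' :: real and i
    assume "j > 0" "n > 0" "n' > 0" "\<omega> j n (prod.swap i) = 0"
    then show "\<omega> j n' (prod.swap i) = 0"
      by (rule PI_familyD(5)[OF \<omega>])
  qed
  obtain \<rho> :: "nat \<Rightarrow> real" where r: "\<forall>k. \<rho> k > 0" "\<forall>j>0. \<forall>k i. \<omega> j (\<rho> (Suc k)) i \<le> \<omega> j (\<rho> k) i"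
    "\<forall>n>0. \<exists>k. \<forall>j>0. \<forall>i. \<omega> j (\<rho> k) i \<le> \<omega> j n i"
    using PI_familyD(6)[OF \<omega>] by (elim exE conjE)
  show "\<exists>\<rho>. (\<forall>k::nat. \<rho> k > 0) \<and> (\<forall>j>0. \<forall>k i. transp (\<omega> j (\<rho> (Suc k))) i \<le> transp (\<omega> j (\<rho> k)) i) \<and>
       (\<forall>n>0. \<exists>k. \<forall>j>0. \<forall>i. transp (\<omega> j (\<rho> k)) i \<le> transp (\<omega> j n) i)"
  proof (intro exI[of _ \<rho>] conjI allI impI)
    show "\<rho> k > 0" for k
      using r(1) by simp
    show "transp (\<omega> j (\<rho> (Suc k))) i \<le> transp (\<omega> j (\<rho> k)) i" if "j > 0" for j k i
      using r(2) that unfolding transp_apply by blast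
    fix n :: real assume "n > 0"
    then obtain k where "\<forall>j>0. \<forall>i. \<omega> j (\<rho> k) i \<le> \<omega> j n i"
      using r(3) by blast
    then show "\<exists>k. \<forall>j>0. \<forall>i. transp (\<omega> j (\<rho> k)) i \<le> transp (\<omega> j n) i"
      by (intro exI[of _ k]) (simp add: transp_apply)
  qed
qed

lemma IP_family_transp:
  assumes \<omega>: "IP_family decay \<omega>"
  shows "IP_family decay (\<lambda>j n. transp (\<omega> j n))"
  unfolding IP_family_def
proof (intro conjI)
  show "monotone_family (\<lambda>j n. transp (\<omega> j n))"
    by (rule monotone_family_transp[OF IP_familyD(1)[OF \<omega>]])
  show "\<forall>j>0. \<exists>j'>0. \<forall>n>0. \<exists>n'>0. faster decay (transp (\<omega> j' n)) (transp (\<omega> j n'))"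
    using IP_familyD(2)[OF \<omega>] faster_transp by meson
  show "\<forall>i. \<exists>j>0. \<forall>n>0. transp (\<omega> j n) i < \<infinity>"
    unfolding transp_apply by (intro allI IP_familyD(3)[OF \<omega>])
  show "\<forall>j>0. \<forall>i. \<exists>n>0. 0 < transp (\<omega> j n) i"
    unfolding transp_apply by (intro allI impI IP_familyD(4)[OF \<omega>])
  obtain \<rho> :: "nat \<Rightarrow> real" where r: "\<forall>k. \<rho> k > 0" "\<forall>j>0. \<forall>k i. \<omega> j (\<rho> k) i \<le> \<omega> j (\<rho> (Suc k)) i"
    "\<forall>n>0. \<exists>k. \<forall>j>0. \<forall>i. \<omega> j n i \<le> \<omega> j (\<rho> k) i"
    using IP_familyD(5)[OF \<omega>] by (elim exE conjE)
  show "\<exists>\<rho>. (\<forall>k::nat. \<rho> k > 0) \<and> (\<forall>j>0. \<forall>k i. transp (\<omega> j (\<rho> k)) i \<le> transp (\<omega> j (\<rho> (Suc k))) i) \<and>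
       (\<forall>n>0. \<exists>k. \<forall>j>0. \<forall>i. transp (\<omega> j n) i \<le> transp (\<omega> j (\<rho> k)) i)"
  proof (intro exI[of _ \<rho>] conjI allI impI)
    show "\<rho> k > 0" for k
      using r(1) by simp
    show "transp (\<omega> j (\<rho> k)) i \<le> transp (\<omega> j (\<rho> (Suc k))) i" if "j > 0" for j k i
      using r(2) that unfolding transp_apply by blast
    fix n :: real assume "n > 0"
    then obtain k where "\<forall>j>0. \<forall>i. \<omega> j n i \<le> \<omega> j (\<rho> k) i"
      using r(3) by blast
    then show "\<exists>k. \<forall>j>0. \<forall>i. transp (\<omega> j n) i \<le> transp (\<omega> j (\<rho> k)) i"
      by (intro exI[of _ k]) (simp add: transp_apply)
  qed
qed

lemma wB_eq: "wB th r q = (\<lambda>(\<alpha>, \<beta>). th r \<alpha> * inverse (th q \<beta>))"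
  by (simp add: wB_def divide_ennreal_def)

lemma wA_inv_eq: "wA_inv th r = (\<lambda>i. inverse (wA th r i))"
  by (simp add: wA_inv_def divide_ennreal_def)

lemma wA_mono: "(\<And>\<alpha>. th r \<alpha> \<le> th q \<alpha>) \<Longrightarrow> wA th r i \<le> wA th q i"
  by (auto simp: wA_def intro: mult_mono split: prod.splits)

lemma wA_inv_mono: "(\<And>\<alpha>. th r \<alpha> \<le> th q \<alpha>) \<Longrightarrow> wA_inv th q i \<le> wA_inv th r i"
  unfolding wA_inv_eq by (intro ennreal_inverse_antimono wA_mono)

lemma wB_mono:
  "(\<And>\<alpha>. th r \<alpha> \<le> th r' \<alpha>) \<Longrightarrow> (\<And>\<alpha>. th q' \<alpha> \<le> th q \<alpha>) \<Longrightarrow> wB th r q i \<le> wB th r' q' i"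
  by (auto simp: wB_eq intro!: mult_mono ennreal_inverse_antimono split: prod.splits)

lemma wB_mono_left: "(\<And>\<alpha>. th r \<alpha> \<le> th r' \<alpha>) \<Longrightarrow> wB th r q i \<le> wB th r' q i"
  by (rule wB_mono) simp_all

lemma wB_mono_right: "(\<And>\<alpha>. th q' \<alpha> \<le> th q \<alpha>) \<Longrightarrow> wB th r q i \<le> wB th r q' i"
  by (rule wB_mono) simp_all

text \<open>A simple limit is treated as an iterated one with a dummy parameter; this lemma and
  \<open>const_inner\<close> supply the resulting quantifiers.\<close>

lemma const_outer:
  fixes P :: "real \<Rightarrow> real \<Rightarrow> bool"
  assumes "\<And>n. n > 0 \<Longrightarrow> \<exists>n'>0. P n' n"
  shows "\<forall>j. 0 < (j::real) \<longrightarrow> (\<exists>j'>0::real. \<forall>n>0. \<exists>n'>0. P n' n)"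
  using assms by (auto intro!: exI[of _ 1])

lemma const_inner:
  fixes P :: "real \<Rightarrow> real \<Rightarrow> bool"
  assumes "\<And>j. j > 0 \<Longrightarrow> \<exists>j'>0. P j j'"
  shows "\<forall>j. 0 < j \<longrightarrow> (\<exists>j'>0. \<forall>n>0::real. \<exists>n'>0::real. P j j')"
proof (intro allI impI)
  fix j :: real assume "j > 0"
  then obtain j' where "j' > 0" "P j j'"
    using assms by blast
  then show "\<exists>j'>0. \<forall>n>0::real. \<exists>n'>0::real. P j j'"
    by (intro exI[of _ j'] conjI allI impI exI[of _ "1::real"]) auto
qed

lemma inverse_le_mult:
  fixes a b K :: ennreal
  assumes "a \<le> K * b" "0 < a" "K < \<infinity>"
  shows "inverse b \<le> K * inverse a"
proof (cases "b = top")
  case False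
  have "b \<noteq> 0"
    using assms(1,2) by auto
  then have b: "0 < b" "b < top"
    using False by (auto simp: less_top zero_less_iff_neq_zero)
  have "a < top"
    using assms(1) ennreal_mult_finite[OF assms(3), of b] b by (auto intro: order_le_less_trans)
  then have "inverse b = inverse b * (inverse a * a)"
    using ennreal_inverse_cancel[OF assms(2)] by simp
  also have "\<dots> \<le> inverse b * (inverse a * (K * b))"
    by (intro mult_left_mono assms(1)) auto
  also have "\<dots> = K * inverse a * (inverse b * b)"
    by (simp only: ac_simps)
  also have "\<dots> = K * inverse a"
    using ennreal_inverse_cancel[of b] b by simp
  finally show ?thesis .
qed simp

text \<open>The relation \<open>faster\<close> for a single multi-index. Two such gains multiply to
  the factor \<open>decay\<close>, also through reciprocals, where the direction is
  reversed.\<close>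

definition absorbs :: "(real \<Rightarrow> ('d::finite) mindex \<Rightarrow> ennreal) \<Rightarrow> real \<Rightarrow> real \<Rightarrow> bool" where
  "absorbs th r q \<longleftrightarrow> (\<exists>C<\<infinity>. \<forall>\<alpha>. th r \<alpha> \<le> C * ennreal ((1 / 2) ^ mlen \<alpha>) * th q \<alpha>)"

context scale
begin

lemma th_pos: "r > 0 \<Longrightarrow> 0 < th r \<alpha>"
  using th_low[of r] by (auto intro: order_less_le_trans)

lemma th_one_le: "r > 0 \<Longrightarrow> \<exists>E<\<infinity>. \<forall>\<alpha>. 1 \<le> E * th r \<alpha>"
proof -
  assume "r > 0"
  then obtain a where a: "a > 0" "\<And>\<alpha>. a \<le> th r \<alpha>"
    using th_low by blast
  define b where "b = min a 1"
  have b: "0 < b" "b < \<infinity>" "b \<le> a"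
    using a(1) by (auto simp: b_def min_def intro: order_le_less_trans[of _ 1])
  have "1 \<le> inverse b * th r \<alpha>" for \<alpha>
  proof -
    have "1 = inverse b * b"
      using ennreal_inverse_cancel[OF b(1,2)] by simp
    also have "\<dots> \<le> inverse b * th r \<alpha>"
      using b(3) a(2) by (intro mult_left_mono) (auto intro: order_trans)
    finally show ?thesis .
  qed
  moreover have "inverse b < \<infinity>"
    using b(1) by (auto simp: less_top[symmetric])
  ultimately show ?thesis
    by blast
qed

lemma dominatedE:
  assumes "dominated R th r p q"
  obtains C where "C < \<infinity>"
    "\<And>\<alpha> \<beta>. ennreal (R ^ (mlen \<alpha> + mlen \<beta>)) * th r (\<alpha> + \<beta>) \<le> C * (th p \<alpha> * th q \<beta>)"
  using assms unfolding dominated_def by blast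

text \<open>The case \<beta> = 0, where the weight equals 1.\<close>

lemma dominated_left:
  assumes "dominated R th r p q" "q > 0"
  obtains C where "C < \<infinity>" "\<And>\<alpha>. ennreal (R ^ mlen \<alpha>) * th r \<alpha> \<le> C * th p \<alpha>"
proof -
  obtain C where C: "C < \<infinity>"
    "\<And>\<alpha> \<beta>. ennreal (R ^ (mlen \<alpha> + mlen \<beta>)) * th r (\<alpha> + \<beta>) \<le> C * (th p \<alpha> * th q \<beta>)"
    using dominatedE[OF assms(1)] by blast
  have "ennreal (R ^ mlen \<alpha>) * th r \<alpha> \<le> C * th p \<alpha>" for \<alpha>
    using C(2)[of \<alpha> 0] th_zero[OF assms(2)] by simp
  with C(1) show thesis
    by (rule that)
qed

lemma dominated_right:
  assumes "dominated R th r p q" "r > 0" "p > 0"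
  obtains C where "C < \<infinity>" "\<And>\<alpha>. ennreal (R ^ mlen \<alpha>) \<le> C * th q \<alpha>"
proof -
  obtain C where C: "C < \<infinity>"
    "\<And>\<alpha> \<beta>. ennreal (R ^ (mlen \<alpha> + mlen \<beta>)) * th r (\<alpha> + \<beta>) \<le> C * (th p \<alpha> * th q \<beta>)"
    using dominatedE[OF assms(1)] by blast
  obtain E where E: "E < \<infinity>" "\<And>\<alpha>. 1 \<le> E * th r \<alpha>"
    using th_one_le[OF assms(2)] by blast
  have "ennreal (R ^ mlen \<alpha>) \<le> E * C * th q \<alpha>" for \<alpha>
  proof -
    have "ennreal (R ^ mlen \<alpha>) * 1 \<le> ennreal (R ^ mlen \<alpha>) * (E * th r \<alpha>)"
      by (intro mult_left_mono E(2)) simp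
    also have "\<dots> = E * (ennreal (R ^ mlen \<alpha>) * th r \<alpha>)"
      by (simp only: ac_simps)
    also have "\<dots> \<le> E * (C * th q \<alpha>)"
      using C(2)[of 0 \<alpha>] th_zero[OF assms(3)] by (intro mult_left_mono) simp_all
    finally show ?thesis
      by (simp add: mult.assoc)
  qed
  then show thesis
    by (rule that[OF ennreal_mult_finite[OF E(1) C(1)]])
qed

lemma dominated_absorbs:
  assumes "dominated R th r p q" "q > 0"
  shows "absorbs th r p"
proof -
  obtain C where C: "C < \<infinity>" "\<And>\<alpha>. ennreal (R ^ mlen \<alpha>) * th r \<alpha> \<le> C * th p \<alpha>"
    using dominated_left[OF assms] by blast
  have "th r \<alpha> \<le> C * ennreal ((1 / 2) ^ mlen \<alpha>) * th p \<alpha>" for \<alpha>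
  proof -
    have "1 \<le> ennreal ((1 / 2) ^ mlen \<alpha>) * ennreal (R ^ mlen \<alpha>)"
    proof -
      have "(1 / 2) ^ mlen \<alpha> * 2 ^ mlen \<alpha> \<le> (1 / 2) ^ mlen \<alpha> * R ^ mlen \<alpha>"
        using R by (intro mult_left_mono power_mono) auto
      then have "1 \<le> (1 / 2) ^ mlen \<alpha> * R ^ mlen \<alpha>"
        by (simp flip: power_mult_distrib)
      then have "ennreal 1 \<le> ennreal ((1 / 2) ^ mlen \<alpha> * R ^ mlen \<alpha>)"
        by (rule ennreal_leI)
      also have "\<dots> = ennreal ((1 / 2) ^ mlen \<alpha>) * ennreal (R ^ mlen \<alpha>)"
        using R by (intro ennreal_mult) auto
      finally show ?thesis
        by simp
    qed
    then have "1 * th r \<alpha> \<le> ennreal ((1 / 2) ^ mlen \<alpha>) * ennreal (R ^ mlen \<alpha>) * th r \<alpha>"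
      by (rule mult_right_mono) simp
    also have "\<dots> = ennreal ((1 / 2) ^ mlen \<alpha>) * (ennreal (R ^ mlen \<alpha>) * th r \<alpha>)"
      by (rule mult.assoc)
    also have "\<dots> \<le> ennreal ((1 / 2) ^ mlen \<alpha>) * (C * th p \<alpha>)"
      by (intro mult_left_mono C(2)) simp
    finally show ?thesis
      by (simp add: ac_simps)
  qed
  with C(1) show ?thesis
    unfolding absorbs_def by blast
qed

lemma decay_eq: "decay (\<alpha>, \<beta>) = ennreal ((1 / 2) ^ mlen \<alpha>) * ennreal ((1 / 2) ^ mlen \<beta>)"
  unfolding decay_def prod.case power_add by (rule ennreal_mult) auto

lemma faster_wA:
  assumes "absorbs th r q"
  shows "faster decay (wA th r) (wA th q)"
proof -
  obtain C where C: "C < \<infinity>" "\<And>\<alpha>. th r \<alpha> \<le> C * ennreal ((1 / 2) ^ mlen \<alpha>) * th q \<alpha>"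
    using assms by (auto simp: absorbs_def)
  have "wA th r i \<le> (C * C) * decay i * wA th q i" for i
  proof -
    obtain \<alpha> \<beta> where i: "i = (\<alpha>, \<beta>)"
      by fastforce
    have "th r \<alpha> * th r \<beta> \<le> (C * ennreal ((1 / 2) ^ mlen \<alpha>) * th q \<alpha>) * (C * ennreal ((1 / 2) ^ mlen \<beta>) * th q \<beta>)"
      by (intro mult_mono C(2)) auto
    then show ?thesis
      by (simp only: i wA_def prod.case decay_eq ac_simps)
  qed
  then show ?thesis
    unfolding faster_def using ennreal_mult_finite[OF C(1) C(1)] by blast
qed

lemma faster_wA_inv:
  assumes "absorbs th r q" "r > 0"
  shows "faster decay (wA_inv th q) (wA_inv th r)"
proof -
  obtain C where C: "C < \<infinity>" "\<And>i. wA th r i \<le> C * decay i * wA th q i"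
    using faster_wA[OF assms(1)] by (auto simp: faster_def)
  have "wA_inv th q i \<le> C * decay i * wA_inv th r i" for i
    unfolding wA_inv_eq
  proof (rule inverse_le_mult[OF C(2)])
    show "0 < wA th r i"
      using th_pos[OF assms(2)] by (auto simp: wA_def ennreal_zero_less_mult_iff split: prod.splits)
    show "C * decay i < \<infinity>"
      using C(1) nuclear_decay[unfolded nuclear_def, THEN conjunct1, THEN spec, of i]
      by (intro ennreal_mult_finite) simp_all
  qed
  then show ?thesis
    unfolding faster_def using C(1) by blast
qed

lemma faster_wB:
  assumes "absorbs th r r'" "absorbs th q' q" "q' > 0"
  shows "faster decay (wB th r q) (wB th r' q')"
proof -
  obtain C where C: "C < \<infinity>" "\<And>\<alpha>. th r \<alpha> \<le> C * ennreal ((1 / 2) ^ mlen \<alpha>) * th r' \<alpha>"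
    using assms by (auto simp: absorbs_def)
  obtain D where D: "D < \<infinity>" "\<And>\<alpha>. th q' \<alpha> \<le> D * ennreal ((1 / 2) ^ mlen \<alpha>) * th q \<alpha>"
    using assms by (auto simp: absorbs_def)
  have "wB th r q i \<le> (C * D) * decay i * wB th r' q' i" for i
  proof -
    obtain \<alpha> \<beta> where i: "i = (\<alpha>, \<beta>)"
      by fastforce
    have "inverse (th q \<beta>) \<le> D * ennreal ((1 / 2) ^ mlen \<beta>) * inverse (th q' \<beta>)"
      using D(1) by (intro inverse_le_mult[OF D(2)] th_pos assms(3) ennreal_mult_finite) auto
    then have "th r \<alpha> * inverse (th q \<beta>) \<le>
        (C * ennreal ((1 / 2) ^ mlen \<alpha>) * th r' \<alpha>) * (D * ennreal ((1 / 2) ^ mlen \<beta>) * inverse (th q' \<beta>))"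
      by (intro mult_mono C(2)) auto
    then show ?thesis
      by (simp only: i wB_eq prod.case decay_eq ac_simps)
  qed
  then show ?thesis
    unfolding faster_def using ennreal_mult_finite[OF C(1) D(1)] by blast
qed

lemma monotone_wA: "monotone_family (\<lambda>_. wA th)" "monotone_family (\<lambda>j _. wA th j)"
  and monotone_wA_inv: "monotone_family (\<lambda>_. wA_inv th)" "monotone_family (\<lambda>j _. wA_inv th j)"
proof -
  have "(\<forall>i. wA th r i \<le> wA th q i) \<or> (\<forall>i. wA th q i \<le> wA th r i)"
    "(\<forall>i. wA_inv th r i \<le> wA_inv th q i) \<or> (\<forall>i. wA_inv th q i \<le> wA_inv th r i)" if "r > 0" "q > 0" for r q
    using th_chain[OF that] by (blast intro: wA_mono wA_inv_mono)+
  then show "monotone_family (\<lambda>_. wA th)" "monotone_family (\<lambda>j _. wA th j)"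
    "monotone_family (\<lambda>_. wA_inv th)" "monotone_family (\<lambda>j _. wA_inv th j)"
    unfolding monotone_family_def by simp_all
qed

lemma monotone_wB: "monotone_family (wB th)" "monotone_family (\<lambda>j n. wB th n j)"
proof -
  have 1: "(\<forall>n>0. \<forall>i. wB th r n i \<le> wB th q n i) \<or> (\<forall>n>0. \<forall>i. wB th q n i \<le> wB th r n i)" if "r > 0" "q > 0" for r q
    using th_chain[OF that] by (blast intro: wB_mono)
  have 2: "(\<forall>n>0. \<forall>i. wB th n r i \<le> wB th n q i) \<or> (\<forall>n>0. \<forall>i. wB th n q i \<le> wB th n r i)" if "r > 0" "q > 0" for r q
    using th_chain[OF that] by (blast intro: wB_mono)
  show "monotone_family (wB th)" "monotone_family (\<lambda>j n. wB th n j)"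
    unfolding monotone_family_def by (intro conjI allI impI 1 2; assumption)+
qed

lemma wA_pos: "r > 0 \<Longrightarrow> 0 < wA th r i"
  by (auto simp: wA_def ennreal_zero_less_mult_iff th_pos split: prod.splits)

lemma wA_inv_finite: "r > 0 \<Longrightarrow> wA_inv th r i < \<infinity>"
  using wA_pos[of r i] by (auto simp: wA_inv_eq less_top[symmetric])

lemma wB_finite: "th r \<alpha> < \<infinity> \<Longrightarrow> q > 0 \<Longrightarrow> wB th r q (\<alpha>, \<beta>) < \<infinity>"
  using th_pos[of q \<beta>] unfolding wB_eq prod.case
  by (intro ennreal_mult_finite) (auto simp: less_top[symmetric])

lemma wB_pos: "r > 0 \<Longrightarrow> th q \<beta> < \<infinity> \<Longrightarrow> 0 < wB th r q (\<alpha>, \<beta>)"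
  using th_pos[of r \<alpha>] by (simp add: wB_eq ennreal_zero_less_mult_iff ennreal_inverse_positive less_top)

text \<open>Numerators are positive, so a zero can only come from an infinite denominator, which
  depends on \<open>q\<close> alone.\<close>

lemma wB_zero: "r > 0 \<Longrightarrow> r' > 0 \<Longrightarrow> wB th r q i = 0 \<Longrightarrow> wB th r' q i = 0"
  using th_pos[of r "fst i"] by (auto simp: wB_eq split: prod.splits)

end

section \<open>Families of weights for s < 1/2\<close>

context scale_down
begin

lemma down_absorbs: "q > 0 \<Longrightarrow> \<exists>r>0. absorbs th r q"
  using down[of q q] dominated_absorbs by blast

lemma down_finite2: "\<exists>r>0. th r \<alpha> < \<infinity> \<and> th r \<beta> < \<infinity>"
proof -
  obtain r q where rq: "r > 0" "th r \<alpha> < \<infinity>" "q > 0" "th q \<beta> < \<infinity>"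
    using down_finite[of \<alpha>] down_finite[of \<beta>] by blast
  from th_chain[OF rq(1,3)] show ?thesis
  proof
    assume "\<forall>\<alpha>. th r \<alpha> \<le> th q \<alpha>"
    then show ?thesis
      using rq by (intro exI[of _ r]) (auto intro: order_le_less_trans)
  next
    assume "\<forall>\<alpha>. th q \<alpha> \<le> th r \<alpha>"
    then show ?thesis
      using rq by (intro exI[of _ q]) (auto intro: order_le_less_trans)
  qed
qed

lemma wA_finite: "\<exists>r>0. wA th r i < \<infinity>"
  using down_finite2[of "fst i" "snd i"] by (auto simp: wA_def ennreal_mult_less_top split: prod.splits)

lemma cofinalE:
  obtains \<rho> :: "nat \<Rightarrow> real" where "\<And>k. \<rho> k > 0" "\<And>k \<alpha>. th (\<rho> (Suc k)) \<alpha> \<le> th (\<rho> k) \<alpha>"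
    "\<And>n. n > 0 \<Longrightarrow> \<exists>k. \<forall>\<alpha>. th (\<rho> k) \<alpha> \<le> th n \<alpha>"
  using down_cofinal by blast

lemma PI_A: "PI_family decay (\<lambda>_. wA th)"
  unfolding PI_family_def
proof (intro conjI monotone_wA)
  show "\<forall>j>(0::real). \<exists>j'>(0::real). \<forall>n>(0::real). \<exists>n'>(0::real). faster decay (wA th n') (wA th n)"
    by (rule const_outer) (use down_absorbs faster_wA in blast)
  show "\<forall>j>(0::real). \<forall>i. \<exists>n>(0::real). wA th n i < \<infinity>"
    using wA_finite by simp
  show "\<forall>i. \<exists>j>(0::real). \<forall>n>(0::real). 0 < wA th n i"
    using wA_pos by (auto intro: exI[of _ 1])
  show "\<forall>j>(0::real). \<forall>n>(0::real). \<forall>n'>(0::real). \<forall>i. wA th n i = 0 \<longrightarrow> wA th n' i = 0"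
    by (intro allI impI) (simp add: wA_pos less_imp_neq[symmetric])
  obtain \<rho> :: "nat \<Rightarrow> real" where \<rho>: "\<And>k. \<rho> k > 0" "\<And>k \<alpha>. th (\<rho> (Suc k)) \<alpha> \<le> th (\<rho> k) \<alpha>"
    "\<And>n. n > 0 \<Longrightarrow> \<exists>k. \<forall>\<alpha>. th (\<rho> k) \<alpha> \<le> th n \<alpha>"
    by (rule cofinalE) blast
  show "\<exists>\<rho>::nat \<Rightarrow> real. (\<forall>k. \<rho> k > 0) \<and> (\<forall>j>(0::real). \<forall>k i. wA th (\<rho> (Suc k)) i \<le> wA th (\<rho> k) i) \<and>
       (\<forall>n>(0::real). \<exists>k. \<forall>j>(0::real). \<forall>i. wA th (\<rho> k) i \<le> wA th n i)"
  proof (intro exI[of _ \<rho>] conjI allI impI)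
    show "\<rho> k > 0" for k
      by (rule \<rho>(1))
    show "wA th (\<rho> (Suc k)) i \<le> wA th (\<rho> k) i" for j k i
      by (rule wA_mono[OF \<rho>(2)])
    fix n :: real assume "n > 0"
    then obtain k where k: "\<And>\<alpha>. th (\<rho> k) \<alpha> \<le> th n \<alpha>"
      using \<rho>(3) by blast
    show "\<exists>k. \<forall>j>(0::real). \<forall>i. wA th (\<rho> k) i \<le> wA th n i"
      by (intro exI[of _ k] allI impI wA_mono k)
  qed
qed

lemma PI_A_inv: "PI_family decay (\<lambda>j _. wA_inv th j)"
  unfolding PI_family_def
proof (intro conjI monotone_wA_inv)
  show "\<forall>j>(0::real). \<exists>j'>(0::real). \<forall>n>(0::real). \<exists>n'>(0::real). faster decay (wA_inv th j) (wA_inv th j')"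
    by (rule const_inner) (use down_absorbs faster_wA_inv in blast)
  show "\<forall>j>(0::real). \<forall>i. \<exists>n>(0::real). wA_inv th j i < \<infinity>"
    using wA_inv_finite zero_less_one by blast
  show "\<forall>i. \<exists>j>(0::real). \<forall>n>(0::real). 0 < wA_inv th j i"
    using wA_finite by (auto simp: wA_inv_eq ennreal_inverse_positive less_top)
  show "\<exists>\<rho>::nat \<Rightarrow> real. (\<forall>k. \<rho> k > 0) \<and> (\<forall>j>(0::real). \<forall>k i. wA_inv th j i \<le> wA_inv th j i) \<and>
       (\<forall>n>(0::real). \<exists>k. \<forall>j>(0::real). \<forall>i. wA_inv th j i \<le> wA_inv th j i)"
    \<comment> \<open>The family does not vary with the inner parameter, so a constant sequence is
      cofinal.\<close>
    by (rule exI[of _ "\<lambda>_. 1"]) simp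
qed simp_all

text \<open>The arguments of \<open>wB\<close> appear exchanged because here the outer limit runs
  over the parameter of the denominator.\<close>

lemma PI_B: "PI_family decay (\<lambda>j n. wB th n j)"
  unfolding PI_family_def
proof (intro conjI monotone_wB)
  show "\<forall>j>0. \<exists>j'>0. \<forall>n>0. \<exists>n'>0. faster decay (wB th n' j) (wB th n j')"
    using down_absorbs faster_wB by meson
  show "\<forall>j>0. \<forall>i. \<exists>n>0. wB th n j i < \<infinity>"
    using down_finite wB_finite by (metis surj_pair)
  show "\<forall>i. \<exists>j>0. \<forall>n>0. 0 < wB th n j i"
    using down_finite wB_pos by (metis surj_pair)
  show "\<forall>j>0. \<forall>n>0. \<forall>n'>0. \<forall>i. wB th n j i = 0 \<longrightarrow> wB th n' j i = 0"
    using wB_zero by blast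
  obtain \<rho> :: "nat \<Rightarrow> real" where \<rho>: "\<And>k. \<rho> k > 0" "\<And>k \<alpha>. th (\<rho> (Suc k)) \<alpha> \<le> th (\<rho> k) \<alpha>"
    "\<And>n. n > 0 \<Longrightarrow> \<exists>k. \<forall>\<alpha>. th (\<rho> k) \<alpha> \<le> th n \<alpha>"
    by (rule cofinalE) blast
  show "\<exists>\<rho>::nat \<Rightarrow> real. (\<forall>k. \<rho> k > 0) \<and> (\<forall>j>0. \<forall>k i. wB th (\<rho> (Suc k)) j i \<le> wB th (\<rho> k) j i) \<and>
       (\<forall>n>0. \<exists>k. \<forall>j>0. \<forall>i. wB th (\<rho> k) j i \<le> wB th n j i)"
  proof (intro exI[of _ \<rho>] conjI allI impI)
    show "\<rho> k > 0" for k
      by (rule \<rho>(1))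
    show "wB th (\<rho> (Suc k)) j i \<le> wB th (\<rho> k) j i" for j k i
      by (rule wB_mono_left[OF \<rho>(2)])
    fix n :: real assume "n > 0"
    then obtain k where k: "\<And>\<alpha>. th (\<rho> k) \<alpha> \<le> th n \<alpha>"
      using \<rho>(3) by blast
    show "\<exists>k. \<forall>j>0. \<forall>i. wB th (\<rho> k) j i \<le> wB th n j i"
      by (intro exI[of _ k] allI impI wB_mono_left k)
  qed
qed

lemma IP_C: "IP_family decay (wB th)"
  unfolding IP_family_def
proof (intro conjI monotone_wB)
  show "\<forall>j>0. \<exists>j'>0. \<forall>n>0. \<exists>n'>0. faster decay (wB th j' n) (wB th j n')"
    using down_absorbs faster_wB by meson
  show "\<forall>i. \<exists>j>0. \<forall>n>0. wB th j n i < \<infinity>"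
    using down_finite wB_finite by (metis surj_pair)
  show "\<forall>j>0. \<forall>i. \<exists>n>0. 0 < wB th j n i"
    using down_finite wB_pos by (metis surj_pair)
  obtain \<rho> :: "nat \<Rightarrow> real" where \<rho>: "\<And>k. \<rho> k > 0" "\<And>k \<alpha>. th (\<rho> (Suc k)) \<alpha> \<le> th (\<rho> k) \<alpha>"
    "\<And>n. n > 0 \<Longrightarrow> \<exists>k. \<forall>\<alpha>. th (\<rho> k) \<alpha> \<le> th n \<alpha>"
    by (rule cofinalE) blast
  show "\<exists>\<rho>::nat \<Rightarrow> real. (\<forall>k. \<rho> k > 0) \<and> (\<forall>j>0. \<forall>k i. wB th j (\<rho> k) i \<le> wB th j (\<rho> (Suc k)) i) \<and>
       (\<forall>n>0. \<exists>k. \<forall>j>0. \<forall>i. wB th j n i \<le> wB th j (\<rho> k) i)"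
  proof (intro exI[of _ \<rho>] conjI allI impI)
    show "\<rho> k > 0" for k
      by (rule \<rho>(1))
    show "wB th j (\<rho> k) i \<le> wB th j (\<rho> (Suc k)) i" for j k i
      by (rule wB_mono_right[OF \<rho>(2)])
    fix n :: real assume "n > 0"
    then obtain k where k: "\<And>\<alpha>. th (\<rho> k) \<alpha> \<le> th n \<alpha>"
      using \<rho>(3) by blast
    show "\<exists>k. \<forall>j>0. \<forall>i. wB th j n i \<le> wB th j (\<rho> k) i"
      by (intro exI[of _ k] allI impI wB_mono_right k)
  qed
qed

end

section \<open>Families of weights for 0 < s \<le> 1/2\<close>

context scale_up
begin

lemma up_absorbs: "r > 0 \<Longrightarrow> \<exists>q>0. absorbs th r q"
  using up[of r] dominated_absorbs by (meson order_refl)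

lemma wA_finite: "r > 0 \<Longrightarrow> wA th r i < \<infinity>"
  using up_finite by (auto simp: wA_def ennreal_mult_less_top split: prod.splits)

lemma wA_inv_pos: "r > 0 \<Longrightarrow> 0 < wA_inv th r i"
  using wA_finite[of r i] by (simp add: wA_inv_eq ennreal_inverse_positive less_top)

lemma cofinalE:
  obtains \<rho> :: "nat \<Rightarrow> real" where "\<And>k. \<rho> k > 0" "\<And>k \<alpha>. th (\<rho> k) \<alpha> \<le> th (\<rho> (Suc k)) \<alpha>"
    "\<And>n. n > 0 \<Longrightarrow> \<exists>k. \<forall>\<alpha>. th n \<alpha> \<le> th (\<rho> k) \<alpha>"
  using up_cofinal by blast

lemma wB_finite': "r > 0 \<Longrightarrow> q > 0 \<Longrightarrow> wB th r q i < \<infinity>"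
  using wB_finite[OF up_finite] by (metis surj_pair)

lemma wB_pos': "r > 0 \<Longrightarrow> q > 0 \<Longrightarrow> 0 < wB th r q i"
  using wB_pos[OF _ up_finite] by (metis surj_pair)

lemma PI_A: "PI_family decay (\<lambda>j _. wA th j)"
  unfolding PI_family_def
proof (intro conjI monotone_wA)
  show "\<forall>j>(0::real). \<exists>j'>(0::real). \<forall>n>(0::real). \<exists>n'>(0::real). faster decay (wA th j) (wA th j')"
    by (rule const_inner) (use up_absorbs faster_wA in blast)
  show "\<forall>j>(0::real). \<forall>i. \<exists>n>(0::real). wA th j i < \<infinity>"
    using wA_finite zero_less_one by blast
  show "\<forall>i. \<exists>j>(0::real). \<forall>n>(0::real). 0 < wA th j i"
    using wA_pos by (auto intro: exI[of _ 1])
  show "\<exists>\<rho>::nat \<Rightarrow> real. (\<forall>k. \<rho> k > 0) \<and> (\<forall>j>(0::real). \<forall>k i. wA th j i \<le> wA th j i) \<and>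
       (\<forall>n>(0::real). \<exists>k. \<forall>j>(0::real). \<forall>i. wA th j i \<le> wA th j i)"
    by (rule exI[of _ "\<lambda>_. 1"]) simp
qed simp_all

lemma PI_A_inv: "PI_family decay (\<lambda>_. wA_inv th)"
  unfolding PI_family_def
proof (intro conjI monotone_wA_inv)
  show "\<forall>j>(0::real). \<exists>j'>(0::real). \<forall>n>(0::real). \<exists>n'>(0::real). faster decay (wA_inv th n') (wA_inv th n)"
    by (rule const_outer) (use up_absorbs faster_wA_inv in blast)
  show "\<forall>j>(0::real). \<forall>i. \<exists>n>(0::real). wA_inv th n i < \<infinity>"
    using wA_inv_finite zero_less_one by blast
  show "\<forall>i. \<exists>j>(0::real). \<forall>n>(0::real). 0 < wA_inv th n i"
    using wA_inv_pos by (auto intro: exI[of _ 1])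
  show "\<forall>j>(0::real). \<forall>n>(0::real). \<forall>n'>(0::real). \<forall>i. wA_inv th n i = 0 \<longrightarrow> wA_inv th n' i = 0"
    by (intro allI impI) (simp add: wA_inv_pos less_imp_neq[symmetric])
  obtain \<rho> :: "nat \<Rightarrow> real" where \<rho>: "\<And>k. \<rho> k > 0" "\<And>k \<alpha>. th (\<rho> k) \<alpha> \<le> th (\<rho> (Suc k)) \<alpha>"
    "\<And>n. n > 0 \<Longrightarrow> \<exists>k. \<forall>\<alpha>. th n \<alpha> \<le> th (\<rho> k) \<alpha>"
    by (rule cofinalE) blast
  show "\<exists>\<rho>::nat \<Rightarrow> real. (\<forall>k. \<rho> k > 0) \<and> (\<forall>j>(0::real). \<forall>k i. wA_inv th (\<rho> (Suc k)) i \<le> wA_inv th (\<rho> k) i) \<and>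
       (\<forall>n>(0::real). \<exists>k. \<forall>j>(0::real). \<forall>i. wA_inv th (\<rho> k) i \<le> wA_inv th n i)"
  proof (intro exI[of _ \<rho>] conjI allI impI)
    show "\<rho> k > 0" for k
      by (rule \<rho>(1))
    show "wA_inv th (\<rho> (Suc k)) i \<le> wA_inv th (\<rho> k) i" for j k i
      by (rule wA_inv_mono[OF \<rho>(2)])
    fix n :: real assume "n > 0"
    then obtain k where k: "\<And>\<alpha>. th n \<alpha> \<le> th (\<rho> k) \<alpha>"
      using \<rho>(3) by blast
    show "\<exists>k. \<forall>j>(0::real). \<forall>i. wA_inv th (\<rho> k) i \<le> wA_inv th n i"
      by (intro exI[of _ k] allI impI wA_inv_mono k)
  qed
qed

lemma PI_B: "PI_family decay (wB th)"
  unfolding PI_family_def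
proof (intro conjI monotone_wB)
  show "\<forall>j>0. \<exists>j'>0. \<forall>n>0. \<exists>n'>0. faster decay (wB th j n') (wB th j' n)"
    using up_absorbs faster_wB by meson
  show "\<forall>j>0. \<forall>i. \<exists>n>0. wB th j n i < \<infinity>"
    using wB_finite' zero_less_one by blast
  show "\<forall>i. \<exists>j>0. \<forall>n>0. 0 < wB th j n i"
    using wB_pos' zero_less_one by blast
  show "\<forall>j>0. \<forall>n>0. \<forall>n'>0. \<forall>i. wB th j n i = 0 \<longrightarrow> wB th j n' i = 0"
    by (intro allI impI) (simp add: wB_pos' less_imp_neq[symmetric])
  obtain \<rho> :: "nat \<Rightarrow> real" where \<rho>: "\<And>k. \<rho> k > 0" "\<And>k \<alpha>. th (\<rho> k) \<alpha> \<le> th (\<rho> (Suc k)) \<alpha>"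
    "\<And>n. n > 0 \<Longrightarrow> \<exists>k. \<forall>\<alpha>. th n \<alpha> \<le> th (\<rho> k) \<alpha>"
    by (rule cofinalE) blast
  show "\<exists>\<rho>::nat \<Rightarrow> real. (\<forall>k. \<rho> k > 0) \<and> (\<forall>j>0. \<forall>k i. wB th j (\<rho> (Suc k)) i \<le> wB th j (\<rho> k) i) \<and>
       (\<forall>n>0. \<exists>k. \<forall>j>0. \<forall>i. wB th j (\<rho> k) i \<le> wB th j n i)"
  proof (intro exI[of _ \<rho>] conjI allI impI)
    show "\<rho> k > 0" for k
      by (rule \<rho>(1))
    show "wB th j (\<rho> (Suc k)) i \<le> wB th j (\<rho> k) i" for j k i
      by (rule wB_mono_right[OF \<rho>(2)])
    fix n :: real assume "n > 0"
    then obtain k where k: "\<And>\<alpha>. th n \<alpha> \<le> th (\<rho> k) \<alpha>"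
      using \<rho>(3) by blast
    show "\<exists>k. \<forall>j>0. \<forall>i. wB th j (\<rho> k) i \<le> wB th j n i"
      by (intro exI[of _ k] allI impI wB_mono_right k)
  qed
qed

lemma IP_C: "IP_family decay (\<lambda>j n. wB th n j)"
  unfolding IP_family_def
proof (intro conjI monotone_wB)
  show "\<forall>j>0. \<exists>j'>0. \<forall>n>0. \<exists>n'>0. faster decay (wB th n j') (wB th n' j)"
    using up_absorbs faster_wB by meson
  show "\<forall>i. \<exists>j>0. \<forall>n>0. wB th n j i < \<infinity>"
    using wB_finite' zero_less_one by blast
  show "\<forall>j>0. \<forall>i. \<exists>n>0. 0 < wB th n j i"
    using wB_pos' zero_less_one by blast
  obtain \<rho> :: "nat \<Rightarrow> real" where \<rho>: "\<And>k. \<rho> k > 0" "\<And>k \<alpha>. th (\<rho> k) \<alpha> \<le> th (\<rho> (Suc k)) \<alpha>"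
    "\<And>n. n > 0 \<Longrightarrow> \<exists>k. \<forall>\<alpha>. th n \<alpha> \<le> th (\<rho> k) \<alpha>"
    by (rule cofinalE) blast
  show "\<exists>\<rho>::nat \<Rightarrow> real. (\<forall>k. \<rho> k > 0) \<and> (\<forall>j>0. \<forall>k i. wB th (\<rho> k) j i \<le> wB th (\<rho> (Suc k)) j i) \<and>
       (\<forall>n>0. \<exists>k. \<forall>j>0. \<forall>i. wB th n j i \<le> wB th (\<rho> k) j i)"
  proof (intro exI[of _ \<rho>] conjI allI impI)
    show "\<rho> k > 0" for k
      by (rule \<rho>(1))
    show "wB th (\<rho> k) j i \<le> wB th (\<rho> (Suc k)) j i" for j k i
      by (rule wB_mono_left[OF \<rho>(2)])
    fix n :: real assume "n > 0"
    then obtain k where k: "\<And>\<alpha>. th n \<alpha> \<le> th (\<rho> k) \<alpha>"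
      using \<rho>(3) by blast
    show "\<exists>k. \<forall>j>0. \<forall>i. wB th n j i \<le> wB th (\<rho> k) j i"
      by (intro exI[of _ k] allI impI wB_mono_left k)
  qed
qed

end

section \<open>Norm estimates for the kernel\<close>

text \<open>Removes quotients from sup bounds so that the estimates become products. The constants
  on the two sides may differ, which takes care of infinite denominators.\<close>

lemma ennreal_divide_le_iff:
  fixes a b :: "'i \<Rightarrow> ennreal"
  assumes b: "\<And>i. 0 < b i"
  shows "(\<exists>C<\<infinity>. \<forall>i. x i * (a i / b i) \<le> C) \<longleftrightarrow> (\<exists>C<\<infinity>. \<forall>i. x i * a i \<le> C * b i)"
proof
  assume "\<exists>C<\<infinity>. \<forall>i. x i * (a i / b i) \<le> C"
  then obtain C where C: "C < \<infinity>" "\<And>i. x i * (a i / b i) \<le> C"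
    by blast
  have "x i * a i \<le> (C + 1) * b i" for i
    using C by (intro ennreal_le_mult_inverse) (simp_all add: divide_ennreal_def ac_simps)
  moreover have "C + 1 < \<infinity>"
    using C(1) by simp
  ultimately show "\<exists>C<\<infinity>. \<forall>i. x i * a i \<le> C * b i"
    by blast
next
  assume "\<exists>C<\<infinity>. \<forall>i. x i * a i \<le> C * b i"
  then obtain C where C: "C < \<infinity>" "\<And>i. x i * a i \<le> C * b i"
    by blast
  have "x i * (a i / b i) \<le> C" for i
  proof (cases "b i = top")
    case False
    have "x i * (a i / b i) = (x i * a i) * inverse (b i)"
      by (simp add: divide_ennreal_def mult.assoc)
    also have "\<dots> \<le> C * b i * inverse (b i)"
      by (intro mult_right_mono C(2)) simp
    also have "\<dots> = C * (inverse (b i) * b i)"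
      by (simp only: ac_simps)
    also have "\<dots> = C"
      using ennreal_inverse_cancel[OF b[of i]] False by (simp add: less_top)
    finally show ?thesis .
  qed simp
  with C(1) show "\<exists>C<\<infinity>. \<forall>i. x i * (a i / b i) \<le> C"
    by blast
qed

text \<open>The inequality chain behind \<open>core_B\<close> with all weights abstracted to
  letters, so that every link is one replacement after a commutative rearrangement. The next two
  lemmas do the same for \<open>core_A\<close> and \<open>core_AB\<close>.\<close>

lemma chain_B:
  fixes X Y :: ennreal
  assumes "Ra * tr \<le> E1 * (ta * sa)" "X * ta \<le> C1 * tb" "Rb * tb \<le> E2 * (ub * sg)" "sa * sg \<le> sag"
    "Y * sag \<le> C2 * vb" "Rc * vb \<le> E3 * wb" "ub * wb \<le> w"
  shows "X * Y * (Ra * Rb * Rc) * tr \<le> (E1 * C1 * E2 * C2 * E3) * w"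
proof -
  have "X * Y * (Ra * Rb * Rc) * tr = (X * Y * Rb * Rc) * (Ra * tr)"
    by (simp only: ac_simps)
  also have "\<dots> \<le> (X * Y * Rb * Rc) * (E1 * (ta * sa))"
    by (intro mult_left_mono assms) simp
  also have "\<dots> = (Y * Rb * Rc * E1 * sa) * (X * ta)"
    by (simp only: ac_simps)
  also have "\<dots> \<le> (Y * Rb * Rc * E1 * sa) * (C1 * tb)"
    by (intro mult_left_mono assms) simp
  also have "\<dots> = (Y * Rc * E1 * sa * C1) * (Rb * tb)"
    by (simp only: ac_simps)
  also have "\<dots> \<le> (Y * Rc * E1 * sa * C1) * (E2 * (ub * sg))"
    by (intro mult_left_mono assms) simp
  also have "\<dots> = (Y * Rc * E1 * C1 * E2 * ub) * (sa * sg)"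
    by (simp only: ac_simps)
  also have "\<dots> \<le> (Y * Rc * E1 * C1 * E2 * ub) * sag"
    by (intro mult_left_mono assms) simp
  also have "\<dots> = (Rc * E1 * C1 * E2 * ub) * (Y * sag)"
    by (simp only: ac_simps)
  also have "\<dots> \<le> (Rc * E1 * C1 * E2 * ub) * (C2 * vb)"
    by (intro mult_left_mono assms) simp
  also have "\<dots> = (E1 * C1 * E2 * C2 * ub) * (Rc * vb)"
    by (simp only: ac_simps)
  also have "\<dots> \<le> (E1 * C1 * E2 * C2 * ub) * (E3 * wb)"
    by (intro mult_left_mono assms) simp
  also have "\<dots> = (E1 * C1 * E2 * C2 * E3) * (ub * wb)"
    by (simp only: ac_simps)
  also have "\<dots> \<le> (E1 * C1 * E2 * C2 * E3) * w"
    by (intro mult_left_mono assms) simp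
  finally show ?thesis .
qed

lemma chain_A:
  fixes X Y :: ennreal
  assumes "Ra * tr \<le> E1 * (ta * ta')" "Rb * sr \<le> E2 * (sb * sb')" "Rg \<le> E3 * tg" "ta' * tg \<le> tag"
    "sb \<le> E4 * sbg" "X * (ta * sbg) \<le> C1" "Y * (tag * sb') \<le> C2"
  shows "X * Y * (Ra * Rb * Rg) * (tr * sr) \<le> E1 * E2 * E3 * E4 * C1 * C2"
proof -
  have "X * Y * (Ra * Rb * Rg) * (tr * sr) = X * Y * ((Ra * tr) * (Rb * sr) * Rg)"
    by (simp only: ac_simps)
  also have "\<dots> \<le> X * Y * ((E1 * (ta * ta')) * (E2 * (sb * sb')) * (E3 * tg))"
    by (intro mult_left_mono mult_mono assms) simp_all
  also have "\<dots> = (X * Y * E1 * E2 * E3 * ta * sb') * (sb * (ta' * tg))"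
    by (simp only: ac_simps)
  also have "\<dots> \<le> (X * Y * E1 * E2 * E3 * ta * sb') * ((E4 * sbg) * tag)"
    by (intro mult_left_mono mult_mono assms) simp_all
  also have "\<dots> = (E1 * E2 * E3 * E4) * ((X * (ta * sbg)) * (Y * (tag * sb')))"
    by (simp only: ac_simps)
  also have "\<dots> \<le> (E1 * E2 * E3 * E4) * (C1 * C2)"
    by (intro mult_left_mono mult_mono assms) simp_all
  finally show ?thesis
    by (simp only: ac_simps)
qed

lemma chain_AB:
  fixes X Y :: ennreal
  assumes "X \<le> C1 * (ta * tb)" "Ra * ta \<le> E1 * ua" "Rb * tb \<le> E2 * (ub * sg)" "Ra' \<le> E3 * sa" "sa * sg \<le> sag"
    "Y * sag \<le> C2 * vb" "Rc * vb \<le> E4 * wb" "ub * wb \<le> w" "ua \<le> E5 * z"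
  shows "X * Y * (Ra * Rb * Ra' * Rc) \<le> (C1 * E1 * E2 * E3 * C2 * E4 * E5) * (z * w)"
proof -
  have "X * Y * (Ra * Rb * Ra' * Rc) \<le> (C1 * (ta * tb)) * Y * (Ra * Rb * Ra' * Rc)"
    by (intro mult_right_mono assms) simp_all
  also have "\<dots> = (C1 * Y * Rc) * ((Ra * ta) * (Rb * tb) * Ra')"
    by (simp only: ac_simps)
  also have "\<dots> \<le> (C1 * Y * Rc) * ((E1 * ua) * (E2 * (ub * sg)) * (E3 * sa))"
    by (intro mult_left_mono mult_mono assms) simp_all
  also have "\<dots> = (C1 * Rc * E1 * ua * E2 * ub * E3 * Y) * (sa * sg)"
    by (simp only: ac_simps)
  also have "\<dots> \<le> (C1 * Rc * E1 * ua * E2 * ub * E3 * Y) * sag"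
    by (intro mult_left_mono assms) simp
  also have "\<dots> = (C1 * Rc * E1 * ua * E2 * ub * E3) * (Y * sag)"
    by (simp only: ac_simps)
  also have "\<dots> \<le> (C1 * Rc * E1 * ua * E2 * ub * E3) * (C2 * vb)"
    by (intro mult_left_mono assms) simp
  also have "\<dots> = (C1 * E1 * ua * E2 * ub * E3 * C2) * (Rc * vb)"
    by (simp only: ac_simps)
  also have "\<dots> \<le> (C1 * E1 * ua * E2 * ub * E3 * C2) * (E4 * wb)"
    by (intro mult_left_mono assms) simp
  also have "\<dots> = (C1 * E1 * E2 * E3 * C2 * E4) * (ua * (ub * wb))"
    by (simp only: ac_simps)
  also have "\<dots> \<le> (C1 * E1 * E2 * E3 * C2 * E4) * ((E5 * z) * w)"
    by (intro mult_left_mono mult_mono assms) simp_all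
  finally show ?thesis
    by (simp only: ac_simps)
qed

lemma two_le_rate: "2 \<le> rate t"
  by (simp add: rate_def)

lemma ennreal_power_add: "0 \<le> r \<Longrightarrow> ennreal (r ^ (m + n)) = ennreal (r ^ m) * ennreal (r ^ n)"
  by (simp add: power_add ennreal_mult)

text \<open>The substitution \<open>((a, a'), (b, b'), \<gamma>)\<close> to
  \<open>((b', b), (a', a), \<gamma>)\<close> exchanges the two arguments up to transposition and
  merely permutes the four binomials of the coefficient. It is an involution, hence a bijection of
  the summation indices.\<close>

lemma pos_transp:
  "kernel.pos (coef t) arg1 arg2 arg3 x y = transp (kernel.pos (coef t) arg1 arg2 arg3 (transp y) (transp x))"
proof
  fix \<nu> :: "'a dindex"
  define h :: "'a quint \<Rightarrow> 'a quint" where "h = (\<lambda>((a, a'), (b, b'), \<gamma>). ((b', b), (a', a), \<gamma>))"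
  have "h (h u) = u" for u
    by (auto simp: h_def split: prod.splits)
  then have bij: "bij_betw h UNIV UNIV"
    by (intro bij_betw_byWitness[where f' = h]) auto
  have h: "arg1 (h u) = prod.swap (arg2 u)" "arg2 (h u) = prod.swap (arg1 u)" "arg3 (h u) = prod.swap (arg3 u)"
    "coef t (h u) = coef t u" for u
    by (auto simp: h_def arg1_def arg2_def arg3_def coef_def add.commute mult.commute mult.left_commute split: prod.splits)
  have "transp (kernel.pos (coef t) arg1 arg2 arg3 (transp y) (transp x)) \<nu> =
      (\<integral>\<^sup>+u. ennreal (cmod (coef t u)) * transp y (arg1 u) * transp x (arg2 u) * delta (prod.swap \<nu>) (arg3 u) \<partial>count_space UNIV)"
    by (simp add: transp_apply kernel.pos_def kernel.tri_def)
  also have "\<dots> = (\<integral>\<^sup>+u. ennreal (cmod (coef t (h u))) * transp y (arg1 (h u)) * transp x (arg2 (h u)) * delta (prod.swap \<nu>) (arg3 (h u)) \<partial>count_space UNIV)"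
    by (rule nn_integral_bij_count_space[OF bij, symmetric])
  also have "\<dots> = (\<integral>\<^sup>+u. ennreal (cmod (coef t u)) * x (arg1 u) * y (arg2 u) * delta \<nu> (arg3 u) \<partial>count_space UNIV)"
  proof (rule nn_integral_cong)
    fix u :: "'a quint"
    have "delta (prod.swap \<nu>) (prod.swap (arg3 u)) = delta \<nu> (arg3 u)"
      by (cases \<nu>; cases "arg3 u") (auto simp: delta_def indicator_def)
    then show "ennreal (cmod (coef t (h u))) * transp y (arg1 (h u)) * transp x (arg2 (h u)) * delta (prod.swap \<nu>) (arg3 (h u)) =
        ennreal (cmod (coef t u)) * x (arg1 u) * y (arg2 u) * delta \<nu> (arg3 u)"
      by (simp only: h transp_apply swap_swap ac_simps)
  qed
  finally show "kernel.pos (coef t) arg1 arg2 arg3 x y \<nu> = transp (kernel.pos (coef t) arg1 arg2 arg3 (transp y) (transp x)) \<nu>"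
    by (simp add: kernel.pos_def kernel.tri_def)
qed

section \<open>Sup-norm bounds for the positive kernel\<close>

locale scale_rate = scale "rate t" th for t and th :: "real \<Rightarrow> ('d::finite) mindex \<Rightarrow> ennreal"
begin

abbreviation P :: "('d dindex \<Rightarrow> ennreal) \<Rightarrow> ('d dindex \<Rightarrow> ennreal) \<Rightarrow> 'd dindex \<Rightarrow> ennreal" where
  "P \<equiv> kernel.pos (coef t) arg1 arg2 arg3"

lemma rate_pow: "ennreal (rate t ^ (m + n)) = ennreal (rate t ^ m) * ennreal (rate t ^ n)"
  using R by (intro ennreal_power_add) auto

lemma Bsp_wB: "q > 0 \<Longrightarrow> x \<in> Bsp (wB th r q) \<longleftrightarrow> (\<exists>C<\<infinity>. \<forall>\<alpha> \<beta>. x (\<alpha>, \<beta>) * th r \<alpha> \<le> C * th q \<beta>)"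
  using ennreal_divide_le_iff[of "\<lambda>i. th q (snd i)" x "\<lambda>i. th r (fst i)"] th_pos
  by (simp add: Bsp_def wB_def split_beta)

lemma Bsp_wA: "x \<in> Bsp (wA th r) \<longleftrightarrow> (\<exists>C<\<infinity>. \<forall>\<alpha> \<beta>. x (\<alpha>, \<beta>) * (th r \<alpha> * th r \<beta>) \<le> C)"
  by (simp add: Bsp_def wA_def split_beta)

lemma Bsp_wA_inv: "r > 0 \<Longrightarrow> x \<in> Bsp (wA_inv th r) \<longleftrightarrow> (\<exists>C<\<infinity>. \<forall>\<alpha> \<beta>. x (\<alpha>, \<beta>) \<le> C * (th r \<alpha> * th r \<beta>))"
  using ennreal_divide_le_iff[of "wA th r" x "\<lambda>_. 1"] wA_pos
  by (simp add: Bsp_def wA_inv_def wA_def split_beta)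

text \<open>Weights travel through the kernel: the weight at \<open>a + a'\<close> is split into
  weights at \<open>a\<close> and \<open>a'\<close>; the bound on \<open>x\<close> trades the one at
  \<open>a\<close> for one at \<open>b + \<gamma>\<close>, which is split again; the parts at
  \<open>a'\<close> and \<gamma> merge by superadditivity into the weight of \<open>y\<close> at
  \<open>a' + \<gamma>\<close>; the bound on \<open>y\<close> trades it for one at
  \<open>b'\<close>, which merges with the part at \<open>b\<close>. Each split also absorbs powers
  of \<open>rate t\<close>.\<close>

lemma core_B:
  assumes pos: "r\<^sub>1 > 0" "q\<^sub>1 > 0" "\<rho>\<^sub>1 > 0" "q\<^sub>2 > 0"
    and dom: "dominated (rate t) th \<rho>\<^sub>2 r\<^sub>2 q\<^sub>2" "dominated (rate t) th r\<^sub>1 \<rho>\<^sub>1 q\<^sub>2" "dominated (rate t) th q\<^sub>1 \<rho>\<^sub>1 q" and q: "q > 0"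
    and x: "x \<in> Bsp (wB th r\<^sub>2 r\<^sub>1)" and y: "y \<in> Bsp (wB th q\<^sub>2 q\<^sub>1)"
  shows "P x y \<in> Bsp (wB th \<rho>\<^sub>2 \<rho>\<^sub>1)"
proof -
  obtain C1 where C1: "C1 < \<infinity>" "\<And>\<alpha> \<beta>. x (\<alpha>, \<beta>) * th r\<^sub>2 \<alpha> \<le> C1 * th r\<^sub>1 \<beta>"
    using x pos by (auto simp: Bsp_wB)
  obtain C2 where C2: "C2 < \<infinity>" "\<And>\<alpha> \<beta>. y (\<alpha>, \<beta>) * th q\<^sub>2 \<alpha> \<le> C2 * th q\<^sub>1 \<beta>"
    using y pos by (auto simp: Bsp_wB)
  obtain E1 where E1: "E1 < \<infinity>"
    "\<And>\<alpha> \<beta>. ennreal (rate t ^ (mlen \<alpha> + mlen \<beta>)) * th \<rho>\<^sub>2 (\<alpha> + \<beta>) \<le> E1 * (th r\<^sub>2 \<alpha> * th q\<^sub>2 \<beta>)"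
    using dominatedE[OF dom(1)] by blast
  obtain E2 where E2: "E2 < \<infinity>"
    "\<And>\<alpha> \<beta>. ennreal (rate t ^ (mlen \<alpha> + mlen \<beta>)) * th r\<^sub>1 (\<alpha> + \<beta>) \<le> E2 * (th \<rho>\<^sub>1 \<alpha> * th q\<^sub>2 \<beta>)"
    using dominatedE[OF dom(2)] by blast
  obtain E3 where E3: "E3 < \<infinity>" "\<And>\<alpha>. ennreal (rate t ^ mlen \<alpha>) * th q\<^sub>1 \<alpha> \<le> E3 * th \<rho>\<^sub>1 \<alpha>"
    using dominated_left[OF dom(3) q] by blast
  let ?C = "E1 * C1 * E2 * C2 * E3"
  have C: "?C < \<infinity>"
    by (intro ennreal_mult_finite C1 C2 E1 E2 E3)
  let ?v = "\<lambda>u::'d quint. x (arg1 u) * y (arg2 u) * ennreal (rate t ^ qlen u)"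
  have main: "?v u * th \<rho>\<^sub>2 (fst (arg3 u)) \<le> ?C * th \<rho>\<^sub>1 (snd (arg3 u))" for u
  proof -
    obtain a a' b b' \<gamma> where u: "u = ((a, a'), (b, b'), \<gamma>)"
      by (metis surj_pair)
    have "ennreal (rate t ^ qlen u) = ennreal (rate t ^ (mlen a + mlen a')) * ennreal (rate t ^ (mlen b + mlen \<gamma>)) * ennreal (rate t ^ mlen b')"
      by (simp add: u qlen_def rate_pow[symmetric] ac_simps)
    then show ?thesis
      using chain_B[OF E1(2)[of a a'] C1(2)[of a "b + \<gamma>"] E2(2)[of b \<gamma>] th_superadd[OF pos(4), of a' \<gamma>]
          C2(2)[of "a' + \<gamma>" b'] E3(2)[of b'] th_superadd[OF pos(3), of b b']]
      by (simp add: u arg1_def arg2_def arg3_def)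
  qed
  have "\<exists>C<\<infinity>. \<forall>u. ?v u * (th \<rho>\<^sub>2 (fst (arg3 u)) / th \<rho>\<^sub>1 (snd (arg3 u))) \<le> C"
    using main C th_pos[OF pos(3)] by (subst ennreal_divide_le_iff) auto
  then obtain K where "K < \<infinity>" "\<And>u. ?v u * (th \<rho>\<^sub>2 (fst (arg3 u)) / th \<rho>\<^sub>1 (snd (arg3 u))) \<le> K"
    by blast
  then show ?thesis
    by (intro pos_in_Bsp[of K]) (auto simp: wB_def split_beta)
qed

text \<open>Both target weights are split, and the power belonging to \<gamma> is absorbed by a
  weight at \<gamma> that merges with the one at \<open>a'\<close>. The weight at \<open>b\<close>
  grows to one at \<open>b + \<gamma>\<close>, as weights are bounded below and
  superadditive.\<close>

lemma core_A:
  assumes pos: "r > 0" "q > 0" "\<rho> > 0" and dom: "dominated (rate t) th \<rho> r q"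
    and x: "x \<in> Bsp (wA th r)" and y: "y \<in> Bsp (wA th q)"
  shows "P x y \<in> Bsp (wA th \<rho>)"
proof -
  obtain C1 where C1: "C1 < \<infinity>" "\<And>\<alpha> \<beta>. x (\<alpha>, \<beta>) * (th r \<alpha> * th r \<beta>) \<le> C1"
    using x by (auto simp: Bsp_wA)
  obtain C2 where C2: "C2 < \<infinity>" "\<And>\<alpha> \<beta>. y (\<alpha>, \<beta>) * (th q \<alpha> * th q \<beta>) \<le> C2"
    using y by (auto simp: Bsp_wA)
  obtain E1 where E1: "E1 < \<infinity>"
    "\<And>\<alpha> \<beta>. ennreal (rate t ^ (mlen \<alpha> + mlen \<beta>)) * th \<rho> (\<alpha> + \<beta>) \<le> E1 * (th r \<alpha> * th q \<beta>)"
    using dominatedE[OF dom(1)] by blast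
  obtain E3 where E3: "E3 < \<infinity>" "\<And>\<alpha>. ennreal (rate t ^ mlen \<alpha>) \<le> E3 * th q \<alpha>"
    using dominated_right[OF dom pos(3,1)] by blast
  obtain E4 where E4: "E4 < \<infinity>" "\<And>\<alpha>. 1 \<le> E4 * th r \<alpha>"
    using th_one_le[OF pos(1)] by blast
  have E4': "th r \<alpha> \<le> E4 * th r (\<alpha> + \<beta>)" for \<alpha> \<beta>
  proof -
    have "th r \<alpha> * 1 \<le> th r \<alpha> * (E4 * th r \<beta>)"
      by (intro mult_left_mono E4(2)) simp
    also have "\<dots> = E4 * (th r \<alpha> * th r \<beta>)"
      by (simp only: ac_simps)
    also have "\<dots> \<le> E4 * th r (\<alpha> + \<beta>)"
      by (intro mult_left_mono th_superadd pos) simp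
    finally show ?thesis
      by simp
  qed
  let ?C = "E1 * E1 * E3 * E4 * C1 * C2"
  have C: "?C < \<infinity>"
    by (intro ennreal_mult_finite C1 C2 E1 E3 E4)
  have main: "x (arg1 u) * y (arg2 u) * ennreal (rate t ^ qlen u) * wA th \<rho> (arg3 u) \<le> ?C" for u :: "'d quint"
  proof -
    obtain a a' b b' \<gamma> where u: "u = ((a, a'), (b, b'), \<gamma>)"
      by (metis surj_pair)
    have "ennreal (rate t ^ qlen u) = ennreal (rate t ^ (mlen a + mlen a')) * ennreal (rate t ^ (mlen b + mlen b')) * ennreal (rate t ^ mlen \<gamma>)"
      by (simp add: u qlen_def rate_pow[symmetric] ac_simps)
    then show ?thesis
      using chain_A[OF E1(2)[of a a'] E1(2)[of b b'] E3(2)[of \<gamma>] th_superadd[OF pos(2), of a' \<gamma>] E4'[of b \<gamma>]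
          C1(2)[of a "b + \<gamma>"] C2(2)[of "a' + \<gamma>" b']]
      by (simp add: u arg1_def arg2_def arg3_def wA_def)
  qed
  show ?thesis
    by (rule pos_in_Bsp[OF C main])
qed

text \<open>With reciprocal weights the bound on \<open>x\<close> enters first. Its factor at
  \<open>b + \<gamma>\<close> is split to provide \<gamma>, the power belonging to \<open>a'\<close>
  provides a weight at \<open>a'\<close>, and both merge for \<open>y\<close>; the weight at
  \<open>a\<close> is finally enlarged to one at \<open>a + a'\<close>.\<close>

lemma core_AB:
  assumes pos: "r > 0" "q\<^sub>1 > 0" "q\<^sub>2 > 0" "\<rho> > 0" "q > 0"
    and dom: "dominated (rate t) th r \<rho> q\<^sub>2" "dominated (rate t) th q\<^sub>1 \<rho> q"
    and x: "x \<in> Bsp (wA_inv th r)" and y: "y \<in> Bsp (wB th q\<^sub>2 q\<^sub>1)"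
  shows "P x y \<in> Bsp (wA_inv th \<rho>)"
proof -
  obtain C1 where C1: "C1 < \<infinity>" "\<And>\<alpha> \<beta>. x (\<alpha>, \<beta>) \<le> C1 * (th r \<alpha> * th r \<beta>)"
    using x pos by (auto simp: Bsp_wA_inv)
  obtain C2 where C2: "C2 < \<infinity>" "\<And>\<alpha> \<beta>. y (\<alpha>, \<beta>) * th q\<^sub>2 \<alpha> \<le> C2 * th q\<^sub>1 \<beta>"
    using y pos by (auto simp: Bsp_wB)
  obtain E1 where E1: "E1 < \<infinity>" "\<And>\<alpha>. ennreal (rate t ^ mlen \<alpha>) * th r \<alpha> \<le> E1 * th \<rho> \<alpha>"
    using dominated_left[OF dom(1) pos(3)] by blast
  obtain E2 where E2: "E2 < \<infinity>"
    "\<And>\<alpha> \<beta>. ennreal (rate t ^ (mlen \<alpha> + mlen \<beta>)) * th r (\<alpha> + \<beta>) \<le> E2 * (th \<rho> \<alpha> * th q\<^sub>2 \<beta>)"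
    using dominatedE[OF dom(1)] by blast
  obtain E3 where E3: "E3 < \<infinity>" "\<And>\<alpha>. ennreal (rate t ^ mlen \<alpha>) \<le> E3 * th q\<^sub>2 \<alpha>"
    using dominated_right[OF dom(1) pos(1,4)] by blast
  obtain E4 where E4: "E4 < \<infinity>" "\<And>\<alpha>. ennreal (rate t ^ mlen \<alpha>) * th q\<^sub>1 \<alpha> \<le> E4 * th \<rho> \<alpha>"
    using dominated_left[OF dom(2) pos(5)] by blast
  obtain E5 where E5: "E5 < \<infinity>" "\<And>\<alpha>. 1 \<le> E5 * th \<rho> \<alpha>"
    using th_one_le[OF pos(4)] by blast
  have E5': "th \<rho> \<alpha> \<le> E5 * th \<rho> (\<alpha> + \<beta>)" for \<alpha> \<beta>
  proof -
    have "th \<rho> \<alpha> * 1 \<le> th \<rho> \<alpha> * (E5 * th \<rho> \<beta>)"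
      by (intro mult_left_mono E5(2)) simp
    also have "\<dots> = E5 * (th \<rho> \<alpha> * th \<rho> \<beta>)"
      by (simp only: ac_simps)
    also have "\<dots> \<le> E5 * th \<rho> (\<alpha> + \<beta>)"
      by (intro mult_left_mono th_superadd pos) simp
    finally show ?thesis
      by simp
  qed
  let ?C = "C1 * E1 * E2 * E3 * C2 * E4 * E5"
  have C: "?C < \<infinity>"
    by (intro ennreal_mult_finite C1 C2 E1 E2 E3 E4 E5)
  let ?v = "\<lambda>u::'d quint. x (arg1 u) * y (arg2 u) * ennreal (rate t ^ qlen u)"
  have main: "?v u * 1 \<le> ?C * wA th \<rho> (arg3 u)" for u
  proof -
    obtain a a' b b' \<gamma> where u: "u = ((a, a'), (b, b'), \<gamma>)"
      by (metis surj_pair)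
    have "ennreal (rate t ^ qlen u) = ennreal (rate t ^ mlen a) * ennreal (rate t ^ (mlen b + mlen \<gamma>)) *
        ennreal (rate t ^ mlen a') * ennreal (rate t ^ mlen b')"
      by (simp add: u qlen_def rate_pow[symmetric] ac_simps)
    then show ?thesis
      using chain_AB[OF C1(2)[of a "b + \<gamma>"] E1(2)[of a] E2(2)[of b \<gamma>] E3(2)[of a'] th_superadd[OF pos(3), of a' \<gamma>]
          C2(2)[of "a' + \<gamma>" b'] E4(2)[of b'] th_superadd[OF pos(4), of b b'] E5'[of a a']]
      by (simp add: u arg1_def arg2_def arg3_def wA_def)
  qed
  have "\<exists>C<\<infinity>. \<forall>u. ?v u * (1 / wA th \<rho> (arg3 u)) \<le> C"
    using main C wA_pos[OF pos(4)] by (subst ennreal_divide_le_iff) auto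
  then obtain K where "K < \<infinity>" "\<And>u. ?v u * (1 / wA th \<rho> (arg3 u)) \<le> K"
    by blast
  then show ?thesis
    by (intro pos_in_Bsp[of K]) (auto simp: wA_inv_def)
qed

end

section \<open>Extension of \<open>U\<^bsub>t,#\<^esub>\<close>\<close>

text \<open>The hypotheses \<open>right\<close> and \<open>left\<close> of \<open>PI_spaces\<close>
  for this kernel, bundled because transposition exchanges them.\<close>

definition PI_bound ::
  "complex \<Rightarrow> (real \<Rightarrow> real \<Rightarrow> ('d::finite) dindex \<Rightarrow> ennreal) \<Rightarrow> (real \<Rightarrow> real \<Rightarrow> 'd dindex \<Rightarrow> ennreal) \<Rightarrow>
   (real \<Rightarrow> real \<Rightarrow> 'd dindex \<Rightarrow> ennreal) \<Rightarrow> bool" where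
  "PI_bound t \<omega>X \<omega>Y \<omega>Z \<longleftrightarrow>
    (\<forall>x. (\<forall>j>0. x \<in> Bstep \<omega>X j) \<longrightarrow>
      (\<forall>\<rho>>0. \<exists>q>0. \<forall>y\<in>Bstep \<omega>Y q. kernel.pos (coef t) arg1 arg2 arg3 x y \<in> Bstep \<omega>Z \<rho>)) \<and>
    (\<forall>y. (\<forall>j>0. y \<in> Bstep \<omega>Y j) \<longrightarrow>
      (\<forall>\<rho>>0. \<exists>q>0. \<forall>x\<in>Bstep \<omega>X q. kernel.pos (coef t) arg1 arg2 arg3 x y \<in> Bstep \<omega>Z \<rho>))"

text \<open>Stated with sup norms; \<open>IP_Bsp_in_S\<close> recovers the l^1 form at another outer
  parameter.\<close>

definition IP_bound :: "complex \<Rightarrow> (real \<Rightarrow> real \<Rightarrow> ('d::finite) dindex \<Rightarrow> ennreal) \<Rightarrow> bool" where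
  "IP_bound t \<omega> \<longleftrightarrow>
    (\<forall>x y. \<forall>j>0. \<forall>k>0. (\<forall>n>0. x \<in> Bsp (\<omega> j n)) \<longrightarrow> (\<forall>n>0. y \<in> Bsp (\<omega> k n)) \<longrightarrow>
      (\<exists>l>0. \<forall>n>0. kernel.pos (coef t) arg1 arg2 arg3 x y \<in> Bsp (\<omega> l n)))"

lemma BstepI: "n > 0 \<Longrightarrow> x \<in> Bsp (\<omega> j n) \<Longrightarrow> x \<in> Bstep \<omega> j"
  by (auto simp: Bstep_def)

lemma BstepE: "x \<in> Bstep \<omega> j \<Longrightarrow> (\<And>n. n > 0 \<Longrightarrow> x \<in> Bsp (\<omega> j n) \<Longrightarrow> thesis) \<Longrightarrow> thesis"
  by (auto simp: Bstep_def)

lemma Bstep_transp: "x \<in> Bstep (\<lambda>j n. transp (\<omega> j n)) j \<longleftrightarrow> transp x \<in> Bstep \<omega> j"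
  by (simp add: Bstep_def Bsp_transp)

lemma PI_bound_transp:
  assumes "PI_bound t \<omega>X \<omega>Y \<omega>Z"
  shows "PI_bound t (\<lambda>j n. transp (\<omega>Y j n)) (\<lambda>j n. transp (\<omega>X j n)) (\<lambda>j n. transp (\<omega>Z j n))"
  unfolding PI_bound_def Bstep_transp
proof (intro conjI allI impI)
  fix x :: "'a dindex \<Rightarrow> ennreal" and \<rho> :: real
  assume x: "\<forall>j>0. transp x \<in> Bstep \<omega>Y j" and \<rho>: "\<rho> > 0"
  obtain q where q: "q > 0"
    "\<forall>z\<in>Bstep \<omega>X q. kernel.pos (coef t) arg1 arg2 arg3 z (transp x) \<in> Bstep \<omega>Z \<rho>"
    using assms x \<rho> unfolding PI_bound_def by blast
  show "\<exists>q>0. \<forall>y\<in>Bstep (\<lambda>j n. transp (\<omega>X j n)) q.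
      transp (kernel.pos (coef t) arg1 arg2 arg3 x y) \<in> Bstep \<omega>Z \<rho>"
  proof (intro exI[of _ q] conjI ballI q(1))
    fix y assume "y \<in> Bstep (\<lambda>j n. transp (\<omega>X j n)) q"
    then have "kernel.pos (coef t) arg1 arg2 arg3 (transp y) (transp x) \<in> Bstep \<omega>Z \<rho>"
      using q(2) Bstep_transp by blast
    then show "transp (kernel.pos (coef t) arg1 arg2 arg3 x y) \<in> Bstep \<omega>Z \<rho>"
      by (subst pos_transp) simp
  qed
next
  fix y :: "'a dindex \<Rightarrow> ennreal" and \<rho> :: real
  assume y: "\<forall>j>0. transp y \<in> Bstep \<omega>X j" and \<rho>: "\<rho> > 0"
  obtain q where q: "q > 0"
    "\<forall>z\<in>Bstep \<omega>Y q. kernel.pos (coef t) arg1 arg2 arg3 (transp y) z \<in> Bstep \<omega>Z \<rho>"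
    using assms y \<rho> unfolding PI_bound_def by blast
  show "\<exists>q>0. \<forall>x\<in>Bstep (\<lambda>j n. transp (\<omega>Y j n)) q.
      transp (kernel.pos (coef t) arg1 arg2 arg3 x y) \<in> Bstep \<omega>Z \<rho>"
  proof (intro exI[of _ q] conjI ballI q(1))
    fix x assume "x \<in> Bstep (\<lambda>j n. transp (\<omega>Y j n)) q"
    then have "kernel.pos (coef t) arg1 arg2 arg3 (transp y) (transp x) \<in> Bstep \<omega>Z \<rho>"
      using q(2) Bstep_transp by blast
    then show "transp (kernel.pos (coef t) arg1 arg2 arg3 x y) \<in> Bstep \<omega>Z \<rho>"
      by (subst pos_transp) simp
  qed
qed

lemma IP_bound_transp:
  assumes "IP_bound t \<omega>"
  shows "IP_bound t (\<lambda>j n. transp (\<omega> j n))"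
  unfolding IP_bound_def Bsp_transp
proof (intro allI impI)
  fix x y :: "'a dindex \<Rightarrow> ennreal" and j k :: real
  assume xy: "j > 0" "k > 0" "\<forall>n>0. transp x \<in> Bsp (\<omega> j n)" "\<forall>n>0. transp y \<in> Bsp (\<omega> k n)"
  show "\<exists>l>0. \<forall>n>0. transp (kernel.pos (coef t) arg1 arg2 arg3 x y) \<in> Bsp (\<omega> l n)"
    unfolding pos_transp[of t x y] transp_transp
    by (rule assms[unfolded IP_bound_def, rule_format, OF xy(2,1)]) (use xy in blast)+
qed

text \<open>The extension is the formula itself: its infinite sum, defined for all sequences,
  converges absolutely on the larger spaces.\<close>

lemma U_sharp_extends:
  assumes "extends_bil X Y Z (kernel.bil (coef t) arg1 arg2 arg3)"
  shows "extends_to X Y Z (U_sharp t) (U_sharp t)"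
    and "\<And>G. extends_to X Y Z (U_sharp t) G \<Longrightarrow> separately_continuous X Y Z G \<Longrightarrow>
      \<forall>x\<in>topspace X. \<forall>y\<in>topspace Y. G x y = U_sharp t x y"
proof -
  have U: "kernel.bil (coef t) arg1 arg2 arg3 = (U_sharp t :: 'a dseq \<Rightarrow> _)"
    by (intro ext) (simp add: U_sharp_eq_bil)
  note X = assms[unfolded U extends_bil_def, folded finsupp_l0]
  show "extends_to X Y Z (U_sharp t) (U_sharp t)"
    using X unfolding extends_to_def by blast
  show "\<forall>x\<in>topspace X. \<forall>y\<in>topspace Y. G x y = U_sharp t x y"
    if "extends_to X Y Z (U_sharp t) G" "separately_continuous X Y Z G" for G
    using X that unfolding extends_to_def by blast
qed

lemma uniquely_extends_hypoI:
  assumes "extends_bil X Y Z (kernel.bil (coef t) arg1 arg2 arg3)"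
    and "hypocontinuous X Y Z (kernel.bil (coef t) arg1 arg2 arg3)"
  shows "uniquely_extends_hypo X Y Z (U_sharp t)"
proof -
  have U: "kernel.bil (coef t) arg1 arg2 arg3 = (U_sharp t :: 'a dseq \<Rightarrow> _)"
    by (intro ext) (simp add: U_sharp_eq_bil)
  show ?thesis
    using U_sharp_extends[OF assms(1)] assms(2) unfolding uniquely_extends_hypo_def U by blast
qed

lemma uniquely_extends_jointI:
  assumes "extends_bil X Y Z (kernel.bil (coef t) arg1 arg2 arg3)"
    and "jointly_continuous X Y Z (kernel.bil (coef t) arg1 arg2 arg3)"
  shows "uniquely_extends_joint X Y Z (U_sharp t)"
proof -
  have U: "kernel.bil (coef t) arg1 arg2 arg3 = (U_sharp t :: 'a dseq \<Rightarrow> _)"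
    by (intro ext) (simp add: U_sharp_eq_bil)
  show ?thesis
    using U_sharp_extends[OF assms(1)] assms(2) unfolding uniquely_extends_joint_def U by blast
qed

lemma PI_extends:
  assumes X: "PI_family decay \<omega>X" and Y: "PI_family decay \<omega>Y" and Z: "PI_family decay \<omega>Z"
    and bound: "PI_bound t \<omega>X \<omega>Y \<omega>Z"
  shows "uniquely_extends_hypo (ktop (PI_S \<omega>X) (PI_W \<omega>X)) (ktop (PI_S \<omega>Y) (PI_W \<omega>Y))
    (ktop (PI_S \<omega>Z) (PI_W \<omega>Z)) (U_sharp t)"
proof -
  have right: "\<exists>q>0. \<forall>y\<in>Bstep \<omega>Y q. kernel.pos (coef t) arg1 arg2 arg3 x y \<in> Bstep \<omega>Z \<rho>"
    if "\<And>j. j > 0 \<Longrightarrow> x \<in> Bstep \<omega>X j" "\<rho> > 0" for x \<rho>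
    using bound that unfolding PI_bound_def by blast
  have left: "\<exists>q>0. \<forall>x\<in>Bstep \<omega>X q. kernel.pos (coef t) arg1 arg2 arg3 x y \<in> Bstep \<omega>Z \<rho>"
    if "\<And>j. j > 0 \<Longrightarrow> y \<in> Bstep \<omega>Y j" "\<rho> > 0" for y \<rho>
    using bound that unfolding PI_bound_def by blast
  show ?thesis
    by (rule uniquely_extends_hypoI[OF kernel.PI_spaces(1,2)[OF nuclear_decay X Y Z right left]])
qed

lemma IP_extends:
  assumes \<omega>: "IP_family decay \<omega>" and bound: "IP_bound t \<omega>"
  defines "X \<equiv> ktop (IP_S \<omega>) (dual (IP_S \<omega>))"
  shows "uniquely_extends_hypo X X X (U_sharp t)"
proof -
  note k = kgood_IP[OF nuclear_decay \<omega>]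
  have h0: "kernel.pos (coef t) arg1 arg2 arg3 x y \<in> IP_S \<omega>" if xy: "x \<in> IP_S \<omega>" "y \<in> IP_S \<omega>" for x y
  proof -
    obtain j where j: "j > 0" "\<forall>n>0. x \<in> Bsp (\<omega> j n)"
      using xy(1) Lsp_subset_Bsp by (fastforce simp: IP_S_def)
    obtain k where k: "k > 0" "\<forall>n>0. y \<in> Bsp (\<omega> k n)"
      using xy(2) Lsp_subset_Bsp by (fastforce simp: IP_S_def)
    have "\<exists>l>0. \<forall>n>0. kernel.pos (coef t) arg1 arg2 arg3 x y \<in> Bsp (\<omega> l n)"
      by (rule bound[unfolded IP_bound_def, rule_format, OF j(1) k(1)]) (use j k in simp)+
    then obtain l where "l > 0" "\<And>n. n > 0 \<Longrightarrow> kernel.pos (coef t) arg1 arg2 arg3 x y \<in> Bsp (\<omega> l n)"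
      by blast
    then show ?thesis
      by (rule IP_Bsp_in_S[OF nuclear_decay \<omega>])
  qed
  show ?thesis
    unfolding X_def
    by (rule uniquely_extends_hypoI[OF kernel.normal_spaces(1,2)[OF nuclear_decay k k k h0]])
qed

lemma transp_wA_inv [simp]: "transp (wA_inv th r) = wA_inv th r"
  by (auto simp: transp_def wA_inv_def wA_def mult.commute)

section \<open>Order of the parameters for s < 1/2\<close>

locale scale_rate_down = scale_rate t th + scale_down "rate t" th
  for t and th :: "real \<Rightarrow> ('d::finite) mindex \<Rightarrow> ennreal"
begin

lemma joint_A:
  "uniquely_extends_joint (ktop (PI_S (\<lambda>_. wA th)) (PI_W (\<lambda>_. wA th)))
    (ktop (PI_S (\<lambda>_. wA th)) (PI_W (\<lambda>_. wA th))) (ktop (PI_S (\<lambda>_. wA th)) (PI_W (\<lambda>_. wA th))) (U_sharp t)"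
proof -
  have low: "\<exists>a>0. \<forall>i. a \<le> wA th r i" if "r > 0" for r
  proof -
    obtain a where a: "a > 0" "\<And>\<alpha>. a \<le> th r \<alpha>"
      using th_low[OF \<open>r > 0\<close>] by blast
    show ?thesis
      using a by (intro exI[of _ "a * a"])
        (auto simp: wA_def ennreal_zero_less_mult_iff intro: mult_mono)
  qed
  have step: "\<exists>\<rho>>0. P x y \<in> Bsp (wA th \<rho>)" if xy: "r > 0" "x \<in> Bsp (wA th r)" "y \<in> Bsp (wA th r)" for r x y
  proof -
    obtain \<rho> where "\<rho> > 0" "dominated (rate t) th \<rho> r r"
      using down[OF xy(1,1)] by blast
    then show ?thesis
      using core_A[OF xy(1,1)] xy(2,3) by blast
  qed
  show ?thesis
    by (rule uniquely_extends_jointI[OF kernel.joint_ind(1,2)[OF nuclear_decay PI_A low step]])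
qed

text \<open>The target parameter \<rho> fixes \<open>q1\<close>, then \<open>y\<close> supplies
  \<open>q2\<close>, and \<rho> and \<open>q2\<close> determine \<open>r\<close>. When
  \<open>y\<close> varies, \<open>r\<close> varies with it, so \<open>x\<close> must be available at
  every parameter; when \<open>y\<close> is fixed beforehand, one \<open>r\<close> serves all
  \<open>x\<close>.\<close>

lemma bound_AB: "PI_bound t (\<lambda>j _. wA_inv th j) (\<lambda>j n. wB th n j) (\<lambda>j _. wA_inv th j)"
  unfolding PI_bound_def
proof (intro conjI allI impI)
  fix x :: "'d dindex \<Rightarrow> ennreal" and \<rho> :: real
  assume x: "\<forall>j>0. x \<in> Bstep (\<lambda>j _. wA_inv th j) j" and \<rho>: "\<rho> > 0"
  obtain q1 where q1: "q1 > 0" "dominated (rate t) th q1 \<rho> \<rho>"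
    using down[OF \<rho> \<rho>] by blast
  show "\<exists>q>0. \<forall>y\<in>Bstep (\<lambda>j n. wB th n j) q. P x y \<in> Bstep (\<lambda>j _. wA_inv th j) \<rho>"
  proof (intro exI[of _ q1] conjI ballI q1(1))
    fix y assume "y \<in> Bstep (\<lambda>j n. wB th n j) q1"
    then obtain q2 where q2: "q2 > 0" "y \<in> Bsp (wB th q2 q1)"
      by (rule BstepE)
    obtain r where r: "r > 0" "dominated (rate t) th r \<rho> q2"
      using down[OF \<rho> q2(1)] by blast
    have "x \<in> Bsp (wA_inv th r)"
      using x r(1) by (auto simp: Bstep_def)
    then show "P x y \<in> Bstep (\<lambda>j _. wA_inv th j) \<rho>"
      by (intro BstepI[of 1] core_AB[OF r(1) q1(1) q2(1) \<rho> \<rho> r(2) q1(2) _ q2(2)]) simp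
  qed
next
  fix y :: "'d dindex \<Rightarrow> ennreal" and \<rho> :: real
  assume y: "\<forall>j>0. y \<in> Bstep (\<lambda>j n. wB th n j) j" and \<rho>: "\<rho> > 0"
  obtain q1 where q1: "q1 > 0" "dominated (rate t) th q1 \<rho> \<rho>"
    using down[OF \<rho> \<rho>] by blast
  obtain q2 where q2: "q2 > 0" "y \<in> Bsp (wB th q2 q1)"
    using y q1(1) by (auto elim: BstepE)
  obtain r where r: "r > 0" "dominated (rate t) th r \<rho> q2"
    using down[OF \<rho> q2(1)] by blast
  show "\<exists>q>0. \<forall>x\<in>Bstep (\<lambda>j _. wA_inv th j) q. P x y \<in> Bstep (\<lambda>j _. wA_inv th j) \<rho>"
  proof (intro exI[of _ r] conjI ballI r(1))
    fix x assume "x \<in> Bstep (\<lambda>j _. wA_inv th j) r"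
    then have "x \<in> Bsp (wA_inv th r)"
      by (auto simp: Bstep_def)
    then show "P x y \<in> Bstep (\<lambda>j _. wA_inv th j) \<rho>"
      by (intro BstepI[of 1] core_AB[OF r(1) q1(1) q2(1) \<rho> \<rho> r(2) q1(2) _ q2(2)]) simp
  qed
qed

text \<open>The choices run \<rho>1, \<open>q1\<close>, \<open>q2\<close> (from \<open>y\<close>),
  \<open>r1\<close>, \<open>r2\<close> (from \<open>x\<close>), \<rho>2. The quantifiers in the two
  halves differ only in which argument is fixed before its parameter is chosen.\<close>

lemma bound_B: "PI_bound t (\<lambda>j n. wB th n j) (\<lambda>j n. wB th n j) (\<lambda>j n. wB th n j)"
  unfolding PI_bound_def
proof (intro conjI allI impI)
  fix x :: "'d dindex \<Rightarrow> ennreal" and \<rho>1 :: real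
  assume x: "\<forall>j>0. x \<in> Bstep (\<lambda>j n. wB th n j) j" and \<rho>1: "\<rho>1 > 0"
  obtain q1 where q1: "q1 > 0" "dominated (rate t) th q1 \<rho>1 \<rho>1"
    using down[OF \<rho>1 \<rho>1] by blast
  show "\<exists>q>0. \<forall>y\<in>Bstep (\<lambda>j n. wB th n j) q. P x y \<in> Bstep (\<lambda>j n. wB th n j) \<rho>1"
  proof (intro exI[of _ q1] conjI ballI q1(1))
    fix y assume "y \<in> Bstep (\<lambda>j n. wB th n j) q1"
    then obtain q2 where q2: "q2 > 0" "y \<in> Bsp (wB th q2 q1)"
      by (rule BstepE)
    obtain r1 where r1: "r1 > 0" "dominated (rate t) th r1 \<rho>1 q2"
      using down[OF \<rho>1 q2(1)] by blast
    obtain r2 where r2: "r2 > 0" "x \<in> Bsp (wB th r2 r1)"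
      using x r1(1) by (auto elim: BstepE)
    obtain \<rho>2 where \<rho>2: "\<rho>2 > 0" "dominated (rate t) th \<rho>2 r2 q2"
      using down[OF r2(1) q2(1)] by blast
    show "P x y \<in> Bstep (\<lambda>j n. wB th n j) \<rho>1"
      by (rule BstepI, rule \<rho>2(1), rule core_B[OF r1(1) q1(1) \<rho>1 q2(1) \<rho>2(2) r1(2) q1(2) \<rho>1 r2(2) q2(2)])
  qed
next
  fix y :: "'d dindex \<Rightarrow> ennreal" and \<rho>1 :: real
  assume y: "\<forall>j>0. y \<in> Bstep (\<lambda>j n. wB th n j) j" and \<rho>1: "\<rho>1 > 0"
  obtain q1 where q1: "q1 > 0" "dominated (rate t) th q1 \<rho>1 \<rho>1"
    using down[OF \<rho>1 \<rho>1] by blast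
  obtain q2 where q2: "q2 > 0" "y \<in> Bsp (wB th q2 q1)"
    using y q1(1) by (auto elim: BstepE)
  obtain r1 where r1: "r1 > 0" "dominated (rate t) th r1 \<rho>1 q2"
    using down[OF \<rho>1 q2(1)] by blast
  show "\<exists>q>0. \<forall>x\<in>Bstep (\<lambda>j n. wB th n j) q. P x y \<in> Bstep (\<lambda>j n. wB th n j) \<rho>1"
  proof (intro exI[of _ r1] conjI ballI r1(1))
    fix x assume "x \<in> Bstep (\<lambda>j n. wB th n j) r1"
    then obtain r2 where r2: "r2 > 0" "x \<in> Bsp (wB th r2 r1)"
      by (rule BstepE)
    obtain \<rho>2 where \<rho>2: "\<rho>2 > 0" "dominated (rate t) th \<rho>2 r2 q2"
      using down[OF r2(1) q2(1)] by blast
    show "P x y \<in> Bstep (\<lambda>j n. wB th n j) \<rho>1"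
      by (rule BstepI, rule \<rho>2(1), rule core_B[OF r1(1) q1(1) \<rho>1 q2(1) \<rho>2(2) r1(2) q1(2) \<rho>1 r2(2) q2(2)])
  qed
qed

text \<open>The numerator parameter \<rho>2 depends only on those of \<open>x\<close> and
  \<open>y\<close>; afterwards every \<rho>1 is reached, since both arguments are available for all
  denominators.\<close>

lemma bound_C: "IP_bound t (wB th)"
  unfolding IP_bound_def
proof (intro allI impI)
  fix x y :: "'d dindex \<Rightarrow> ennreal" and r2 q2 :: real
  assume r2: "r2 > 0" and q2: "q2 > 0"
    and x: "\<forall>n>0. x \<in> Bsp (wB th r2 n)" and y: "\<forall>n>0. y \<in> Bsp (wB th q2 n)"
  obtain \<rho>2 where \<rho>2: "\<rho>2 > 0" "dominated (rate t) th \<rho>2 r2 q2"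
    using down[OF r2 q2] by blast
  show "\<exists>l>0. \<forall>n>0. P x y \<in> Bsp (wB th l n)"
  proof (intro exI[of _ \<rho>2] conjI allI impI \<rho>2(1))
    fix \<rho>1 :: real assume \<rho>1: "\<rho>1 > 0"
    obtain q1 where q1: "q1 > 0" "dominated (rate t) th q1 \<rho>1 \<rho>1"
      using down[OF \<rho>1 \<rho>1] by blast
    obtain r1 where r1: "r1 > 0" "dominated (rate t) th r1 \<rho>1 q2"
      using down[OF \<rho>1 q2] by blast
    show "P x y \<in> Bsp (wB th \<rho>2 \<rho>1)"
      using x y r1(1) q1(1) by (intro core_B[OF r1(1) q1(1) \<rho>1 q2 \<rho>2(2) r1(2) q1(2) \<rho>1]) auto
  qed
qed

end

section \<open>Order of the parameters for 0 < s \<le> 1/2\<close>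

locale scale_rate_up = scale_rate t th + scale_up "rate t" th
  for t and th :: "real \<Rightarrow> ('d::finite) mindex \<Rightarrow> ennreal"
begin

lemma up2:
  assumes "a > 0" "b > 0"
  obtains q where "q > 0" "\<And>p p'. p \<ge> q \<Longrightarrow> p' \<ge> q \<Longrightarrow> dominated (rate t) th a p p'"
    "\<And>p p'. p \<ge> q \<Longrightarrow> p' \<ge> q \<Longrightarrow> dominated (rate t) th b p p'"
proof -
  obtain q1 where q1: "q1 > 0" "\<forall>p\<ge>q1. \<forall>p'\<ge>q1. dominated (rate t) th a p p'"
    using up[OF assms(1)] by blast
  obtain q2 where q2: "q2 > 0" "\<forall>p\<ge>q2. \<forall>p'\<ge>q2. dominated (rate t) th b p p'"
    using up[OF assms(2)] by blast
  show thesis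
    by (rule that[of "max q1 q2"]) (use q1 q2 in auto)
qed

lemma joint_A:
  "uniquely_extends_joint (ktop (PI_S (\<lambda>j _. wA th j)) (PI_W (\<lambda>j _. wA th j)))
    (ktop (PI_S (\<lambda>j _. wA th j)) (PI_W (\<lambda>j _. wA th j)))
    (ktop (PI_S (\<lambda>j _. wA th j)) (PI_W (\<lambda>j _. wA th j))) (U_sharp t)"
proof -
  have step: "\<exists>r>0. \<forall>x\<in>Bsp (wA th r). \<forall>y\<in>Bsp (wA th r). P x y \<in> Bsp (wA th \<rho>)" if \<rho>: "\<rho> > 0" for \<rho>
  proof -
    obtain r where "r > 0" "dominated (rate t) th \<rho> r r"
      using up[OF \<rho>] by blast
    then show ?thesis
      using core_A[OF _ _ \<rho>] by blast
  qed
  show ?thesis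
    by (rule uniquely_extends_jointI[OF kernel.joint_proj(1,2)[OF nuclear_decay PI_A wA_pos step]])
qed

text \<open>The choices run \<open>r\<close> (from \<open>x\<close>), \<open>q2\<close>,
  \<open>q1\<close> (from \<open>y\<close>), \<rho>. The target is an inductive limit, so \<rho> may
  come last and depend on both arguments.\<close>

lemma bound_AB: "PI_bound t (\<lambda>_. wA_inv th) (wB th) (\<lambda>_. wA_inv th)"
  unfolding PI_bound_def
proof (intro conjI allI impI)
  fix x :: "'d dindex \<Rightarrow> ennreal" and \<rho>' :: real
  assume x: "\<forall>j>0. x \<in> Bstep (\<lambda>_. wA_inv th) j" and \<rho>': "\<rho>' > 0"
  obtain r where r: "r > 0" "x \<in> Bsp (wA_inv th r)"
    using x \<rho>' by (auto elim: BstepE)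
  obtain q2 where q2: "q2 > 0" "\<forall>p\<ge>q2. \<forall>q\<ge>q2. dominated (rate t) th r p q"
    using up[OF r(1)] by blast
  show "\<exists>q>0. \<forall>y\<in>Bstep (wB th) q. P x y \<in> Bstep (\<lambda>_. wA_inv th) \<rho>'"
  proof (intro exI[of _ q2] conjI ballI q2(1))
    fix y assume "y \<in> Bstep (wB th) q2"
    then obtain q1 where q1: "q1 > 0" "y \<in> Bsp (wB th q2 q1)"
      by (rule BstepE)
    obtain q0 where q0: "q0 > 0" "\<forall>p\<ge>q0. \<forall>q\<ge>q0. dominated (rate t) th q1 p q"
      using up[OF q1(1)] by blast
    define \<rho> where "\<rho> = max q0 q2"
    have \<rho>: "\<rho> > 0" "dominated (rate t) th q1 \<rho> \<rho>" "dominated (rate t) th r \<rho> q2"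
      using q0 q2 by (auto simp: \<rho>_def)
    show "P x y \<in> Bstep (\<lambda>_. wA_inv th) \<rho>'"
      by (rule BstepI, rule \<rho>(1), rule core_AB[OF r(1) q1(1) q2(1) \<rho>(1,1,3,2) r(2) q1(2)])
  qed
next
  fix y :: "'d dindex \<Rightarrow> ennreal" and \<rho>' :: real
  assume y: "\<forall>j>0. y \<in> Bstep (wB th) j"
  show "\<exists>q>0. \<forall>x\<in>Bstep (\<lambda>_. wA_inv th) q. P x y \<in> Bstep (\<lambda>_. wA_inv th) \<rho>'"
  \<comment> \<open>The family of the first argument is constant in the outer parameter, so any
    value serves.\<close>
  proof (intro exI[of _ "1::real"] conjI ballI)
    fix x assume "x \<in> Bstep (\<lambda>_. wA_inv th) 1"
    then obtain r where r: "r > 0" "x \<in> Bsp (wA_inv th r)"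
      by (rule BstepE)
    obtain q2 where q2: "q2 > 0" "\<forall>p\<ge>q2. \<forall>q\<ge>q2. dominated (rate t) th r p q"
      using up[OF r(1)] by blast
    obtain q1 where q1: "q1 > 0" "y \<in> Bsp (wB th q2 q1)"
      using y q2(1) by (auto elim: BstepE)
    obtain q0 where q0: "q0 > 0" "\<forall>p\<ge>q0. \<forall>q\<ge>q0. dominated (rate t) th q1 p q"
      using up[OF q1(1)] by blast
    define \<rho> where "\<rho> = max q0 q2"
    have \<rho>: "\<rho> > 0" "dominated (rate t) th q1 \<rho> \<rho>" "dominated (rate t) th r \<rho> q2"
      using q0 q2 by (auto simp: \<rho>_def)
    show "P x y \<in> Bstep (\<lambda>_. wA_inv th) \<rho>'"
      by (rule BstepI, rule \<rho>(1), rule core_AB[OF r(1) q1(1) q2(1) \<rho>(1,1,3,2) r(2) q1(2)])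
  qed simp
qed

text \<open>The choices run \<rho>2, \<open>r2\<close>, \<open>r1\<close> (from \<open>x\<close>),
  \<open>q2\<close>, \<open>q1\<close> (from \<open>y\<close>), \<rho>1. If \<open>x\<close> is
  fixed, \<open>q2\<close> can be chosen uniformly in \<open>y\<close>; otherwise \<open>q2\<close>
  depends on \<open>x\<close> and \<open>y\<close> must be available at every parameter.\<close>

lemma bound_B: "PI_bound t (wB th) (wB th) (wB th)"
  unfolding PI_bound_def
proof (intro conjI allI impI)
  fix x :: "'d dindex \<Rightarrow> ennreal" and \<rho>2 :: real
  assume x: "\<forall>j>0. x \<in> Bstep (wB th) j" and \<rho>2: "\<rho>2 > 0"
  obtain r2 where r2: "r2 > 0" "\<forall>p\<ge>r2. \<forall>q\<ge>r2. dominated (rate t) th \<rho>2 p q"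
    using up[OF \<rho>2] by blast
  obtain r1 where r1: "r1 > 0" "x \<in> Bsp (wB th r2 r1)"
    using x r2(1) by (auto elim: BstepE)
  obtain q0 where q0: "q0 > 0" "\<forall>p\<ge>q0. \<forall>q\<ge>q0. dominated (rate t) th r1 p q"
    using up[OF r1(1)] by blast
  \<comment> \<open>\<open>q2\<close> serves two splits at once: of the weight \<rho>2 together with
    \<open>r2\<close>, and of the weight \<open>r1\<close> together with \<rho>1.\<close>
  define q2 where "q2 = max r2 q0"
  have q2: "q2 > 0" "dominated (rate t) th \<rho>2 r2 q2" "q2 \<ge> q0"
    using r2 by (auto simp: q2_def)
  show "\<exists>q>0. \<forall>y\<in>Bstep (wB th) q. P x y \<in> Bstep (wB th) \<rho>2"
  proof (intro exI[of _ q2] conjI ballI q2(1))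
    fix y assume "y \<in> Bstep (wB th) q2"
    then obtain q1 where q1: "q1 > 0" "y \<in> Bsp (wB th q2 q1)"
      by (rule BstepE)
    obtain p0 where p0: "p0 > 0" "\<forall>p\<ge>p0. \<forall>q\<ge>p0. dominated (rate t) th q1 p q"
      using up[OF q1(1)] by blast
    define \<rho>1 where "\<rho>1 = max p0 q0"
    have \<rho>1: "\<rho>1 > 0" "dominated (rate t) th r1 \<rho>1 q2" "dominated (rate t) th q1 \<rho>1 \<rho>1"
      using p0 q0 q2 by (auto simp: \<rho>1_def)
    show "P x y \<in> Bstep (wB th) \<rho>2"
      by (rule BstepI, rule \<rho>1(1), rule core_B[OF r1(1) q1(1) \<rho>1(1) q2(1,2) \<rho>1(2,3,1) r1(2) q1(2)])
  qed
next
  fix y :: "'d dindex \<Rightarrow> ennreal" and \<rho>2 :: real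
  assume y: "\<forall>j>0. y \<in> Bstep (wB th) j" and \<rho>2: "\<rho>2 > 0"
  obtain r2 where r2: "r2 > 0" "\<forall>p\<ge>r2. \<forall>q\<ge>r2. dominated (rate t) th \<rho>2 p q"
    using up[OF \<rho>2] by blast
  show "\<exists>q>0. \<forall>x\<in>Bstep (wB th) q. P x y \<in> Bstep (wB th) \<rho>2"
  proof (intro exI[of _ r2] conjI ballI r2(1))
    fix x assume "x \<in> Bstep (wB th) r2"
    then obtain r1 where r1: "r1 > 0" "x \<in> Bsp (wB th r2 r1)"
      by (rule BstepE)
    obtain q0 where q0: "q0 > 0" "\<forall>p\<ge>q0. \<forall>q\<ge>q0. dominated (rate t) th r1 p q"
      using up[OF r1(1)] by blast
    define q2 where "q2 = max r2 q0"
    have q2: "q2 > 0" "dominated (rate t) th \<rho>2 r2 q2" "q2 \<ge> q0"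
      using r2 by (auto simp: q2_def)
    obtain q1 where q1: "q1 > 0" "y \<in> Bsp (wB th q2 q1)"
      using y q2(1) by (auto elim: BstepE)
    obtain p0 where p0: "p0 > 0" "\<forall>p\<ge>p0. \<forall>q\<ge>p0. dominated (rate t) th q1 p q"
      using up[OF q1(1)] by blast
    define \<rho>1 where "\<rho>1 = max p0 q0"
    have \<rho>1: "\<rho>1 > 0" "dominated (rate t) th r1 \<rho>1 q2" "dominated (rate t) th q1 \<rho>1 \<rho>1"
      using p0 q0 q2 by (auto simp: \<rho>1_def)
    show "P x y \<in> Bstep (wB th) \<rho>2"
      by (rule BstepI, rule \<rho>1(1), rule core_B[OF r1(1) q1(1) \<rho>1(1) q2(1,2) \<rho>1(2,3,1) r1(2) q1(2)])
  qed
qed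

text \<open>A single denominator parameter \<rho>1 must be large for both \<open>r1\<close> and
  \<open>q1\<close> before the numerator \<rho>2 is given; then \<open>r2\<close> and
  \<open>q2\<close> may grow with \<rho>2.\<close>

lemma bound_C: "IP_bound t (\<lambda>j n. wB th n j)"
  unfolding IP_bound_def
proof (intro allI impI)
  fix x y :: "'d dindex \<Rightarrow> ennreal" and r1 q1 :: real
  assume r1: "r1 > 0" and q1: "q1 > 0"
    and x: "\<forall>n>0. x \<in> Bsp (wB th n r1)" and y: "\<forall>n>0. y \<in> Bsp (wB th n q1)"
  obtain \<rho>1 where \<rho>1: "\<rho>1 > 0"
    "\<And>p p'. p \<ge> \<rho>1 \<Longrightarrow> p' \<ge> \<rho>1 \<Longrightarrow> dominated (rate t) th r1 p p'"
    "\<And>p p'. p \<ge> \<rho>1 \<Longrightarrow> p' \<ge> \<rho>1 \<Longrightarrow> dominated (rate t) th q1 p p'"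
    using up2[OF r1 q1] by blast
  show "\<exists>l>0. \<forall>n>0. P x y \<in> Bsp (wB th n l)"
  proof (intro exI[of _ \<rho>1] conjI allI impI \<rho>1(1))
    fix \<rho>2 :: real assume \<rho>2: "\<rho>2 > 0"
    obtain r2 where r2: "r2 > 0" "\<forall>p\<ge>r2. \<forall>q\<ge>r2. dominated (rate t) th \<rho>2 p q"
      using up[OF \<rho>2] by blast
    define q2 where "q2 = max r2 \<rho>1"
    have q2: "q2 > 0" "dominated (rate t) th \<rho>2 r2 q2" "q2 \<ge> \<rho>1"
      using r2 by (auto simp: q2_def)
    have dom: "dominated (rate t) th r1 \<rho>1 q2" "dominated (rate t) th q1 \<rho>1 \<rho>1"
      using \<rho>1(2)[of \<rho>1 q2] \<rho>1(3)[of \<rho>1 \<rho>1] q2(3) by simp_all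
    show "P x y \<in> Bsp (wB th \<rho>2 \<rho>1)"
      using x y r2(1) q2(1) by (intro core_B[OF r1 q1 \<rho>1(1) q2(1,2) dom \<rho>1(1)]) auto
  qed
qed

end

text \<open>In the starred weight the two parameters are exchanged along with the multi-indices, so
  each starred limit is the limit of the transposed family with the same outer and inner
  roles.\<close>

lemma weight_eqs:
  "w\<^sub>A s r = wA (\<lambda>r. \<theta> r s) r" "(\<lambda>x. 1 / w\<^sub>A s r x) = wA_inv (\<lambda>r. \<theta> r s) r"
  "w\<^sub>B s r\<^sub>2 r\<^sub>1 = wB (\<lambda>r. \<theta> r s) r\<^sub>2 r\<^sub>1" "w\<^sub>B_star s r\<^sub>2 r\<^sub>1 = transp (wB (\<lambda>r. \<theta> r s) r\<^sub>1 r\<^sub>2)"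
  by (auto simp: w\<^sub>A_def wA_def wA_inv_def w\<^sub>B_def wB_def w\<^sub>B_star_def transp_def)

theorem proposition3p9:
  fixes t :: complex and s :: rflat and p :: ennreal
    and U :: "('d::finite) dseq \<Rightarrow> 'd dseq \<Rightarrow> 'd dseq"
  assumes "0 < p" and "s \<in> R_flat" and "U = U_sharp t"
  shows "(\<forall>c\<^sub>1\<in>l\<^sub>0. \<forall>c\<^sub>2\<in>l\<^sub>0. U c\<^sub>1 c\<^sub>2 \<in> l\<^sub>0) \<and>
    (s < Fin (1/2) \<longrightarrow>
      uniquely_extends_joint (lA p s) (lA p s) (lA p s) U \<and>
      uniquely_extends_hypo (lA_star p s) (lB p s) (lA_star p s) U \<and>
      uniquely_extends_hypo (lB_star p s) (lA_star p s) (lA_star p s) U \<and>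
      uniquely_extends_hypo (lB p s) (lB p s) (lB p s) U \<and>
      uniquely_extends_hypo (lB_star p s) (lB_star p s) (lB_star p s) U \<and>
      uniquely_extends_hypo (lC p s) (lC p s) (lC p s) U \<and>
      uniquely_extends_hypo (lC_star p s) (lC_star p s) (lC_star p s) U) \<and>
    (Fin 0 < s \<and> s \<le> Fin (1/2) \<longrightarrow>
      uniquely_extends_joint (lA0 p s) (lA0 p s) (lA0 p s) U \<and>
      uniquely_extends_hypo (lA0_star p s) (lB0 p s) (lA0_star p s) U \<and>
      uniquely_extends_hypo (lB0_star p s) (lA0_star p s) (lA0_star p s) U \<and>
      uniquely_extends_hypo (lB0 p s) (lB0 p s) (lB0 p s) U \<and>
      uniquely_extends_hypo (lB0_star p s) (lB0_star p s) (lB0_star p s) U \<and>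
      uniquely_extends_hypo (lC0 p s) (lC0 p s) (lC0 p s) U \<and>
      uniquely_extends_hypo (lC0_star p s) (lC0_star p s) (lC0_star p s) U)"
proof (intro conjI impI ballI)
  fix c1 c2 :: "'d dseq" assume "c1 \<in> l\<^sub>0" "c2 \<in> l\<^sub>0"
  then show "U c1 c2 \<in> l\<^sub>0"
    by (simp add: assms(3) U_sharp_l0)
next
  let ?th = "\<lambda>r. \<theta> r s :: 'd mindex \<Rightarrow> ennreal"
  note p = assms(1) nuclear_decay
  {
    assume s: "s < Fin (1/2)"
    interpret scale_down "rate t" ?th
      by (rule scale_down_theta[OF two_le_rate assms(2) s])
    interpret scale_rate_down t ?th
      by unfold_locales
    have A: "lA p s = ktop (PI_S (\<lambda>_. wA ?th)) (PI_W (\<lambda>_. wA ?th))"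
      unfolding lA_def weight_eqs by (rule ind_lim_lw[OF p PI_A])
    have A_star: "lA_star p s = ktop (PI_S (\<lambda>j _. wA_inv ?th j)) (PI_W (\<lambda>j _. wA_inv ?th j))"
      unfolding lA_star_def weight_eqs(2) by (rule proj_lim_lw[OF p PI_A_inv])
    have B: "lB p s = ktop (PI_S (\<lambda>j n. wB ?th n j)) (PI_W (\<lambda>j n. wB ?th n j))"
      unfolding lB_def weight_eqs by (rule proj_ind_lim_lw[OF p PI_B])
    note PI_B_star = PI_family_transp[OF PI_B]
    have B_star: "lB_star p s = ktop (PI_S (\<lambda>j n. transp (wB ?th n j))) (PI_W (\<lambda>j n. transp (wB ?th n j)))"
      unfolding lB_star_def weight_eqs by (rule proj_ind_lim_lw[OF p PI_B_star])
    have C: "lC p s = ktop (IP_S (wB ?th)) (dual (IP_S (wB ?th)))"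
      unfolding lC_def weight_eqs by (rule ind_proj_lim_lw[OF p IP_C])
    note IP_C_star = IP_family_transp[OF IP_C]
    have C_star: "lC_star p s = ktop (IP_S (\<lambda>j n. transp (wB ?th j n))) (dual (IP_S (\<lambda>j n. transp (wB ?th j n))))"
      unfolding lC_star_def weight_eqs by (rule ind_proj_lim_lw[OF p IP_C_star])
    show "uniquely_extends_joint (lA p s) (lA p s) (lA p s) U"
      unfolding A assms(3) by (rule joint_A)
    show "uniquely_extends_hypo (lA_star p s) (lB p s) (lA_star p s) U"
      unfolding A_star B assms(3) by (rule PI_extends[OF PI_A_inv PI_B PI_A_inv bound_AB])
    show "uniquely_extends_hypo (lB_star p s) (lA_star p s) (lA_star p s) U"
      unfolding A_star B_star assms(3)
      by (rule PI_extends[OF PI_B_star PI_A_inv PI_A_inv PI_bound_transp[OF bound_AB, unfolded transp_wA_inv]])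
    show "uniquely_extends_hypo (lB p s) (lB p s) (lB p s) U"
      unfolding B assms(3) by (rule PI_extends[OF PI_B PI_B PI_B bound_B])
    show "uniquely_extends_hypo (lB_star p s) (lB_star p s) (lB_star p s) U"
      unfolding B_star assms(3)
      by (rule PI_extends[OF PI_B_star PI_B_star PI_B_star PI_bound_transp[OF bound_B]])
    show "uniquely_extends_hypo (lC p s) (lC p s) (lC p s) U"
      unfolding C assms(3) by (rule IP_extends[OF IP_C bound_C])
    show "uniquely_extends_hypo (lC_star p s) (lC_star p s) (lC_star p s) U"
      unfolding C_star assms(3) by (rule IP_extends[OF IP_C_star IP_bound_transp[OF bound_C]])
  }
  {
    assume s: "Fin 0 < s \<and> s \<le> Fin (1/2)"
    interpret scale_up "rate t" ?th
      by (rule scale_up_theta[OF two_le_rate assms(2) conjunct1[OF s] conjunct2[OF s]])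
    interpret scale_rate_up t ?th
      by unfold_locales
    have A: "lA0 p s = ktop (PI_S (\<lambda>j _. wA ?th j)) (PI_W (\<lambda>j _. wA ?th j))"
      unfolding lA0_def weight_eqs by (rule proj_lim_lw[OF p PI_A])
    have A_star: "lA0_star p s = ktop (PI_S (\<lambda>_. wA_inv ?th)) (PI_W (\<lambda>_. wA_inv ?th))"
      unfolding lA0_star_def weight_eqs(2) by (rule ind_lim_lw[OF p PI_A_inv])
    have B: "lB0 p s = ktop (PI_S (wB ?th)) (PI_W (wB ?th))"
      unfolding lB0_def weight_eqs by (rule proj_ind_lim_lw[OF p PI_B])
    note PI_B_star = PI_family_transp[OF PI_B]
    have B_star: "lB0_star p s = ktop (PI_S (\<lambda>j n. transp (wB ?th j n))) (PI_W (\<lambda>j n. transp (wB ?th j n)))"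
      unfolding lB0_star_def weight_eqs by (rule proj_ind_lim_lw[OF p PI_B_star])
    have C: "lC0 p s = ktop (IP_S (\<lambda>j n. wB ?th n j)) (dual (IP_S (\<lambda>j n. wB ?th n j)))"
      unfolding lC0_def weight_eqs by (rule ind_proj_lim_lw[OF p IP_C])
    note IP_C_star = IP_family_transp[OF IP_C]
    have C_star: "lC0_star p s = ktop (IP_S (\<lambda>j n. transp (wB ?th n j))) (dual (IP_S (\<lambda>j n. transp (wB ?th n j))))"
      unfolding lC0_star_def weight_eqs by (rule ind_proj_lim_lw[OF p IP_C_star])
    show "uniquely_extends_joint (lA0 p s) (lA0 p s) (lA0 p s) U"
      unfolding A assms(3) by (rule joint_A)
    show "uniquely_extends_hypo (lA0_star p s) (lB0 p s) (lA0_star p s) U"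
      unfolding A_star B assms(3) by (rule PI_extends[OF PI_A_inv PI_B PI_A_inv bound_AB])
    show "uniquely_extends_hypo (lB0_star p s) (lA0_star p s) (lA0_star p s) U"
      unfolding A_star B_star assms(3)
      by (rule PI_extends[OF PI_B_star PI_A_inv PI_A_inv PI_bound_transp[OF bound_AB, unfolded transp_wA_inv]])
    show "uniquely_extends_hypo (lB0 p s) (lB0 p s) (lB0 p s) U"
      unfolding B assms(3) by (rule PI_extends[OF PI_B PI_B PI_B bound_B])
    show "uniquely_extends_hypo (lB0_star p s) (lB0_star p s) (lB0_star p s) U"
      unfolding B_star assms(3)
      by (rule PI_extends[OF PI_B_star PI_B_star PI_B_star PI_bound_transp[OF bound_B]])
    show "uniquely_extends_hypo (lC0 p s) (lC0 p s) (lC0 p s) U"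
      unfolding C assms(3) by (rule IP_extends[OF IP_C bound_C])
    show "uniquely_extends_hypo (lC0_star p s) (lC0_star p s) (lC0_star p s) U"
      unfolding C_star assms(3) by (rule IP_extends[OF IP_C_star IP_bound_transp[OF bound_C]])
  }
qed

end
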